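(* Let $\mathcal G_{\rm b}$ be a standard Bismut-flat generalized metric on a compact, simply-connected, semisimple Lie group $\mathsf G$. Then there exists $\delta>0$ such that, if $\mathcal G_0$ is a left-invariant generalized metric with $d(\mathcal G_0,\mathcal G_{\rm b})<\delta$, then the solution $\mathcal G_t$ of the generalized Ricci flow starting at $\mathcal G_0$ exists for all positive times and converges exponentially fast, in the $C^\infty$ topology, to a bi-invariant Bismut-flat generalized metric.
   Context: Let $\mathfrak g$ be the Lie algebra of $\mathsf G$, $g_{\rm b}$ a bi-invariant metric, and $H_{\rm b}=\pm g_{\rm b}([\cdot,\cdot],\cdot)$ (for one choice of sign) an associated Cartan $3$-form. Let $\mathfrak G=\mathfrak g\oplus\mathfrak g^*$ with $\langle X+\xi,Y+\eta\rangle=\tfrac12(\xi(Y)+\eta(X))$; this is the fibre at the identity of $(T\oplus T^* )_{H_{\rm b}}$ over $\mathsf G$. A left-invariant generalized metric is an endomorphism $\mathcal G$ of $\mathfrak G$ preserving $\langle\cdot,\cdot\rangle$, with $\mathcal G^2=\mathrm{Id}$ and $\langle\mathcal G\cdot,\cdot\rangle$ symmetric positive definite. Each is uniquely of the form $$\mathcal G(g,b)=e^b\begin{pmatrix}0&g^{-1}\\ g&0\end{pmatrix}e^{-b},\qquad e^b(X+\xi)=X+\xi+\iota_Xb,$$ with $g$ an inner product on $\mathfrak g$ and $b\in\Lambda^2\mathfrak g^*$; its associated pair is $(g,\,H=H_{\rm b}+db)$. The standard Bismut-flat generalized metric is $\mathcal G_{\rm b}=\mathcal G(g_{\rm b},0)$,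 with pair $(g_{\rm b},H_{\rm b})$. A generalized metric with pair $(g,H)$ is Bismut-flat if the metric connections $\nabla^\pm$ of $g$ with torsion $\pm H$ are flat, and bi-invariant if $g$ and $H$ are bi-invariant. Generalized Ricci flow: $\mathcal G^{-1}\partial_t\mathcal G=-2\,\mathcal Rc(\mathcal G)$, where $$\mathcal Rc(\mathcal G(g,b))=e^b\begin{pmatrix}R&\tfrac12g^{-1}(d_g^*H)g^{-1}\\-\tfrac12d_g^*H&-R^*\end{pmatrix}e^{-b},\quad R=g^{-1}(\mathrm{Ric}_g-\tfrac14H^2),\quad H=H_{\rm b}+db,$$ with $H^2(X,Y)=\sum_{i,j}H(X,e_i,e_j)H(Y,e_i,e_j)$ in an orthonormal basis. Equivalently, $\partial_tg=-2\mathrm{Ric}_g+\tfrac12H^2$ and $\partial_tb=-d_g^*H$. $d$ is the Riemannian distance on the manifold of left-invariant generalized metrics induced by the symmetric metric $g^{\rm sym}_{\mathcal G}(A,B)=\mathrm{tr}(AB)$, where a tangent vector $\dot{\mathcal G}$ at $\mathcal G$ is identified with the endomorphism $A=\mathcal G^{-1}\dot{\mathcal G}$ of $\mathfrak G$. *)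

theory Defs
  imports "HOL-Analysis.Analysis" "HOL-Algebra.Group"
begin

section \<open>Lie groups\<close>

text \<open>\<open>C_k_on k f S\<close> is meant for open \<open>S\<close>.\<close>

fun C_k_on :: "nat \<Rightarrow> ('a::real_normed_vector \<Rightarrow> 'b::real_normed_vector) \<Rightarrow> 'a set \<Rightarrow> bool" where
  "C_k_on 0 f S \<longleftrightarrow> continuous_on S f"
| "C_k_on (Suc k) f S \<longleftrightarrow>
     f differentiable_on S \<and> (\<forall>v. C_k_on k (\<lambda>x. frechet_derivative f (at x) v) S)"

definition smooth_on :: "('a::real_normed_vector \<Rightarrow> 'b::real_normed_vector) \<Rightarrow> 'a set \<Rightarrow> bool" where
  "smooth_on f S \<longleftrightarrow> (\<forall>k. C_k_on k f S)"

text \<open>A chart is a domain together with a coordinate map; the coordinate map is irrelevant outside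
  the domain.\<close>

type_synonym ('a, 'g) chart = "'a set \<times> ('a \<Rightarrow> 'g)"

definition smooth_atlas :: "'a::topological_space set \<Rightarrow> ('a, 'g::euclidean_space) chart set \<Rightarrow> bool" where
  "smooth_atlas M A \<longleftrightarrow>
     (\<forall>(U, \<phi>) \<in> A. openin (top_of_set M) U \<and> open (\<phi> ` U) \<and>
        homeomorphism U (\<phi> ` U) \<phi> (inv_into U \<phi>)) \<and>
     (\<Union>(U, \<phi>) \<in> A. U) = M \<and>
     (\<forall>(U, \<phi>) \<in> A. \<forall>(V, \<psi>) \<in> A. smooth_on (\<lambda>x. \<psi> (inv_into U \<phi> x)) (\<phi> ` (U \<inter> V)))"

text \<open>The Hausdorff axiom is the class constraint \<open>t2_space\<close>.\<close>

definition lie_group :: "('a::t2_space) monoid \<Rightarrow> ('a, 'g::euclidean_space) chart set \<Rightarrow> bool" where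
  "lie_group G A \<longleftrightarrow>
     group G \<and>
     second_countable (top_of_set (carrier G)) \<and>
     smooth_atlas (carrier G) A \<and>
     continuous_on (carrier G \<times> carrier G) (\<lambda>(x, y). x \<otimes>\<^bsub>G\<^esub> y) \<and>
     continuous_on (carrier G) (\<lambda>x. m_inv G x) \<and>
     (\<forall>(U, \<phi>) \<in> A. \<forall>(V, \<psi>) \<in> A. \<forall>(W, \<theta>) \<in> A.
        smooth_on (\<lambda>(x, y). \<theta> (inv_into U \<phi> x \<otimes>\<^bsub>G\<^esub> inv_into V \<psi> y))
          {(x, y). x \<in> \<phi> ` U \<and> y \<in> \<psi> ` V \<and> inv_into U \<phi> x \<otimes>\<^bsub>G\<^esub> inv_into V \<psi> y \<in> W}) \<and>
     (\<forall>(U, \<phi>) \<in> A. \<forall>(V, \<psi>) \<in> A.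
        smooth_on (\<lambda>x. \<psi> (m_inv G (inv_into U \<phi> x)))
          {x \<in> \<phi> ` U. m_inv G (inv_into U \<phi> x) \<in> V})"

text \<open>Fix a chart \<open>(U, \<phi>)\<close> around the identity. The differential of \<open>\<phi>\<close> identifies the tangent space
  at the identity, that is the Lie algebra, with the model space \<open>'g\<close>. In the coordinates \<open>\<phi>\<close>,
  \<open>left_inv_field G U \<phi> X\<close> is the left-invariant vector field whose value at the identity is \<open>X\<close>,
  and \<open>lie_bracket\<close> is the value at the identity of the commutator of two such vector fields.\<close>

definition left_inv_field ::
  "('a::topological_space) monoid \<Rightarrow> 'a set \<Rightarrow> ('a \<Rightarrow> 'g::euclidean_space) \<Rightarrow> 'g \<Rightarrow> 'g \<Rightarrow> 'g" where
  "left_inv_field G U \<phi> X x =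
     frechet_derivative (\<lambda>y. \<phi> (inv_into U \<phi> x \<otimes>\<^bsub>G\<^esub> inv_into U \<phi> y)) (at (\<phi> \<one>\<^bsub>G\<^esub>)) X"

definition lie_bracket ::
  "('a::topological_space) monoid \<Rightarrow> 'a set \<Rightarrow> ('a \<Rightarrow> 'g::euclidean_space) \<Rightarrow> 'g \<Rightarrow> 'g \<Rightarrow> 'g" where
  "lie_bracket G U \<phi> X Y =
     frechet_derivative (left_inv_field G U \<phi> Y) (at (\<phi> \<one>\<^bsub>G\<^esub>)) X
   - frechet_derivative (left_inv_field G U \<phi> X) (at (\<phi> \<one>\<^bsub>G\<^esub>)) Y"

definition Ad ::
  "('a::topological_space) monoid \<Rightarrow> 'a set \<Rightarrow> ('a \<Rightarrow> 'g::euclidean_space) \<Rightarrow> 'a \<Rightarrow> 'g \<Rightarrow> 'g" where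
  "Ad G U \<phi> a X =
     frechet_derivative (\<lambda>x. \<phi> (a \<otimes>\<^bsub>G\<^esub> inv_into U \<phi> x \<otimes>\<^bsub>G\<^esub> m_inv G a)) (at (\<phi> \<one>\<^bsub>G\<^esub>)) X"

text \<open>The derived series of a subspace of the Lie algebra, and semisimplicity as vanishing of the
  solvable radical.\<close>

definition derived_alg :: "('g::real_vector \<Rightarrow> 'g \<Rightarrow> 'g) \<Rightarrow> 'g set \<Rightarrow> 'g set" where
  "derived_alg br I = span {br X Y | X Y. X \<in> I \<and> Y \<in> I}"

definition lie_ideal :: "('g::real_vector \<Rightarrow> 'g \<Rightarrow> 'g) \<Rightarrow> 'g set \<Rightarrow> bool" where
  "lie_ideal br I \<longleftrightarrow> subspace I \<and> (\<forall>X. \<forall>Y \<in> I. br X Y \<in> I)"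

definition semisimple :: "('g::real_vector \<Rightarrow> 'g \<Rightarrow> 'g) \<Rightarrow> bool" where
  "semisimple br \<longleftrightarrow>
     (\<forall>I. lie_ideal br I \<and> (\<exists>n. (derived_alg br ^^ n) I = {0}) \<longrightarrow> I = {0})"


section \<open>Left-invariant tensors\<close>

text \<open>Left-invariant tensor fields are identified with their values at the identity; the parameter
  \<open>br\<close> is the bracket of the Lie algebra \<open>'g\<close>. Bilinear forms \<open>g\<close> are maps from \<open>'g\<close> to its dual,
  \<open>X \<mapsto> g X = g(X, \<cdot>)\<close>, so that \<open>blinfun_inv g\<close> is the usual inverse from the dual to \<open>'g\<close> and
  \<open>b X\<close> is the contraction of the 2-form \<open>b\<close> with \<open>X\<close>.\<close>

type_synonym 'g dual = "'g \<Rightarrow>\<^sub>L real"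
type_synonym 'g bilform = "'g \<Rightarrow>\<^sub>L 'g \<Rightarrow>\<^sub>L real"
type_synonym 'g form3 = "'g \<Rightarrow> 'g \<Rightarrow> 'g \<Rightarrow> real"

definition blinfun_inv :: "('a::real_normed_vector \<Rightarrow>\<^sub>L 'b::real_normed_vector) \<Rightarrow> 'b \<Rightarrow>\<^sub>L 'a" where
  "blinfun_inv T = Blinfun (inv_into UNIV (blinfun_apply T))"

definition bilform_of :: "('g::real_normed_vector \<Rightarrow> 'g \<Rightarrow> real) \<Rightarrow> 'g bilform" where
  "bilform_of F = Blinfun (\<lambda>X. Blinfun (F X))"

definition inner_product :: "('g::real_normed_vector) bilform \<Rightarrow> bool" where
  "inner_product g \<longleftrightarrow> (\<forall>X Y. g X Y = g Y X) \<and> (\<forall>X. X \<noteq> 0 \<longrightarrow> g X X > 0)"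

definition two_form :: "('g::real_normed_vector) bilform \<Rightarrow> bool" where
  "two_form b \<longleftrightarrow> (\<forall>X Y. b X Y = - b Y X)"

text \<open>A left-invariant tensor field is bi-invariant iff its value at the identity is invariant under
  the adjoint representation.\<close>

definition bi_invariant_metric ::
  "('a::topological_space) monoid \<Rightarrow> 'a set \<Rightarrow> ('a \<Rightarrow> 'g::euclidean_space) \<Rightarrow> 'g bilform \<Rightarrow> bool" where
  "bi_invariant_metric G U \<phi> g \<longleftrightarrow> inner_product g \<and>
     (\<forall>a \<in> carrier G. \<forall>X Y. g (Ad G U \<phi> a X) (Ad G U \<phi> a Y) = g X Y)"

definition bi_invariant_form3 ::
  "('a::topological_space) monoid \<Rightarrow> 'a set \<Rightarrow> ('a \<Rightarrow> 'g::euclidean_space) \<Rightarrow> 'g form3 \<Rightarrow> bool" where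
  "bi_invariant_form3 G U \<phi> H \<longleftrightarrow>
     (\<forall>a \<in> carrier G. \<forall>X Y Z. H (Ad G U \<phi> a X) (Ad G U \<phi> a Y) (Ad G U \<phi> a Z) = H X Y Z)"

text \<open>The exterior derivative of a left-invariant 2-form; in the general formula for \<open>d\<close> the terms
  differentiating the constant functions \<open>b(X, Y)\<close> vanish.\<close>

definition ext_d :: "('g::real_normed_vector \<Rightarrow> 'g \<Rightarrow> 'g) \<Rightarrow> 'g bilform \<Rightarrow> 'g form3" where
  "ext_d br b X Y Z = - b (br X Y) Z - b (br Y Z) X - b (br Z X) Y"

definition cartan_form ::
  "('g::real_normed_vector \<Rightarrow> 'g \<Rightarrow> 'g) \<Rightarrow> 'g bilform \<Rightarrow> real \<Rightarrow> 'g form3" where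
  "cartan_form br g s X Y Z = s * g (br X Y) Z"


section \<open>Connections, curvature and codifferential\<close>

text \<open>A left-invariant connection is given by \<open>\<Gamma> X Y\<close>, the covariant derivative of the left-invariant
  field \<open>Y\<close> along the left-invariant field \<open>X\<close>. \<open>connection br g T\<close> is the unique metric
  connection of \<open>g\<close> with (totally skew-symmetric) torsion \<open>T\<close>; for \<open>T = 0\<close> it is the
  Levi-Civita connection.\<close>

type_synonym 'g conn = "'g \<Rightarrow>\<^sub>L 'g \<Rightarrow>\<^sub>L 'g"

definition metric_connection ::
  "('g::real_normed_vector \<Rightarrow> 'g \<Rightarrow> 'g) \<Rightarrow> 'g bilform \<Rightarrow> 'g form3 \<Rightarrow> 'g conn \<Rightarrow> bool" where
  "metric_connection br g T \<Gamma> \<longleftrightarrow>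
     (\<forall>X Y Z. g (\<Gamma> X Y) Z + g Y (\<Gamma> X Z) = 0) \<and>
     (\<forall>X Y Z. g (\<Gamma> X Y - \<Gamma> Y X - br X Y) Z = T X Y Z)"

definition connection ::
  "('g::real_normed_vector \<Rightarrow> 'g \<Rightarrow> 'g) \<Rightarrow> 'g bilform \<Rightarrow> 'g form3 \<Rightarrow> 'g conn" where
  "connection br g T = (THE \<Gamma>. metric_connection br g T \<Gamma>)"

definition levi_civita :: "('g::real_normed_vector \<Rightarrow> 'g \<Rightarrow> 'g) \<Rightarrow> 'g bilform \<Rightarrow> 'g conn" where
  "levi_civita br g = connection br g (\<lambda>X Y Z. 0)"

definition curvature ::
  "('g::real_normed_vector \<Rightarrow> 'g \<Rightarrow> 'g) \<Rightarrow> 'g conn \<Rightarrow> 'g \<Rightarrow> 'g \<Rightarrow> 'g \<Rightarrow> 'g" where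
  "curvature br \<Gamma> X Y Z = \<Gamma> X (\<Gamma> Y Z) - \<Gamma> Y (\<Gamma> X Z) - \<Gamma> (br X Y) Z"

definition flat :: "('g::real_normed_vector \<Rightarrow> 'g \<Rightarrow> 'g) \<Rightarrow> 'g conn \<Rightarrow> bool" where
  "flat br \<Gamma> \<longleftrightarrow> (\<forall>X Y Z. curvature br \<Gamma> X Y Z = 0)"

definition bismut_flat ::
  "('g::real_normed_vector \<Rightarrow> 'g \<Rightarrow> 'g) \<Rightarrow> 'g bilform \<Rightarrow> 'g form3 \<Rightarrow> bool" where
  "bismut_flat br g H \<longleftrightarrow>
     flat br (connection br g H) \<and> flat br (connection br g (\<lambda>X Y Z. - H X Y Z))"

definition orthonormal_basis :: "('g::real_normed_vector) bilform \<Rightarrow> 'g set \<Rightarrow> bool" where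
  "orthonormal_basis g E \<longleftrightarrow>
     (\<forall>u \<in> E. \<forall>v \<in> E. g u v = (if u = v then 1 else 0)) \<and> span E = UNIV"

text \<open>The expressions below do not depend on the orthonormal basis that is chosen here.\<close>

definition onb :: "('g::real_normed_vector) bilform \<Rightarrow> 'g set" where
  "onb g = (SOME E. orthonormal_basis g E)"

definition ricci :: "('g::real_normed_vector \<Rightarrow> 'g \<Rightarrow> 'g) \<Rightarrow> 'g bilform \<Rightarrow> 'g \<Rightarrow> 'g \<Rightarrow> real" where
  "ricci br g Y Z = (\<Sum>e \<in> onb g. g (curvature br (levi_civita br g) e Y Z) e)"

definition H_squared :: "('g::real_normed_vector) bilform \<Rightarrow> 'g form3 \<Rightarrow> 'g \<Rightarrow> 'g \<Rightarrow> real" where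
  "H_squared g H X Y = (\<Sum>e \<in> onb g. \<Sum>e' \<in> onb g. H X e e' * H Y e e')"

definition nabla_form3 :: "('g::real_normed_vector) conn \<Rightarrow> 'g form3 \<Rightarrow> 'g \<Rightarrow> 'g form3" where
  "nabla_form3 \<Gamma> H W X Y Z = - H (\<Gamma> W X) Y Z - H X (\<Gamma> W Y) Z - H X Y (\<Gamma> W Z)"

definition codiff ::
  "('g::real_normed_vector \<Rightarrow> 'g \<Rightarrow> 'g) \<Rightarrow> 'g bilform \<Rightarrow> 'g form3 \<Rightarrow> 'g \<Rightarrow> 'g \<Rightarrow> real" where
  "codiff br g H Y Z = - (\<Sum>e \<in> onb g. nabla_form3 (levi_civita br g) H e e Y Z)"


section \<open>Left-invariant generalized metrics\<close>

type_synonym 'g gtan = "'g \<times> ('g \<Rightarrow>\<^sub>L real)"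
type_synonym 'g gend = "'g gtan \<Rightarrow>\<^sub>L 'g gtan"

definition pairing :: "('g::real_normed_vector) gtan \<Rightarrow> 'g gtan \<Rightarrow> real" where
  "pairing u v = (snd u (fst v) + snd v (fst u)) / 2"

definition gen_metric :: "('g::real_normed_vector) gend \<Rightarrow> bool" where
  "gen_metric \<G> \<longleftrightarrow>
     (\<forall>u v. pairing (\<G> u) (\<G> v) = pairing u v) \<and>
     \<G> o\<^sub>L \<G> = id_blinfun \<and>
     (\<forall>u v. pairing (\<G> u) v = pairing (\<G> v) u) \<and>
     (\<forall>u. u \<noteq> 0 \<longrightarrow> pairing (\<G> u) u > 0)"

text \<open>\<open>block_end P Q R S\<close> is the block matrix with rows \<open>P Q\<close> and \<open>R S\<close>.\<close>

definition block_end ::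
  "('g::real_normed_vector \<Rightarrow>\<^sub>L 'g) \<Rightarrow> ('g dual \<Rightarrow>\<^sub>L 'g) \<Rightarrow> ('g \<Rightarrow>\<^sub>L 'g dual) \<Rightarrow> ('g dual \<Rightarrow>\<^sub>L 'g dual) \<Rightarrow> 'g gend"
  where "block_end P Q R S = Blinfun (\<lambda>(X, \<xi>). (P X + Q \<xi>, R X + S \<xi>))"

definition exp_b :: "('g::real_normed_vector) bilform \<Rightarrow> 'g gend" where
  "exp_b b = Blinfun (\<lambda>(X, \<xi>). (X, \<xi> + b X))"

definition gmet :: "('g::real_normed_vector) bilform \<Rightarrow> 'g bilform \<Rightarrow> 'g gend" where
  "gmet g b = exp_b b o\<^sub>L block_end 0 (blinfun_inv g) g 0 o\<^sub>L exp_b (- b)"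

definition gmet_pair :: "('g::real_normed_vector) gend \<Rightarrow> 'g bilform \<times> 'g bilform" where
  "gmet_pair \<G> = (THE (g, b). inner_product g \<and> two_form b \<and> \<G> = gmet g b)"

definition metric_of :: "('g::real_normed_vector) gend \<Rightarrow> 'g bilform" where
  "metric_of \<G> = fst (gmet_pair \<G>)"

definition H_of ::
  "('g::real_normed_vector \<Rightarrow> 'g \<Rightarrow> 'g) \<Rightarrow> 'g form3 \<Rightarrow> 'g gend \<Rightarrow> 'g form3" where
  "H_of br Hb \<G> X Y Z = Hb X Y Z + ext_d br (snd (gmet_pair \<G>)) X Y Z"

definition bi_invariant_bismut_flat ::
  "('a::topological_space) monoid \<Rightarrow> 'a set \<Rightarrow> ('a \<Rightarrow> 'g::euclidean_space) \<Rightarrow> 'g form3 \<Rightarrow> 'g gend \<Rightarrow> bool" where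
  "bi_invariant_bismut_flat G U \<phi> Hb \<G> \<longleftrightarrow>
     (let br = lie_bracket G U \<phi>; g = metric_of \<G>; H = H_of br Hb \<G> in
        gen_metric \<G> \<and>
        bi_invariant_metric G U \<phi> g \<and> bi_invariant_form3 G U \<phi> H \<and>
        bismut_flat br g H)"

text \<open>The trace is computed in the basis of \<open>'g gtan\<close> formed by a basis of \<open>'g\<close> and its dual basis.\<close>

definition trace_end :: "('g::euclidean_space) gend \<Rightarrow> real" where
  "trace_end A =
     (\<Sum>e \<in> Basis. fst (A (e, 0)) \<bullet> e) + (\<Sum>e \<in> Basis. snd (A (0, blinfun_inner_right e)) e)"

definition g_sym :: "('g::euclidean_space) gend \<Rightarrow> 'g gend \<Rightarrow> real" where
  "g_sym A B = trace_end (A o\<^sub>L B)"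

text \<open>The derivative of a \<open>valid_path\<close> may be unbounded near a break point; requiring the integral
  defining the length to exist excludes paths of infinite length.\<close>

definition gmet_dist :: "('g::euclidean_space) gend \<Rightarrow> 'g gend \<Rightarrow> real" where
  "gmet_dist \<G>0 \<G>1 = Inf {L. \<exists>\<gamma>. valid_path \<gamma> \<and> (\<forall>t \<in> {0..1}. gen_metric (\<gamma> t)) \<and>
     pathstart \<gamma> = \<G>0 \<and> pathfinish \<gamma> = \<G>1 \<and>
     ((\<lambda>t. let A = blinfun_inv (\<gamma> t) o\<^sub>L vector_derivative \<gamma> (at t within {0..1})
           in sqrt (g_sym A A)) has_integral L) {0..1}}"


section \<open>Generalized Ricci flow\<close>

definition gen_ricci ::
  "('g::real_normed_vector \<Rightarrow> 'g \<Rightarrow> 'g) \<Rightarrow> 'g form3 \<Rightarrow> 'g gend \<Rightarrow> 'g gend" where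
  "gen_ricci br Hb \<G> =
     (let g = fst (gmet_pair \<G>); b = snd (gmet_pair \<G>); H = H_of br Hb \<G>;
          ginv = blinfun_inv g;
          R = ginv o\<^sub>L bilform_of (\<lambda>X Y. ricci br g X Y - H_squared g H X Y / 4);
          Rstar = Blinfun (\<lambda>\<xi>. \<xi> o\<^sub>L R);
          dH = bilform_of (codiff br g H)
      in exp_b b
         o\<^sub>L block_end R ((1/2) *\<^sub>R (ginv o\<^sub>L dH o\<^sub>L ginv)) (- ((1/2) *\<^sub>R dH)) (- Rstar)
         o\<^sub>L exp_b (- b))"

definition gen_ricci_flow ::
  "('g::real_normed_vector \<Rightarrow> 'g \<Rightarrow> 'g) \<Rightarrow> 'g form3 \<Rightarrow> real set \<Rightarrow> (real \<Rightarrow> 'g gend) \<Rightarrow> bool" where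
  "gen_ricci_flow br Hb I \<G> \<longleftrightarrow>
     (\<forall>t \<in> I. gen_metric (\<G> t) \<and>
        (\<exists>D. (\<G> has_vector_derivative D) (at t within I) \<and>
             blinfun_inv (\<G> t) o\<^sub>L D = - 2 *\<^sub>R gen_ricci br Hb (\<G> t)))"


section \<open>Exponential convergence in the smooth topology\<close>

text \<open>The connection induced by \<open>\<Gamma>\<close> on the sum of the tangent and the cotangent bundle, and on
  endomorphisms of it. \<open>nabla_iter \<Gamma> A [X1, ..., Xk]\<close> is the \<open>k\<close>-th covariant derivative of the
  left-invariant endomorphism \<open>A\<close>, evaluated on the left-invariant fields \<open>X1, ..., Xk\<close> (\<open>X1\<close> being
  the outermost derivative).\<close>

definition nabla_gtan :: "('g::real_normed_vector) conn \<Rightarrow> 'g \<Rightarrow> 'g gend" where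
  "nabla_gtan \<Gamma> X = Blinfun (\<lambda>(Y, \<eta>). (\<Gamma> X Y, - (\<eta> o\<^sub>L \<Gamma> X)))"

definition nabla_gend :: "('g::real_normed_vector) conn \<Rightarrow> 'g \<Rightarrow> 'g gend \<Rightarrow> 'g gend" where
  "nabla_gend \<Gamma> X A = (nabla_gtan \<Gamma> X o\<^sub>L A) - (A o\<^sub>L nabla_gtan \<Gamma> X)"

fun nabla_iter :: "('g::real_normed_vector) conn \<Rightarrow> 'g gend \<Rightarrow> 'g list \<Rightarrow> 'g gend" where
  "nabla_iter \<Gamma> A [] = A"
| "nabla_iter \<Gamma> A (X # Xs) =
     nabla_gend \<Gamma> X (nabla_iter \<Gamma> A Xs)
     - (\<Sum>i<length Xs. nabla_iter \<Gamma> A (Xs[i := \<Gamma> X (Xs ! i)]))"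

text \<open>The norm of a left-invariant section is constant on the group, so the supremum over the group
  in the \<open>C\<^sup>k\<close> norm is the value at the identity. The fibre norms used here are the norm of \<open>'g\<close> and
  the induced operator norms.\<close>

definition Ck_norm :: "('g::real_normed_vector) conn \<Rightarrow> nat \<Rightarrow> 'g gend \<Rightarrow> real" where
  "Ck_norm \<Gamma> k A =
     (\<Sum>j\<le>k. SUP Xs \<in> {Xs. length Xs = j \<and> (\<forall>X \<in> set Xs. norm X \<le> 1)}. norm (nabla_iter \<Gamma> A Xs))"

definition smooth_exp_converges ::
  "('g::real_normed_vector) conn \<Rightarrow> (real \<Rightarrow> 'g gend) \<Rightarrow> 'g gend \<Rightarrow> bool" where
  "smooth_exp_converges \<Gamma> \<G> L \<longleftrightarrow>
     (\<exists>\<kappa>>0. \<forall>k. \<exists>C. \<forall>t\<ge>0. Ck_norm \<Gamma> k (\<G> t - L) \<le> C * exp (- \<kappa> * t))"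

end

theory Submission
  imports Defs
begin

text \<open>A left-invariant generalized metric is \<open>gmet g b\<close> for a unique inner product
  \<open>g\<close> and 2-form \<open>b\<close> on the Lie algebra, and in these coordinates the flow is
  the ordinary differential equation \<open>g' = - 2 Ric + H\<^sup>2 / 2\<close>, \<open>b' = -
  d\<^sup>* H\<close> with \<open>H = Hb + db\<close> (\<open>ode_imp_flow\<close>,
  \<open>flow_imp_ode\<close>). Its right-hand side is a polynomial in \<open>g\<close>,
  \<open>g\<^sup>-\<^sup>1\<close> and \<open>db\<close>, with coefficients given by the bracket
  (\<open>ricci_formula\<close>, \<open>codiff_formula\<close>); in particular it is locally Lipschitz,
  which gives uniqueness (\<open>ode_unique\<close>).

  The base point \<open>(gb, 0)\<close> is not an isolated zero: adding a closed form to
  \<open>b\<close> changes nothing. This degeneracy is removed by a gauge fixing. Let \<open>b~\<close>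
  solve \<open>b~' = - d\<^sup>* H - \<rho>(b~)\<close> with a certain exact 2-form
  \<open>\<rho>(b~)\<close>, depending linearly on \<open>b~\<close>; then \<open>db~ = db\<close>, so
  \<open>g\<close> and \<open>H\<close> are not affected. The single bilinear form \<open>\<gamma> = (g
  - gb) - s b~\<close> has \<open>g - gb\<close> as symmetric and \<open>- s b~\<close> as skew part,
  and it satisfies an autonomous equation whose linearization at \<open>0\<close> is simply
  \<open>\<gamma>' = - \<gamma>(\<cdot>, C \<cdot>)\<close>, where \<open>C\<close> is the Casimir
  operator of the adjoint representation (\<open>gf_field_has_derivative\<close>). This reflects that
  the two Bismut connections of \<open>(gb, Hb)\<close> are flat, one with the left-invariant fields as
  parallel frame: one slot of \<open>\<gamma>\<close> is left alone, and the Laplacian acts on the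
  other. The kernel of \<open>C\<close> is the center, which is an abelian ideal and so vanishes by
  semisimplicity. Therefore \<open>C\<close> is positive (\<open>casimir_coercive\<close>) and the
  Hilbert-Schmidt norm of \<open>\<gamma>\<close> decays exponentially
  (\<open>lyapunov_inequality\<close>, \<open>gauge_fixed_flow\<close>).

  Since \<open>d\<^sup>* H\<close> is of the order of \<open>\<gamma>\<close>, the form \<open>b\<close>
  converges exponentially as well, to some \<open>l\<close>, and \<open>dl\<close> is the limit of
  \<open>db~\<close>, that is \<open>0\<close> (\<open>stable_flow_of_pairs\<close>). Hence the limit
  \<open>gmet gb l\<close> has the pair \<open>(gb, Hb)\<close>. This pair is bi-invariant because the
  adjoint action preserves the metric and the bracket, and it is Bismut-flat because its two connections
  are \<open>0\<close> and the bracket (\<open>bismut_flat_base\<close>).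

  Three more ingredients connect this with the statement. In a chart at the identity, the facts about
  the Lie group that are used (\<open>Ad\<close> is an automorphism, the Jacobi identity, and
  \<open>ad\<close>-invariance of a bi-invariant metric) follow from the symmetry of second derivatives.
  The distance controls the norm because along a path the speed bounds the logarithmic derivative of
  \<open>g(X, X)\<close> and the \<open>g\<close>-norm of \<open>b'\<close>
  (\<open>gmet_path_estimate\<close>). Convergence in every \<open>C\<^sup>k\<close> norm is convergence
  in norm because on left-invariant tensors a covariant derivative is a bounded algebraic operation
  (\<open>Ck_norm_bound\<close>).\<close>

section \<open>Second derivatives\<close>

text \<open>Differentiable near \<open>p\<close> with a derivative that is differentiable at \<open>p\<close>:
  this is all that is needed for a symmetric second derivative, and unlike \<open>C_k_on\<close> it
  refers to the derivative as one operator-valued map, which makes it easy to compose.\<close>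

definition twice_diff_at ::
  "('a::real_normed_vector \<Rightarrow> 'b::real_normed_vector) \<Rightarrow> 'a \<Rightarrow> bool" where
  "twice_diff_at f p \<longleftrightarrow>
     (\<exists>f'. (\<forall>\<^sub>F x in nhds p. (f has_derivative blinfun_apply (f' x)) (at x)) \<and> f' differentiable (at p))"

text \<open>The mean value inequality for \<open>s \<mapsto> f (p + s u + t v) - f (p + s u)\<close> on \<open>[0,
  t]\<close>: its derivative differs from \<open>t f''(v)(u)\<close> by \<open>o(t)\<close>.\<close>

lemma second_difference_estimate:
  fixes f :: "'a::real_normed_vector \<Rightarrow> 'b::real_normed_vector" and f' :: "'a \<Rightarrow> 'a \<Rightarrow>\<^sub>L 'b"
  assumes ev: "\<forall>\<^sub>F x in nhds p. (f has_derivative blinfun_apply (f' x)) (at x)"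
    and f'': "(f' has_derivative f'') (at p)" and e: "e > 0"
  shows "\<exists>d>0. \<forall>t. 0 < t \<and> t < d \<longrightarrow>
    norm (f (p + t *\<^sub>R u + t *\<^sub>R v) - f (p + t *\<^sub>R u) - f (p + t *\<^sub>R v) + f p - t\<^sup>2 *\<^sub>R f'' v u) \<le> e * t\<^sup>2"
proof -
  interpret f'': bounded_linear f'' using f'' has_derivative_bounded_linear by blast
  define K where "K = norm u + norm v + 1"
  have K: "K > 0" "norm u \<le> K" "norm v \<le> K" "norm u + norm v \<le> K"
    unfolding K_def by (auto simp: add_nonneg_pos)
  define e' where "e' = e / (2 * K * K)"
  have e': "e' > 0" using e K by (simp add: e'_def)
  obtain d1 where d1: "d1 > 0" "\<And>x. dist x p < d1 \<Longrightarrow> (f has_derivative blinfun_apply (f' x)) (at x)"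
    using ev unfolding eventually_nhds_metric by blast
  obtain d2 where d2: "d2 > 0"
    "\<And>y. norm (y - p) < d2 \<Longrightarrow> norm (f' y - f' p - f'' (y - p)) \<le> e' * norm (y - p)"
    using f'' e' unfolding has_derivative_at_alt by blast
  define d where "d = min d1 d2 / K"
  have d: "d > 0" using d1 d2 K by (simp add: d_def)
  have main: "norm (f (p + t *\<^sub>R u + t *\<^sub>R v) - f (p + t *\<^sub>R u) - f (p + t *\<^sub>R v) + f p - t\<^sup>2 *\<^sub>R f'' v u) \<le> e * t\<^sup>2"
    if t: "0 < t" "t < d" for t
  proof -
    have tK: "t * K < d1" "t * K < d2" using t K unfolding d_def by (simp_all add: field_simps)
    have nb: "norm (s *\<^sub>R u + r *\<^sub>R v) \<le> t * K" if "0 \<le> s" "s \<le> t" "0 \<le> r" "r \<le> t" for s r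
    proof -
      have "norm (s *\<^sub>R u + r *\<^sub>R v) \<le> s * norm u + r * norm v"
        using norm_triangle_ineq[of "s *\<^sub>R u" "r *\<^sub>R v"] that by simp
      also have "\<dots> \<le> t * norm u + t * norm v" using that by (intro add_mono mult_right_mono) auto
      also have "\<dots> = t * (norm u + norm v)" by (simp add: algebra_simps)
      also have "\<dots> \<le> t * K" using K t by (intro mult_left_mono) auto
      finally show ?thesis .
    qed
    \<comment> \<open>the linear term is subtracted so that the derivative of \<open>g\<close> is itself small\<close>
    define g where "g s = f (p + s *\<^sub>R u + t *\<^sub>R v) - f (p + s *\<^sub>R u) - s *\<^sub>R (t *\<^sub>R f'' v u)" for s
    define g' where "g' s = f' (p + s *\<^sub>R u + t *\<^sub>R v) u - f' (p + s *\<^sub>R u) u - t *\<^sub>R f'' v u" for s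
    have g': "(g has_derivative (\<lambda>h. h *\<^sub>R g' s)) (at s within {0..t})" if s: "s \<in> {0..t}" for s
    proof -
      have a1: "(f has_derivative blinfun_apply (f' (p + s *\<^sub>R u + t *\<^sub>R v))) (at (p + s *\<^sub>R u + t *\<^sub>R v))"
        using nb[of s t] s t tK by (intro d1(2)) (auto simp: dist_norm algebra_simps)
      have a2: "(f has_derivative blinfun_apply (f' (p + s *\<^sub>R u))) (at (p + s *\<^sub>R u))"
        using nb[of s 0] s t tK by (intro d1(2)) (auto simp: dist_norm algebra_simps)
      have b1: "((\<lambda>s. p + s *\<^sub>R u + t *\<^sub>R v) has_derivative (\<lambda>h. h *\<^sub>R u)) (at s within {0..t})"
        by (auto intro!: derivative_eq_intros)
      have b2: "((\<lambda>s. p + s *\<^sub>R u) has_derivative (\<lambda>h. h *\<^sub>R u)) (at s within {0..t})"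
        by (auto intro!: derivative_eq_intros)
      have c1: "((\<lambda>s. f (p + s *\<^sub>R u + t *\<^sub>R v)) has_derivative (\<lambda>h. f' (p + s *\<^sub>R u + t *\<^sub>R v) (h *\<^sub>R u))) (at s within {0..t})"
        using has_derivative_compose[OF b1 a1] by simp
      have c2: "((\<lambda>s. f (p + s *\<^sub>R u)) has_derivative (\<lambda>h. f' (p + s *\<^sub>R u) (h *\<^sub>R u))) (at s within {0..t})"
        using has_derivative_compose[OF b2 a2] by simp
      show ?thesis unfolding g_def g'_def
        by (rule has_derivative_eq_rhs, rule has_derivative_diff, rule has_derivative_diff, rule c1, rule c2)
          (auto intro!: derivative_eq_intros simp: fun_eq_iff blinfun.scaleR_right algebra_simps)
    qed
    have bnd: "norm (g' s) \<le> 2 * e' * (t * K) * K" if s: "s \<in> {0..t}" for s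
    proof -
      let ?y1 = "p + s *\<^sub>R u + t *\<^sub>R v" and ?y2 = "p + s *\<^sub>R u"
      have n1: "norm (?y1 - p) \<le> t * K" using nb[of s t] s t by (auto simp: algebra_simps)
      have n2: "norm (?y2 - p) \<le> t * K" using nb[of s 0] s t by (auto simp: algebra_simps)
      have q1: "norm (f' ?y1 - f' p - f'' (?y1 - p)) \<le> e' * (t * K)"
        using d2(2)[of ?y1] n1 tK e' by (smt (verit) mult_left_mono)
      have q2: "norm (f' ?y2 - f' p - f'' (?y2 - p)) \<le> e' * (t * K)"
        using d2(2)[of ?y2] n2 tK e' by (smt (verit) mult_left_mono)
      have "f'' (?y1 - p) - f'' (?y2 - p) = t *\<^sub>R f'' v"
        by (simp flip: f''.diff f''.scaleR)
      then have eq: "f' ?y1 - f' ?y2 - t *\<^sub>R f'' v = (f' ?y1 - f' p - f'' (?y1 - p)) - (f' ?y2 - f' p - f'' (?y2 - p))"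
        by (simp add: algebra_simps)
      have "norm (f' ?y1 - f' ?y2 - t *\<^sub>R f'' v) \<le> e' * (t * K) + e' * (t * K)"
        unfolding eq by (rule norm_triangle_le_diff) (use q1 q2 in linarith)
      moreover have "g' s = (f' ?y1 - f' ?y2 - t *\<^sub>R f'' v) u"
        by (simp add: g'_def blinfun.bilinear_simps)
      ultimately have "norm (g' s) \<le> (e' * (t * K) + e' * (t * K)) * norm u"
        by (metis norm_blinfun order_trans mult_right_mono norm_ge_zero)
      also have "\<dots> \<le> (e' * (t * K) + e' * (t * K)) * K"
        using K t e' by (intro mult_left_mono) auto
      finally show ?thesis by (simp add: algebra_simps)
    qed
    have on: "onorm (\<lambda>h. h *\<^sub>R g' s) \<le> 2 * e' * (t * K) * K" if "s \<in> {0..t}" for s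
    proof (rule onorm_le)
      fix x :: real
      have "\<bar>x\<bar> * norm (g' s) \<le> \<bar>x\<bar> * (2 * e' * (t * K) * K)" by (rule mult_left_mono[OF bnd[OF that]]) simp
      then show "norm (x *\<^sub>R g' s) \<le> 2 * e' * (t * K) * K * norm x" by (simp add: mult.commute)
    qed
    have "norm (g t - g 0) \<le> (2 * e' * (t * K) * K) * norm (t - 0)"
      using g' on t by (intro differentiable_bound[of "{0..t}" g "\<lambda>s h. h *\<^sub>R g' s"]) auto
    also have "\<dots> = e * t\<^sup>2" using t K by (simp add: e'_def power2_eq_square)
    finally show ?thesis by (simp add: g_def power2_eq_square algebra_simps)
  qed
  then show ?thesis using d by blast
qed

text \<open>The second difference is symmetric in \<open>u\<close> and \<open>v\<close>, so both
  \<open>f''(v)(u)\<close> and \<open>f''(u)(v)\<close> are its limit after division by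
  \<open>t\<^sup>2\<close>.\<close>

lemma second_derivative_symmetric:
  fixes f :: "'a::real_normed_vector \<Rightarrow> 'b::real_normed_vector" and f' :: "'a \<Rightarrow> 'a \<Rightarrow>\<^sub>L 'b"
  assumes ev: "\<forall>\<^sub>F x in nhds p. (f has_derivative blinfun_apply (f' x)) (at x)"
    and f'': "(f' has_derivative f'') (at p)"
  shows "f'' u v = f'' v u"
proof -
  have "norm (f'' v u - f'' u v) \<le> 2 * e" if e: "e > 0" for e
  proof -
    obtain d1 where d1: "d1 > 0" "\<And>t. 0 < t \<and> t < d1 \<Longrightarrow>
      norm (f (p + t *\<^sub>R u + t *\<^sub>R v) - f (p + t *\<^sub>R u) - f (p + t *\<^sub>R v) + f p - t\<^sup>2 *\<^sub>R f'' v u) \<le> e * t\<^sup>2"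
      using second_difference_estimate[OF ev f'' e, of u v] by blast
    obtain d2 where d2: "d2 > 0" "\<And>t. 0 < t \<and> t < d2 \<Longrightarrow>
      norm (f (p + t *\<^sub>R v + t *\<^sub>R u) - f (p + t *\<^sub>R v) - f (p + t *\<^sub>R u) + f p - t\<^sup>2 *\<^sub>R f'' u v) \<le> e * t\<^sup>2"
      using second_difference_estimate[OF ev f'' e, of v u] by blast
    define t where "t = min d1 d2 / 2"
    have t: "0 < t" "t < d1" "t < d2" using d1(1) d2(1) by (auto simp: t_def min_def)
    let ?D = "f (p + t *\<^sub>R u + t *\<^sub>R v) - f (p + t *\<^sub>R u) - f (p + t *\<^sub>R v) + f p"
    have 2: "norm (?D - t\<^sup>2 *\<^sub>R f'' u v) \<le> e * t\<^sup>2" using d2(2)[of t] t by (simp add: algebra_simps)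
    have 1: "norm (?D - t\<^sup>2 *\<^sub>R f'' v u) \<le> e * t\<^sup>2" using d1(2)[of t] t by simp
    have "t\<^sup>2 *\<^sub>R (f'' v u - f'' u v) = (?D - t\<^sup>2 *\<^sub>R f'' u v) - (?D - t\<^sup>2 *\<^sub>R f'' v u)"
      by (simp add: algebra_simps)
    then have "norm (t\<^sup>2 *\<^sub>R (f'' v u - f'' u v)) \<le> e * t\<^sup>2 + e * t\<^sup>2"
      using 1 2 norm_triangle_le_diff by (smt (verit))
    then have "t\<^sup>2 * norm (f'' v u - f'' u v) \<le> t\<^sup>2 * (2 * e)" unfolding norm_scaleR by (simp add: ac_simps)
    then show ?thesis using t by (simp add: mult_le_cancel_left_pos)
  qed
  note bound = this
  have "norm (f'' v u - f'' u v) \<le> 0"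
  proof (rule field_le_epsilon)
    fix e :: real assume "e > 0"
    then show "norm (f'' v u - f'' u v) \<le> 0 + e"
      using bound[of "e / 2"] by simp
  qed
  then show ?thesis by simp
qed

lemma twice_diff_at_cong:
  assumes "twice_diff_at f p" "\<forall>\<^sub>F x in nhds p. f x = g x"
  shows "twice_diff_at g p"
proof -
  obtain f' where f': "\<forall>\<^sub>F x in nhds p. (f has_derivative blinfun_apply (f' x)) (at x)" "f' differentiable (at p)"
    using assms(1) unfolding twice_diff_at_def by blast
  have "\<forall>\<^sub>F x in nhds p. \<forall>\<^sub>F y in nhds x. f y = g y"
    using assms(2) by (simp add: eventually_eventually)
  then have "\<forall>\<^sub>F x in nhds p. (g has_derivative blinfun_apply (f' x)) (at x)"
    using f'(1)
  proof eventually_elim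
    case (elim x)
    have "f x = g x" using elim(1) eventually_nhds_x_imp_x by blast
    moreover have "\<forall>\<^sub>F y in at x. f y = g y" using elim(1) by (simp add: eventually_at_filter eventually_mono)
    ultimately show ?case using elim(2) has_derivative_transform_eventually by blast
  qed
  then show ?thesis using f'(2) unfolding twice_diff_at_def by blast
qed

lemma twice_diff_at_affine:
  assumes "bounded_linear l" shows "twice_diff_at (\<lambda>x. c + l x) p"
proof -
  have "((\<lambda>x. c + l x) has_derivative blinfun_apply (Blinfun l)) (at x)" for x
    unfolding bounded_linear_Blinfun_apply[OF assms]
    using has_derivative_add[OF has_derivative_const[of c] bounded_linear.has_derivative[OF assms has_derivative_ident]]
    by simp
  then show ?thesis unfolding twice_diff_at_def by (intro exI[of _ "\<lambda>_. Blinfun l"]) auto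
qed

lemma twice_diff_at_compose:
  assumes f: "twice_diff_at f (g p)" and g: "twice_diff_at g p"
  shows "twice_diff_at (\<lambda>x. f (g x)) p"
proof -
  obtain f' where f': "\<forall>\<^sub>F x in nhds (g p). (f has_derivative blinfun_apply (f' x)) (at x)" "f' differentiable (at (g p))"
    using f unfolding twice_diff_at_def by blast
  obtain g' where g': "\<forall>\<^sub>F x in nhds p. (g has_derivative blinfun_apply (g' x)) (at x)" "g' differentiable (at p)"
    using g unfolding twice_diff_at_def by blast
  have gd: "(g has_derivative blinfun_apply (g' p)) (at p)"
    using g'(1) eventually_nhds_x_imp_x by blast
  then have "isCont g p" by (rule has_derivative_continuous)
  then have "(g \<longlongrightarrow> g p) (nhds p)" by (simp add: isCont_def tendsto_at_iff_tendsto_nhds)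
  then have "\<forall>\<^sub>F x in nhds p. (f has_derivative blinfun_apply (f' (g x))) (at (g x))"
    using f'(1) unfolding filterlim_iff by blast
  then have ev: "\<forall>\<^sub>F x in nhds p. ((\<lambda>x. f (g x)) has_derivative blinfun_apply (f' (g x) o\<^sub>L g' x)) (at x)"
    using g'(1)
  proof eventually_elim
    case (elim x)
    have "blinfun_apply (f' (g x) o\<^sub>L g' x) = (\<lambda>h. f' (g x) (g' x h))" by auto
    then show ?case using has_derivative_compose[OF elim(2,1)] by simp
  qed
  obtain F'' where F'': "(f' has_derivative F'') (at (g p))" using f'(2) by (auto simp: differentiable_def)
  obtain G'' where G'': "(g' has_derivative G'') (at p)" using g'(2) by (auto simp: differentiable_def)
  have D: "((\<lambda>x. f' (g x) o\<^sub>L g' x) has_derivative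
      (\<lambda>h. (f' (g p) o\<^sub>L G'' h) + (F'' (g' p h) o\<^sub>L g' p))) (at p)"
    by (rule bounded_bilinear.FDERIV[OF bounded_bilinear_blinfun_compose has_derivative_compose[OF gd F''] G''])
  have "(\<lambda>x. f' (g x) o\<^sub>L g' x) differentiable (at p)" unfolding differentiable_def by (rule exI, rule D)
  then show ?thesis unfolding twice_diff_at_def by (intro exI[of _ "\<lambda>x. f' (g x) o\<^sub>L g' x"] conjI ev)
qed

text \<open>Smoothness only provides the directional derivatives \<open>x \<mapsto> f'(x) v\<close>; in finite
  dimension the operator \<open>f'(x)\<close> is a finite combination of those with \<open>v\<close> in
  the basis.\<close>

lemma smooth_on_imp_twice_diff_at:
  fixes f :: "'a::euclidean_space \<Rightarrow> 'b::real_normed_vector"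
  assumes "smooth_on f S" "open S" "p \<in> S"
  shows "twice_diff_at f p"
proof -
  have "C_k_on (Suc (Suc 0)) f S" using assms(1) unfolding smooth_on_def by blast
  then have d1: "f differentiable_on S" and d2: "\<And>v. (\<lambda>x. frechet_derivative f (at x) v) differentiable_on S"
    by auto
  define f' where "f' x = Blinfun (frechet_derivative f (at x))" for x
  have fd: "(f has_derivative frechet_derivative f (at x)) (at x)" if "x \<in> S" for x
    using d1 that assms(2) differentiable_on_eq_differentiable_at frechet_derivative_works by blast
  have f': "blinfun_apply (f' x) = frechet_derivative f (at x)" if "x \<in> S" for x
    unfolding f'_def using bounded_linear_Blinfun_apply[OF has_derivative_bounded_linear[OF fd[OF that]]] .
  have evS: "\<forall>\<^sub>F x in nhds p. x \<in> S" using assms by (simp add: eventually_nhds_in_open)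
  have ev: "\<forall>\<^sub>F x in nhds p. (f has_derivative blinfun_apply (f' x)) (at x)"
    using evS by eventually_elim (simp add: f' fd)
  define F where "F x = (\<Sum>v\<in>Basis. blinfun_scaleR_left (frechet_derivative f (at x) v) o\<^sub>L blinfun_inner_right v)" for x
  have eq: "F x = f' x" if "x \<in> S" for x
  proof (rule blinfun_eqI)
    fix u
    interpret bounded_linear "frechet_derivative f (at x)" using fd[OF that] has_derivative_bounded_linear by blast
    have "F x u = (\<Sum>v\<in>Basis. (v \<bullet> u) *\<^sub>R frechet_derivative f (at x) v)"
      by (simp add: F_def blinfun.sum_left)
    also have "\<dots> = frechet_derivative f (at x) (\<Sum>v\<in>Basis. (u \<bullet> v) *\<^sub>R v)"
      by (simp add: sum scaleR inner_commute)
    also have "\<dots> = f' x u" by (simp add: euclidean_representation f'[OF that])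
    finally show "F x u = f' x u" .
  qed
  have "F differentiable (at p)" unfolding F_def
  proof (rule differentiable_sum[OF finite_Basis], rule ballI)
    fix v :: 'a assume "v \<in> Basis"
    have "(\<lambda>x. frechet_derivative f (at x) v) differentiable (at p)"
      using d2[of v] assms differentiable_on_eq_differentiable_at by blast
    then obtain D where D: "((\<lambda>x. frechet_derivative f (at x) v) has_derivative D) (at p)" by (auto simp: differentiable_def)
    have "((\<lambda>x. blinfun_scaleR_left (frechet_derivative f (at x) v) o\<^sub>L blinfun_inner_right v)
       has_derivative (\<lambda>h. blinfun_scaleR_left (D h) o\<^sub>L blinfun_inner_right v)) (at p)"
      by (rule bounded_linear.has_derivative[OF bounded_linear_compose[OF
           bounded_bilinear.bounded_linear_left[OF bounded_bilinear_blinfun_compose] bounded_linear_blinfun_scaleR_left] D])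
    then show "(\<lambda>x. blinfun_scaleR_left (frechet_derivative f (at x) v) o\<^sub>L blinfun_inner_right v) differentiable (at p)"
      by (auto simp: differentiable_def)
  qed
  then obtain D where D: "(F has_derivative D) (at p)" by (auto simp: differentiable_def)
  have "(f' has_derivative D) (at p)"
  proof (rule has_derivative_transform_eventually[OF D])
    show "\<forall>\<^sub>F x in at p. F x = f' x" using evS unfolding eventually_at_filter
      by eventually_elim (simp add: eq)
  qed (auto simp: eq assms)
  then show ?thesis using ev unfolding twice_diff_at_def differentiable_def by blast
qed

section \<open>The Lie algebra of a Lie group\<close>

text \<open>A Lie group with a fixed chart \<open>(U, \<phi>)\<close> around the identity. Here
  \<open>\<iota>\<close> is the inverse of the chart, \<open>p\<close> is the point that represents the
  identity, \<open>m\<close> is the multiplication and \<open>conj_map a\<close> the conjugation by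
  \<open>a\<close> in the chart. Identities that involve \<open>m\<close> hold near \<open>p\<close>,
  where the products stay in \<open>U\<close>.\<close>

locale lie_group_chart =
  fixes G :: "('a::t2_space) monoid" and A :: "('a, 'g::euclidean_space) chart set"
    and U :: "'a set" and \<phi> :: "'a \<Rightarrow> 'g"
  assumes lie: "lie_group G A" and chart: "(U, \<phi>) \<in> A" and one_U: "\<one>\<^bsub>G\<^esub> \<in> U"
begin

sublocale group G using lie by (simp add: lie_group_def)

abbreviation "\<iota> \<equiv> inv_into U \<phi>"
abbreviation "p \<equiv> \<phi> \<one>\<^bsub>G\<^esub>"
abbreviation "br \<equiv> lie_bracket G U \<phi>"

definition m :: "'g \<Rightarrow> 'g \<Rightarrow> 'g" where "m x y = \<phi> (\<iota> x \<otimes>\<^bsub>G\<^esub> \<iota> y)"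
definition conj_map :: "'a \<Rightarrow> 'g \<Rightarrow> 'g" where "conj_map a x = \<phi> (a \<otimes>\<^bsub>G\<^esub> \<iota> x \<otimes>\<^bsub>G\<^esub> m_inv G a)"

lemma chartD:
  assumes "(V, \<psi>) \<in> A"
  shows "openin (top_of_set (carrier G)) V" "V \<subseteq> carrier G" "open (\<psi> ` V)"
    "continuous_on V \<psi>" "continuous_on (\<psi> ` V) (inv_into V \<psi>)" "\<And>a. a \<in> V \<Longrightarrow> inv_into V \<psi> (\<psi> a) = a"
    "\<And>x. x \<in> \<psi> ` V \<Longrightarrow> inv_into V \<psi> x \<in> V" "\<And>x. x \<in> \<psi> ` V \<Longrightarrow> \<psi> (inv_into V \<psi> x) = x"
proof -
  have *: "openin (top_of_set (carrier G)) V \<and> open (\<psi> ` V) \<and> homeomorphism V (\<psi> ` V) \<psi> (inv_into V \<psi>)"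
    using lie assms unfolding lie_group_def smooth_atlas_def by blast
  then show "openin (top_of_set (carrier G)) V" "open (\<psi> ` V)" by auto
  show "V \<subseteq> carrier G" using * openin_imp_subset by blast
  show "continuous_on V \<psi>" "continuous_on (\<psi> ` V) (inv_into V \<psi>)" "\<And>a. a \<in> V \<Longrightarrow> inv_into V \<psi> (\<psi> a) = a"
    using * by (auto simp: homeomorphism_def)
  show "\<And>x. x \<in> \<psi> ` V \<Longrightarrow> inv_into V \<psi> x \<in> V" by (rule inv_into_into)
  show "\<And>x. x \<in> \<psi> ` V \<Longrightarrow> \<psi> (inv_into V \<psi> x) = x" by (rule f_inv_into_f)
qed

lemma chart_exists: "a \<in> carrier G \<Longrightarrow> \<exists>V \<psi>. (V, \<psi>) \<in> A \<and> a \<in> V"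
  using lie unfolding lie_group_def smooth_atlas_def by blast

lemma open_preimage_chart:
  assumes V: "(V, \<psi>) \<in> A" and f: "continuous_on S f" "open S" "f ` S \<subseteq> carrier G"
  shows "open {x \<in> S. f x \<in> V}"
proof -
  obtain T where T: "open T" "V = carrier G \<inter> T" using chartD(1)[OF V] by (auto simp: openin_open)
  have "{x \<in> S. f x \<in> V} = S \<inter> f -` T" using T f(3) by auto
  then show ?thesis using continuous_open_preimage[OF f(1,2) T(1)] by simp
qed

lemma mult_cont: "continuous_on S f \<Longrightarrow> continuous_on S h \<Longrightarrow> f ` S \<subseteq> carrier G \<Longrightarrow> h ` S \<subseteq> carrier G \<Longrightarrow>
  continuous_on S (\<lambda>x. f x \<otimes>\<^bsub>G\<^esub> h x)"
proof -
  assume *: "continuous_on S f" "continuous_on S h" "f ` S \<subseteq> carrier G" "h ` S \<subseteq> carrier G"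
  have "continuous_on (carrier G \<times> carrier G) (\<lambda>(x, y). x \<otimes>\<^bsub>G\<^esub> y)" using lie by (simp add: lie_group_def)
  from continuous_on_compose2[OF this continuous_on_Pair[OF *(1,2)]] * show ?thesis by auto
qed

lemma mult_twice_diff:
  assumes V: "(V, \<psi>) \<in> A" "a \<in> V" and W: "(W, \<theta>) \<in> A" "b \<in> W" and Z: "(Z, \<zeta>) \<in> A" "a \<otimes>\<^bsub>G\<^esub> b \<in> Z"
  shows "twice_diff_at (\<lambda>(x, y). \<zeta> (inv_into V \<psi> x \<otimes>\<^bsub>G\<^esub> inv_into W \<theta> y)) (\<psi> a, \<theta> b)"
proof (rule smooth_on_imp_twice_diff_at)
  let ?S = "{(x, y). x \<in> \<psi> ` V \<and> y \<in> \<theta> ` W \<and> inv_into V \<psi> x \<otimes>\<^bsub>G\<^esub> inv_into W \<theta> y \<in> Z}"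
  show "smooth_on (\<lambda>(x, y). \<zeta> (inv_into V \<psi> x \<otimes>\<^bsub>G\<^esub> inv_into W \<theta> y)) ?S"
    using lie V W Z unfolding lie_group_def by blast
  have c1: "continuous_on (\<psi> ` V \<times> \<theta> ` W) (\<lambda>z. inv_into V \<psi> (fst z))"
    by (rule continuous_on_compose2[OF chartD(5)[OF V(1)]]) (auto intro!: continuous_intros)
  have c2: "continuous_on (\<psi> ` V \<times> \<theta> ` W) (\<lambda>z. inv_into W \<theta> (snd z))"
    by (rule continuous_on_compose2[OF chartD(5)[OF W(1)]]) (auto intro!: continuous_intros)
  have s1: "(\<lambda>z. inv_into V \<psi> (fst z)) ` (\<psi> ` V \<times> \<theta> ` W) \<subseteq> carrier G"
    using chartD(2,7)[OF V(1)] by fastforce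
  have s2: "(\<lambda>z. inv_into W \<theta> (snd z)) ` (\<psi> ` V \<times> \<theta> ` W) \<subseteq> carrier G"
    using chartD(2,7)[OF W(1)] by fastforce
  have "open {z \<in> \<psi> ` V \<times> \<theta> ` W. inv_into V \<psi> (fst z) \<otimes>\<^bsub>G\<^esub> inv_into W \<theta> (snd z) \<in> Z}"
    using s1 s2 by (intro open_preimage_chart[OF Z(1)] mult_cont c1 c2 open_Times chartD(3)[OF V(1)] chartD(3)[OF W(1)])
      (auto intro!: m_closed simp: image_subset_iff)
  also have "{z \<in> \<psi> ` V \<times> \<theta> ` W. inv_into V \<psi> (fst z) \<otimes>\<^bsub>G\<^esub> inv_into W \<theta> (snd z) \<in> Z} = ?S" by auto
  finally show "open ?S" .
  show "(\<psi> a, \<theta> b) \<in> ?S" using V W Z by (auto simp: chartD(6))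
qed

lemma p_in: "p \<in> \<phi> ` U" and \<iota>_p: "\<iota> p = \<one>\<^bsub>G\<^esub>"
  using one_U chartD(6)[OF chart] by auto

lemma ev_chart: "\<forall>\<^sub>F x in nhds p. x \<in> \<phi> ` U"
  using chartD(3)[OF chart] p_in by (simp add: eventually_nhds_in_open)

lemma \<iota>_carrier: "x \<in> \<phi> ` U \<Longrightarrow> \<iota> x \<in> carrier G"
  using chartD(2,7)[OF chart] by blast

lemma \<phi>_\<iota>: "x \<in> \<phi> ` U \<Longrightarrow> \<phi> (\<iota> x) = x" by (rule chartD(8)[OF chart])

lemma \<iota>_\<phi>: "a \<in> U \<Longrightarrow> \<iota> (\<phi> a) = a" by (rule chartD(6)[OF chart])

lemma ev_translate:
  assumes "(V, \<psi>) \<in> A" "a \<in> carrier G" "b \<in> carrier G" "a \<otimes>\<^bsub>G\<^esub> b \<in> V"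
  shows "\<forall>\<^sub>F x in nhds p. a \<otimes>\<^bsub>G\<^esub> \<iota> x \<otimes>\<^bsub>G\<^esub> b \<in> V"
proof -
  have c: "continuous_on (\<phi> ` U) (\<lambda>x. a \<otimes>\<^bsub>G\<^esub> \<iota> x \<otimes>\<^bsub>G\<^esub> b)"
    using assms \<iota>_carrier by (intro mult_cont continuous_on_const chartD(5)[OF chart]) auto
  have "open {x \<in> \<phi> ` U. a \<otimes>\<^bsub>G\<^esub> \<iota> x \<otimes>\<^bsub>G\<^esub> b \<in> V}"
    using assms \<iota>_carrier by (intro open_preimage_chart[OF assms(1) c chartD(3)[OF chart]]) auto
  moreover have "p \<in> {x \<in> \<phi> ` U. a \<otimes>\<^bsub>G\<^esub> \<iota> x \<otimes>\<^bsub>G\<^esub> b \<in> V}" using assms p_in \<iota>_p by simp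
  ultimately have "\<forall>\<^sub>F x in nhds p. x \<in> {x \<in> \<phi> ` U. a \<otimes>\<^bsub>G\<^esub> \<iota> x \<otimes>\<^bsub>G\<^esub> b \<in> V}" by (rule eventually_nhds_in_open)
  then show ?thesis by eventually_elim auto
qed

lemma m_twice_diff: "twice_diff_at (\<lambda>(x, y). m x y) (p, p)"
  unfolding m_def by (rule mult_twice_diff[OF chart one_U chart one_U chart]) (simp add: one_U)

lemma conj_map_p: "a \<in> carrier G \<Longrightarrow> conj_map a p = p"
  by (simp add: conj_map_def \<iota>_p)

text \<open>Neither \<open>a\<close> nor its inverse need lie in \<open>U\<close>. Conjugation is therefore split
  into \<open>y \<mapsto> a y\<close>, read in a chart around \<open>a\<close>, followed by \<open>z
  \<mapsto> z a\<^sup>-\<^sup>1\<close>, and both are slices of a multiplication between three charts.\<close>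

lemma conj_map_twice_diff:
  assumes a: "a \<in> carrier G" shows "twice_diff_at (conj_map a) p"
proof -
  obtain V \<psi> where V: "(V, \<psi>) \<in> A" "a \<in> V" using chart_exists a by blast
  obtain W \<theta> where W: "(W, \<theta>) \<in> A" "m_inv G a \<in> W" using chart_exists a by blast
  let ?f1 = "\<lambda>(x, y). \<psi> (inv_into V \<psi> x \<otimes>\<^bsub>G\<^esub> inv_into U \<phi> y)"
  let ?f2 = "\<lambda>(x, y). \<phi> (inv_into V \<psi> x \<otimes>\<^bsub>G\<^esub> inv_into W \<theta> y)"
  define h1 where "h1 y = ?f1 (\<psi> a, y)" for y
  define h2 where "h2 z = ?f2 (z, \<theta> (m_inv G a))" for z
  have "twice_diff_at ?f1 (\<psi> a, p)" using a V by (intro mult_twice_diff[OF V chart one_U V(1)]) simp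
  then have "twice_diff_at (\<lambda>y. ?f1 ((\<psi> a, 0) + (0, y))) p"
    by (intro twice_diff_at_compose[where f="?f1" and g="\<lambda>y. (\<psi> a, 0) + (0, y)"] twice_diff_at_affine) (auto intro: bounded_linear_intros bounded_linear_Pair bounded_linear_zero bounded_linear_ident)
  then have t1: "twice_diff_at h1 p" by (simp add: h1_def[abs_def])
  have h1p: "h1 p = \<psi> a" using a V by (simp add: h1_def \<iota>_p chartD(6))
  have "twice_diff_at ?f2 (\<psi> a, \<theta> (m_inv G a))" using a one_U by (intro mult_twice_diff[OF V W chart]) simp
  then have "twice_diff_at (\<lambda>z. ?f2 ((0, \<theta> (m_inv G a)) + (z, 0))) (\<psi> a)"
    by (intro twice_diff_at_compose[where f="?f2" and g="\<lambda>z. (0, \<theta> (m_inv G a)) + (z, 0)"] twice_diff_at_affine) (auto intro: bounded_linear_Pair bounded_linear_zero bounded_linear_ident)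
  then have t2: "twice_diff_at h2 (h1 p)" by (simp add: h2_def[abs_def] h1p)
  have "\<forall>\<^sub>F x in nhds p. a \<otimes>\<^bsub>G\<^esub> \<iota> x \<otimes>\<^bsub>G\<^esub> \<one>\<^bsub>G\<^esub> \<in> V" using V a by (intro ev_translate) auto
  then have "\<forall>\<^sub>F x in nhds p. h2 (h1 x) = conj_map a x"
    using ev_chart
  proof eventually_elim
    case (elim x)
    then have "a \<otimes>\<^bsub>G\<^esub> \<iota> x \<in> V" using a \<iota>_carrier by simp
    then show ?case using V W by (simp add: h1_def h2_def conj_map_def chartD(6))
  qed
  then show ?thesis using twice_diff_at_cong[OF twice_diff_at_compose[OF t2 t1]] by simp
qed

lemma eventually_nhds_pair:
  assumes "\<forall>\<^sub>F z in nhds (x, y). P z"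
  shows "\<forall>\<^sub>F x' in nhds x. \<forall>\<^sub>F y' in nhds y. P (x', y')"
proof -
  obtain Pf Pg where "\<forall>\<^sub>F a in nhds x. Pf a" "\<forall>\<^sub>F b in nhds y. Pg b" and *: "\<And>a b. Pf a \<Longrightarrow> Pg b \<Longrightarrow> P (a, b)"
    using assms unfolding nhds_prod eventually_prod_filter by auto
  then show ?thesis by (auto elim!: eventually_mono)
qed

definition Dm :: "'g \<times> 'g \<Rightarrow> ('g \<times> 'g) \<Rightarrow>\<^sub>L 'g" where
  "Dm = (SOME f'. (\<forall>\<^sub>F z in nhds (p, p). ((\<lambda>(x, y). m x y) has_derivative blinfun_apply (f' z)) (at z)) \<and>
           f' differentiable (at (p, p)))"

definition D2m :: "'g \<times> 'g \<Rightarrow> ('g \<times> 'g) \<Rightarrow>\<^sub>L 'g" where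
  "D2m = (SOME D. (Dm has_derivative D) (at (p, p)))"

lemma Dm: "\<forall>\<^sub>F z in nhds (p, p). ((\<lambda>(x, y). m x y) has_derivative blinfun_apply (Dm z)) (at z)"
  and D2m: "(Dm has_derivative D2m) (at (p, p))"
proof -
  have *: "(\<forall>\<^sub>F z in nhds (p, p). ((\<lambda>(x, y). m x y) has_derivative blinfun_apply (Dm z)) (at z)) \<and>
           Dm differentiable (at (p, p))"
    unfolding Dm_def by (rule someI_ex[OF m_twice_diff[unfolded twice_diff_at_def]])
  then show "\<forall>\<^sub>F z in nhds (p, p). ((\<lambda>(x, y). m x y) has_derivative blinfun_apply (Dm z)) (at z)" by blast
  show "(Dm has_derivative D2m) (at (p, p))"
    unfolding D2m_def by (rule someI_ex[OF *[THEN conjunct2, unfolded differentiable_def]])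
qed

lemma D2m_symmetric: "D2m u v = D2m v u"
  by (rule second_derivative_symmetric[OF Dm D2m])

lemma m_right_derivative:
  "((\<lambda>(x, y). m x y) has_derivative blinfun_apply (Dm (x, y))) (at (x, y)) \<Longrightarrow>
   (m x has_derivative (\<lambda>Y. Dm (x, y) (0, Y))) (at y)"
  using has_derivative_compose[OF has_derivative_Pair[OF has_derivative_const[of x] has_derivative_ident],
      of "\<lambda>(x, y). m x y" "blinfun_apply (Dm (x, y))" y UNIV]
  by simp

lemma m_left_derivative:
  "((\<lambda>(x, y). m x y) has_derivative blinfun_apply (Dm (x, y))) (at (x, y)) \<Longrightarrow>
   ((\<lambda>x. m x y) has_derivative (\<lambda>X. Dm (x, y) (X, 0))) (at x)"
  using has_derivative_compose[OF has_derivative_Pair[OF has_derivative_ident has_derivative_const[of y]],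
      of "\<lambda>(x, y). m x y" "blinfun_apply (Dm (x, y))" x UNIV]
  by simp

lemma ev_left: "\<forall>\<^sub>F x in nhds p. ((\<lambda>(x, y). m x y) has_derivative blinfun_apply (Dm (x, p))) (at (x, p))"
  using eventually_nhds_pair[OF Dm] by eventually_elim (rule eventually_nhds_x_imp_x)

lemma ev_right: "\<forall>\<^sub>F y in nhds p. ((\<lambda>(x, y). m x y) has_derivative blinfun_apply (Dm (p, y))) (at (p, y))"
  using eventually_nhds_pair[OF Dm, THEN eventually_nhds_x_imp_x] .

lemma ev_left_inv_field: "\<forall>\<^sub>F x in nhds p. \<forall>Y. left_inv_field G U \<phi> Y x = Dm (x, p) (0, Y)"
  using ev_left
proof eventually_elim
  case (elim x)
  have "frechet_derivative (m x) (at p) = (\<lambda>Y. Dm (x, p) (0, Y))"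
    using m_right_derivative[OF elim] by (rule frechet_derivative_at[symmetric])
  then show ?case by (simp add: left_inv_field_def m_def[abs_def])
qed

lemma has_derivative_cong_ev:
  assumes "(f has_derivative D) (at p)" "\<forall>\<^sub>F x in nhds p. f x = h x"
  shows "(h has_derivative D) (at p)"
proof (rule has_derivative_transform_eventually[OF assms(1)])
  show "\<forall>\<^sub>F x in at p. f x = h x" using assms(2) by (simp add: eventually_at_filter eventually_mono)
  show "f p = h p" using assms(2) eventually_nhds_x_imp_x by blast
qed simp

lemma Dm_left_slice: "((\<lambda>x. Dm (x, p) v) has_derivative (\<lambda>X. D2m (X, 0) v)) (at p)"
proof -
  have "((\<lambda>x. Dm (x, p)) has_derivative (\<lambda>X. D2m (X, 0))) (at p)"
    by (rule has_derivative_compose[of "\<lambda>x. (x, p)" "\<lambda>X. (X, 0)" p UNIV Dm D2m])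
      (use D2m in \<open>auto intro!: has_derivative_Pair has_derivative_const has_derivative_ident\<close>)
  from bounded_linear.has_derivative[OF blinfun.bounded_linear_left this] show ?thesis .
qed

lemma Dm_right_slice: "((\<lambda>y. Dm (p, y) v) has_derivative (\<lambda>X. D2m (0, X) v)) (at p)"
proof -
  have "((\<lambda>y. Dm (p, y)) has_derivative (\<lambda>X. D2m (0, X))) (at p)"
    by (rule has_derivative_compose[of "\<lambda>x. (p, x)" "\<lambda>X. (0, X)" p UNIV Dm D2m])
      (use D2m in \<open>auto intro!: has_derivative_Pair has_derivative_const has_derivative_ident\<close>)
  from bounded_linear.has_derivative[OF blinfun.bounded_linear_left this] show ?thesis .
qed

text \<open>The left-invariant field of \<open>Y\<close> is \<open>x \<mapsto> D\<^sub>2m(x, p) Y\<close>, so the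
  bracket is the skew part of the mixed second derivative of the multiplication.\<close>

lemma br_eq: "br X Y = D2m (X, 0) (0, Y) - D2m (Y, 0) (0, X)"
proof -
  have "(left_inv_field G U \<phi> Z has_derivative (\<lambda>X. D2m (X, 0) (0, Z))) (at p)" for Z
    by (rule has_derivative_cong_ev[OF Dm_left_slice]) (use ev_left_inv_field in \<open>eventually_elim, simp\<close>)
  then have "frechet_derivative (left_inv_field G U \<phi> Z) (at p) = (\<lambda>X. D2m (X, 0) (0, Z))" for Z
    using frechet_derivative_at by metis
  then show ?thesis by (simp add: lie_bracket_def)
qed

lemma br_bilinear: "bounded_bilinear br"
proof -
  interpret M: bounded_linear D2m using D2m has_derivative_bounded_linear by blast
  have pl: "D2m (X + X', 0) = D2m (X, 0) + D2m (X', 0)" "D2m (r *\<^sub>R X, 0) = r *\<^sub>R D2m (X, 0)"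
    "D2m v (0, X + X') = D2m v (0, X) + D2m v (0, X')" "D2m v (0, r *\<^sub>R X) = r *\<^sub>R D2m v (0, X)" for X X' r v
    using M.add[of "(X, 0)" "(X', 0)"] M.scaleR[of r "(X, 0)"] blinfun.add_right[of "D2m v" "(0, X)" "(0, X')"]
      blinfun.scaleR_right[of "D2m v" r "(0, X)"] by simp_all
  have "bilinear br"
    unfolding bilinear_def
  proof (intro conjI allI)
    fix X show "linear (br X)" unfolding br_eq
      by (rule linearI) (simp_all add: blinfun.bilinear_simps pl algebra_simps)
  next
    fix Y show "linear (\<lambda>X. br X Y)" unfolding br_eq
      by (rule linearI) (simp_all add: blinfun.bilinear_simps pl algebra_simps)
  qed
  then show ?thesis using bilinear_conv_bounded_bilinear by blast
qed

lemma br_antisym: "br X Y = - br Y X" by (simp add: br_eq)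

lemma m_p_right: "\<forall>\<^sub>F x in nhds p. m x p = x"
  using ev_chart by eventually_elim (simp add: m_def \<iota>_p \<iota>_carrier \<phi>_\<iota>)

lemma m_p_left: "\<forall>\<^sub>F x in nhds p. m p x = x"
  using ev_chart by eventually_elim (simp add: m_def \<iota>_p \<iota>_carrier \<phi>_\<iota>)

lemma Dm_pp: "Dm (p, p) (0, Y) = Y" "Dm (p, p) (X, 0) = X"
proof -
  have "(m p has_derivative (\<lambda>Y. Dm (p, p) (0, Y))) (at p)"
    by (rule m_right_derivative[OF eventually_nhds_x_imp_x[OF ev_left]])
  from has_derivative_cong_ev[OF this m_p_left] have "(\<lambda>Y. Dm (p, p) (0, Y)) = (\<lambda>Y. Y)"
    by (rule has_derivative_unique) (rule has_derivative_ident)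
  then show "Dm (p, p) (0, Y) = Y" by metis
  have "((\<lambda>x. m x p) has_derivative (\<lambda>X. Dm (p, p) (X, 0))) (at p)"
    by (rule m_left_derivative[OF eventually_nhds_x_imp_x[OF ev_left]])
  from has_derivative_cong_ev[OF this m_p_right] have "(\<lambda>X. Dm (p, p) (X, 0)) = (\<lambda>Y. Y)"
    by (rule has_derivative_unique) (rule has_derivative_ident)
  then show "Dm (p, p) (X, 0) = X" by metis
qed

lemma conj_map_tendsto:
  assumes "a \<in> carrier G" shows "(conj_map a \<longlongrightarrow> p) (nhds p)"
proof -
  obtain f' where "\<forall>\<^sub>F x in nhds p. (conj_map a has_derivative blinfun_apply (f' x)) (at x)"
    using conj_map_twice_diff[OF assms] unfolding twice_diff_at_def by blast
  then have "isCont (conj_map a) p" using eventually_nhds_x_imp_x has_derivative_continuous by blast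
  then have "(conj_map a \<longlongrightarrow> conj_map a p) (nhds p)" by (simp add: isCont_def tendsto_at_iff_tendsto_nhds)
  then show ?thesis by (simp add: conj_map_p[OF assms])
qed

lemma ev_conj:
  assumes a: "a \<in> carrier G"
  shows "\<forall>\<^sub>F x in nhds p. x \<in> \<phi> ` U \<and> a \<otimes>\<^bsub>G\<^esub> \<iota> x \<otimes>\<^bsub>G\<^esub> m_inv G a \<in> U \<and> conj_map a x \<in> \<phi> ` U \<and>
    \<iota> (conj_map a x) = a \<otimes>\<^bsub>G\<^esub> \<iota> x \<otimes>\<^bsub>G\<^esub> m_inv G a"
proof -
  have "\<forall>\<^sub>F x in nhds p. a \<otimes>\<^bsub>G\<^esub> \<iota> x \<otimes>\<^bsub>G\<^esub> m_inv G a \<in> U"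
    using a one_U by (intro ev_translate[OF chart]) auto
  then show ?thesis using ev_chart by eventually_elim (auto simp: conj_map_def \<iota>_\<phi>)
qed

lemma Ad_eqI:
  assumes "(conj_map a has_derivative D) (at p)"
  shows "Ad G U \<phi> a X = D X"
  using frechet_derivative_at[OF assms] by (simp add: Ad_def conj_map_def[abs_def])

lemma Ad_derivative:
  assumes "a \<in> carrier G" shows "(conj_map a has_derivative Ad G U \<phi> a) (at p)"
proof -
  obtain f' where "\<forall>\<^sub>F x in nhds p. (conj_map a has_derivative blinfun_apply (f' x)) (at x)"
    using conj_map_twice_diff[OF assms] unfolding twice_diff_at_def by blast
  then have D: "(conj_map a has_derivative blinfun_apply (f' p)) (at p)" by (rule eventually_nhds_x_imp_x)
  have "Ad G U \<phi> a = blinfun_apply (f' p)" using Ad_eqI[OF D] by auto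
  then show ?thesis using D by simp
qed

lemma ev_mult_U: "\<forall>\<^sub>F z in nhds (p, p). \<iota> (fst z) \<otimes>\<^bsub>G\<^esub> \<iota> (snd z) \<in> U"
proof -
  have c: "continuous_on (\<phi> ` U \<times> \<phi> ` U) (\<lambda>z. \<iota> (fst z) \<otimes>\<^bsub>G\<^esub> \<iota> (snd z))"
    using \<iota>_carrier by (intro mult_cont continuous_on_compose2[OF chartD(5)[OF chart]]) (auto intro!: continuous_intros)
  have "open {z \<in> \<phi> ` U \<times> \<phi> ` U. \<iota> (fst z) \<otimes>\<^bsub>G\<^esub> \<iota> (snd z) \<in> U}"
    using \<iota>_carrier by (intro open_preimage_chart[OF chart c] open_Times chartD(3)[OF chart]) auto
  moreover have "(p, p) \<in> {z \<in> \<phi> ` U \<times> \<phi> ` U. \<iota> (fst z) \<otimes>\<^bsub>G\<^esub> \<iota> (snd z) \<in> U}"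
    using p_in \<iota>_p one_U by simp
  ultimately have "\<forall>\<^sub>F z in nhds (p, p). z \<in> {z \<in> \<phi> ` U \<times> \<phi> ` U. \<iota> (fst z) \<otimes>\<^bsub>G\<^esub> \<iota> (snd z) \<in> U}"
    by (rule eventually_nhds_in_open)
  then show ?thesis by eventually_elim auto
qed

text \<open>Left-invariant fields are related by conjugation: \<open>c'(x) L\<^sub>Y(x) = L\<^sub>Z(c x)\<close>
  with \<open>Z = Ad\<^sub>a Y\<close>. Differentiating this at the identity along \<open>X\<close> and
  taking the skew part in \<open>X\<close>, \<open>Y\<close> cancels \<open>c''\<close>.\<close>

lemma Ad_automorphism:
  assumes a: "a \<in> carrier G"
  shows "Ad G U \<phi> a (br X Y) = br (Ad G U \<phi> a X) (Ad G U \<phi> a Y)"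
proof -
  let ?c = "conj_map a" and ?T = "Ad G U \<phi> a"
  obtain c' where c': "\<forall>\<^sub>F x in nhds p. (?c has_derivative blinfun_apply (c' x)) (at x)" "c' differentiable (at p)"
    using conj_map_twice_diff[OF a] unfolding twice_diff_at_def by blast
  obtain c'' where c'': "(c' has_derivative c'') (at p)" using c'(2) by (auto simp: differentiable_def)
  have T: "blinfun_apply (c' p) = ?T" using Ad_eqI[OF eventually_nhds_x_imp_x[OF c'(1)]] by auto
  have ev_hom: "\<forall>\<^sub>F x in nhds p. \<forall>\<^sub>F y in nhds p. ?c (m x y) = m (?c x) (?c y)"
  proof -
    have mU: "\<forall>\<^sub>F x in nhds p. \<forall>\<^sub>F y in nhds p. \<iota> x \<otimes>\<^bsub>G\<^esub> \<iota> y \<in> U"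
      using eventually_nhds_pair[OF ev_mult_U] by simp
    show ?thesis using mU ev_conj[OF a]
    proof eventually_elim
      case (elim x)
      note x = elim(2)
      show ?case using elim(1) ev_conj[OF a]
      proof eventually_elim
        case (elim y)
        have inv_cancel: "m_inv G a \<otimes>\<^bsub>G\<^esub> (a \<otimes>\<^bsub>G\<^esub> z) = z" if "z \<in> carrier G" for z
          using a that by (simp flip: m_assoc)
        have "a \<otimes>\<^bsub>G\<^esub> (\<iota> x \<otimes>\<^bsub>G\<^esub> \<iota> y) \<otimes>\<^bsub>G\<^esub> m_inv G a
            = (a \<otimes>\<^bsub>G\<^esub> \<iota> x \<otimes>\<^bsub>G\<^esub> m_inv G a) \<otimes>\<^bsub>G\<^esub> (a \<otimes>\<^bsub>G\<^esub> \<iota> y \<otimes>\<^bsub>G\<^esub> m_inv G a)"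
          using a \<iota>_carrier x elim by (simp add: m_assoc inv_cancel)
        then show ?case using elim x by (simp add: conj_map_def m_def \<iota>_\<phi>)
      qed
    qed
  qed
  have ev_c: "\<forall>\<^sub>F x in nhds p. ((\<lambda>(x, y). m x y) has_derivative blinfun_apply (Dm (?c x, p))) (at (?c x, p))"
    using conj_map_tendsto[OF a] ev_left unfolding filterlim_iff by blast
  have key: "\<forall>\<^sub>F x in nhds p. \<forall>Y. c' x (Dm (x, p) (0, Y)) = Dm (?c x, p) (0, ?T Y)"
    using ev_hom ev_c ev_left c'(1) m_p_right
  proof eventually_elim
    case (elim x)
    have "((\<lambda>y. ?c (m x y)) has_derivative (\<lambda>Y. c' x (Dm (x, p) (0, Y)))) (at p)"
      using has_derivative_compose[OF m_right_derivative[OF elim(3)], of ?c "blinfun_apply (c' x)"] elim(4,5) by simp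
    then have 1: "((\<lambda>y. m (?c x) (?c y)) has_derivative (\<lambda>Y. c' x (Dm (x, p) (0, Y)))) (at p)"
      by (rule has_derivative_cong_ev) (rule elim(1))
    have 2: "((\<lambda>y. m (?c x) (?c y)) has_derivative (\<lambda>Y. Dm (?c x, p) (0, ?T Y))) (at p)"
      using has_derivative_compose[OF Ad_derivative[OF a], of "m (?c x)" "\<lambda>Y. Dm (?c x, p) (0, Y)"]
        m_right_derivative[OF elim(2)] conj_map_p[OF a] by simp
    show ?case using has_derivative_unique[OF 1 2] by metis
  qed
  have "c'' X Y + ?T (D2m (X, 0) (0, Y)) = D2m (?T X, 0) (0, ?T Y)" for X Y
  proof -
    have 1: "((\<lambda>x. c' x (Dm (x, p) (0, Y))) has_derivative
        (\<lambda>X. c' p (D2m (X, 0) (0, Y)) + c'' X (Dm (p, p) (0, Y)))) (at p)"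
      by (rule bounded_bilinear.FDERIV[OF bounded_bilinear_blinfun_apply c'' Dm_left_slice])
    have "((\<lambda>x. Dm (?c x, p) (0, ?T Y)) has_derivative (\<lambda>X. D2m (?T X, 0) (0, ?T Y))) (at p)"
      using has_derivative_compose[OF Ad_derivative[OF a], of "\<lambda>z. Dm (z, p) (0, ?T Y)" "\<lambda>X. D2m (X, 0) (0, ?T Y)"]
        Dm_left_slice conj_map_p[OF a] by simp
    then have 2: "((\<lambda>x. c' x (Dm (x, p) (0, Y))) has_derivative (\<lambda>X. D2m (?T X, 0) (0, ?T Y))) (at p)"
      by (rule has_derivative_cong_ev) (use key in \<open>eventually_elim, simp\<close>)
    show ?thesis using fun_cong[OF has_derivative_unique[OF 1 2], of X] by (simp add: T Dm_pp add.commute)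
  qed
  note eq = this
  have sym: "c'' X Y = c'' Y X" by (rule second_derivative_symmetric[OF c'(1) c''])
  have lin: "linear ?T" using Ad_derivative[OF a] has_derivative_linear by blast
  show ?thesis unfolding br_eq linear_diff[OF lin] by (simp add: sym flip: eq)
qed

text \<open>The derivative in \<open>y\<close> of the identity \<open>(x y x\<^sup>-\<^sup>1) x = x y\<close>.\<close>

lemma ev_Ad_right_inv:
  "\<forall>\<^sub>F x in nhds p. \<forall>Y. Dm (p, x) (Ad G U \<phi> (\<iota> x) Y, 0) = Dm (x, p) (0, Y)"
  using ev_left ev_right ev_chart
proof eventually_elim
  case (elim x)
  let ?a = "\<iota> x"
  have a: "?a \<in> carrier G" using \<iota>_carrier elim by blast
  have ev: "\<forall>\<^sub>F y in nhds p. m (conj_map ?a y) x = m x y"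
    using ev_conj[OF a]
  proof eventually_elim
    case (elim y)
    then show ?case using a \<iota>_carrier by (simp add: m_def m_assoc)
  qed
  have 1: "((\<lambda>y. m x y) has_derivative (\<lambda>Y. Dm (x, p) (0, Y))) (at p)" by (rule m_right_derivative[OF elim(1)])
  have "((\<lambda>y. m (conj_map ?a y) x) has_derivative (\<lambda>Y. Dm (p, x) (Ad G U \<phi> ?a Y, 0))) (at p)"
    using has_derivative_compose[OF Ad_derivative[OF a], of "\<lambda>y. m y x" "\<lambda>X. Dm (p, x) (X, 0)"]
      m_left_derivative[OF elim(2)] conj_map_p[OF a] by simp
  then have 2: "((\<lambda>y. m x y) has_derivative (\<lambda>Y. Dm (p, x) (Ad G U \<phi> ?a Y, 0))) (at p)"
    by (rule has_derivative_cong_ev) (rule ev)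
  show ?case using has_derivative_unique[OF 2 1] by metis
qed

text \<open>The derivative of \<open>Ad\<close> at the identity is the bracket. Write \<open>R\<^sub>x\<close> for
  the derivative of the right translation by \<open>x\<close>. The preceding lemma says \<open>R\<^sub>x
  (Ad\<^sub>x Y - Y) = L\<^sub>Y(x) - R\<^sub>x Y\<close>. The right-hand side has derivative \<open>[X,
  Y]\<close> along \<open>X\<close>, because the mixed second derivatives of the multiplication are
  symmetric, and \<open>R\<^sub>x\<close> tends to the identity, so \<open>Ad\<^sub>x Y - Y\<close> has
  the same derivative.\<close>

lemma Ad_line_derivative:
  "((\<lambda>t. Ad G U \<phi> (\<iota> (p + t *\<^sub>R X)) Y) has_vector_derivative br X Y) (at 0)"
  "Ad G U \<phi> (\<iota> p) Y = Y"
  "\<forall>\<^sub>F t in nhds 0. \<iota> (p + t *\<^sub>R X) \<in> carrier G"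
proof -
  let ?l = "\<lambda>t::real. p + t *\<^sub>R X"
  define T where "T t = Ad G U \<phi> (\<iota> (?l t)) Y" for t
  define r where "r t = Dm (p, ?l t)" for t
  \<comment> \<open>left- minus right-invariant extension of \<open>Y\<close> along the line \<open>p + t X\<close>\<close>
  define u where "u t = Dm (?l t, p) (0, Y) - Dm (p, ?l t) (Y, 0)" for t
  have "isCont ?l 0" by (intro continuous_intros)
  then have "(?l \<longlongrightarrow> ?l 0) (nhds 0)" using tendsto_at_iff_tendsto_nhds[of ?l 0] by (simp only: isCont_def)
  then have lim: "(?l \<longlongrightarrow> p) (nhds 0)" by simp
  have ev: "\<forall>\<^sub>F t in nhds 0. Dm (p, ?l t) (T t, 0) = Dm (?l t, p) (0, Y)"
    using filterlim_iff[THEN iffD1, OF lim, rule_format, OF ev_Ad_right_inv] by eventually_elim (simp add: T_def)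
  show "\<forall>\<^sub>F t in nhds 0. \<iota> (p + t *\<^sub>R X) \<in> carrier G"
    using filterlim_iff[THEN iffD1, OF lim, rule_format, OF ev_chart] by eventually_elim (rule \<iota>_carrier)
  show Tp: "Ad G U \<phi> (\<iota> p) Y = Y"
    using eventually_nhds_x_imp_x[OF ev_Ad_right_inv] by (simp add: Dm_pp)
  have ld: "(?l has_derivative (\<lambda>h. h *\<^sub>R X)) (at 0)" by (auto intro!: derivative_eq_intros)
  have "(u has_derivative (\<lambda>h. D2m (h *\<^sub>R X, 0) (0, Y) - D2m (0, h *\<^sub>R X) (Y, 0))) (at 0)"
    unfolding u_def
    by (intro has_derivative_diff has_derivative_compose[OF ld])
      (use Dm_left_slice Dm_right_slice in auto)
  moreover have "D2m (h *\<^sub>R X, 0) (0, Y) - D2m (0, h *\<^sub>R X) (Y, 0) = h *\<^sub>R br X Y" for h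
  proof -
    interpret B: bounded_bilinear br by (rule br_bilinear)
    have "D2m (0, h *\<^sub>R X) (Y, 0) = D2m (Y, 0) (0, h *\<^sub>R X)" by (rule D2m_symmetric)
    then show ?thesis using br_eq[of "h *\<^sub>R X" Y] by (simp add: B.scaleR_left)
  qed
  ultimately have "(u has_derivative (\<lambda>h. h *\<^sub>R br X Y)) (at 0)" by simp
  moreover have u0: "u 0 = 0" by (simp add: u_def Dm_pp)
  ultimately have q: "((\<lambda>t. norm (u t - t *\<^sub>R br X Y) / norm t) \<longlongrightarrow> 0) (at 0)"
    by (simp add: has_derivative_iff_norm)
  define \<rho> where "\<rho> t = norm (r t - r 0)" for t
  have "(r has_derivative (\<lambda>h. D2m (0, h *\<^sub>R X))) (at 0)"
    unfolding r_def by (rule has_derivative_compose[of "\<lambda>t. (p, ?l t)" "\<lambda>h. (0, h *\<^sub>R X)" 0 UNIV Dm D2m])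
      (use D2m ld in \<open>auto intro!: has_derivative_Pair\<close>)
  then have "isCont r 0" by (rule has_derivative_continuous)
  then have "(\<rho> \<longlongrightarrow> norm (r 0 - r 0)) (at 0)" unfolding \<rho>_def isCont_def by (intro tendsto_intros)
  then have \<rho>: "(\<rho> \<longlongrightarrow> 0) (at 0)" by simp
  have T0: "T 0 = Y" using Tp by (simp add: T_def)
  have r0: "r 0 (Z, 0) = Z" for Z by (simp add: r_def Dm_pp)
  have "\<forall>\<^sub>F t in at 0. \<rho> t < 1/2" using order_tendstoD(2)[OF \<rho>, of "1/2"] by simp
  then have bound: "\<forall>\<^sub>F t in at 0. norm (norm (T t - Y - t *\<^sub>R br X Y) / norm t)
      \<le> 2 * (norm (u t - t *\<^sub>R br X Y) / norm t) + 2 * \<rho> t * norm (br X Y)"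
    using eventually_nhds_conv_at[THEN iffD1, OF ev, THEN conjunct1]
      eventually_neq_at_within[of 0 0 UNIV]
  proof eventually_elim
    case (elim t)
    let ?D = "T t - Y" and ?w = "br X Y"
    have u: "u t = r t (?D, 0)"
    proof -
      have "(?D, 0::'g) = (T t, 0) - (Y, 0)" by simp
      then show ?thesis using elim(2) by (simp add: u_def r_def blinfun.diff_right del: diff_Pair)
    qed
    have "u t - ?D = (r t - r 0) (?D, 0)" by (simp add: u r0 blinfun.diff_left)
    then have d1: "norm (u t - ?D) \<le> \<rho> t * norm ?D"
      using norm_blinfun[of "r t - r 0" "(?D, 0)"] by (simp add: \<rho>_def)
    also have "\<dots> \<le> 1/2 * norm ?D" using elim(1) by (intro mult_right_mono) auto
    \<comment> \<open>absorb the error term, which has at most half the size of \<open>?D\<close>\<close>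
    finally have d2: "norm ?D \<le> 2 * norm (u t)" using norm_triangle_ineq3[of ?D "u t"] by (simp add: norm_minus_commute)
    have "norm (u t) \<le> norm (u t - t *\<^sub>R ?w) + \<bar>t\<bar> * norm ?w"
      using norm_triangle_ineq[of "u t - t *\<^sub>R ?w" "t *\<^sub>R ?w"] by simp
    then have d3: "\<rho> t * norm ?D \<le> \<rho> t * (2 * (norm (u t - t *\<^sub>R ?w) + \<bar>t\<bar> * norm ?w))"
      using d2 by (intro mult_left_mono) (auto simp: \<rho>_def)
    have d4: "2 * \<rho> t * norm (u t - t *\<^sub>R ?w) \<le> 1 * norm (u t - t *\<^sub>R ?w)"
      using elim(1) by (intro mult_right_mono) auto
    have "norm (?D - t *\<^sub>R ?w) \<le> norm (u t - t *\<^sub>R ?w) + norm (u t - ?D)"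
    proof -
      have "?D - t *\<^sub>R ?w = (u t - t *\<^sub>R ?w) - (u t - ?D)" by simp
      then show ?thesis by (simp only: norm_triangle_ineq4)
    qed
    also have "\<dots> \<le> 2 * norm (u t - t *\<^sub>R ?w) + \<bar>t\<bar> * (2 * \<rho> t * norm ?w)"
      using d1 d3 d4 by (simp add: algebra_simps)
    finally show ?case using elim(3) by (simp add: field_simps)
  qed
  have "((\<lambda>t. 2 * (norm (u t - t *\<^sub>R br X Y) / norm t) + 2 * \<rho> t * norm (br X Y)) \<longlongrightarrow> 2 * 0 + 2 * 0 * norm (br X Y)) (at 0)"
    by (intro tendsto_intros q \<rho>)
  then have "((\<lambda>t. norm (T t - Y - t *\<^sub>R br X Y) / norm t) \<longlongrightarrow> 0) (at 0)"
    using Lim_null_comparison[OF bound] by simp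
  then have "(T has_derivative (\<lambda>h. h *\<^sub>R br X Y)) (at 0)"
    unfolding has_derivative_iff_norm by (simp add: T0 bounded_linear_scaleR_left)
  then show "((\<lambda>t. Ad G U \<phi> (\<iota> (?l t)) Y) has_vector_derivative br X Y) (at 0)"
    by (simp add: has_vector_derivative_def T_def[abs_def])
qed

lemma has_vector_derivative_ev_eq_unique:
  assumes "(f has_vector_derivative d) (at 0)" "(h has_vector_derivative e) (at 0)" "\<forall>\<^sub>F t in nhds (0::real). f t = h t"
  shows "d = e"
proof -
  have "(h has_derivative (\<lambda>x. x *\<^sub>R d)) (at 0)"
    using assms(1) unfolding has_vector_derivative_def
  proof (rule has_derivative_transform_eventually)
    show "\<forall>\<^sub>F x in at 0. f x = h x" using assms(3) by (simp add: eventually_at_filter eventually_mono)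
    show "f 0 = h 0" using assms(3) eventually_nhds_x_imp_x by blast
  qed simp
  then show ?thesis using assms(2) vector_derivative_unique_at has_vector_derivative_def by blast
qed

text \<open>The derivative of \<open>Ad\<^sub>a [Y, Z] = [Ad\<^sub>a Y, Ad\<^sub>a Z]\<close> in \<open>a\<close>.\<close>

lemma br_jacobi: "br X (br Y Z) = br (br X Y) Z + br Y (br X Z)"
proof -
  let ?T = "\<lambda>t. Ad G U \<phi> (\<iota> (p + t *\<^sub>R X))"
  have 1: "((\<lambda>t. ?T t (br Y Z)) has_vector_derivative br X (br Y Z)) (at 0)" by (rule Ad_line_derivative(1))
  have "((\<lambda>t. br (?T t Y) (?T t Z)) has_vector_derivative (br (?T 0 Y) (br X Z) + br (br X Y) (?T 0 Z))) (at 0)"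
    by (rule bounded_bilinear.has_vector_derivative[OF br_bilinear Ad_line_derivative(1) Ad_line_derivative(1)])
  then have 2: "((\<lambda>t. br (?T t Y) (?T t Z)) has_vector_derivative (br Y (br X Z) + br (br X Y) Z)) (at 0)"
    by (simp add: Ad_line_derivative(2))
  have "\<forall>\<^sub>F t in nhds 0. ?T t (br Y Z) = br (?T t Y) (?T t Z)"
    using Ad_line_derivative(3)[of X] by eventually_elim (rule Ad_automorphism)
  from has_vector_derivative_ev_eq_unique[OF 1 2 this] show ?thesis by simp
qed

text \<open>The derivative of \<open>g (Ad\<^sub>a Y, Ad\<^sub>a Z) = g (Y, Z)\<close> in \<open>a\<close>.\<close>

lemma bi_invariant_metric_ad_invariant:
  assumes "bi_invariant_metric G U \<phi> g"
  shows "g (br X Y) Z + g Y (br X Z) = 0"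
proof -
  let ?T = "\<lambda>t. Ad G U \<phi> (\<iota> (p + t *\<^sub>R X))"
  have b: "bounded_bilinear (\<lambda>Y Z. g Y Z)"
    by (rule bounded_bilinear.comp[OF bounded_bilinear_blinfun_apply blinfun.bounded_linear_right bounded_linear_ident])
  have "((\<lambda>t. g (?T t Y) (?T t Z)) has_vector_derivative (g (?T 0 Y) (br X Z) + g (br X Y) (?T 0 Z))) (at 0)"
    by (rule bounded_bilinear.has_vector_derivative[OF b Ad_line_derivative(1) Ad_line_derivative(1)])
  then have 2: "((\<lambda>t. g (?T t Y) (?T t Z)) has_vector_derivative (g Y (br X Z) + g (br X Y) Z)) (at 0)"
    by (simp add: Ad_line_derivative(2))
  have ev: "\<forall>\<^sub>F t in nhds 0. g (?T t Y) (?T t Z) = g Y Z"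
    using Ad_line_derivative(3)[of X]
    by eventually_elim (use assms in \<open>simp add: bi_invariant_metric_def\<close>)
  have "g Y (br X Z) + g (br X Y) Z = 0"
    by (rule has_vector_derivative_ev_eq_unique[OF 2 has_vector_derivative_const ev])
  then show ?thesis by simp
qed

lemma cartan_form_bi_invariant:
  assumes "bi_invariant_metric G U \<phi> g"
  shows "bi_invariant_form3 G U \<phi> (cartan_form br g s)"
  using assms by (simp add: bi_invariant_form3_def bi_invariant_metric_def cartan_form_def flip: Ad_automorphism)

end

text \<open>The center is an abelian ideal, hence a solvable one.\<close>

lemma semisimple_center_trivial:
  fixes br :: "'g::real_vector \<Rightarrow> 'g \<Rightarrow> 'g"
  assumes ss: "semisimple br" and lin: "\<And>X. linear (br X)" and asym: "\<And>X Y. br X Y = - br Y X"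
    and Z: "\<And>X. br X Z = 0"
  shows "Z = 0"
proof -
  define I where "I = {W. \<forall>X. br X W = 0}"
  have "subspace I" unfolding I_def subspace_def
    using lin by (auto simp: linear_0 linear_add linear_scale)
  then have "lie_ideal br I" unfolding lie_ideal_def using subspace_0 by (auto simp: I_def linear_0[OF lin])
  moreover have "derived_alg br I = {0}"
  proof -
    have *: "{br X Y |X Y. X \<in> I \<and> Y \<in> I} \<subseteq> {0}" by (auto simp: I_def)
    have "derived_alg br I \<subseteq> span {0}" unfolding derived_alg_def by (rule span_mono[OF *])
    moreover have "span {0::'g} = {0}" by (metis span_empty span_insert_0)
    moreover have "0 \<in> derived_alg br I" unfolding derived_alg_def by (rule span_zero)
    ultimately show ?thesis by auto
  qed
  then have "(derived_alg br ^^ 1) I = {0}" by simp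
  ultimately have "I = {0}" using ss unfolding semisimple_def by blast
  then show ?thesis using Z by (auto simp: I_def)
qed

section \<open>Ordinary differential equations\<close>

lemma has_integral_norm_le:
  fixes f :: "real \<Rightarrow> 'x::banach"
  assumes "(f has_integral i) S" "(g has_integral j) S" "\<And>x. x \<in> S \<Longrightarrow> norm (f x) \<le> g x"
  shows "norm i \<le> j"
proof -
  have "norm (integral S f) \<le> integral S g"
    by (rule integral_norm_bound_integral) (use assms in \<open>auto simp: has_integral_integrable\<close>)
  then show ?thesis using assms(1,2) by (simp add: integral_unique)
qed

text \<open>Picard iteration as a contraction for the norm \<open>sup e\<^sup>-\<^sup>l\<^sup>t |x(t)|\<close>
  with \<open>l\<close> larger than twice the Lipschitz constant, so that no continuation of local
  solutions is needed. The rescaled function \<open>y(t) = e\<^sup>-\<^sup>l\<^sup>t x(t)\<close> is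
  bounded because the vector field is.\<close>

lemma lipschitz_ode_global_solution:
  fixes F :: "'x::banach \<Rightarrow> 'x"
  assumes lip: "\<And>x y. norm (F x - F y) \<le> K * norm (x - y)" and bd: "\<And>x. norm (F x) \<le> B"
  shows "\<exists>x. x 0 = x0 \<and> (\<forall>t\<ge>0. (x has_vector_derivative F (x t)) (at t within {0..}))"
proof -
  have K0: "K \<ge> 0 \<or> (\<forall>x y::'x. x = y)"
  proof (rule ccontr)
    assume "\<not> ?thesis"
    then obtain x y :: 'x where "K < 0" "x \<noteq> y" by auto
    then show False using lip[of x y] mult_neg_pos[of K "norm (x - y)"] norm_ge_zero[of "F x - F y"]
      by (smt (verit) zero_less_norm_iff right_minus_eq)
  qed
  define k where "k = \<bar>K\<bar> + 1"
  have k: "k > 0" "\<And>x y. norm (F x - F y) \<le> k * norm (x - y)"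
    using order_trans[OF lip mult_right_mono] by (auto simp: k_def)
  have contF: "continuous_on UNIV F"
    by (rule lipschitz_on_continuous_on[of k]) (auto simp: lipschitz_on_def dist_norm k less_imp_le)
  define l where "l = 2 * k"
  have l: "l > 0" using k by (simp add: l_def)
  have B0: "B \<ge> 0" using bd norm_ge_zero order_trans by blast
  \<comment> \<open>bounded continuous functions live on the whole line; negative times are frozen at \<open>0\<close>\<close>
  define \<tau> :: "real \<Rightarrow> real" where "\<tau> t = max 0 t" for t
  have \<tau>: "\<And>t. \<tau> t \<ge> 0" "continuous_on UNIV \<tau>" "\<And>t. t \<ge> 0 \<Longrightarrow> \<tau> t = t"
    unfolding \<tau>_def by (auto intro!: continuous_intros)
  define G :: "(real \<Rightarrow>\<^sub>C 'x) \<Rightarrow> real \<Rightarrow> 'x" where "G y s = F (exp (l * s) *\<^sub>R apply_bcontfun y s)" for y s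
  have contG: "continuous_on T (G y)" for y T
    unfolding G_def by (rule continuous_on_compose2[OF contF]) (auto intro!: continuous_intros)
  have intG: "G y integrable_on {0..t}" for y t
    by (rule integrable_continuous_real[OF contG])
  define \<Phi> where "\<Phi> y t = exp (- l * \<tau> t) *\<^sub>R (x0 + integral {0..\<tau> t} (G y))" for y t
  have ccI: "continuous_on {0..} (\<lambda>t. integral {0..t} (G y))" for y
    unfolding continuous_on_eq_continuous_within
  proof
    fix t :: real assume t: "t \<in> {0..}"
    have "continuous_on {0..t+1} (\<lambda>t. integral {0..t} (G y))"
      by (rule indefinite_integral_continuous_1[OF intG])
    then have "continuous (at t within {0..t+1}) (\<lambda>t. integral {0..t} (G y))"
      using t by (auto simp: continuous_on_eq_continuous_within)
    moreover have "at t within {0..} = at t within {0..t+1}"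
      using t by (intro at_within_nhd[of t "{..<t+1}"]) auto
    ultimately show "continuous (at t within {0..}) (\<lambda>t. integral {0..t} (G y))" by simp
  qed
  have cont\<Phi>: "continuous_on UNIV (\<Phi> y)" for y
    unfolding \<Phi>_def
    by (intro continuous_intros continuous_on_compose2[OF ccI \<tau>(2)]) (auto simp: \<tau> intro!: \<tau>(2))
  have bexp: "exp (- l * t) * t \<le> 1 / l" if "t \<ge> 0" for t
  proof -
    have "l * t \<le> exp (l * t)" using exp_ge_add_one_self[of "l*t"] by linarith
    then show ?thesis using l by (simp add: exp_minus field_simps)
  qed
  have bd\<Phi>: "norm (\<Phi> y t) \<le> norm x0 + B / l" for y t
  proof -
    have "norm (integral {0..\<tau> t} (G y)) \<le> B * (\<tau> t - 0)"
      by (rule integral_bound[OF \<tau>(1) contG]) (auto simp: G_def bd)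
    then have "norm (\<Phi> y t) \<le> exp (- l * \<tau> t) * (norm x0 + B * \<tau> t)"
      unfolding \<Phi>_def norm_scaleR using norm_triangle_ineq[of x0 "integral {0..\<tau> t} (G y)"] by simp
    also have "\<dots> = exp (- l * \<tau> t) * norm x0 + B * (exp (- l * \<tau> t) * \<tau> t)" by (simp add: algebra_simps)
    also have "\<dots> \<le> 1 * norm x0 + B * (1 / l)"
      using l \<tau>(1)[of t] bexp[OF \<tau>(1)] B0 by (intro add_mono mult_right_mono mult_left_mono) auto
    finally show ?thesis by simp
  qed
  define \<Psi> where "\<Psi> y = Bcontfun (\<Phi> y)" for y
  have \<Psi>: "apply_bcontfun (\<Psi> y) = \<Phi> y" for y
    unfolding \<Psi>_def by (rule Bcontfun_inverse, rule bcontfun_normI[OF cont\<Phi> bd\<Phi>])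
  have contr: "dist (\<Psi> y) (\<Psi> z) \<le> 1/2 * dist y z" for y z
  proof (rule dist_bound)
    fix t
    define D where "D = dist y z"
    have e1: "((\<lambda>s. k * exp (l * s) * D) has_integral (k / l * exp (l * \<tau> t) * D - k / l * exp (l * 0) * D)) {0..\<tau> t}"
      by (rule fundamental_theorem_of_calculus[OF \<tau>(1)])
        (use l in \<open>auto intro!: derivative_eq_intros simp flip: has_real_derivative_iff_has_vector_derivative\<close>)
    have "norm (integral {0..\<tau> t} (\<lambda>s. G y s - G z s)) \<le> integral {0..\<tau> t} (\<lambda>s. k * exp (l * s) * D)"
    proof (rule integral_norm_bound_integral)
      fix s assume "s \<in> {0..\<tau> t}"
      have "norm (G y s - G z s) \<le> k * norm (exp (l * s) *\<^sub>R (apply_bcontfun y s - apply_bcontfun z s))"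
        unfolding G_def using k(2) by (metis scaleR_right_diff_distrib)
      also have "\<dots> = k * exp (l * s) * dist (apply_bcontfun y s) (apply_bcontfun z s)" by (simp add: dist_norm)
      also have "\<dots> \<le> k * exp (l * s) * D" unfolding D_def using k by (intro mult_left_mono dist_bounded) auto
      finally show "norm (G y s - G z s) \<le> k * exp (l * s) * D" .
    qed (use e1 in \<open>auto intro!: integrable_diff intG\<close>)
    also have "\<dots> = k / l * exp (l * \<tau> t) * D - k / l * D" using integral_unique[OF e1] by simp
    also have "\<dots> \<le> k / l * exp (l * \<tau> t) * D" using k l by (simp add: D_def)
    finally have n: "norm (integral {0..\<tau> t} (\<lambda>s. G y s - G z s)) \<le> k / l * exp (l * \<tau> t) * D" .
    have "dist (\<Psi> y t) (\<Psi> z t) = exp (- l * \<tau> t) * norm (integral {0..\<tau> t} (\<lambda>s. G y s - G z s))"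
      unfolding \<Psi> \<Phi>_def dist_norm integral_diff[OF intG intG]
      by (simp flip: scaleR_right_diff_distrib)
    also have "\<dots> \<le> exp (- l * \<tau> t) * (k / l * exp (l * \<tau> t) * D)" using n by (intro mult_left_mono) auto
    also have "\<dots> = k / l * D" by (simp add: exp_minus)
    also have "\<dots> = 1/2 * D" using k by (simp add: l_def)
    finally show "dist (\<Psi> y t) (\<Psi> z t) \<le> 1/2 * dist y z" by (simp add: D_def)
  qed
  obtain y where y: "\<Psi> y = y" using banach_fix_type[of "1/2" \<Psi>] contr by auto
  define x where "x t = x0 + integral {0..t} (G y)" for t
  have xy: "exp (l * t) *\<^sub>R apply_bcontfun y t = x t" if "t \<ge> 0" for t
  proof -
    have "apply_bcontfun y t = \<Phi> y t" using y \<Psi>[of y] by simp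
    then show ?thesis using that by (simp add: \<Phi>_def x_def \<tau> exp_minus)
  qed
  have "(x has_vector_derivative F (x t)) (at t within {0..})" if t: "t \<ge> 0" for t
  proof -
    have "((\<lambda>u. integral {0..u} (G y)) has_vector_derivative G y t) (at t within {0..t+1})"
      using t by (intro integral_has_vector_derivative contG) auto
    then have "(x has_vector_derivative G y t) (at t within {0..t+1})"
      unfolding x_def by (auto intro!: derivative_eq_intros)
    moreover have "at t within {0..} = at t within {0..t+1}"
      using t by (intro at_within_nhd[of t "{..<t+1}"]) auto
    ultimately show ?thesis using xy[OF t] by (simp add: G_def)
  qed
  moreover have "x 0 = x0" by (simp add: x_def)
  ultimately show ?thesis by blast
qed

text \<open>Composition with this map turns a vector field that is Lipschitz on a ball into a bounded one that is
  Lipschitz everywhere, without changing it inside the ball.\<close>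

definition radial_retraction :: "real \<Rightarrow> 'x::real_normed_vector \<Rightarrow> 'x" where
  "radial_retraction r x = (if norm x \<le> r then x else (r / norm x) *\<^sub>R x)"

lemma norm_radial_retraction: "r > 0 \<Longrightarrow> norm (radial_retraction r x) \<le> r"
  by (auto simp: radial_retraction_def)

lemma radial_retraction_lipschitz:
  assumes r: "r > 0"
  shows "norm (radial_retraction r x - radial_retraction r y) \<le> 2 * norm (x - y)"
proof -
  have aux: "norm (u - (r / norm v) *\<^sub>R v) \<le> 2 * norm (u - v)" if "norm u \<le> r" "norm v > r" for u v :: 'a
  proof -
    have "v - (r / norm v) *\<^sub>R v = (1 - r / norm v) *\<^sub>R v" by (simp add: algebra_simps)
    moreover have "0 \<le> 1 - r / norm v" using that r divide_le_eq_1_pos[of "norm v" r] by linarith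
    ultimately have "norm (v - (r / norm v) *\<^sub>R v) = (1 - r / norm v) * norm v" by simp
    also have "\<dots> = norm v - r"
    proof -
      have "norm v \<noteq> 0" using that r by linarith
      then show ?thesis by (simp add: field_simps)
    qed
    also have "\<dots> \<le> norm (u - v)" using that norm_triangle_ineq3[of v u] by (simp add: norm_minus_commute)
    finally show ?thesis using norm_triangle_ineq[of "u - v" "v - (r / norm v) *\<^sub>R v"] by simp
  qed
  consider "norm x \<le> r" "norm y \<le> r" | "norm x \<le> r" "norm y > r" | "norm x > r" "norm y \<le> r"
    | "norm x > r" "norm y > r" by linarith
  then show ?thesis
  proof cases
    case 1 then show ?thesis by (simp add: radial_retraction_def)
  next
    case 2 then show ?thesis using aux[of x y] by (simp add: radial_retraction_def)
  next
    case 3 then show ?thesis using aux[of y x] by (simp add: radial_retraction_def norm_minus_commute)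
  next
    case 4
    have nz: "norm x \<noteq> 0" "norm y \<noteq> 0" using 4 r by linarith+
    have eq: "(r / norm x) *\<^sub>R x - (r / norm y) *\<^sub>R y = (r / norm x) *\<^sub>R (x - y) + (r / norm x - r / norm y) *\<^sub>R y"
      by (simp add: algebra_simps)
    have "norm ((r / norm x - r / norm y) *\<^sub>R y) = \<bar>(r / norm x - r / norm y) * norm y\<bar>" by (simp add: abs_mult)
    also have "(r / norm x - r / norm y) * norm y = (r / norm x) * (norm y - norm x)" using nz by (simp add: field_simps)
    also have "\<bar>\<dots>\<bar> = (r / norm x) * \<bar>norm y - norm x\<bar>" using r by (simp add: abs_mult)
    also have "\<dots> \<le> (r / norm x) * norm (x - y)"
      using r norm_triangle_ineq3[of y x] by (intro mult_left_mono) (auto simp: norm_minus_commute)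
    finally have "norm ((r / norm x) *\<^sub>R x - (r / norm y) *\<^sub>R y) \<le> (r / norm x) * norm (x - y) + (r / norm x) * norm (x - y)"
      unfolding eq using r by (intro norm_triangle_le add_mono) auto
    also have "\<dots> \<le> 1 * norm (x - y) + 1 * norm (x - y)"
    proof -
      have "r / norm x \<le> 1" using 4(1) r divide_le_eq_1_pos[of "norm x" r] by linarith
      then show ?thesis by (intro add_mono mult_right_mono) auto
    qed
    finally show ?thesis using 4 by (simp add: radial_retraction_def)
  qed
qed

text \<open>On an interval of length \<open>h = 1 / (2 k)\<close> that starts at a zero of \<open>u\<close>, the
  mean value inequality gives \<open>sup |u| \<le> k h sup |u| = sup |u| / 2\<close>; finitely many such
  intervals cover \<open>[0, T]\<close>.\<close>

lemma differential_inequality_zero: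
  fixes u :: "real \<Rightarrow> 'x::real_normed_vector"
  assumes der: "\<And>t. t \<in> {0..T} \<Longrightarrow> (u has_vector_derivative u' t) (at t within {0..T})"
    and le: "\<And>t. t \<in> {0..T} \<Longrightarrow> norm (u' t) \<le> K * norm (u t)" and u0: "u 0 = 0" and t: "t \<in> {0..T}"
  shows "u t = 0"
proof -
  define k where "k = \<bar>K\<bar> + 1"
  have k: "k > 0" "\<And>t. t \<in> {0..T} \<Longrightarrow> norm (u' t) \<le> k * norm (u t)"
    using order_trans[OF le mult_right_mono] by (auto simp: k_def)
  have cont: "continuous_on {0..T} u"
    using der by (meson continuous_on_eq_continuous_within has_vector_derivative_continuous)
  define h where "h = 1 / (2 * k)"
  have step: "\<forall>s\<in>{0..T}. s \<le> real n * h \<longrightarrow> u s = 0" for n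
  proof (induction n)
    case 0 then show ?case using u0 by auto
  next
    case (Suc n)
    define a where "a = real n * h"
    define J where "J = {a..min T (a + h)}"
    have a0: "a \<ge> 0" using k by (simp add: a_def h_def)
    show ?case
    proof (intro ballI impI)
      fix s assume s: "s \<in> {0..T}" "s \<le> real (Suc n) * h"
      show "u s = 0"
      proof (cases "s \<le> a")
        case True then show ?thesis using Suc s a_def by blast
      next
        case False
        have sJ: "s \<in> J" using s False by (auto simp: J_def a_def algebra_simps)
        have JT: "J \<subseteq> {0..T}" using a0 by (auto simp: J_def)
        have aJ: "a \<in> J" using sJ by (auto simp: J_def)
        have ua: "u a = 0" using Suc aJ JT a_def by (metis order_refl subsetD)
        have "compact J" by (simp add: J_def)
        then obtain m where m: "m \<in> J" "\<And>t. t \<in> J \<Longrightarrow> norm (u t) \<le> norm (u m)"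
          using continuous_attains_sup[of J "\<lambda>t. norm (u t)"] cont JT aJ
          by (metis continuous_on_norm continuous_on_subset empty_iff)
        have "norm (u m - u a) \<le> (k * norm (u m)) * norm (m - a)"
        proof (rule differentiable_bound[of J u "\<lambda>t h. h *\<^sub>R u' t"])
          show "convex J" by (simp add: J_def)
          fix t assume tJ: "t \<in> J"
          show "(u has_derivative (\<lambda>h. h *\<^sub>R u' t)) (at t within J)"
            using der tJ JT has_vector_derivative_within_subset unfolding has_vector_derivative_def
            by (meson has_derivative_subset subsetD)
          have "norm (u' t) \<le> k * norm (u m)" using k m tJ JT mult_left_mono[of "norm (u t)" "norm (u m)" k]
            by (meson less_imp_le order_trans subsetD)
          then have "\<bar>x\<bar> * norm (u' t) \<le> \<bar>x\<bar> * (k * norm (u m))" for x :: real by (rule mult_left_mono) simp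
          then show "onorm (\<lambda>h. h *\<^sub>R u' t) \<le> k * norm (u m)"
            by (intro onorm_le) (simp add: mult.commute)
        qed (use m aJ in auto)
        also have "\<dots> \<le> (k * norm (u m)) * h"
          using m(1) k by (intro mult_left_mono) (auto simp: J_def)
        also have "\<dots> = norm (u m) / 2" using k by (simp add: h_def)
        finally have "norm (u m) \<le> 0" using ua by simp
        then show ?thesis using m(2)[OF sJ] by simp
      qed
    qed
  qed
  obtain n :: nat where "T / h \<le> real n" using real_arch_simple by blast
  then have "T \<le> real n * h" using k by (simp add: h_def field_simps)
  then show ?thesis using step[of n] t by auto
qed

lemma exponential_decay:
  fixes N :: "real \<Rightarrow> real"
  assumes der: "\<And>t. t \<ge> 0 \<Longrightarrow> (N has_vector_derivative N' t) (at t within {0..})"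
    and le: "\<And>t. t \<ge> 0 \<Longrightarrow> N' t \<le> - c * N t" and t: "t \<ge> 0"
  shows "N t \<le> N 0 * exp (- c * t)"
proof -
  define P where "P s = exp (c * s) * N s" for s
  have "P t \<le> P 0"
  proof (cases "t = 0")
    case False
    then have t0: "t > 0" using t by simp
    have contN: "continuous_on {0..} N"
      using der by (meson atLeast_iff continuous_on_eq_continuous_within has_vector_derivative_continuous)
    show ?thesis
    proof (rule DERIV_nonpos_imp_decreasing_open[OF t])
      fix s assume s: "0 < s" "s < t"
      have "(N has_vector_derivative N' s) (at s)"
        using der[of s] s at_within_interior[of s "{0..}"] by auto
      then have "(N has_field_derivative N' s) (at s)" by (simp add: has_real_derivative_iff_has_vector_derivative)
      then have "(P has_field_derivative (exp (c * s) * (c * N s + N' s))) (at s)"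
        unfolding P_def by (auto intro!: derivative_eq_intros simp: algebra_simps)
      moreover have "exp (c * s) * (c * N s + N' s) \<le> 0" using le[of s] s by (simp add: mult_nonneg_nonpos)
      ultimately show "\<exists>y. (P has_real_derivative y) (at s) \<and> y \<le> 0" by blast
    next
      show "continuous_on {0..t} P" unfolding P_def
        by (intro continuous_intros continuous_on_subset[OF contN]) auto
    qed
  qed simp
  then show ?thesis by (simp add: P_def exp_minus field_simps)
qed

lemma exponentially_decaying_derivative_converges:
  fixes u :: "real \<Rightarrow> 'x::banach"
  assumes der: "\<And>t. t \<ge> 0 \<Longrightarrow> (u has_vector_derivative u' t) (at t within {0..})"
    and le: "\<And>t. t \<ge> 0 \<Longrightarrow> norm (u' t) \<le> C * exp (- c * t)" and c: "c > 0"
  shows "\<exists>l. \<forall>t\<ge>0. norm (u t - l) \<le> C / c * exp (- c * t)"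
proof -
  have C0: "C \<ge> 0" using order_trans[OF norm_ge_zero le[of 0]] by simp
  have diff: "norm (u t - u s) \<le> C / c * exp (- c * s)" if "0 \<le> s" "s \<le> t" for s t
  proof -
    have "(u' has_integral (u t - u s)) {s..t}"
      using that by (intro fundamental_theorem_of_calculus) (auto intro: has_vector_derivative_within_subset[OF der])
    moreover have "((\<lambda>r. C * exp (- c * r)) has_integral (- C / c * exp (- c * t) - (- C / c * exp (- c * s)))) {s..t}"
      using that c by (intro fundamental_theorem_of_calculus)
        (auto intro!: derivative_eq_intros simp flip: has_real_derivative_iff_has_vector_derivative)
    ultimately have "norm (u t - u s) \<le> - C / c * exp (- c * t) - (- C / c * exp (- c * s))"
      by (rule has_integral_norm_le) (use that le in auto)
    also have "\<dots> \<le> C / c * exp (- c * s)" using C0 c by simp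
    finally show ?thesis .
  qed
  have "Cauchy (\<lambda>n. u (real n))"
  proof (rule metric_CauchyI)
    fix e :: real assume e: "e > 0"
    have "(\<lambda>n. C / c * exp (- c * real n)) \<longlonglongrightarrow> C / c * 0"
      using c by (intro tendsto_intros filterlim_compose[OF exp_at_bot]
        filterlim_tendsto_neg_mult_at_bot[OF tendsto_const] filterlim_real_sequentially) auto
    then have "\<forall>\<^sub>F n in sequentially. C / c * exp (- c * real n) < e"
      using e by (auto dest: order_tendstoD(2))
    then obtain M where M: "\<And>n. n \<ge> M \<Longrightarrow> C / c * exp (- c * real n) < e" by (auto simp: eventually_sequentially)
    have "dist (u (real m)) (u (real n)) < e" if "m \<ge> M" "n \<ge> M" for m n
    proof (cases "m \<le> n")
      case True then show ?thesis using diff[of "real m" "real n"] M[OF that(1)] by (simp add: dist_norm norm_minus_commute)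
    next
      case False then show ?thesis using diff[of "real n" "real m"] M[OF that(2)] by (simp add: dist_norm)
    qed
    then show "\<exists>M. \<forall>m\<ge>M. \<forall>n\<ge>M. dist (u (real m)) (u (real n)) < e" by blast
  qed
  then obtain l where l: "(\<lambda>n. u (real n)) \<longlonglongrightarrow> l" by (auto simp: Cauchy_convergent_iff convergent_def)
  have "norm (u t - l) \<le> C / c * exp (- c * t)" if t: "t \<ge> 0" for t
  proof (rule tendsto_upperbound[of "\<lambda>n. norm (u t - u (real n))"])
    show "(\<lambda>n. norm (u t - u (real n))) \<longlonglongrightarrow> norm (u t - l)" by (intro tendsto_intros l)
    obtain M :: nat where "t \<le> real M" using real_arch_simple by blast
    then show "\<forall>\<^sub>F n in sequentially. norm (u t - u (real n)) \<le> C / c * exp (- c * t)"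
      using diff[OF t] by (intro eventually_sequentiallyI[of M]) (simp add: norm_minus_commute[of "u t"])
  qed simp
  then show ?thesis by blast
qed

section \<open>Inner products, orthonormal bases and inverses\<close>

text \<open>The inverse is defined through \<open>Blinfun\<close> of a set-theoretic inverse; it is meaningful
  once a bounded two-sided inverse is known.\<close>

lemma blinfun_inv_eqI:
  fixes T :: "'a::real_normed_vector \<Rightarrow>\<^sub>L 'b::real_normed_vector" and R :: "'b \<Rightarrow>\<^sub>L 'a"
  assumes "\<And>x. blinfun_apply R (T x) = x" "\<And>y. blinfun_apply T (R y) = y"
  shows "blinfun_inv T = R"
proof -
  have "inj (blinfun_apply T)" using assms(1) by (metis injI)
  then have "inv_into UNIV (blinfun_apply T) = blinfun_apply R"
    using assms(2) by (metis (no_types) ext inv_f_f)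
  then show ?thesis by (simp add: blinfun_inv_def blinfun_apply_inverse)
qed

lemma blinfun2_apply:
  assumes "bounded_bilinear F"
  shows "blinfun_apply (blinfun_apply (Blinfun (\<lambda>X. Blinfun (F X))) X) Y = F X Y"
proof -
  interpret F: bounded_bilinear F by fact
  have 1: "blinfun_apply (Blinfun (F X)) = F X" for X
    by (rule bounded_linear_Blinfun_apply[OF F.bounded_linear_right])
  obtain K where K: "\<And>a b. norm (F a b) \<le> norm a * norm b * K" using F.bounded by blast
  have "bounded_linear (\<lambda>X. Blinfun (F X))"
  proof (rule bounded_linear_intro)
    show "Blinfun (F (x + y)) = Blinfun (F x) + Blinfun (F y)" for x y
      by (rule blinfun_eqI) (simp add: 1 F.add_left blinfun.add_left)
    show "Blinfun (F (r *\<^sub>R x)) = r *\<^sub>R Blinfun (F x)" for r x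
      by (rule blinfun_eqI) (simp add: 1 F.scaleR_left blinfun.scaleR_left)
    show "norm (Blinfun (F x)) \<le> norm x * \<bar>K\<bar>" for x
    proof (rule norm_blinfun_bound)
      fix y
      have "norm (F x y) \<le> norm x * norm y * \<bar>K\<bar>"
        using K[of x y] by (smt (verit) mult_left_mono norm_ge_zero mult_nonneg_nonneg)
      then show "norm (Blinfun (F x) y) \<le> norm x * \<bar>K\<bar> * norm y" by (simp add: 1 algebra_simps)
    qed auto
  qed
  then show ?thesis by (simp add: bounded_linear_Blinfun_apply 1)
qed

lemma bilinear_bounded_euclidean:
  fixes F :: "'a::euclidean_space \<Rightarrow> 'a \<Rightarrow> 'b::real_normed_vector"
  assumes "\<And>y. linear (\<lambda>x. F x y)" "\<And>x. linear (F x)"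
  shows "bounded_bilinear F"
  using assms bilinear_conv_bounded_bilinear[of F] unfolding bilinear_def by blast

lemma bilform_of_apply:
  fixes F :: "'a::euclidean_space \<Rightarrow> 'a \<Rightarrow> real"
  assumes "\<And>y. linear (\<lambda>x. F x y)" "\<And>x. linear (F x)"
  shows "bilform_of F X Y = F X Y"
  unfolding bilform_of_def by (rule blinfun2_apply[OF bilinear_bounded_euclidean[OF assms]])

text \<open>From \<open>R y - R0 = - R y (T y - T0) R0\<close> one first bounds \<open>R y\<close> and then the
  difference.\<close>

lemma blinfun_inverse_tendsto:
  fixes T :: "'x \<Rightarrow> 'a::real_normed_vector \<Rightarrow>\<^sub>L 'b::real_normed_vector" and R :: "'x \<Rightarrow> 'b \<Rightarrow>\<^sub>L 'a" and R0 :: "'b \<Rightarrow>\<^sub>L 'a"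
  assumes T: "(T \<longlongrightarrow> T0) F" and inv0: "\<And>w. T0 (R0 w) = w"
    and inv: "\<forall>\<^sub>F y in F. \<forall>v. R y (T y v) = v"
  shows "(R \<longlongrightarrow> R0) F"
proof -
  define M where "M = norm R0 + 1"
  have M: "M > 0" "norm R0 \<le> M" by (auto simp: M_def add_nonneg_pos)
  have d0: "((\<lambda>y. norm (T y - T0)) \<longlongrightarrow> 0) F" using T by (simp add: LIM_zero tendsto_norm_zero)
  have small: "\<forall>\<^sub>F y in F. norm (T y - T0) < 1 / (2 * M)"
    using order_tendstoD(2)[OF d0, of "1 / (2 * M)"] M by simp
  have "\<forall>\<^sub>F y in F. norm (R y - R0) \<le> 2 * M * norm (T y - T0) * M"
    using inv small
  proof eventually_elim
    case (elim y)
    have "R y - R0 = - (R y o\<^sub>L (T y - T0) o\<^sub>L R0)"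
      by (rule blinfun_eqI) (use elim(1) in \<open>simp add: blinfun.bilinear_simps inv0\<close>)
    then have n: "norm (R y - R0) \<le> norm (R y) * norm (T y - T0) * norm R0"
      by (metis (no_types, lifting) mult_right_mono norm_blinfun_compose norm_ge_zero norm_minus_cancel order_trans)
    also have "\<dots> \<le> norm (R y) * (1 / (2 * M)) * M" using elim(2) M by (intro mult_mono) auto
    also have "\<dots> = norm (R y) / 2" using M by simp
    finally have "norm (R y) \<le> 2 * M" using norm_triangle_sub[of "R y" R0] M by linarith
    then have "norm (R y) * norm (T y - T0) * norm R0 \<le> 2 * M * norm (T y - T0) * M"
      using M by (intro mult_mono) auto
    then show ?case using n by linarith
  qed
  moreover have "((\<lambda>y. 2 * M * norm (T y - T0) * M) \<longlongrightarrow> 2 * M * 0 * M) F" by (intro tendsto_intros d0)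
  ultimately have "((\<lambda>y. R y - R0) \<longlongrightarrow> 0) F"
    by (intro Lim_null_comparison[of "\<lambda>y. R y - R0"]) simp_all
  then show ?thesis by (simp add: LIM_zero_iff)
qed

text \<open>The remainder is \<open>- R E R - (R\<^sub>y - R) (T\<^sub>y - T) R\<close> with \<open>E\<close> the
  remainder of \<open>T\<close>; the second term is small since \<open>R\<close> is continuous.\<close>

lemma blinfun_inverse_has_derivative:
  fixes T :: "'x::real_normed_vector \<Rightarrow> 'a::real_normed_vector \<Rightarrow>\<^sub>L 'b::real_normed_vector"
    and R :: "'x \<Rightarrow> 'b \<Rightarrow>\<^sub>L 'a"
  assumes T: "(T has_derivative T') (at x within I)"
    and inv0: "\<And>v. R x (T x v) = v" "\<And>w. T x (R x w) = w"
    and inv: "\<forall>\<^sub>F y in at x within I. (\<forall>v. R y (T y v) = v)"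
  shows "(R has_derivative (\<lambda>h. - (R x o\<^sub>L T' h o\<^sub>L R x))) (at x within I)"
proof -
  interpret T': bounded_linear T' using T has_derivative_bounded_linear by blast
  define q where "q y = norm (T y - T x - T' (y - x)) / norm (y - x)" for y
  have q: "(q \<longlongrightarrow> 0) (at x within I)" using T unfolding has_derivative_iff_norm q_def by blast
  have Tc: "(T \<longlongrightarrow> T x) (at x within I)" using has_derivative_continuous[OF T] by (simp add: continuous_within)
  have "(R \<longlongrightarrow> R x) (at x within I)" by (rule blinfun_inverse_tendsto[OF Tc inv0(2) inv])
  then have r0: "((\<lambda>y. norm (R y - R x)) \<longlongrightarrow> 0) (at x within I)" by (simp add: LIM_zero tendsto_norm_zero)
  obtain K where K: "\<And>h. norm (T' h) \<le> norm h * K" "K > 0" using T'.pos_bounded by blast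
  define M where "M = norm (R x)"
  have bound: "\<forall>\<^sub>F y in at x within I. norm (norm (R y - R x - (- (R x o\<^sub>L T' (y - x) o\<^sub>L R x))) / norm (y - x))
     \<le> M * M * q y + norm (R y - R x) * (q y + K) * M"
    using inv eventually_neq_at_within[of x x I]
  proof eventually_elim
    case (elim y)
    let ?N = "norm (y - x)" and ?D = "T y - T x" and ?E = "T y - T x - T' (y - x)"
    have N: "?N > 0" using elim(2) by simp
    have id: "R y - R x - (- (R x o\<^sub>L T' (y - x) o\<^sub>L R x)) = - (R x o\<^sub>L ?E o\<^sub>L R x) - ((R y - R x) o\<^sub>L ?D o\<^sub>L R x)"
      by (rule blinfun_eqI) (use elim(1) in \<open>simp add: blinfun.bilinear_simps inv0\<close>)
    have A: "norm (R x o\<^sub>L ?E o\<^sub>L R x) \<le> M * norm ?E * M"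
      unfolding M_def by (meson mult_right_mono norm_blinfun_compose norm_ge_zero order_trans)
    have "norm ((R y - R x) o\<^sub>L ?D o\<^sub>L R x) \<le> norm (R y - R x) * norm ?D * M"
      unfolding M_def by (meson mult_right_mono norm_blinfun_compose norm_ge_zero order_trans)
    also have "\<dots> \<le> norm (R y - R x) * (norm ?E + ?N * K) * M"
    proof -
      have "norm ?D \<le> norm ?E + ?N * K" using norm_triangle_sub[of ?D "T' (y - x)"] K(1)[of "y - x"] by linarith
      then show ?thesis by (intro mult_right_mono mult_left_mono) (auto simp: M_def)
    qed
    finally have B: "norm ((R y - R x) o\<^sub>L ?D o\<^sub>L R x) \<le> norm (R y - R x) * (norm ?E + ?N * K) * M" .
    have "norm (R y - R x - (- (R x o\<^sub>L T' (y - x) o\<^sub>L R x)))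
        \<le> M * norm ?E * M + norm (R y - R x) * (norm ?E + ?N * K) * M"
      unfolding id using A B norm_triangle_ineq4[of "- (R x o\<^sub>L ?E o\<^sub>L R x)" "(R y - R x) o\<^sub>L ?D o\<^sub>L R x"] by simp
    also have "\<dots> = (M * M * q y + norm (R y - R x) * (q y + K) * M) * ?N"
      using N by (simp add: q_def field_simps)
    finally show ?case using N by (simp add: divide_le_eq)
  qed
  have "((\<lambda>y. M * M * q y + norm (R y - R x) * (q y + K) * M) \<longlongrightarrow>
      M * M * 0 + 0 * (0 + K) * M) (at x within I)"
    by (intro tendsto_intros q r0)
  then have lim: "((\<lambda>y. norm (R y - R x - (- (R x o\<^sub>L T' (y - x) o\<^sub>L R x))) / norm (y - x)) \<longlongrightarrow> 0) (at x within I)"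
    using Lim_null_comparison[OF bound] by simp
  have "bounded_linear (\<lambda>h. - (R x o\<^sub>L T' h o\<^sub>L R x))"
    by (intro bounded_linear_minus bounded_linear_compose[OF bounded_bilinear.bounded_linear_left[OF bounded_bilinear_blinfun_compose]]
        bounded_linear_compose[OF bounded_bilinear.bounded_linear_right[OF bounded_bilinear_blinfun_compose]] T'.bounded_linear_axioms)
  then show ?thesis using lim unfolding has_derivative_iff_norm by blast
qed

lemma inner_product_sym: "inner_product g \<Longrightarrow> g X Y = g Y X" for g :: "'g::real_normed_vector bilform"
  by (simp add: inner_product_def)

lemma inner_product_pos: "inner_product g \<Longrightarrow> X \<noteq> 0 \<Longrightarrow> g X X > 0" for g :: "'g::real_normed_vector bilform"
  by (simp add: inner_product_def)

lemma inner_product_nonneg: "inner_product g \<Longrightarrow> g X X \<ge> 0" for g :: "'g::real_normed_vector bilform"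
  by (cases "X = 0") (auto simp: inner_product_def blinfun.bilinear_simps less_imp_le)

lemma inner_product_nondegenerate:
  fixes g :: "'g::real_normed_vector bilform"
  assumes "inner_product g" "\<And>Y. g X Y = 0" shows "X = 0"
  using inner_product_pos[OF assms(1), of X] assms(2)[of X] by force

lemma linear_blinfun: "linear (blinfun_apply f)"
  by (rule bounded_linear.linear[OF blinfun.bounded_linear_right])

lemma orthonormal_independent:
  fixes g :: "'g::euclidean_space bilform"
  assumes E: "\<forall>u \<in> E. \<forall>v \<in> E. g u v = (if u = v then 1 else (0::real))"
  shows "independent E"
proof
  assume "dependent E"
  then obtain e where e: "e \<in> E" "e \<in> span (E - {e})" unfolding dependent_def by blast
  have "blinfun_apply (blinfun_apply g e) v = 0" if "v \<in> span (E - {e})" for v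
    using that
  proof (induction rule: span_induct)
    case base show ?case by (auto simp: subspace_def blinfun.bilinear_simps)
  next
    case (step x) then show ?case using E e by auto
  qed
  then show False using e E by fastforce
qed

text \<open>An orthonormal set of maximal cardinality spans: otherwise one Gram-Schmidt step enlarges it.\<close>

lemma orthonormal_basis_exists:
  fixes g :: "'g::euclidean_space bilform"
  assumes g: "inner_product g"
  shows "\<exists>E. orthonormal_basis g E"
proof -
  let ?P = "\<lambda>E::'g set. \<forall>u \<in> E. \<forall>v \<in> E. g u v = (if u = v then 1 else (0::real))"
  have bnd: "\<forall>E. ?P E \<longrightarrow> card E \<le> DIM('g)"
    using orthonormal_independent independent_bound by blast
  have "\<exists>E. ?P E \<and> (\<forall>E'. ?P E' \<longrightarrow> card E' \<le> card E)"
    by (rule ex_has_greatest_nat[of ?P "{}" card "Suc (DIM('g))"]) (use bnd in \<open>auto simp: le_imp_less_Suc\<close>)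
  \<comment> \<open>orthonormal sets are independent, so their cardinality is bounded by the dimension\<close>
  then obtain E where E: "?P E" and max: "\<And>E'. ?P E' \<Longrightarrow> card E' \<le> card E" by blast
  have fin: "finite E" using orthonormal_independent[OF E] independent_bound by blast
  have "span E = UNIV"
  proof (rule ccontr)
    assume "span E \<noteq> UNIV"
    then obtain v where v: "v \<notin> span E" by blast
    define w where "w = v - (\<Sum>e\<in>E. g v e *\<^sub>R e)"
    have w0: "w \<noteq> 0"
    proof
      assume "w = 0"
      then have "v = (\<Sum>e\<in>E. g v e *\<^sub>R e)" by (simp add: w_def)
      also have "\<dots> \<in> span E" by (intro span_sum span_scale span_base)
      finally show False using v by simp
    qed
    have ort: "g w e = 0" if e: "e \<in> E" for e
    proof -
      have "(\<Sum>e'\<in>E. g v e' * g e' e) = (\<Sum>e'\<in>E. if e' = e then g v e' else 0)"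
        using E e by (intro sum.cong) auto
      also have "\<dots> = g v e" using fin e by (simp add: sum.delta')
      finally show ?thesis by (simp add: w_def blinfun.bilinear_simps blinfun.sum_left)
    qed
    define u where "u = (1 / sqrt (g w w)) *\<^sub>R w"
    have p: "g w w > 0" by (rule inner_product_pos[OF g w0])
    have u: "g u u = 1" using p by (simp add: u_def blinfun.bilinear_simps field_simps)
    have ue: "g u e = 0" "g e u = 0" if "e \<in> E" for e
      using ort[OF that] inner_product_sym[OF g, of e w] by (simp_all add: u_def blinfun.bilinear_simps)
    have "u \<notin> E" using u ue by force
    moreover have "?P (insert u E)" using E u ue by auto
    ultimately show False using max[of "insert u E"] fin by simp
  qed
  then show ?thesis using E unfolding orthonormal_basis_def by blast
qed

lemma onb_orthonormal: "inner_product g \<Longrightarrow> orthonormal_basis g (onb g)"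
  for g :: "'g::euclidean_space bilform"
  unfolding onb_def using someI_ex[OF orthonormal_basis_exists[of g]] by simp

lemma onb_finite: "inner_product g \<Longrightarrow> finite (onb g)" for g :: "'g::euclidean_space bilform"
  using independent_bound[OF orthonormal_independent[of "onb g" g]] onb_orthonormal[of g]
  unfolding orthonormal_basis_def by simp

lemma onb_expansion:
  fixes g :: "'g::euclidean_space bilform"
  assumes g: "inner_product g" shows "(\<Sum>e\<in>onb g. g v e *\<^sub>R e) = v"
proof -
  have on: "\<forall>u \<in> onb g. \<forall>v \<in> onb g. g u v = (if u = v then 1 else 0)" and sp: "span (onb g) = UNIV"
    using onb_orthonormal[OF g] unfolding orthonormal_basis_def by auto
  define L where "L v = (\<Sum>e\<in>onb g. g v e *\<^sub>R e)" for v
  have lin: "linear L" unfolding L_def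
    by (rule linearI) (simp_all add: blinfun.bilinear_simps scaleR_left_distrib sum.distrib scaleR_sum_right)
  have "v \<in> span (onb g)" using sp by simp
  then have "L v = v"
  proof (induction rule: span_induct)
    case base show ?case
      by (auto simp: subspace_def linear_add[OF lin] linear_scale[OF lin] linear_0[OF lin])
  next
    case (step x)
    have "L x = (\<Sum>e\<in>onb g. if e = x then x else 0)"
      unfolding L_def using on step by (intro sum.cong) auto
    then show ?case using onb_finite[OF g] step by simp
  qed
  then show ?thesis by (simp add: L_def)
qed

lemma onb_linear:
  fixes g :: "'g::euclidean_space bilform"
  assumes g: "inner_product g" and l: "linear l"
  shows "(\<Sum>e\<in>onb g. g v e *\<^sub>R l e) = l v"
proof -
  have "(\<Sum>e\<in>onb g. g v e *\<^sub>R l e) = l (\<Sum>e\<in>onb g. g v e *\<^sub>R e)"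
    using l by (simp add: linear_sum linear_scale)
  then show ?thesis by (simp add: onb_expansion[OF g])
qed

lemma onb_linear_real:
  fixes g :: "'g::euclidean_space bilform"
  assumes g: "inner_product g" and l: "linear l"
  shows "(\<Sum>e\<in>onb g. g v e * l e) = l v"
  using onb_linear[OF assms, of v] by simp

lemma onb_parseval:
  fixes g :: "'g::euclidean_space bilform"
  assumes g: "inner_product g" shows "(\<Sum>e\<in>onb g. g v e * g w e) = g w v"
  using onb_linear_real[OF g, of "blinfun_apply (g w)" v] by (simp add: linear_blinfun)

lemma inner_product_cauchy_schwarz:
  fixes g :: "'g::euclidean_space bilform"
  assumes g: "inner_product g" shows "\<bar>g v w\<bar> \<le> sqrt (g v v) * sqrt (g w w)"
proof -
  have "(g v w)\<^sup>2 \<le> g v v * g w w"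
    using Cauchy_Schwarz_ineq_sum[of "\<lambda>e. g w e" "\<lambda>e. g v e" "onb g"] onb_parseval[OF g, of w v] onb_parseval[OF g, of w w] onb_parseval[OF g, of v v]
    by (simp add: power2_eq_square mult.commute)
  then show ?thesis using real_sqrt_le_mono[of "(g v w)\<^sup>2" "g v v * g w w"] by (simp add: real_sqrt_mult)
qed

lemma blinfun_inv_inner_product:
  fixes g :: "'g::euclidean_space bilform"
  assumes g: "inner_product g"
  shows "g (blinfun_inv g \<xi>) = \<xi>" "blinfun_inv g (g X) = X"
proof -
  define R where "R = (\<Sum>e\<in>onb g. blinfun_scaleR_left e o\<^sub>L Blinfun (\<lambda>\<xi>::'g dual. \<xi> e))"
  have R: "R \<xi> = (\<Sum>e\<in>onb g. \<xi> e *\<^sub>R e)" for \<xi>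
    by (simp add: R_def blinfun.sum_left bounded_linear_Blinfun_apply blinfun.bounded_linear_left)
  have 1: "R (g X) = X" for X by (simp add: R onb_expansion[OF g])
  have 2: "g (R \<xi>) = \<xi>" for \<xi>
  proof (rule blinfun_eqI)
    fix Z
    have "g (R \<xi>) Z = (\<Sum>e\<in>onb g. g Z e * \<xi> e)"
      by (simp add: R blinfun.sum_left blinfun.sum_right blinfun.bilinear_simps inner_product_sym[OF g, of _ Z] mult.commute)
    also have "\<dots> = \<xi> Z" by (rule onb_linear_real[OF g linear_blinfun])
    finally show "g (R \<xi>) Z = \<xi> Z" .
  qed
  have "blinfun_inv g = R" by (rule blinfun_inv_eqI) (simp_all add: 1 2)
  then show "g (blinfun_inv g \<xi>) = \<xi>" "blinfun_inv g (g X) = X" by (simp_all add: 1 2)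
qed

lemma inner_product_inv_apply:
  fixes g :: "'g::euclidean_space bilform"
  assumes g: "inner_product g"
  shows "g (blinfun_inv g \<xi>) v = \<xi> v" "g v (blinfun_inv g \<xi>) = \<xi> v"
  using blinfun_inv_inner_product(1)[OF g, of \<xi>] inner_product_sym[OF g, of v] by simp_all

text \<open>The vector \<open>w\<close> with \<open>g (w, \<cdot>) = gb (e, \<cdot>)\<close>. It serves to rewrite
  a trace with respect to \<open>g\<close> in a basis that is orthonormal for the fixed metric
  \<open>gb\<close>, where the dependence on \<open>g\<close> is only through its inverse.\<close>

definition raise :: "'g::euclidean_space bilform \<Rightarrow> 'g bilform \<Rightarrow> 'g \<Rightarrow> 'g" where
  "raise gb g e = blinfun_inv g (gb e)"

text \<open>Both sides are the trace of \<open>Q\<close> with respect to \<open>g\<close>: expand \<open>raise gb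
  g e\<close> in the \<open>g\<close>-orthonormal basis and sum over \<open>e\<close>.\<close>

lemma contraction_change_basis:
  fixes g gb :: "'g::euclidean_space bilform"
  assumes g: "inner_product g" and gb: "inner_product gb"
    and Q: "\<And>v. linear (\<lambda>u. Q u v)" "\<And>u. linear (\<lambda>v. (Q u v :: real))"
  shows "(\<Sum>u\<in>onb g. Q u u) = (\<Sum>e\<in>onb gb. Q e (raise gb g e))"
proof -
  have ex: "raise gb g e = (\<Sum>u\<in>onb g. gb e u *\<^sub>R u)" for e
    using onb_expansion[OF g, of "raise gb g e"] by (simp add: raise_def inner_product_inv_apply[OF g])
  have "(\<Sum>e\<in>onb gb. Q e (raise gb g e)) = (\<Sum>e\<in>onb gb. \<Sum>u\<in>onb g. gb e u * Q e u)"
    by (simp add: ex linear_sum[OF Q(2)] linear_scale[OF Q(2)])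
  also have "\<dots> = (\<Sum>u\<in>onb g. \<Sum>e\<in>onb gb. gb u e * Q e u)"
    by (subst sum.swap) (simp add: inner_product_sym[OF gb])
  also have "\<dots> = (\<Sum>u\<in>onb g. Q u u)" by (simp add: onb_linear_real[OF gb Q(1)])
  finally show ?thesis ..
qed

lemma contraction2_change_basis:
  fixes g gb :: "'g::euclidean_space bilform"
  assumes g: "inner_product g" and gb: "inner_product gb"
    and Q: "\<And>v. linear (\<lambda>u. Q u v)" "\<And>u. linear (\<lambda>v. (Q u v :: real))"
    and R: "\<And>v. linear (\<lambda>u. R u v)" "\<And>u. linear (\<lambda>v. (R u v :: real))"
  shows "(\<Sum>u\<in>onb g. \<Sum>v\<in>onb g. Q u v * R u v)
    = (\<Sum>e\<in>onb gb. \<Sum>f\<in>onb gb. Q e f * R (raise gb g e) (raise gb g f))"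
proof -
  have lin: "linear (\<lambda>u. l u * c)" "linear (\<lambda>u. c * l u)" if "linear l" for l :: "'g \<Rightarrow> real" and c
    using that by (auto intro!: linearI simp: linear_add linear_scale algebra_simps)
  have 1: "(\<Sum>v\<in>onb g. Q u v * R u v) = (\<Sum>f\<in>onb gb. Q u f * R u (raise gb g f))" for u
    by (rule contraction_change_basis[OF g gb lin(1)[OF Q(2)] lin(2)[OF R(2)]])
  have 2: "(\<Sum>u\<in>onb g. Q u f * R u w) = (\<Sum>e\<in>onb gb. Q e f * R (raise gb g e) w)" for f w
    by (rule contraction_change_basis[OF g gb lin(1)[OF Q(1)] lin(2)[OF R(1)]])
  show ?thesis unfolding 1 by (subst sum.swap, subst 2, rule sum.swap)
qed

section \<open>Curvature of left-invariant metrics\<close>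

lemma sum_antisymmetric_zero:
  fixes D :: "'i \<Rightarrow> 'i \<Rightarrow> real"
  assumes "\<And>e f. D e f = - D f e" shows "(\<Sum>e\<in>E. \<Sum>f\<in>E. D e f) = 0"
proof -
  have "(\<Sum>e\<in>E. \<Sum>f\<in>E. D e f) = (\<Sum>e\<in>E. \<Sum>f\<in>E. D f e)" by (rule sum.swap)
  also have "\<dots> = (\<Sum>e\<in>E. \<Sum>f\<in>E. - D e f)" by (intro sum.cong refl assms)
  finally show ?thesis by (simp add: sum_negf)
qed

text \<open>A Lie algebra without center with an invariant inner product. The number \<open>s =
  \<plusminus>1\<close> is the sign in the Cartan form, and \<open>flux b\<close> is the 3-form \<open>H
  = Hb + db\<close>.\<close>

locale metric_lie_algebra =
  fixes br :: "'g::euclidean_space \<Rightarrow> 'g \<Rightarrow> 'g" and gb :: "'g bilform" and s :: real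
  assumes br_bounded: "bounded_bilinear br"
    and br_anti: "br X Y = - br Y X"
    and jacobi: "br X (br Y Z) = br (br X Y) Z + br Y (br X Z)"
    and gb: "inner_product gb"
    and ad_invariant: "gb (br X Y) Z + gb Y (br X Z) = 0"
    and center: "(\<And>X. br X Z = 0) \<Longrightarrow> Z = 0"
    and s: "s * s = 1"
begin

sublocale br: bounded_bilinear br by (rule br_bounded)

lemmas bsimps = br.add_left br.add_right br.scaleR_left br.scaleR_right br.minus_left br.minus_right
  br.diff_left br.diff_right br.zero_left br.zero_right blinfun.bilinear_simps

abbreviation "E \<equiv> onb gb"
abbreviation "Hb \<equiv> cartan_form br gb s"

definition flux :: "'g bilform \<Rightarrow> 'g form3" where
  "flux b X Y Z = Hb X Y Z + ext_d br b X Y Z"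

lemma br_self [simp]: "br X X = 0"
proof -
  have "br X X + br X X = 0" using br_anti[of X X] by (metis add.right_inverse)
  then show ?thesis by (simp flip: scaleR_2)
qed

lemma ad_skew: "gb (br X Y) Z = - gb Y (br X Z)"
  using ad_invariant[of X Y Z] by simp

lemma bracket_form_cyclic: "gb (br X Y) Z = gb (br Y Z) X" "gb (br X Y) Z = - gb (br X Z) Y"
proof -
  show *: "gb (br X Y) Z = - gb (br X Z) Y" for X Y Z
    using ad_skew[of X Y Z] inner_product_sym[OF gb, of Y] by simp
  have "gb (br X Y) Z = - gb (br Y X) Z" by (subst br_anti) (simp add: bsimps)
  then show "gb (br X Y) Z = gb (br Y Z) X" using *[of Y X Z] by simp
qed

lemma flux_linear:
  "linear (\<lambda>X. flux b X Y Z)" "linear (\<lambda>Y. flux b X Y Z)" "linear (\<lambda>Z. flux b X Y Z)"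
  by (auto intro!: linearI simp: flux_def cartan_form_def ext_d_def bsimps algebra_simps)

lemma flux_alternating:
  assumes b: "two_form b"
  shows "flux b X Y Z = - flux b Y X Z" "flux b X Y Z = - flux b X Z Y" "flux b X Y Z = flux b Y Z X"
proof -
  have 1: "flux b X Y Z = - flux b Y X Z" for X Y Z
    unfolding flux_def cartan_form_def ext_d_def
    by (subst (1 2 3 4) br_anti) (simp add: bsimps br_anti[of Y X] br_anti[of X Z] br_anti[of Z Y])
  have 2: "flux b X Y Z = flux b Y Z X" for X Y Z
    using bracket_form_cyclic(1)[of X Y Z] by (simp add: flux_def cartan_form_def ext_d_def)
  show "flux b X Y Z = - flux b Y X Z" "flux b X Y Z = flux b Y Z X" by (fact 1, fact 2)
  show "flux b X Y Z = - flux b X Z Y" using 2[of X Y Z] 1[of Y Z X] 2[of X Z Y] 2[of Z Y X] by simp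
qed

lemma bracket_linear:
  "linear (\<lambda>X. g (br X Y) Z)" "linear (\<lambda>Y. g (br X Y) Z)" "linear (\<lambda>Z. blinfun_apply (blinfun_apply g W) Z)"
  "linear (\<lambda>W. blinfun_apply (blinfun_apply g W) Z)" "linear (\<lambda>Z. g W (br X Z))" "linear (\<lambda>Z. g W (br Z X))"
  for g :: "'g bilform"
  by (auto intro!: linearI simp: bsimps)

text \<open>The trace of \<open>ad X\<close> does not depend on the basis, and in a basis that is orthonormal for
  the invariant metric every summand is \<open>0\<close>.\<close>

lemma unimodular:
  assumes g: "inner_product g" shows "(\<Sum>e\<in>onb g. g (br X e) e) = 0"
proof -
  have "(\<Sum>e\<in>onb g. g (br X e) e) = (\<Sum>e\<in>E. g (br X e) (raise gb g e))"
    by (rule contraction_change_basis[OF g gb]) (rule bracket_linear)+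
  also have "\<dots> = (\<Sum>e\<in>E. gb e (br X e))" by (simp add: raise_def inner_product_inv_apply[OF g])
  also have "\<dots> = 0"
  proof (rule sum.neutral, rule ballI)
    fix e show "gb e (br X e) = 0" using ad_skew[of X e e] inner_product_sym[OF gb, of e "br X e"] by simp
  qed
  finally show ?thesis .
qed

definition koszul :: "'g bilform \<Rightarrow> 'g \<Rightarrow> 'g \<Rightarrow> 'g \<Rightarrow> real" where
  "koszul g X Y Z = (g (br X Y) Z - g (br Y Z) X + g (br Z X) Y) / 2"

lemma koszul_linear:
  "linear (\<lambda>X. koszul g X Y Z)" "linear (\<lambda>Y. koszul g X Y Z)" "linear (\<lambda>Z. koszul g X Y Z)"
  by (auto intro!: linearI simp: koszul_def bsimps algebra_simps add_divide_distrib diff_divide_distrib)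

text \<open>The difference of two such connections is skew in the last two and symmetric in the first two
  arguments, hence \<open>0\<close>.\<close>

lemma metric_connection_unique:
  assumes g: "inner_product g" and 1: "metric_connection br g T \<Gamma>" and 2: "metric_connection br g T \<Delta>"
  shows "\<Gamma> = \<Delta>"
proof -
  define D where "D X Y Z = g (\<Gamma> X Y - \<Delta> X Y) Z" for X Y Z
  have a: "D X Y Z = - D X Z Y" for X Y Z
  proof -
    have "g (\<Gamma> X Y) Z = - g Y (\<Gamma> X Z)" "g (\<Delta> X Y) Z = - g Y (\<Delta> X Z)"
      using 1 2 unfolding metric_connection_def by (smt (verit))+
    then show ?thesis using inner_product_sym[OF g, of Y] by (simp add: D_def bsimps)
  qed
  have c: "D X Y Z = D Y X Z" for X Y Z
  proof -
    have "g (\<Gamma> X Y - \<Gamma> Y X - br X Y) Z = g (\<Delta> X Y - \<Delta> Y X - br X Y) Z"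
      using 1 2 unfolding metric_connection_def by simp
    then show ?thesis by (simp add: D_def bsimps)
  qed
  have "D X Y Z = 0" for X Y Z
    using a[of X Y Z] c[of X Z Y] a[of Z X Y] c[of Z Y X] a[of Y Z X] c[of Y X Z] by simp
  then have "\<Gamma> X Y = \<Delta> X Y" for X Y
    using inner_product_nondegenerate[OF g, of "\<Gamma> X Y - \<Delta> X Y"] by (simp add: D_def)
  then show ?thesis by (intro blinfun_eqI) simp
qed

lemma connection_eqI:
  assumes "inner_product g" "metric_connection br g T \<Gamma>" shows "connection br g T = \<Gamma>"
  unfolding connection_def by (rule the_equality) (use assms metric_connection_unique in blast)+

lemma levi_civita_koszul:
  assumes g: "inner_product g" shows "g (levi_civita br g X Y) Z = koszul g X Y Z"
proof -
  define F where "F X Y = (\<Sum>u\<in>onb g. koszul g X Y u *\<^sub>R u)" for X Y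
  define \<Gamma> where "\<Gamma> = Blinfun (\<lambda>X. Blinfun (F X))"
  have "bounded_bilinear F" unfolding F_def
    by (intro bilinear_bounded_euclidean linearI)
      (simp_all add: linear_add[OF koszul_linear(1)] linear_add[OF koszul_linear(2)] linear_scale[OF koszul_linear(1)]
        linear_scale[OF koszul_linear(2)] scaleR_left_distrib sum.distrib scaleR_sum_right)
  then have \<Gamma>: "\<Gamma> X Y = F X Y" for X Y unfolding \<Gamma>_def by (rule blinfun2_apply)
  have K: "g (\<Gamma> X Y) Z = koszul g X Y Z" for X Y Z
  proof -
    have "g (\<Gamma> X Y) Z = (\<Sum>u\<in>onb g. g Z u * koszul g X Y u)"
      by (simp add: \<Gamma> F_def blinfun.sum_right blinfun.sum_left bsimps inner_product_sym[OF g, of Z] mult.commute)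
    then show ?thesis using onb_linear_real[OF g koszul_linear(3)] by simp
  qed
  have "metric_connection br g (\<lambda>X Y Z. 0) \<Gamma>"
    unfolding metric_connection_def
  proof (intro conjI allI)
    fix X Y Z
    have "g Y (\<Gamma> X Z) = koszul g X Z Y" using K inner_product_sym[OF g] by metis
    then show "g (\<Gamma> X Y) Z + g Y (\<Gamma> X Z) = 0"
      by (simp add: K koszul_def br_anti[of Z Y] br_anti[of Z X] br_anti[of Y X] bsimps field_simps)
    show "g (\<Gamma> X Y - \<Gamma> Y X - br X Y) Z = 0"
      by (simp add: K koszul_def br_anti[of Y X] br_anti[of Z X] br_anti[of Z Y] bsimps field_simps)
  qed
  then have "levi_civita br g = \<Gamma>" unfolding levi_civita_def by (rule connection_eqI[OF g])
  then show ?thesis by (simp add: K)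
qed

text \<open>Let \<open>P\<^sub>Y(e, f) = g([Y, e], f)\<close> and \<open>M\<^sub>Y(e, f) = g([e, f], Y)\<close>.
  By the Koszul formula the Ricci tensor is a sum over \<open>e\<close>, \<open>f\<close> of products of
  entries of these matrices and of their transposes; the term \<open>\<nabla>\<^sub>e e\<close> drops
  out by unimodularity. The difference to the claimed expression is skew under exchange of
  \<open>e\<close> and \<open>f\<close>.\<close>

lemma ricci_formula:
  assumes g: "inner_product g"
  shows "ricci br g Y Z = - (\<Sum>e\<in>onb g. g (br Y e) (br Z e)) / 2 - (\<Sum>e\<in>onb g. g (br Z (br Y e)) e) / 2
     + (\<Sum>e\<in>onb g. \<Sum>f\<in>onb g. g (br e f) Y * g (br e f) Z) / 4"
proof -
  let ?B = "onb g" and ?G = "levi_civita br g" and ?K = "koszul g"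
  define P where "P Y e f = g (br Y e) f" for Y e f
  define M where "M Y e f = g (br e f) Y" for Y e f
  note K = levi_civita_koszul[OF g]
  have Msym: "M Y e f = - M Y f e" for Y e f unfolding M_def by (subst br_anti) (simp add: bsimps)
  have K1: "?K e Z f = (- P Z e f - P Z f e - M Z e f) / 2" for Z e f
    by (simp add: koszul_def P_def M_def br_anti[of e Z] br_anti[of f e] bsimps)
  have K2: "?K Y e f = (P Y e f - M Y e f - P Y f e) / 2" for Y e f
    by (simp add: koszul_def P_def M_def br_anti[of f Y] bsimps)
  have Kskew: "?K X Y Z = - ?K X Z Y" for X Y Z
    by (simp add: koszul_def br_anti[of Z Y] br_anti[of Z X] br_anti[of Y X] bsimps field_simps)
  have t1: "(\<Sum>e\<in>?B. g (?G e W) e) = 0" for W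
  proof -
    have "g (?G e W) e = - g (br W e) e" for e
      by (simp add: K koszul_def br_anti[of e W] bsimps)
    then show ?thesis using unimodular[OF g, of W] by (simp add: sum_negf)
  qed
  have t2: "g (?G Y (?G e Z)) e = - (\<Sum>f\<in>?B. ?K e Z f * ?K Y e f)" for e
  proof -
    have "g (?G Y (?G e Z)) e = - g (?G Y e) (?G e Z)" by (simp add: K Kskew[of Y _ e])
    also have "g (?G Y e) (?G e Z) = (\<Sum>f\<in>?B. g (?G e Z) f * g (?G Y e) f)" by (rule onb_parseval[OF g, symmetric])
    finally show ?thesis by (simp add: K)
  qed
  have t3: "g (?G (br e Y) Z) e = - (\<Sum>f\<in>?B. P Y e f * ?K f Z e)" for e
  proof -
    have "?K (br Y e) Z e = (\<Sum>f\<in>?B. P Y e f * ?K f Z e)"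
      unfolding P_def by (rule onb_linear_real[OF g koszul_linear(1), symmetric])
    moreover have "?K (br e Y) Z e = - ?K (br Y e) Z e"
      by (subst br_anti) (rule linear_neg[OF koszul_linear(1)])
    ultimately show ?thesis by (simp add: K)
  qed
  have "ricci br g Y Z = (\<Sum>e\<in>?B. g (?G e (?G Y Z)) e - g (?G Y (?G e Z)) e - g (?G (br e Y) Z) e)"
    by (simp add: ricci_def curvature_def bsimps)
  also have "\<dots> = (\<Sum>e\<in>?B. \<Sum>f\<in>?B. ?K e Z f * ?K Y e f + P Y e f * ?K f Z e)"
    by (simp add: sum_subtractf t1 t2 t3 sum_negf sum.distrib)
  also have "\<dots> = (\<Sum>e\<in>?B. \<Sum>f\<in>?B. - (P Y e f * P Z e f) / 2 - P Y e f * P Z f e / 2 + M Y e f * M Z e f / 4)"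
  proof -
    define D where "D e f = ?K e Z f * ?K Y e f + P Y e f * ?K f Z e
      - (- (P Y e f * P Z e f) / 2 - P Y e f * P Z f e / 2 + M Y e f * M Z e f / 4)" for e f
    have "D e f = - D f e" for e f
      unfolding D_def K1[of e Z f] K1[of f Z e] K2[of Y e f] K2[of Y f e] Msym[of _ f e] by (simp add: field_simps)
    from sum_antisymmetric_zero[of D, OF this] show ?thesis by (simp add: D_def sum_subtractf)
  qed
  also have "\<dots> = - (\<Sum>e\<in>?B. g (br Y e) (br Z e)) / 2 - (\<Sum>e\<in>?B. g (br Z (br Y e)) e) / 2
     + (\<Sum>e\<in>?B. \<Sum>f\<in>?B. g (br e f) Y * g (br e f) Z) / 4"
  proof -
    have "(\<Sum>f\<in>?B. P Y e f * P Z e f) = g (br Y e) (br Z e)" for e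
      using onb_parseval[OF g, of "br Z e" "br Y e"] by (simp add: P_def mult.commute)
    moreover have "(\<Sum>f\<in>?B. P Y e f * P Z f e) = g (br Z (br Y e)) e" for e
      unfolding P_def by (rule onb_linear_real[OF g]) (auto intro!: linearI simp: bsimps)
    ultimately show ?thesis
      by (simp add: sum.distrib sum_subtractf sum_negf M_def flip: sum_divide_distrib)
  qed
  finally show ?thesis .
qed

text \<open>Only the part of \<open>g(\<nabla>\<^sub>e Y, f)\<close> that is skew in \<open>e\<close>,
  \<open>f\<close> pairs with \<open>H\<close>, and by the Koszul formula it is \<open>- g([e, f], Y) /
  2\<close>.\<close>

lemma codiff_formula:
  assumes g: "inner_product g" and b: "two_form b"
  shows "codiff br g (flux b) Y Z = ((\<Sum>e\<in>onb g. \<Sum>f\<in>onb g. flux b Y e f * g (br e f) Z)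
     - (\<Sum>e\<in>onb g. \<Sum>f\<in>onb g. flux b Z e f * g (br e f) Y)) / 2"
proof -
  let ?B = "onb g" and ?G = "levi_civita br g" and ?K = "koszul g" and ?H = "flux b"
  note K = levi_civita_koszul[OF g]
  have t1: "(\<Sum>e\<in>?B. ?H (?G e e) Y Z) = 0"
  proof -
    have "?H (?G e e) Y Z = (\<Sum>f\<in>?B. g (br f e) e * ?H f Y Z)" for e
    proof -
      have "?K e e f = g (br f e) e" for f by (simp add: koszul_def br_anti[of e f] bsimps)
      then show ?thesis using onb_linear_real[OF g flux_linear(1)[of b Y Z], of "?G e e"] by (simp add: K)
    qed
    then have "(\<Sum>e\<in>?B. ?H (?G e e) Y Z) = (\<Sum>f\<in>?B. \<Sum>e\<in>?B. g (br f e) e * ?H f Y Z)"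
      by simp (rule sum.swap)
    then show ?thesis by (simp add: unimodular[OF g] flip: sum_distrib_right)
  qed
  have main: "(\<Sum>e\<in>?B. \<Sum>f\<in>?B. ?K e Y f * ?H Z e f) = - (\<Sum>e\<in>?B. \<Sum>f\<in>?B. ?H Z e f * g (br e f) Y) / 2" for Y Z
  proof -
    define D where "D e f = ?K e Y f * ?H Z e f + ?H Z e f * g (br e f) Y / 2" for e f
    have "D e f = - D f e" for e f
      unfolding D_def koszul_def flux_alternating(2)[OF b, of Z f e]
      by (simp add: br_anti[of e Y] br_anti[of f e] br_anti[of f Y] bsimps field_simps)
    from sum_antisymmetric_zero[of D ?B, OF this] show ?thesis
      by (simp add: D_def sum.distrib eq_neg_iff_add_eq_0 flip: sum_divide_distrib)
  qed
  have t2: "?H e (?G e Y) Z = (\<Sum>f\<in>?B. ?K e Y f * ?H Z e f)" for e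
    using onb_linear_real[OF g flux_linear(2)[of b e Z], of "?G e Y"]
    by (simp add: K flux_alternating(3)[OF b, of Z])
  have t3: "?H e Y (?G e Z) = - (\<Sum>f\<in>?B. ?K e Z f * ?H Y e f)" for e
  proof -
    have "?H e Y f = - ?H Y e f" for f by (rule flux_alternating(1)[OF b])
    then show ?thesis
      using onb_linear_real[OF g flux_linear(3)[of b e Y], of "?G e Z"] by (simp add: K sum_negf)
  qed
  show ?thesis
    by (simp add: codiff_def nabla_form3_def sum.distrib sum_subtractf sum_negf t1 t2 t3 main)
qed

text \<open>The right-hand sides \<open>- 2 Ric + H\<^sup>2 / 2\<close> and \<open>- d\<^sup>* H\<close> as
  polynomials in \<open>g\<close>, \<open>b\<close> and an operator \<open>S\<close> that stands for the
  inverse of \<open>g\<close>. All sums run over the basis of the fixed metric \<open>gb\<close>.\<close>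

definition g_rhs :: "'g bilform \<Rightarrow> ('g dual \<Rightarrow>\<^sub>L 'g) \<Rightarrow> 'g bilform \<Rightarrow> 'g \<Rightarrow> 'g \<Rightarrow> real" where
  "g_rhs g S b Y Z = (\<Sum>e\<in>E. g (br Y e) (br Z (S (gb e)))) - (\<Sum>e\<in>E. gb (br Y e) (br Z e))
    - (\<Sum>e\<in>E. \<Sum>f\<in>E. g (br e f) Y * g (br (S (gb e)) (S (gb f))) Z) / 2
    + (\<Sum>e\<in>E. \<Sum>f\<in>E. flux b Y e f * flux b Z (S (gb e)) (S (gb f))) / 2"

definition b_rhs_aux :: "'g bilform \<Rightarrow> ('g dual \<Rightarrow>\<^sub>L 'g) \<Rightarrow> 'g bilform \<Rightarrow> 'g \<Rightarrow> 'g \<Rightarrow> real" where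
  "b_rhs_aux g S b Y Z = (\<Sum>e\<in>E. \<Sum>f\<in>E. flux b Y e f * g (br (S (gb e)) (S (gb f))) Z)"

definition b_rhs :: "'g bilform \<Rightarrow> ('g dual \<Rightarrow>\<^sub>L 'g) \<Rightarrow> 'g bilform \<Rightarrow> 'g \<Rightarrow> 'g \<Rightarrow> real" where
  "b_rhs g S b Y Z = (b_rhs_aux g S b Z Y - b_rhs_aux g S b Y Z) / 2"

lemma ricci_eq_g_rhs:
  assumes g: "inner_product g"
  shows "- 2 * ricci br g Y Z + H_squared g (flux b) Y Z / 2 = g_rhs g (blinfun_inv g) b Y Z"
proof -
  let ?r = "raise gb g"
  have 1: "(\<Sum>e\<in>onb g. g (br Y e) (br Z e)) = (\<Sum>e\<in>E. g (br Y e) (br Z (?r e)))"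
    by (rule contraction_change_basis[OF g gb]) (auto intro!: linearI simp: bsimps)
  have "(\<Sum>e\<in>onb g. g (br Z (br Y e)) e) = (\<Sum>e\<in>E. g (br Z (br Y e)) (?r e))"
    by (rule contraction_change_basis[OF g gb]) (auto intro!: linearI simp: bsimps)
  also have "\<dots> = (\<Sum>e\<in>E. gb e (br Z (br Y e)))"
    by (simp add: raise_def inner_product_inv_apply[OF g])
  also have "\<dots> = - (\<Sum>e\<in>E. gb (br Y e) (br Z e))"
  proof -
    have "gb e (br Z (br Y e)) = - gb (br Y e) (br Z e)" for e
      using inner_product_sym[OF gb, of e "br Z (br Y e)"] ad_skew[of Z "br Y e" e] by simp
    then show ?thesis by (simp add: sum_negf)
  qed
  finally have 2: "(\<Sum>e\<in>onb g. g (br Z (br Y e)) e) = - (\<Sum>e\<in>E. gb (br Y e) (br Z e))" .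
  have 3: "(\<Sum>e\<in>onb g. \<Sum>f\<in>onb g. g (br e f) Y * g (br e f) Z) = (\<Sum>e\<in>E. \<Sum>f\<in>E. g (br e f) Y * g (br (?r e) (?r f)) Z)"
    by (rule contraction2_change_basis[OF g gb]) (auto intro!: linearI simp: bsimps)
  have 4: "(\<Sum>e\<in>onb g. \<Sum>f\<in>onb g. flux b Y e f * flux b Z e f) = (\<Sum>e\<in>E. \<Sum>f\<in>E. flux b Y e f * flux b Z (?r e) (?r f))"
    by (rule contraction2_change_basis[OF g gb]) (rule flux_linear)+
  show ?thesis unfolding ricci_formula[OF g] H_squared_def 1 2 3 4 g_rhs_def raise_def by simp
qed

lemma codiff_eq_b_rhs:
  assumes g: "inner_product g" and b: "two_form b"
  shows "- codiff br g (flux b) Y Z = b_rhs g (blinfun_inv g) b Y Z"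
proof -
  let ?r = "raise gb g"
  have 1: "(\<Sum>e\<in>onb g. \<Sum>f\<in>onb g. flux b Y e f * g (br e f) Z) = (\<Sum>e\<in>E. \<Sum>f\<in>E. flux b Y e f * g (br (?r e) (?r f)) Z)" for Y Z
    by (rule contraction2_change_basis[OF g gb]) (auto intro!: linearI flux_linear simp: bsimps)
  show ?thesis unfolding codiff_formula[OF g b] 1 b_rhs_def b_rhs_aux_def raise_def by (simp add: field_simps)
qed

end

section \<open>Generalized metrics as pairs of a metric and a 2-form\<close>

definition inl_blinfun :: "'g::real_normed_vector \<Rightarrow>\<^sub>L 'g gtan" where
  "inl_blinfun = Blinfun (\<lambda>X. (X, 0))"

definition inr_blinfun :: "'g::real_normed_vector dual \<Rightarrow>\<^sub>L 'g gtan" where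
  "inr_blinfun = Blinfun (\<lambda>\<xi>. (0, \<xi>))"

lemma inl_blinfun_apply [simp]: "inl_blinfun X = (X, 0)"
  and inr_blinfun_apply [simp]: "inr_blinfun \<xi> = (0, \<xi>)"
  unfolding inl_blinfun_def inr_blinfun_def
  by (subst bounded_linear_Blinfun_apply; auto intro!: bounded_linear_Pair bounded_linear_ident bounded_linear_zero)+

text \<open>Writing the block operators as sums of compositions lets continuity, differentiability and Lipschitz
  bounds of \<open>gmet\<close> follow from those of composition.\<close>

lemma exp_b_eq: "exp_b b = id_blinfun + (inr_blinfun o\<^sub>L b o\<^sub>L fst_blinfun)"
proof -
  have "(\<lambda>(X, \<xi>). (X, \<xi> + b X)) = blinfun_apply (id_blinfun + (inr_blinfun o\<^sub>L b o\<^sub>L fst_blinfun))"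
    by (auto simp: fun_eq_iff blinfun.bilinear_simps)
  then show ?thesis by (simp add: exp_b_def blinfun_apply_inverse)
qed

lemma block_end_eq: "block_end P Q R S = (inl_blinfun o\<^sub>L P o\<^sub>L fst_blinfun) + (inl_blinfun o\<^sub>L Q o\<^sub>L snd_blinfun)
    + (inr_blinfun o\<^sub>L R o\<^sub>L fst_blinfun) + (inr_blinfun o\<^sub>L S o\<^sub>L snd_blinfun)"
proof -
  have "(\<lambda>(X, \<xi>). (P X + Q \<xi>, R X + S \<xi>)) = blinfun_apply ((inl_blinfun o\<^sub>L P o\<^sub>L fst_blinfun) + (inl_blinfun o\<^sub>L Q o\<^sub>L snd_blinfun)
    + (inr_blinfun o\<^sub>L R o\<^sub>L fst_blinfun) + (inr_blinfun o\<^sub>L S o\<^sub>L snd_blinfun))"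
    by (auto simp: fun_eq_iff blinfun.bilinear_simps)
  then show ?thesis by (simp add: block_end_def blinfun_apply_inverse)
qed

lemma exp_b_apply [simp]: "exp_b b (X, \<xi>) = (X, \<xi> + b X)"
  by (simp add: exp_b_eq blinfun.bilinear_simps)

lemma block_end_apply [simp]: "block_end P Q R S (X, \<xi>) = (P X + Q \<xi>, R X + S \<xi>)"
  by (simp add: block_end_eq blinfun.bilinear_simps)

lemma gmet_apply:
  "gmet g b (X, \<xi>) = (blinfun_inv g (\<xi> - b X), g X + b (blinfun_inv g (\<xi> - b X)))"
  by (simp add: gmet_def blinfun.bilinear_simps)

lemma gmet_involution:
  fixes g :: "'g::euclidean_space bilform"
  assumes g: "inner_product g" shows "gmet g b (gmet g b u) = u"
  by (cases u) (simp add: gmet_apply blinfun_inv_inner_product[OF g])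

lemma blinfun_inv_gmet:
  fixes g :: "'g::euclidean_space bilform"
  assumes g: "inner_product g" shows "blinfun_inv (gmet g b) = gmet g b"
  by (rule blinfun_inv_eqI) (simp_all add: gmet_involution[OF g])

text \<open>With \<open>\<xi> = g(w, \<cdot>) + b(X, \<cdot>)\<close>, the form \<open>\<langle>\<G>\<cdot>,
  \<cdot>\<rangle>\<close> is half of \<open>g \<oplus> g\<close> in the coordinates \<open>(X,
  w)\<close>.\<close>

lemma pairing_gmet:
  fixes g :: "'g::euclidean_space bilform"
  assumes g: "inner_product g" and b: "two_form b"
  shows "pairing (gmet g b (X, \<xi>)) (Y, \<eta>)
    = (g X Y + g (blinfun_inv g (\<xi> - b X)) (blinfun_inv g (\<eta> - b Y))) / 2"
proof -
  define w where "w = blinfun_inv g (\<xi> - b X)"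
  define v where "v = blinfun_inv g (\<eta> - b Y)"
  have "g v = \<eta> - b Y" unfolding v_def by (rule blinfun_inv_inner_product[OF g])
  then have "\<eta> w = g v w + b Y w" by (simp add: blinfun.bilinear_simps)
  moreover have "b Y w = - b w Y" using b unfolding two_form_def by blast
  ultimately show ?thesis
    unfolding gmet_apply pairing_def w_def[symmetric] v_def[symmetric]
    by (simp add: blinfun.bilinear_simps inner_product_sym[OF g, of v])
qed

lemma gen_metric_gmet:
  fixes g :: "'g::euclidean_space bilform"
  assumes g: "inner_product g" and b: "two_form b"
  shows "gen_metric (gmet g b)"
proof -
  have sym: "pairing (gmet g b u) v = pairing (gmet g b v) u" for u v
    by (cases u, cases v) (simp add: pairing_gmet[OF g b] inner_product_sym[OF g])
  have pres: "pairing (gmet g b u) (gmet g b v) = pairing u v" for u v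
    using sym[of u "gmet g b v"] by (simp add: gmet_involution[OF g] pairing_def add.commute)
  have pos: "pairing (gmet g b u) u > 0" if "u \<noteq> 0" for u
  proof -
    obtain X \<xi> where u: "u = (X, \<xi>)" by (cases u)
    let ?w = "blinfun_inv g (\<xi> - b X)"
    have "g X X + g ?w ?w > 0"
    proof (cases "X = 0")
      case False then show ?thesis using inner_product_pos[OF g False] inner_product_nonneg[OF g, of ?w] by simp
    next
      case True
      then have "\<xi> \<noteq> 0" using that u by (simp add: zero_prod_def)
      then have "?w \<noteq> 0" using blinfun_inv_inner_product(1)[OF g, of "\<xi> - b X"] True by (auto simp: blinfun.bilinear_simps)
      then show ?thesis using inner_product_pos[OF g] inner_product_nonneg[OF g, of X] by (simp add: add_nonneg_pos)
    qed
    then show ?thesis by (simp add: u pairing_gmet[OF g b])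
  qed
  have "gmet g b o\<^sub>L gmet g b = id_blinfun"
    by (rule blinfun_eqI) (simp add: gmet_involution[OF g])
  then show ?thesis using sym pres pos unfolding gen_metric_def by blast
qed

text \<open>The two upper blocks of \<open>gmet g b\<close> are the inverse of \<open>g\<close> and \<open>-
  g\<^sup>-\<^sup>1 b\<close>; they determine the pair.\<close>

definition upper_right :: "'g::real_normed_vector gend \<Rightarrow> 'g dual \<Rightarrow>\<^sub>L 'g" where
  "upper_right A = fst_blinfun o\<^sub>L A o\<^sub>L inr_blinfun"

definition upper_left :: "'g::real_normed_vector gend \<Rightarrow> 'g \<Rightarrow>\<^sub>L 'g" where
  "upper_left A = fst_blinfun o\<^sub>L A o\<^sub>L inl_blinfun"

lemma upper_right_gmet: "upper_right (gmet g b) = blinfun_inv g"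
  by (rule blinfun_eqI) (simp add: upper_right_def gmet_apply blinfun.bilinear_simps)

lemma upper_left_gmet: "upper_left (gmet g b) = - (blinfun_inv g o\<^sub>L b)"
  by (rule blinfun_eqI) (simp add: upper_left_def gmet_apply blinfun.bilinear_simps)

lemma gmet_eq_iff:
  fixes g :: "'g::euclidean_space bilform"
  assumes g: "inner_product g" and g': "inner_product g'" and eq: "gmet g b = gmet g' b'"
  shows "g = g'" "b = b'"
proof -
  have S: "blinfun_inv g = blinfun_inv g'" using eq upper_right_gmet by metis
  show "g = g'"
    by (intro blinfun_eqI) (metis S blinfun_inv_inner_product(1)[OF g'] blinfun_inv_inner_product(2)[OF g])
  have P: "- (blinfun_inv g o\<^sub>L b) = - (blinfun_inv g' o\<^sub>L b')" using eq upper_left_gmet by metis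
  have "blinfun_inv g (b X) = blinfun_inv g (b' X)" for X
    using arg_cong[OF P, of "\<lambda>T. blinfun_apply T X"] by (simp add: blinfun.bilinear_simps S)
  then show "b = b'" by (intro blinfun_eqI) (metis blinfun_inv_inner_product(1)[OF g])
qed

lemma gmet_pair_gmet:
  fixes g :: "'g::euclidean_space bilform"
  assumes g: "inner_product g" and b: "two_form b"
  shows "gmet_pair (gmet g b) = (g, b)"
  unfolding gmet_pair_def
proof (rule the_equality)
  show "case (g, b) of (g', b') \<Rightarrow> inner_product g' \<and> two_form b' \<and> gmet g b = gmet g' b'" using g b by simp
next
  fix p assume p: "case p of (g', b') \<Rightarrow> inner_product g' \<and> two_form b' \<and> gmet g b = gmet g' b'"
  then show "p = (g, b)" using gmet_eq_iff[OF g, of "fst p" b "snd p"] by (auto simp: case_prod_beta prod_eq_iff)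
qed

text \<open>Let \<open>Q\<close> and \<open>P\<close> be the upper right and upper left blocks. Positivity makes
  \<open>Q\<close> injective, hence invertible by dimension; \<open>g = Q\<^sup>-\<^sup>1\<close> and
  \<open>b = - g P\<close>. The relation \<open>\<G>\<^sup>2 = 1\<close> then fixes the lower blocks,
  and symmetry of the pairing makes \<open>b\<close> skew.\<close>

lemma gen_metric_imp_gmet:
  fixes \<G> :: "'g::euclidean_space gend"
  assumes G: "gen_metric \<G>"
  shows "\<exists>g b. inner_product g \<and> two_form b \<and> \<G> = gmet g b"
proof -
  have inv: "\<G> (\<G> u) = u" for u
    using G unfolding gen_metric_def by (metis blinfun_apply_blinfun_compose blinfun_apply_id_blinfun id_apply)
  have sym: "pairing (\<G> u) v = pairing (\<G> v) u" for u v using G unfolding gen_metric_def by blast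
  have pos: "u \<noteq> 0 \<Longrightarrow> pairing (\<G> u) u > 0" for u using G unfolding gen_metric_def by blast
  define Q where "Q = upper_right \<G>"
  define P where "P = upper_left \<G>"
  have Qa: "Q \<xi> = fst (\<G> (0, \<xi>))" for \<xi> by (simp add: Q_def upper_right_def)
  have Pa: "P X = fst (\<G> (X, 0))" for X by (simp add: P_def upper_left_def)
  \<comment> \<open>the Riesz map identifies the dual with \<open>'g\<close>, where injective endomorphisms are onto\<close>
  define r where "r v = (blinfun_inner_right v :: 'g dual)" for v
  have rl: "linear r" unfolding r_def by (rule bounded_linear.linear[OF bounded_linear_blinfun_inner_right])
  have r_surj: "\<exists>v. \<xi> = r v" for \<xi> :: "'g dual"
  proof
    show "\<xi> = r (\<Sum>e\<in>Basis. \<xi> e *\<^sub>R e)"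
      by (rule blinfun_euclidean_eqI) (simp add: r_def inner_sum_left inner_Basis if_distrib sum.delta cong: if_cong)
  qed
  have Qpos: "\<xi> (Q \<xi>) > 0" if "\<xi> \<noteq> 0" for \<xi>
    using pos[of "(0, \<xi>)"] that by (simp add: pairing_def Qa zero_prod_def)
  have Qinj: "\<xi> = 0" if "Q \<xi> = 0" for \<xi> using Qpos[of \<xi>] that by (force simp: blinfun.bilinear_simps)
  have lin: "linear (\<lambda>v. Q (r v))" using linear_compose[OF rl linear_blinfun[of Q]] by (simp add: o_def)
  have "inj (\<lambda>v. Q (r v))"
    unfolding linear_injective_0[OF lin]
  proof (intro allI impI)
    fix v assume "Q (r v) = 0"
    then have "r v = 0" by (rule Qinj)
    then have "r v v = 0" by simp
    then show "v = 0" by (simp add: r_def)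
  qed
  then have surj: "surj (\<lambda>v. Q (r v))" using linear_injective_imp_surjective[OF lin] by blast
  then obtain l where l: "linear l" "(\<lambda>v. Q (r v)) \<circ> l = id" using linear_surjective_right_inverse[OF lin] by blast
  have Ql: "Q (r (l X)) = X" for X using fun_cong[OF l(2), of X] by simp
  define g where "g = Blinfun (\<lambda>X. r (l X))"
  have "bounded_linear (\<lambda>X. r (l X))"
    using linear_compose[OF l(1) rl] by (simp add: o_def linear_conv_bounded_linear)
  then have ga: "g X = r (l X)" for X by (simp add: g_def bounded_linear_Blinfun_apply)
  have Qg: "Q (g X) = X" for X by (simp add: ga Ql)
  have gQ: "g (Q \<xi>) = \<xi>" for \<xi> :: "'g dual"
  proof -
    have "Q (g (Q \<xi>) - \<xi>) = 0" by (simp add: blinfun.bilinear_simps Qg)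
    then show ?thesis using Qinj by fastforce
  qed
  have Qsym: "\<xi> (Q \<eta>) = \<eta> (Q \<xi>)" for \<xi> \<eta> :: "'g dual" using sym[of "(0, \<xi>)" "(0, \<eta>)"] by (simp add: pairing_def Qa)
  have gsym: "g X Y = g Y X" for X Y using Qsym[of "g X" "g Y"] by (simp add: Qg)
  have ip: "inner_product g"
    unfolding inner_product_def
  proof (intro conjI allI impI)
    show "g X Y = g Y X" for X Y by (rule gsym)
    fix X :: 'g assume "X \<noteq> 0"
    then have "g X \<noteq> 0" using Qg[of X] by (auto simp: blinfun.bilinear_simps)
    from Qpos[OF this] show "g X X > 0" by (simp add: Qg)
  qed
  have S: "blinfun_inv g = Q" by (rule blinfun_inv_eqI) (simp_all add: Qg gQ)
  define b where "b = - (g o\<^sub>L P)"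
  have ba: "b X = - g (P X)" for X by (simp add: b_def blinfun.bilinear_simps)
  have lr: "snd (\<G> (0, \<xi>)) = b (Q \<xi>)" for \<xi> :: "'g dual"
  proof -
    have "\<G> (0, \<xi>) = (Q \<xi>, 0) + (0, snd (\<G> (0, \<xi>)))" by (simp add: Qa prod_eq_iff)
    then have "(0, \<xi>) = \<G> (Q \<xi>, 0) + \<G> (0, snd (\<G> (0, \<xi>)))" using inv[of "(0, \<xi>)"] by (metis blinfun.add_right)
    then have "0 = P (Q \<xi>) + Q (snd (\<G> (0, \<xi>)))" by (metis Pa Qa fst_add fst_conv)
    then have "Q (snd (\<G> (0, \<xi>))) = - P (Q \<xi>)" by (simp add: eq_neg_iff_add_eq_0 add.commute)
    then have "g (Q (snd (\<G> (0, \<xi>)))) = g (- P (Q \<xi>))" by simp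
    then show ?thesis by (simp add: gQ ba blinfun.bilinear_simps)
  qed
  have ll: "snd (\<G> (X, 0)) = g X + b (P X)" for X
  proof -
    have "\<G> (X, 0) = (P X, 0) + (0, snd (\<G> (X, 0)))" by (simp add: Pa prod_eq_iff)
    then have "(X, 0) = \<G> (P X, 0) + \<G> (0, snd (\<G> (X, 0)))" using inv[of "(X, 0)"] by (metis blinfun.add_right)
    then have "X = P (P X) + Q (snd (\<G> (X, 0)))" by (metis Pa Qa fst_add fst_conv)
    then have "g (Q (snd (\<G> (X, 0)))) = g (X - P (P X))" by (metis add_diff_cancel_left')
    then show ?thesis by (simp add: gQ ba blinfun.bilinear_simps)
  qed
  have bform: "two_form b"
    unfolding two_form_def
  proof (intro allI)
    fix X Y
    have "g Y (P X) = b Y X"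
      using sym[of "(X, 0)" "(0, g Y)"] by (simp add: pairing_def Pa lr Qg)
    moreover have "g Y (P X) = - b X Y" by (simp add: ba gsym[of Y] blinfun.bilinear_simps)
    ultimately show "b X Y = - b Y X" by simp
  qed
  have "\<G> = gmet g b"
  proof (rule blinfun_eqI)
    fix u :: "'g gtan"
    obtain X \<xi> where u: "u = (X, \<xi>)" by (cases u)
    have "\<G> u = \<G> (X, 0) + \<G> (0, \<xi>)" by (simp add: u flip: blinfun.add_right)
    then have "\<G> u = (P X + Q \<xi>, g X + b (P X) + b (Q \<xi>))" by (simp add: prod_eq_iff Pa Qa lr ll)
    moreover have e: "Q (\<xi> - b X) = P X + Q \<xi>" by (simp add: blinfun.bilinear_simps ba Qg)
    ultimately show "\<G> u = gmet g b u"
      unfolding u gmet_apply S e by (simp add: blinfun.add_right add.assoc)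
  qed
  then show ?thesis using ip bform by blast
qed

lemmas compose_has_vector_derivative = bounded_bilinear.has_vector_derivative[OF bounded_bilinear_blinfun_compose]

lemma blinfun_inverse_has_vector_derivative:
  fixes T :: "real \<Rightarrow> 'a::real_normed_vector \<Rightarrow>\<^sub>L 'b::real_normed_vector"
    and R :: "real \<Rightarrow> 'b \<Rightarrow>\<^sub>L 'a"
  assumes T: "(T has_vector_derivative T') (at t within I)" and t: "t \<in> I"
    and inv: "\<And>t v. t \<in> I \<Longrightarrow> R t (T t v) = v" "\<And>t w. t \<in> I \<Longrightarrow> T t (R t w) = w"
  shows "(R has_vector_derivative - (R t o\<^sub>L T' o\<^sub>L R t)) (at t within I)"
proof -
  have "(R has_derivative (\<lambda>h. - (R t o\<^sub>L (h *\<^sub>R T') o\<^sub>L R t))) (at t within I)"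
    using T unfolding has_vector_derivative_def
  proof (rule blinfun_inverse_has_derivative)
    show "\<forall>\<^sub>F y in at t within I. \<forall>v. R y (T y v) = v" using inv by (simp add: eventually_at_filter)
  qed (use t inv in auto)
  moreover have "- (R t o\<^sub>L (h *\<^sub>R T') o\<^sub>L R t) = h *\<^sub>R - (R t o\<^sub>L T' o\<^sub>L R t)" for h
    by (rule blinfun_eqI) (simp add: blinfun.bilinear_simps)
  ultimately show ?thesis by (simp add: has_vector_derivative_def)
qed

text \<open>The derivative of \<open>gmet\<close> at \<open>(g, b)\<close> in the direction \<open>(h,
  \<beta>)\<close>, by the product rule.\<close>

definition gmet_velocity :: "'g::real_normed_vector bilform \<Rightarrow> 'g bilform \<Rightarrow> 'g bilform \<Rightarrow> 'g bilform \<Rightarrow> 'g gend" where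
  "gmet_velocity g b h \<beta> =
     ((inr_blinfun o\<^sub>L \<beta> o\<^sub>L fst_blinfun) o\<^sub>L block_end 0 (blinfun_inv g) g 0 o\<^sub>L exp_b (- b))
   + (exp_b b o\<^sub>L block_end 0 (- (blinfun_inv g o\<^sub>L h o\<^sub>L blinfun_inv g)) h 0 o\<^sub>L exp_b (- b))
   - (exp_b b o\<^sub>L block_end 0 (blinfun_inv g) g 0 o\<^sub>L (inr_blinfun o\<^sub>L \<beta> o\<^sub>L fst_blinfun))"

lemma gmet_has_vector_derivative:
  fixes g :: "real \<Rightarrow> 'g::euclidean_space bilform"
  assumes g: "(g has_vector_derivative h) (at t within I)" and b: "(b has_vector_derivative \<beta>) (at t within I)"
    and t: "t \<in> I" and ip: "\<And>t. t \<in> I \<Longrightarrow> inner_product (g t)"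
  shows "((\<lambda>t. gmet (g t) (b t)) has_vector_derivative gmet_velocity (g t) (b t) h \<beta>) (at t within I)"
proof -
  let ?S = "\<lambda>t. blinfun_inv (g t)"
  have S: "(?S has_vector_derivative - (?S t o\<^sub>L h o\<^sub>L ?S t)) (at t within I)"
    by (rule blinfun_inverse_has_vector_derivative[OF g t]) (simp_all add: blinfun_inv_inner_product[OF ip])
  have cl: "((\<lambda>t. C o\<^sub>L f t o\<^sub>L D) has_vector_derivative (C o\<^sub>L f' o\<^sub>L D)) (at t within I)"
    if "(f has_vector_derivative f') (at t within I)"
    for C :: "'y::real_normed_vector \<Rightarrow>\<^sub>L 'z::real_normed_vector" and D :: "'w::real_normed_vector \<Rightarrow>\<^sub>L 'x::real_normed_vector" and f f'
    using compose_has_vector_derivative[OF compose_has_vector_derivative[OF has_vector_derivative_const[of C] that] has_vector_derivative_const[of D]]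
    by simp
  have e1: "((\<lambda>t. exp_b (b t)) has_vector_derivative (inr_blinfun o\<^sub>L \<beta> o\<^sub>L fst_blinfun)) (at t within I)"
    unfolding exp_b_eq using has_vector_derivative_add[OF has_vector_derivative_const cl[OF b]] by simp
  have e2: "((\<lambda>t. exp_b (- b t)) has_vector_derivative - (inr_blinfun o\<^sub>L \<beta> o\<^sub>L fst_blinfun)) (at t within I)"
  proof -
    have "((\<lambda>t. exp_b (- b t)) has_vector_derivative (inr_blinfun o\<^sub>L (- \<beta>) o\<^sub>L fst_blinfun)) (at t within I)"
      unfolding exp_b_eq using has_vector_derivative_add[OF has_vector_derivative_const cl[OF has_vector_derivative_minus[OF b]]] by simp
    moreover have "(inr_blinfun o\<^sub>L (- \<beta>) o\<^sub>L fst_blinfun) = - (inr_blinfun o\<^sub>L \<beta> o\<^sub>L (fst_blinfun :: 'g gtan \<Rightarrow>\<^sub>L 'g))"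
      by (rule blinfun_eqI) (simp add: blinfun.bilinear_simps)
    ultimately show ?thesis by simp
  qed
  have e3: "((\<lambda>t. block_end 0 (?S t) (g t) 0) has_vector_derivative block_end 0 (- (?S t o\<^sub>L h o\<^sub>L ?S t)) h 0) (at t within I)"
    unfolding block_end_eq using has_vector_derivative_add[OF cl[OF S] cl[OF g]] by (simp add: add.assoc)
  have *: "((\<lambda>t. (exp_b (b t) o\<^sub>L block_end 0 (?S t) (g t) 0) o\<^sub>L exp_b (- b t)) has_vector_derivative
     ((exp_b (b t) o\<^sub>L block_end 0 (?S t) (g t) 0) o\<^sub>L - (inr_blinfun o\<^sub>L \<beta> o\<^sub>L fst_blinfun))
     + (((exp_b (b t) o\<^sub>L block_end 0 (- (?S t o\<^sub>L h o\<^sub>L ?S t)) h 0) + ((inr_blinfun o\<^sub>L \<beta> o\<^sub>L fst_blinfun) o\<^sub>L block_end 0 (?S t) (g t) 0)) o\<^sub>L exp_b (- b t))) (at t within I)"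
    by (intro compose_has_vector_derivative e1 e2 e3)
  show ?thesis
    unfolding gmet_def
  proof (rule has_vector_derivative_eq_rhs[OF *])
    show "((exp_b (b t) o\<^sub>L block_end 0 (?S t) (g t) 0) o\<^sub>L - (inr_blinfun o\<^sub>L \<beta> o\<^sub>L fst_blinfun))
     + (((exp_b (b t) o\<^sub>L block_end 0 (- (?S t o\<^sub>L h o\<^sub>L ?S t)) h 0) + ((inr_blinfun o\<^sub>L \<beta> o\<^sub>L fst_blinfun) o\<^sub>L block_end 0 (?S t) (g t) 0)) o\<^sub>L exp_b (- b t))
     = gmet_velocity (g t) (b t) h \<beta>"
      unfolding gmet_velocity_def by (rule blinfun_eqI) (simp add: blinfun.bilinear_simps algebra_simps zero_prod_def)
  qed
qed

lemma gmet_velocity_apply: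
  fixes g :: "'g::euclidean_space bilform"
  defines "S \<equiv> blinfun_inv g"
  shows "gmet_velocity g b h \<beta> (X, \<xi>) =
    (- S (h (S (\<xi> - b X))) - S (\<beta> X),
     \<beta> (S (\<xi> - b X)) + h X + b (- S (h (S (\<xi> - b X))) - S (\<beta> X)))"
  by (simp add: gmet_velocity_def S_def blinfun.bilinear_simps)

text \<open>Since \<open>gmet g b\<close> is its own inverse, this is the endomorphism \<open>\<G>\<^sup>-\<^sup>1
  d\<G>/dt\<close>, which enters both the flow equation and the distance.\<close>

lemma gmet_compose_velocity_apply:
  fixes g :: "'g::euclidean_space bilform"
  assumes g: "inner_product g"
  defines "S \<equiv> blinfun_inv g"
  shows "(gmet g b o\<^sub>L gmet_velocity g b h \<beta>) (X, \<xi>) =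
    (S (h X + \<beta> (S (\<xi> - b X))), b (S (h X + \<beta> (S (\<xi> - b X)))) - h (S (\<xi> - b X)) - \<beta> X)"
  unfolding S_def
  by (simp add: gmet_velocity_apply gmet_apply blinfun.bilinear_simps blinfun_inv_inner_product[OF g])

lemma gen_metric_path_pair:
  fixes \<G> :: "real \<Rightarrow> 'g::euclidean_space gend"
  assumes G: "\<And>t. t \<in> I \<Longrightarrow> gen_metric (\<G> t)"
  shows "\<exists>g b. \<forall>t\<in>I. inner_product (g t) \<and> two_form (b t) \<and> \<G> t = gmet (g t) (b t)"
proof -
  have "\<forall>t\<in>I. \<exists>p. inner_product (fst p) \<and> two_form (snd p) \<and> \<G> t = gmet (fst p) (snd p)"
    using gen_metric_imp_gmet[OF G] by fastforce
  then obtain p where "\<forall>t\<in>I. inner_product (fst (p t)) \<and> two_form (snd (p t)) \<and> \<G> t = gmet (fst (p t)) (snd (p t))"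
    using bchoice by metis
  then show ?thesis by (intro exI[of _ "\<lambda>t. fst (p t)"] exI[of _ "\<lambda>t. snd (p t)"])
qed

lemma upper_has_vector_derivative:
  assumes "(\<G> has_vector_derivative D) F"
  shows "((\<lambda>t. upper_right (\<G> t)) has_vector_derivative upper_right D) F"
    "((\<lambda>t. upper_left (\<G> t)) has_vector_derivative upper_left D) F"
proof -
  have "bounded_linear (\<lambda>A. fst_blinfun o\<^sub>L A o\<^sub>L C)" for C :: "'z::real_normed_vector \<Rightarrow>\<^sub>L _"
    by (intro bounded_linear_compose[OF bounded_bilinear.bounded_linear_left[OF bounded_bilinear_blinfun_compose]]
        bounded_bilinear.bounded_linear_right[OF bounded_bilinear_blinfun_compose])
  from bounded_linear.has_vector_derivative[OF this assms]
  show "((\<lambda>t. upper_right (\<G> t)) has_vector_derivative upper_right D) F"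
    "((\<lambda>t. upper_left (\<G> t)) has_vector_derivative upper_left D) F"
    unfolding upper_right_def upper_left_def by blast+
qed

text \<open>A differentiable path of generalized metrics has differentiable pairs, as the blocks of
  \<open>\<G>\<close> determine \<open>g\<close> and \<open>b\<close> by inversion and composition.\<close>

lemma gmet_path_pair_derivative:
  fixes g :: "real \<Rightarrow> 'g::euclidean_space bilform"
  assumes D: "(\<G> has_vector_derivative D) (at t within I)" and t: "t \<in> I"
    and ip: "\<And>t. t \<in> I \<Longrightarrow> inner_product (g t)" and eq: "\<And>t. t \<in> I \<Longrightarrow> \<G> t = gmet (g t) (b t)"
  shows "\<exists>h \<beta>. (g has_vector_derivative h) (at t within I) \<and> (b has_vector_derivative \<beta>) (at t within I) \<and>
     (at t within I \<noteq> bot \<longrightarrow> D = gmet_velocity (g t) (b t) h \<beta>)"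
proof -
  let ?S = "\<lambda>t. blinfun_inv (g t)"
  have tr: "(f has_vector_derivative f') (at t within I) \<Longrightarrow> (\<And>t. t \<in> I \<Longrightarrow> f t = f2 t) \<Longrightarrow> (f2 has_vector_derivative f') (at t within I)"
    for f f2 :: "real \<Rightarrow> 'z::real_normed_vector" and f'
    using t by (metis has_vector_derivative_transform)
  have S: "(?S has_vector_derivative upper_right D) (at t within I)"
    by (rule tr[OF upper_has_vector_derivative(1)[OF D]]) (simp add: eq upper_right_gmet)
  have P: "((\<lambda>t. - (?S t o\<^sub>L b t)) has_vector_derivative upper_left D) (at t within I)"
    by (rule tr[OF upper_has_vector_derivative(2)[OF D]]) (simp add: eq upper_left_gmet)
  define h where "h = - (g t o\<^sub>L upper_right D o\<^sub>L g t)"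
  have g: "(g has_vector_derivative h) (at t within I)"
    unfolding h_def by (rule blinfun_inverse_has_vector_derivative[OF S t]) (simp_all add: blinfun_inv_inner_product[OF ip])
  define \<beta> where "\<beta> = - ((g t o\<^sub>L upper_left D) + (h o\<^sub>L - (?S t o\<^sub>L b t)))"
  have "((\<lambda>t. - (g t o\<^sub>L - (?S t o\<^sub>L b t))) has_vector_derivative \<beta>) (at t within I)"
    unfolding \<beta>_def by (intro has_vector_derivative_minus compose_has_vector_derivative g P)
  then have b: "(b has_vector_derivative \<beta>) (at t within I)"
    by (rule tr) (auto intro!: blinfun_eqI simp: blinfun.bilinear_simps blinfun_inv_inner_product[OF ip])
  have "(\<G> has_vector_derivative gmet_velocity (g t) (b t) h \<beta>) (at t within I)"
    by (rule tr[OF gmet_has_vector_derivative[OF g b t ip]]) (simp_all add: eq)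
  then show ?thesis using g b D vector_derivative_unique_within by blast
qed

section \<open>The flow as an ordinary differential equation\<close>

context metric_lie_algebra
begin

definition g_field :: "'g bilform \<Rightarrow> 'g bilform \<Rightarrow> 'g bilform" where
  "g_field g b = bilform_of (g_rhs g (blinfun_inv g) b)"

definition b_field :: "'g bilform \<Rightarrow> 'g bilform \<Rightarrow> 'g bilform" where
  "b_field g b = bilform_of (b_rhs g (blinfun_inv g) b)"

lemma g_rhs_linear: "linear (\<lambda>Y. g_rhs g S b Y Z)" "linear (\<lambda>Z. g_rhs g S b Y Z)"
  and b_rhs_aux_linear: "linear (\<lambda>Y. b_rhs_aux g S b Y Z)" "linear (\<lambda>Z. b_rhs_aux g S b Y Z)"
  by (auto intro!: linearI simp: g_rhs_def b_rhs_aux_def bsimps linear_add[OF flux_linear(1)] linear_scale[OF flux_linear(1)]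
      sum.distrib sum_distrib_left sum_subtractf sum_divide_distrib algebra_simps add_divide_distrib)

lemma b_rhs_linear: "linear (\<lambda>Y. b_rhs g S b Y Z)" "linear (\<lambda>Z. b_rhs g S b Y Z)"
  by (auto intro!: linearI simp: b_rhs_def linear_add[OF b_rhs_aux_linear(1)] linear_scale[OF b_rhs_aux_linear(1)]
    linear_add[OF b_rhs_aux_linear(2)] linear_scale[OF b_rhs_aux_linear(2)] field_simps)

lemma g_field_apply: "g_field g b Y Z = g_rhs g (blinfun_inv g) b Y Z"
  unfolding g_field_def by (rule bilform_of_apply[OF g_rhs_linear])

lemma b_field_apply: "b_field g b Y Z = b_rhs g (blinfun_inv g) b Y Z"
  unfolding b_field_def by (rule bilform_of_apply[OF b_rhs_linear])

lemma g_field_sym: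
  assumes g: "inner_product g" shows "g_field g b Y Z = g_field g b Z Y"
proof -
  have "H_squared g (flux b) Y Z = H_squared g (flux b) Z Y" by (simp add: H_squared_def mult.commute)
  moreover have "ricci br g Y Z = ricci br g Z Y"
  proof -
    have "(\<Sum>e\<in>onb g. g (br Z (br Y e)) e) = (\<Sum>e\<in>onb g. g (br Y (br Z e)) e)"
    proof -
      have "(\<Sum>e\<in>onb g. g (br Z (br Y e)) e) = (\<Sum>e\<in>onb g. g (br (br Z Y) e) e + g (br Y (br Z e)) e)"
        by (simp add: jacobi[of Z Y] bsimps)
      then show ?thesis by (simp add: sum.distrib unimodular[OF g])
    qed
    then show ?thesis unfolding ricci_formula[OF g] by (simp add: inner_product_sym[OF g, of "br Y _"] mult.commute)
  qed
  ultimately show ?thesis by (simp add: g_field_apply flip: ricci_eq_g_rhs[OF g])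
qed

lemma b_field_two_form: "two_form (b_field g b)"
  by (simp add: two_form_def b_field_apply b_rhs_def field_simps)

text \<open>Both sides are compared on \<open>(X, g(w, \<cdot>) + b(X, \<cdot>))\<close>, where \<open>exp_b (-
  b)\<close> leaves \<open>(X, g(w, \<cdot>))\<close>.\<close>

lemma gen_ricci_gmet:
  assumes g: "inner_product g" and b: "two_form b"
  shows "- 2 *\<^sub>R gen_ricci br Hb (gmet g b) = gmet g b o\<^sub>L gmet_velocity g b (g_field g b) (b_field g b)"
proof (rule blinfun_eqI)
  fix u :: "'g gtan"
  obtain X \<xi> where u: "u = (X, \<xi>)" by (cases u)
  let ?S = "blinfun_inv g"
  have H: "H_of br Hb (gmet g b) = flux b"
    by (simp add: fun_eq_iff H_of_def flux_def gmet_pair_gmet[OF g b])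
  define \<rho> where "\<rho> = bilform_of (\<lambda>X Y. ricci br g X Y - H_squared g (flux b) X Y / 4)"
  define dH where "dH = bilform_of (codiff br g (flux b))"
  define R where "R = ?S o\<^sub>L \<rho>"
  have "(\<lambda>X Y. ricci br g X Y - H_squared g (flux b) X Y / 4) = (\<lambda>X Y. - (1/2) * g_rhs g ?S b X Y)"
    by (simp add: fun_eq_iff field_simps flip: ricci_eq_g_rhs[OF g])
  moreover have "bilform_of (\<lambda>X Y. - (1/2) * g_rhs g ?S b X Y) X Y = - (1/2) * g_rhs g ?S b X Y" for X Y
    by (rule bilform_of_apply) (auto intro!: linearI simp: linear_add[OF g_rhs_linear(1)] linear_scale[OF g_rhs_linear(1)]
      linear_add[OF g_rhs_linear(2)] linear_scale[OF g_rhs_linear(2)] algebra_simps)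
  ultimately have \<rho>: "\<rho> X Y = - (1/2) * g_field g b X Y" for X Y
    by (simp add: \<rho>_def g_field_apply)
  have "codiff br g (flux b) = (\<lambda>X Y. - b_rhs g ?S b X Y)"
    by (simp add: fun_eq_iff flip: codiff_eq_b_rhs[OF g b])
  moreover have "bilform_of (\<lambda>X Y. - b_rhs g ?S b X Y) X Y = - b_rhs g ?S b X Y" for X Y
    by (rule bilform_of_apply) (auto intro!: linearI simp: linear_add[OF b_rhs_linear(1)] linear_scale[OF b_rhs_linear(1)]
      linear_add[OF b_rhs_linear(2)] linear_scale[OF b_rhs_linear(2)])
  ultimately have "dH X Y = - b_field g b X Y" for X Y by (simp add: dH_def b_field_apply)
  then have dH: "dH = - b_field g b" by (intro blinfun_eqI) (simp add: blinfun.bilinear_simps)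
  have \<rho>': "\<rho> X = - (1/2) *\<^sub>R g_field g b X" for X
    by (rule blinfun_eqI) (simp add: \<rho> blinfun.bilinear_simps)
  have Rs: "blinfun_apply (Blinfun (\<lambda>\<xi>. \<xi> o\<^sub>L R)) \<zeta> = \<zeta> o\<^sub>L R" for \<zeta> :: "'g dual"
    by (simp add: bounded_linear_Blinfun_apply bounded_bilinear.bounded_linear_left[OF bounded_bilinear_blinfun_compose])
  define w where "w = ?S (\<xi> - b X)"
  have \<xi>: "\<xi> = g w + b X" by (simp add: w_def blinfun_inv_inner_product(1)[OF g])
  have Sw: "?S (g v) = v" for v by (rule blinfun_inv_inner_product(2)[OF g])
  have gR: "g w o\<^sub>L R = - (1/2) *\<^sub>R g_field g b w"
    by (rule blinfun_eqI) (simp add: R_def inner_product_inv_apply[OF g] \<rho> g_field_sym[OF g, of _ w] blinfun.bilinear_simps)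
  have RX: "R X = - (1/2) *\<^sub>R ?S (g_field g b X)" by (simp add: R_def \<rho>' blinfun.bilinear_simps)
  have gr: "gen_ricci br Hb (gmet g b) = exp_b b
         o\<^sub>L block_end R ((1/2) *\<^sub>R (?S o\<^sub>L dH o\<^sub>L ?S)) (- ((1/2) *\<^sub>R dH)) (- Blinfun (\<lambda>\<xi>. \<xi> o\<^sub>L R))
         o\<^sub>L exp_b (- b)"
    unfolding gen_ricci_def Let_def H gmet_pair_gmet[OF g b] fst_conv snd_conv R_def \<rho>_def dH_def ..
  define q where "q = ?S (g_field g b X + b_field g b w)"
  have r1: "gen_ricci br Hb (gmet g b) u = (- (1/2) *\<^sub>R q, (1/2) *\<^sub>R b_field g b X + (1/2) *\<^sub>R g_field g b w + b (- (1/2) *\<^sub>R q))"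
    by (simp add: gr u \<xi> blinfun.bilinear_simps Rs gR RX dH Sw q_def algebra_simps)
  have r2: "(gmet g b o\<^sub>L gmet_velocity g b (g_field g b) (b_field g b)) u = (q, b q - g_field g b w - b_field g b X)"
    unfolding u gmet_compose_velocity_apply[OF g] w_def[symmetric] q_def by simp
  have "- 2 *\<^sub>R (1/2) *\<^sub>R x = - x" for x :: "'z::real_vector" by simp
  then show "(- 2 *\<^sub>R gen_ricci br Hb (gmet g b)) u = (gmet g b o\<^sub>L gmet_velocity g b (g_field g b) (b_field g b)) u"
    unfolding r2 blinfun.scaleR_left r1 by (simp add: blinfun.bilinear_simps scaleR_add_right scaleR_diff_right)
qed

lemma gmet_velocity_inj:
  fixes g :: "'g bilform"
  assumes g: "inner_product g" and eq: "gmet g b o\<^sub>L gmet_velocity g b h \<beta> = gmet g b o\<^sub>L gmet_velocity g b h' \<beta>'"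
  shows "h = h'" "\<beta> = \<beta>'"
proof -
  have gS: "g (blinfun_inv g \<xi>) = \<xi>" for \<xi> by (rule blinfun_inv_inner_product(1)[OF g])
  have Sg: "blinfun_inv g (g X) = X" for X by (rule blinfun_inv_inner_product(2)[OF g])
  have "blinfun_inv g (h X + \<beta> w) = blinfun_inv g (h' X + \<beta>' w)" for X w
    using arg_cong[OF eq, of "\<lambda>A. fst (blinfun_apply A (X, g w + b X))"]
    unfolding gmet_compose_velocity_apply[OF g] by (simp add: Sg)
  then have *: "h X + \<beta> w = h' X + \<beta>' w" for X w by (metis gS)
  show "h = h'" using *[of _ 0] by (intro blinfun_eqI) (simp add: blinfun.bilinear_simps)
  show "\<beta> = \<beta>'" using *[of 0] by (intro blinfun_eqI) (simp add: blinfun.bilinear_simps)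
qed

lemma ode_imp_flow:
  assumes ip: "\<And>t. t \<in> I \<Longrightarrow> inner_product (g t)" and tf: "\<And>t. t \<in> I \<Longrightarrow> two_form (b t)"
    and g: "\<And>t. t \<in> I \<Longrightarrow> (g has_vector_derivative g_field (g t) (b t)) (at t within I)"
    and b: "\<And>t. t \<in> I \<Longrightarrow> (b has_vector_derivative b_field (g t) (b t)) (at t within I)"
  shows "gen_ricci_flow br Hb I (\<lambda>t. gmet (g t) (b t))"
  unfolding gen_ricci_flow_def
proof (intro ballI conjI exI)
  fix t assume t: "t \<in> I"
  show "gen_metric (gmet (g t) (b t))" by (rule gen_metric_gmet[OF ip[OF t] tf[OF t]])
  show "((\<lambda>t. gmet (g t) (b t)) has_vector_derivative gmet_velocity (g t) (b t) (g_field (g t) (b t)) (b_field (g t) (b t))) (at t within I)"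
    by (rule gmet_has_vector_derivative[OF g[OF t] b[OF t] t ip])
  show "blinfun_inv (gmet (g t) (b t)) o\<^sub>L gmet_velocity (g t) (b t) (g_field (g t) (b t)) (b_field (g t) (b t))
     = - 2 *\<^sub>R gen_ricci br Hb (gmet (g t) (b t))"
    unfolding blinfun_inv_gmet[OF ip[OF t]] gen_ricci_gmet[OF ip[OF t] tf[OF t]] ..
qed

lemma flow_imp_ode:
  assumes flow: "gen_ricci_flow br Hb I \<G>" and I: "\<And>t. t \<in> I \<Longrightarrow> at t within I \<noteq> bot"
  shows "\<exists>g b. \<forall>t\<in>I. inner_product (g t) \<and> two_form (b t) \<and> \<G> t = gmet (g t) (b t) \<and>
     (g has_vector_derivative g_field (g t) (b t)) (at t within I) \<and> (b has_vector_derivative b_field (g t) (b t)) (at t within I)"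
proof -
  have gm: "gen_metric (\<G> t)" if "t \<in> I" for t using flow that unfolding gen_ricci_flow_def by blast
  obtain g b where gb: "\<And>t. t \<in> I \<Longrightarrow> inner_product (g t) \<and> two_form (b t) \<and> \<G> t = gmet (g t) (b t)"
    using gen_metric_path_pair[of I \<G>] gm by blast
  have "(g has_vector_derivative g_field (g t) (b t)) (at t within I) \<and> (b has_vector_derivative b_field (g t) (b t)) (at t within I)"
    if t: "t \<in> I" for t
  proof -
    note ip = gb[OF t, THEN conjunct1] and tf = gb[OF t, THEN conjunct2, THEN conjunct1]
    have Gt: "\<G> t = gmet (g t) (b t)" using gb t by blast
    obtain D where D: "(\<G> has_vector_derivative D) (at t within I)"
      and eq: "blinfun_inv (\<G> t) o\<^sub>L D = - 2 *\<^sub>R gen_ricci br Hb (\<G> t)"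
      using flow t unfolding gen_ricci_flow_def by blast
    obtain h \<beta> where h: "(g has_vector_derivative h) (at t within I)" "(b has_vector_derivative \<beta>) (at t within I)"
      "D = gmet_velocity (g t) (b t) h \<beta>"
      using gmet_path_pair_derivative[OF D t, of g b] gb I[OF t] by blast
    have "gmet (g t) (b t) o\<^sub>L gmet_velocity (g t) (b t) h \<beta>
       = gmet (g t) (b t) o\<^sub>L gmet_velocity (g t) (b t) (g_field (g t) (b t)) (b_field (g t) (b t))"
      using eq unfolding Gt blinfun_inv_gmet[OF ip] gen_ricci_gmet[OF ip tf] h(3) .
    from gmet_velocity_inj[OF ip this] show ?thesis using h by simp
  qed
  then show ?thesis using gb by blast
qed

end

section \<open>The distance between generalized metrics\<close>

lemma trace_onb:
  fixes g :: "'g::euclidean_space bilform"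
  assumes g: "inner_product g" and T: "linear T"
  shows "(\<Sum>e\<in>Basis. T e \<bullet> e) = (\<Sum>u\<in>onb g. g (T u) u)"
proof -
  have "T e \<bullet> e = (\<Sum>u\<in>onb g. g ((T u \<bullet> e) *\<^sub>R e) u)" for e
  proof -
    have "T e \<bullet> e = (\<Sum>u\<in>onb g. g e u * (T u \<bullet> e))"
      by (rule onb_linear_real[OF g, symmetric]) (auto intro!: linearI simp: linear_add[OF T] linear_scale[OF T] inner_add_left)
    then show ?thesis by (simp add: blinfun.bilinear_simps mult.commute)
  qed
  then have "(\<Sum>e\<in>Basis. T e \<bullet> e) = (\<Sum>u\<in>onb g. \<Sum>e\<in>Basis. g ((T u \<bullet> e) *\<^sub>R e) u)"
    by (simp add: sum.swap[of _ "onb g"])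
  also have "\<dots> = (\<Sum>u\<in>onb g. g (\<Sum>e\<in>Basis. (T u \<bullet> e) *\<^sub>R e) u)"
    by (simp only: blinfun.sum_right blinfun.sum_left)
  finally show ?thesis by (simp add: euclidean_representation)
qed

text \<open>The trace over the dual space, transported to the Lie algebra by \<open>g\<close>.\<close>

lemma trace_onb_dual:
  fixes g :: "'g::euclidean_space bilform"
  assumes g: "inner_product g" and T: "linear T"
  shows "(\<Sum>e\<in>Basis. g (T (blinfun_inv g (blinfun_inner_right e))) e) = (\<Sum>u\<in>onb g. g (T u) u)"
proof -
  let ?f = "\<lambda>e. blinfun_inv g (blinfun_inner_right e)"
  have "g (T (?f e)) e = (\<Sum>u\<in>onb g. g (T u) ((u \<bullet> e) *\<^sub>R e))" for e
  proof -
    have "g (T (?f e)) e = (\<Sum>u\<in>onb g. g (?f e) u * g (T u) e)"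
      by (rule onb_linear_real[OF g, symmetric]) (auto intro!: linearI simp: linear_add[OF T] linear_scale[OF T] blinfun.bilinear_simps)
    then show ?thesis by (simp add: blinfun.bilinear_simps inner_product_inv_apply[OF g] inner_commute)
  qed
  then have "(\<Sum>e\<in>Basis. g (T (?f e)) e) = (\<Sum>u\<in>onb g. \<Sum>e\<in>Basis. g (T u) ((u \<bullet> e) *\<^sub>R e))"
    by (simp add: sum.swap[of _ "onb g"])
  also have "\<dots> = (\<Sum>u\<in>onb g. g (T u) (\<Sum>e\<in>Basis. (u \<bullet> e) *\<^sub>R e))"
    by (simp only: blinfun.sum_right)
  finally show ?thesis by (simp add: euclidean_representation)
qed

lemma trace_onb_cyclic:
  fixes g :: "'g::euclidean_space bilform"
  assumes g: "inner_product g" and T: "linear T" and K: "linear K"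
  shows "(\<Sum>u\<in>onb g. g (T (K u)) u) = (\<Sum>u\<in>onb g. g (K (T u)) u)"
proof -
  have ex: "g (A (B u)) u = (\<Sum>v\<in>onb g. g (B u) v * g (A v) u)" if A: "linear A" for A B u
    by (rule onb_linear_real[OF g, symmetric]) (auto intro!: linearI simp: linear_add[OF A] linear_scale[OF A] blinfun.bilinear_simps)
  show ?thesis unfolding ex[OF T, of K] ex[OF K, of T] by (subst sum.swap) (simp add: mult.commute)
qed

text \<open>Let \<open>a\<close>, \<open>c\<close>, \<open>k\<close> be the operators \<open>g\<^sup>-\<^sup>1
  h\<close>, \<open>g\<^sup>-\<^sup>1 \<beta>\<close>, \<open>g\<^sup>-\<^sup>1 b\<close>. The trace of
  \<open>A\<^sup>2\<close> is \<open>2 tr (a\<^sup>2 - c\<^sup>2)\<close>, since the contributions of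
  \<open>k\<close> from the two diagonal blocks cancel by cyclicity; \<open>a\<close> is symmetric and
  \<open>c\<close> is skew with respect to \<open>g\<close>.\<close>

lemma g_sym_velocity:
  fixes g b h \<beta> :: "'g::euclidean_space bilform"
  assumes g: "inner_product g" and h: "\<And>X Y. h X Y = h Y X" and \<beta>: "\<And>X Y. \<beta> X Y = - \<beta> Y X"
  defines "A \<equiv> gmet g b o\<^sub>L gmet_velocity g b h \<beta>"
  shows "g_sym A A = 2 * ((\<Sum>u\<in>onb g. \<Sum>v\<in>onb g. (h u v)\<^sup>2) + (\<Sum>u\<in>onb g. \<Sum>v\<in>onb g. (\<beta> u v)\<^sup>2))"
proof -
  let ?S = "blinfun_inv g"
  define a where "a X = ?S (h X)" for X
  define c where "c X = ?S (\<beta> X)" for X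
  define k where "k X = ?S (b X)" for X
  define m where "m X = a (c X) - c (a X)" for X
  define n where "n X = a (a X) - c (c X)" for X
  define tr where "tr T = (\<Sum>u\<in>onb g. g (T u) u)" for T
  have lin: "linear a" "linear c" "linear k" by (auto intro!: linearI simp: a_def c_def k_def blinfun.bilinear_simps)
  note ls = linear_add[OF lin(1)] linear_add[OF lin(2)] linear_add[OF lin(3)]
    linear_diff[OF lin(1)] linear_diff[OF lin(2)] linear_diff[OF lin(3)]
    linear_neg[OF lin(1)] linear_neg[OF lin(2)] linear_neg[OF lin(3)]
    linear_scale[OF lin(1)] linear_scale[OF lin(2)] linear_scale[OF lin(3)] linear_0[OF lin(1)] linear_0[OF lin(2)] linear_0[OF lin(3)]
  have lin2: "linear m" "linear n" by (auto intro!: linearI simp: m_def n_def ls algebra_simps)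
  have gS: "g (?S \<xi>) = \<xi>" for \<xi> by (rule blinfun_inv_inner_product(1)[OF g])
  have Sg: "?S (g X) = X" for X by (rule blinfun_inv_inner_product(2)[OF g])
  have ga: "g (a X) = h X" and gc: "g (c X) = \<beta> X" and gk: "g (k X) = b X" for X by (simp_all add: a_def c_def k_def gS)
  have A1: "A (X, g w + b X) = (a X + c w, g (- a w - c X) + b (a X + c w))" for X w
    unfolding A_def gmet_compose_velocity_apply[OF g]
    by (simp add: Sg a_def c_def gS blinfun.bilinear_simps)
  \<comment> \<open>in the coordinates \<open>(X, w)\<close> the square of \<open>A\<close> is the block matrix with entries \<open>n\<close>, \<open>m\<close>\<close>
  have A2: "A (A (X, g w + b X)) = (n X + m w, g (n w + m X) + b (n X + m w))" for X w
  proof -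
    have "a (a X + c w) + c (- a w - c X) = n X + m w" "- a (- a w - c X) - c (a X + c w) = n w + m X"
      by (simp_all add: n_def m_def ls)
    then show ?thesis unfolding A1 by simp
  qed
  have "fst ((A o\<^sub>L A) (e, 0)) = n e - m (k e)" for e
  proof -
    have "(0::'g dual) = g (- k e) + b e" by (simp add: blinfun.bilinear_simps gk)
    then show ?thesis using A2[of e "- k e"] by (simp add: linear_neg[OF lin2(1)])
  qed
  then have t1: "(\<Sum>e\<in>Basis. fst ((A o\<^sub>L A) (e, 0)) \<bullet> e) = tr n - tr (\<lambda>X. m (k X))"
    using trace_onb[OF g lin2(2)] trace_onb[OF g linear_compose[OF lin(3) lin2(1), unfolded o_def]]
    by (simp add: tr_def inner_diff_left sum_subtractf)
  have "snd ((A o\<^sub>L A) (0, \<xi>)) = g (n (?S \<xi>) + k (m (?S \<xi>)))" for \<xi>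
    using A2[of 0 "?S \<xi>"] by (simp add: gS blinfun.bilinear_simps gk linear_0[OF lin2(1)] linear_0[OF lin2(2)])
  then have t2: "(\<Sum>e\<in>Basis. snd ((A o\<^sub>L A) (0, blinfun_inner_right e)) e) = tr n + tr (\<lambda>X. k (m X))"
    using trace_onb_dual[OF g lin2(2)] trace_onb_dual[OF g linear_compose[OF lin2(1) lin(3), unfolded o_def]]
    by (simp add: tr_def blinfun.add_left blinfun.add_right sum.distrib)
  have cyc: "tr (\<lambda>X. k (m X)) = tr (\<lambda>X. m (k X))"
    unfolding tr_def by (rule trace_onb_cyclic[OF g lin(3) lin2(1)])
  have a2: "g (a (a u)) u = (\<Sum>v\<in>onb g. (h u v)\<^sup>2)" for u
  proof -
    have "g (a (a u)) u = h u (a u)" by (simp add: ga h[of u])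
    also have "\<dots> = (\<Sum>v\<in>onb g. g (a u) v * h u v)" by (rule onb_linear_real[OF g linear_blinfun, symmetric])
    finally show ?thesis by (simp add: ga power2_eq_square)
  qed
  have c2: "g (c (c u)) u = - (\<Sum>v\<in>onb g. (\<beta> u v)\<^sup>2)" for u
  proof -
    have "g (c (c u)) u = - \<beta> u (c u)" using \<beta>[of "c u" u] by (simp add: gc)
    also have "\<beta> u (c u) = (\<Sum>v\<in>onb g. g (c u) v * \<beta> u v)" by (rule onb_linear_real[OF g linear_blinfun, symmetric])
    finally show ?thesis by (simp add: gc power2_eq_square)
  qed
  have "tr n = (\<Sum>u\<in>onb g. \<Sum>v\<in>onb g. (h u v)\<^sup>2) + (\<Sum>u\<in>onb g. \<Sum>v\<in>onb g. (\<beta> u v)\<^sup>2)"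
    by (simp add: tr_def n_def blinfun.bilinear_simps a2 c2 sum.distrib sum_negf)
  then show ?thesis unfolding g_sym_def trace_end_def t1 t2 cyc by simp
qed

lemma hilbert_schmidt_bound:
  fixes g :: "'g::euclidean_space bilform" and h :: "'g bilform"
  assumes g: "inner_product g"
  shows "\<bar>h X Y\<bar> \<le> sqrt (\<Sum>u\<in>onb g. \<Sum>v\<in>onb g. (h u v)\<^sup>2) * (sqrt (g X X) * sqrt (g Y Y))"
proof -
  have lin: "linear (\<lambda>X. h X v)" for v by (auto intro!: linearI simp: blinfun.bilinear_simps)
  have par: "(\<Sum>u\<in>onb g. (g X u)\<^sup>2) = g X X" for X using onb_parseval[OF g, of X X] by (simp add: power2_eq_square)
  have 1: "(h X v)\<^sup>2 \<le> g X X * (\<Sum>u\<in>onb g. (h u v)\<^sup>2)" for v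
    using Cauchy_Schwarz_ineq_sum[of "\<lambda>u. g X u" "\<lambda>u. h u v" "onb g"] onb_linear_real[OF g lin, of X v] by (simp add: par)
  have "(h X Y)\<^sup>2 \<le> g Y Y * (\<Sum>v\<in>onb g. (h X v)\<^sup>2)"
    using Cauchy_Schwarz_ineq_sum[of "\<lambda>u. g Y u" "\<lambda>v. h X v" "onb g"] onb_linear_real[OF g linear_blinfun[of "h X"], of Y] by (simp add: par)
  also have "\<dots> \<le> g Y Y * (\<Sum>v\<in>onb g. g X X * (\<Sum>u\<in>onb g. (h u v)\<^sup>2))"
    by (intro mult_left_mono sum_mono 1 inner_product_nonneg[OF g])
  also have "\<dots> = (\<Sum>u\<in>onb g. \<Sum>v\<in>onb g. (h u v)\<^sup>2) * (g X X * g Y Y)"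
    by (subst sum.swap) (simp add: sum_distrib_left sum_distrib_right mult.commute mult.left_commute)
  finally show ?thesis using real_sqrt_le_mono[of "(h X Y)\<^sup>2"] by (fastforce simp: real_sqrt_mult)
qed

text \<open>Exceptional points are allowed, because \<open>gmet_dist\<close> uses piecewise differentiable paths;
  there nothing is known about the integrand, so it is replaced by \<open>0\<close>.\<close>

lemma integral_derivative_bound:
  fixes u :: "real \<Rightarrow> real"
  assumes cont: "continuous_on {0..1} u" and S: "finite S"
    and der: "\<And>t. t \<in> {0..1} - S \<Longrightarrow> (u has_vector_derivative u' t) (at t within {0..1})"
    and le: "\<And>t. t \<in> {0..1} - S \<Longrightarrow> \<bar>u' t\<bar> \<le> c * f t"
    and f: "(f has_integral L) {0..1}" and f0: "\<And>t. t \<in> {0..1} - S \<Longrightarrow> f t \<ge> 0" and c: "c \<ge> 0"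
    and t: "t \<in> {0..1}"
  shows "\<bar>u 1 - u t\<bar> \<le> c * L" "L \<ge> 0"
proof -
  define f1 where "f1 t = (if t \<in> S then 0 else f t)" for t
  define u1 where "u1 t = (if t \<in> S then 0 else u' t)" for t
  have f1: "(f1 has_integral L) {0..1}"
    by (rule has_integral_spike_finite[OF S _ f]) (simp add: f1_def)
  have f1n: "f1 t \<ge> 0" if "t \<in> {0..1}" for t using f0 that by (simp add: f1_def)
  show "L \<ge> 0" by (rule has_integral_nonneg[OF f1 f1n])
  have "(u1 has_integral u 1 - u t) {t..1}"
  proof (rule fundamental_theorem_of_calculus_interior_strong[OF S])
    show "t \<le> 1" using t by simp
    show "continuous_on {t..1} u" by (rule continuous_on_subset[OF cont]) (use t in auto)
    fix x assume x: "x \<in> {t<..<1} - S"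
    then have "(u has_vector_derivative u' x) (at x within {0..1})" using der t by auto
    moreover have "at x within {0..1} = at x" using x t by (intro at_within_interior) auto
    ultimately show "(u has_vector_derivative u1 x) (at x)" using x by (simp add: u1_def)
  qed
  moreover have "f1 integrable_on {t..1}" by (rule integrable_on_subinterval[OF has_integral_integrable[OF f1]]) (use t in auto)
  then have f2: "((\<lambda>x. c * f1 x) has_integral c * integral {t..1} f1) {t..1}"
    by (intro has_integral_mult_right integrable_integral)
  ultimately have "norm (u 1 - u t) \<le> c * integral {t..1} f1"
    by (rule has_integral_norm_le) (use le t f1n in \<open>auto simp: u1_def f1_def\<close>)
  also have "integral {t..1} f1 \<le> integral {0..1} f1"
    by (rule integral_subset_le) (use t f1n f1 \<open>f1 integrable_on {t..1}\<close> in \<open>auto simp: has_integral_integrable\<close>)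
  also have "\<dots> = L" by (rule integral_unique[OF f1])
  finally show "\<bar>u 1 - u t\<bar> \<le> c * L" using c by (simp add: mult_left_mono)
qed

definition gmet_speed :: "(real \<Rightarrow> 'g::euclidean_space gend) \<Rightarrow> real \<Rightarrow> real" where
  "gmet_speed \<gamma> t = (let A = blinfun_inv (\<gamma> t) o\<^sub>L vector_derivative \<gamma> (at t within {0..1}) in sqrt (g_sym A A))"

text \<open>The speed is at least \<open>|g'|\<close> and \<open>|b'|\<close> in the Hilbert-Schmidt norm of
  \<open>g\<close>. The first makes \<open>ln g(X, X)\<close> change by at most the length
  \<open>L\<close>, so all metrics on the path are comparable with factor \<open>e\<^sup>L\<close>; the
  second then bounds the change of \<open>b(X, Y)\<close>.\<close>

lemma gmet_path_estimate:
  fixes \<gamma> :: "real \<Rightarrow> 'g::euclidean_space gend"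
  assumes vp: "valid_path \<gamma>" and gm: "\<And>t. t \<in> {0..1} \<Longrightarrow> gen_metric (\<gamma> t)"
    and g0: "inner_product g0" "two_form b0" "pathstart \<gamma> = gmet g0 b0"
    and g1: "inner_product g1" "two_form b1" "pathfinish \<gamma> = gmet g1 b1"
    and L: "(gmet_speed \<gamma> has_integral L) {0..1}"
  shows "g0 X X \<le> exp L * g1 X X" "g1 X X \<le> exp L * g0 X X"
    "\<bar>b0 X Y - b1 X Y\<bar> \<le> L * (exp L * (sqrt (g1 X X) * sqrt (g1 Y Y)))" "L \<ge> 0"
proof -
  let ?I = "{0..1::real}"
  obtain g b where gb: "\<forall>t\<in>?I. inner_product (g t) \<and> two_form (b t) \<and> \<gamma> t = gmet (g t) (b t)"
    using gen_metric_path_pair[of ?I \<gamma>] gm by blast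
  have ip: "\<And>t. t \<in> ?I \<Longrightarrow> inner_product (g t)" and tf: "\<And>t. t \<in> ?I \<Longrightarrow> two_form (b t)"
    and eq: "\<And>t. t \<in> ?I \<Longrightarrow> \<gamma> t = gmet (g t) (b t)" using gb by auto
  have e0: "g 0 = g0" "b 0 = b0"
    using gmet_eq_iff[OF ip[of 0] g0(1), of "b 0" b0] eq[of 0] g0(3) by (auto simp: pathstart_def)
  have e1: "g 1 = g1" "b 1 = b1"
    using gmet_eq_iff[OF ip[of 1] g1(1), of "b 1" b1] eq[of 1] g1(3) by (auto simp: pathfinish_def)
  have bot: "at t within ?I \<noteq> bot" if "t \<in> ?I" for t
    using that by (simp add: at_within_Icc_at trivial_limit_within islimpt_Icc)
  have pc: "continuous_on ?I \<gamma>" using vp by (simp add: valid_path_def piecewise_C1_differentiable_on_def)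
  have cS: "continuous_on ?I (\<lambda>t. blinfun_inv (g t))"
  proof -
    have "continuous_on ?I (\<lambda>t. upper_right (\<gamma> t))" unfolding upper_right_def
      by (intro bounded_bilinear.continuous_on[OF bounded_bilinear_blinfun_compose] continuous_on_const pc)
    then show ?thesis by (rule continuous_on_eq) (simp add: eq upper_right_gmet)
  qed
  have cP: "continuous_on ?I (\<lambda>t. - (blinfun_inv (g t) o\<^sub>L b t))"
  proof -
    have "continuous_on ?I (\<lambda>t. upper_left (\<gamma> t))" unfolding upper_left_def
      by (intro bounded_bilinear.continuous_on[OF bounded_bilinear_blinfun_compose] continuous_on_const pc)
    then show ?thesis by (rule continuous_on_eq) (simp add: eq upper_left_gmet)
  qed
  have cg: "continuous_on ?I g"
    unfolding continuous_on
  proof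
    fix t assume t: "t \<in> ?I"
    show "(g \<longlongrightarrow> g t) (at t within ?I)"
      by (rule blinfun_inverse_tendsto[where T="\<lambda>t. blinfun_inv (g t)" and ?T0.0="blinfun_inv (g t)"])
        (use cS t in \<open>auto simp: continuous_on blinfun_inv_inner_product[OF ip] eventually_at_filter\<close>)
  qed
  have cb: "continuous_on ?I b"
  proof -
    have "continuous_on ?I (\<lambda>t. - (g t o\<^sub>L - (blinfun_inv (g t) o\<^sub>L b t)))"
      by (intro continuous_on_minus bounded_bilinear.continuous_on[OF bounded_bilinear_blinfun_compose] cg cP)
    then show ?thesis
      by (rule continuous_on_eq) (auto intro!: blinfun_eqI simp: blinfun.bilinear_simps blinfun_inv_inner_product[OF ip])
  qed
  obtain S D where S: "finite S" and D: "\<And>t. t \<in> ?I - S \<Longrightarrow> (\<gamma> has_vector_derivative D t) (at t)"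
    using vp unfolding valid_path_def piecewise_C1_differentiable_on_def C1_differentiable_on_def by metis
  have "\<exists>h \<beta>. (g has_vector_derivative h) (at t within ?I) \<and> (b has_vector_derivative \<beta>) (at t within ?I) \<and>
      gmet_speed \<gamma> t \<ge> sqrt (\<Sum>u\<in>onb (g t). \<Sum>v\<in>onb (g t). (h u v)\<^sup>2) \<and>
      gmet_speed \<gamma> t \<ge> sqrt (\<Sum>u\<in>onb (g t). \<Sum>v\<in>onb (g t). (\<beta> u v)\<^sup>2)" if t: "t \<in> ?I - S" for t
  proof -
    have tI: "t \<in> ?I" using t by simp
    have Dt: "(\<gamma> has_vector_derivative D t) (at t within ?I)" using D[OF t] by (rule has_vector_derivative_at_within)
    then have vd: "vector_derivative \<gamma> (at t within ?I) = D t" by (rule vector_derivative_within[OF bot[OF tI]])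
    obtain h \<beta> where h: "(g has_vector_derivative h) (at t within ?I)" "(b has_vector_derivative \<beta>) (at t within ?I)"
      "D t = gmet_velocity (g t) (b t) h \<beta>"
      using gmet_path_pair_derivative[OF Dt tI ip eq] bot[OF tI] by blast
    have ap: "((\<lambda>t. p t X Y) has_vector_derivative p' X Y) (at t within ?I)"
      if "(p has_vector_derivative p') (at t within ?I)" for p :: "real \<Rightarrow> 'g bilform" and p' X Y
      by (rule bounded_linear.has_vector_derivative[OF blinfun.bounded_linear_left
            bounded_linear.has_vector_derivative[OF blinfun.bounded_linear_left that]])
    have hs: "h X Y = h Y X" for X Y
    proof -
      have "((\<lambda>t. g t X Y) has_vector_derivative h Y X) (at t within ?I)"
        by (rule has_vector_derivative_transform[OF tI inner_product_sym[OF ip] ap[OF h(1), of Y X]])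
      from vector_derivative_unique_within[OF bot[OF tI] ap[OF h(1), of X Y] this] show ?thesis .
    qed
    have bs: "\<beta> X Y = - \<beta> Y X" for X Y
    proof -
      have "((\<lambda>t. b t X Y) has_vector_derivative - \<beta> Y X) (at t within ?I)"
      proof (rule has_vector_derivative_transform[OF tI])
        show "((\<lambda>t. - b t Y X) has_vector_derivative - \<beta> Y X) (at t within ?I)"
          by (rule has_vector_derivative_minus[OF ap[OF h(2), of Y X]])
        show "b t X Y = - b t Y X" if "t \<in> ?I" for t using tf[OF that] unfolding two_form_def by blast
      qed
      from vector_derivative_unique_within[OF bot[OF tI] ap[OF h(2), of X Y] this] show ?thesis .
    qed
    have sp: "gmet_speed \<gamma> t = sqrt (2 * ((\<Sum>u\<in>onb (g t). \<Sum>v\<in>onb (g t). (h u v)\<^sup>2) + (\<Sum>u\<in>onb (g t). \<Sum>v\<in>onb (g t). (\<beta> u v)\<^sup>2)))"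
      unfolding gmet_speed_def Let_def vd h(3) eq[OF tI] blinfun_inv_gmet[OF ip[OF tI]]
      by (subst g_sym_velocity[OF ip[OF tI] hs bs]) simp_all
    have nn: "(\<Sum>u\<in>onb (g t). \<Sum>v\<in>onb (g t). (h u v)\<^sup>2) \<ge> 0" "(\<Sum>u\<in>onb (g t). \<Sum>v\<in>onb (g t). (\<beta> u v)\<^sup>2) \<ge> 0"
      by (intro sum_nonneg zero_le_power2)+
    have le: "x \<le> 2 * (x + y)" "y \<le> 2 * (x + y)" if "x \<ge> 0" "y \<ge> 0" for x y :: real using that by auto
    show ?thesis unfolding sp
      by (rule exI[of _ h], rule exI[of _ \<beta>], intro conjI h(1,2) real_sqrt_le_mono le[OF nn])
  qed
  then obtain h \<beta> where
    hd: "\<And>t. t \<in> ?I - S \<Longrightarrow> (g has_vector_derivative h t) (at t within ?I)" and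
    bd: "\<And>t. t \<in> ?I - S \<Longrightarrow> (b has_vector_derivative \<beta> t) (at t within ?I)" and
    hsp: "\<And>t. t \<in> ?I - S \<Longrightarrow> sqrt (\<Sum>u\<in>onb (g t). \<Sum>v\<in>onb (g t). (h t u v)\<^sup>2) \<le> gmet_speed \<gamma> t" and
    bsp: "\<And>t. t \<in> ?I - S \<Longrightarrow> sqrt (\<Sum>u\<in>onb (g t). \<Sum>v\<in>onb (g t). (\<beta> t u v)\<^sup>2) \<le> gmet_speed \<gamma> t"
    by metis
  have sp0: "gmet_speed \<gamma> t \<ge> 0" if "t \<in> ?I - S" for t
    using hsp[OF that] by (rule order_trans[rotated]) (intro real_sqrt_ge_zero sum_nonneg zero_le_power2)
  have ap: "((\<lambda>t. p t X Y) has_vector_derivative p' X Y) (at t within ?I)"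
    if "(p has_vector_derivative p') (at t within ?I)" for p :: "real \<Rightarrow> 'g bilform" and p' X Y t
    by (rule bounded_linear.has_vector_derivative[OF blinfun.bounded_linear_left
          bounded_linear.has_vector_derivative[OF blinfun.bounded_linear_left that]])
  have ev: "continuous_on ?I (\<lambda>t. p t X Y)" if "continuous_on ?I p" for p :: "real \<Rightarrow> 'g bilform" and X Y
    by (intro continuous_intros that)
  have lnb: "\<bar>ln (g1 X X) - ln (g t X X)\<bar> \<le> 1 * L" and L0: "L \<ge> 0" if t: "t \<in> ?I" and X: "X \<noteq> 0" for t X
  proof -
    have pos: "g t X X > 0" if "t \<in> ?I" for t by (rule inner_product_pos[OF ip[OF that] X])
    have c: "continuous_on ?I (\<lambda>t. ln (g t X X))"
      using pos by (intro continuous_on_ln ev[OF cg]) fastforce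
    have d: "((\<lambda>t. ln (g t X X)) has_vector_derivative (h t X X / g t X X)) (at t within ?I)" if "t \<in> ?I - S" for t
    proof -
      have "((\<lambda>t. g t X X) has_real_derivative h t X X) (at t within ?I)"
        using ap[OF hd[OF that]] by (simp add: has_real_derivative_iff_has_vector_derivative)
      from DERIV_chain2[OF DERIV_ln_divide[OF pos] this] that
      show ?thesis by (simp add: has_real_derivative_iff_has_vector_derivative)
    qed
    have le: "\<bar>h t X X / g t X X\<bar> \<le> 1 * gmet_speed \<gamma> t" if t: "t \<in> ?I - S" for t
    proof -
      have p: "g t X X > 0" using pos t by simp
      have "\<bar>h t X X\<bar> \<le> sqrt (\<Sum>u\<in>onb (g t). \<Sum>v\<in>onb (g t). (h t u v)\<^sup>2) * (sqrt (g t X X) * sqrt (g t X X))"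
        using ip t by (intro hilbert_schmidt_bound) simp
      also have "\<dots> \<le> gmet_speed \<gamma> t * g t X X"
        using p hsp[OF t] by (simp add: mult_right_mono)
      finally show ?thesis using p by (simp add: abs_divide divide_le_eq)
    qed
    show "\<bar>ln (g1 X X) - ln (g t X X)\<bar> \<le> 1 * L"
      using integral_derivative_bound(1)[OF c S d le L sp0 _ t] e1 by simp
    show "L \<ge> 0" using integral_derivative_bound(2)[OF c S d le L sp0 _ t] by simp
  qed
  have cmp: "g t X X \<le> exp L * g1 X X" "g1 X X \<le> exp L * g t X X" if t: "t \<in> ?I" for t X
  proof -
    show "g t X X \<le> exp L * g1 X X"
    proof (cases "X = 0")
      case False
      then have p: "g t X X > 0" "g1 X X > 0" using inner_product_pos ip[OF t] g1(1) by blast+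
      have "ln (g t X X) \<le> L + ln (g1 X X)" using lnb[OF t False] by linarith
      then have "exp (ln (g t X X)) \<le> exp (L + ln (g1 X X))" by simp
      then show ?thesis using p by (simp add: exp_add)
    qed (simp add: blinfun.bilinear_simps)
    show "g1 X X \<le> exp L * g t X X"
    proof (cases "X = 0")
      case False
      then have p: "g t X X > 0" "g1 X X > 0" using inner_product_pos ip[OF t] g1(1) by blast+
      have "ln (g1 X X) \<le> L + ln (g t X X)" using lnb[OF t False] by linarith
      then have "exp (ln (g1 X X)) \<le> exp (L + ln (g t X X))" by simp
      then show ?thesis using p by (simp add: exp_add)
    qed (simp add: blinfun.bilinear_simps)
  qed
  show "g0 X X \<le> exp L * g1 X X" "g1 X X \<le> exp L * g0 X X" using cmp[of 0] e0 by auto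
  \<comment> \<open>bounds \<open>|X| |Y|\<close> for every metric on the path\<close>
  define c where "c = exp L * (sqrt (g1 X X) * sqrt (g1 Y Y))"
  have c0: "c \<ge> 0" unfolding c_def by (intro mult_nonneg_nonneg real_sqrt_ge_zero inner_product_nonneg[OF g1(1)]) simp
  have le: "\<bar>\<beta> t X Y\<bar> \<le> c * gmet_speed \<gamma> t" if t: "t \<in> ?I - S" for t
  proof -
    have tI: "t \<in> ?I" using t by simp
    have n: "sqrt (g t X X) * sqrt (g t Y Y) \<le> c"
    proof -
      have "sqrt (g t X X) * sqrt (g t Y Y) \<le> sqrt (exp L * g1 X X) * sqrt (exp L * g1 Y Y)"
        by (intro mult_mono real_sqrt_le_mono cmp[OF tI] real_sqrt_ge_zero inner_product_nonneg[OF ip[OF tI]] mult_nonneg_nonneg inner_product_nonneg[OF g1(1)]) auto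
      also have "\<dots> = c" by (simp add: c_def real_sqrt_mult)
      finally show ?thesis .
    qed
    have "\<bar>\<beta> t X Y\<bar> \<le> sqrt (\<Sum>u\<in>onb (g t). \<Sum>v\<in>onb (g t). (\<beta> t u v)\<^sup>2) * (sqrt (g t X X) * sqrt (g t Y Y))"
      using ip t by (intro hilbert_schmidt_bound) simp
    also have "\<dots> \<le> gmet_speed \<gamma> t * c"
      using bsp[OF t] n sp0[OF t] by (intro mult_mono mult_nonneg_nonneg real_sqrt_ge_zero inner_product_nonneg[OF ip[OF tI]]) auto
    finally show ?thesis by (simp add: mult.commute)
  qed
  have r: "\<bar>b 1 X Y - b 0 X Y\<bar> \<le> c * L" "L \<ge> 0"
    using integral_derivative_bound[OF ev[OF cb, of X Y] S ap[OF bd] le L sp0 c0, of 0] by auto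
  show "\<bar>b0 X Y - b1 X Y\<bar> \<le> L * (exp L * (sqrt (g1 X X) * sqrt (g1 Y Y)))"
    using r(1) unfolding e0 e1 c_def by (simp add: abs_minus_commute mult.commute)
  show "L \<ge> 0" by (rule r(2))
qed

lemma trace_end_continuous:
  assumes "continuous_on T f" shows "continuous_on T (\<lambda>t. trace_end (f t))"
  unfolding trace_end_def by (intro continuous_intros assms)

text \<open>The infimum in \<open>gmet_dist\<close> is only meaningful over a nonempty set of lengths. The segment
  between the pairs is parametrized by \<open>sin\<^sup>2(\<pi> t / 2)\<close>, which stays in
  \<open>[0, 1]\<close> for all real \<open>t\<close>: so the path consists of generalized metrics also
  outside the unit interval and is differentiable on both sides of its end points.\<close>

lemma gmet_path_exists:
  fixes g0 g1 b0 b1 :: "'g::euclidean_space bilform"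
  assumes g0: "inner_product g0" "two_form b0" and g1: "inner_product g1" "two_form b1"
  shows "\<exists>\<gamma> L. valid_path \<gamma> \<and> (\<forall>t\<in>{0..1}. gen_metric (\<gamma> t)) \<and> pathstart \<gamma> = gmet g0 b0 \<and>
    pathfinish \<gamma> = gmet g1 b1 \<and> (gmet_speed \<gamma> has_integral L) {0..1}"
proof -
  define \<theta> :: "real \<Rightarrow> real" where "\<theta> t = (sin (pi * t / 2))\<^sup>2" for t
  define g where "g t = g0 + \<theta> t *\<^sub>R (g1 - g0)" for t
  define b where "b t = b0 + \<theta> t *\<^sub>R (b1 - b0)" for t
  define \<theta>' where "\<theta>' t = pi * sin (pi * t / 2) * cos (pi * t / 2)" for t
  have \<theta>01: "0 \<le> \<theta> t" "\<theta> t \<le> 1" for t by (simp_all add: \<theta>_def abs_square_le_1)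
  have \<theta>d: "(\<theta> has_vector_derivative \<theta>' t) (at t)" for t
    unfolding \<theta>_def \<theta>'_def has_real_derivative_iff_has_vector_derivative[symmetric]
    by (auto intro!: derivative_eq_intros)
  have gd: "(g has_vector_derivative \<theta>' t *\<^sub>R (g1 - g0)) (at t)" for t
    unfolding g_def using has_vector_derivative_add[OF has_vector_derivative_const
      bounded_linear.has_vector_derivative[OF bounded_linear_scaleR_left \<theta>d]] by simp
  have bd: "(b has_vector_derivative \<theta>' t *\<^sub>R (b1 - b0)) (at t)" for t
    unfolding b_def using has_vector_derivative_add[OF has_vector_derivative_const
      bounded_linear.has_vector_derivative[OF bounded_linear_scaleR_left \<theta>d]] by simp
  have ip: "inner_product (g t)" for t
    unfolding inner_product_def
  proof (intro conjI allI impI)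
    show "g t X Y = g t Y X" for X Y
      by (simp add: g_def blinfun.bilinear_simps inner_product_sym[OF g0(1), of X] inner_product_sym[OF g1(1), of X])
    fix X :: 'g assume X: "X \<noteq> 0"
    have "g t X X = (1 - \<theta> t) * g0 X X + \<theta> t * g1 X X" by (simp add: g_def blinfun.bilinear_simps algebra_simps)
    moreover have "g0 X X > 0" "g1 X X > 0" using inner_product_pos g0 g1 X by blast+
    ultimately show "g t X X > 0" using \<theta>01[of t] by (cases "\<theta> t = 0") (auto intro!: add_nonneg_pos mult_nonneg_nonneg)
  qed
  have tf: "two_form (b t)" for t
    unfolding two_form_def
  proof (intro allI)
    fix X Y
    have "b0 X Y = - b0 Y X" "b1 X Y = - b1 Y X" using g0(2) g1(2) unfolding two_form_def by blast+
    then show "b t X Y = - b t Y X" by (simp add: b_def blinfun.bilinear_simps algebra_simps)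
  qed
  define \<gamma> where "\<gamma> t = gmet (g t) (b t)" for t
  define D where "D t = gmet_velocity (g t) (b t) (\<theta>' t *\<^sub>R (g1 - g0)) (\<theta>' t *\<^sub>R (b1 - b0))" for t
  have \<gamma>d: "(\<gamma> has_vector_derivative D t) (at t)" for t
    unfolding \<gamma>_def D_def by (rule gmet_has_vector_derivative[OF gd bd _ ip]) simp
  have cg: "continuous_on UNIV g" and cb: "continuous_on UNIV b" and c\<gamma>: "continuous_on UNIV \<gamma>"
    using gd bd \<gamma>d by (auto intro!: continuous_at_imp_continuous_on has_vector_derivative_continuous)
  have cS: "continuous_on UNIV (\<lambda>t. blinfun_inv (g t))"
    unfolding continuous_on
  proof
    fix t :: real
    show "((\<lambda>t. blinfun_inv (g t)) \<longlongrightarrow> blinfun_inv (g t)) (at t)"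
      by (rule blinfun_inverse_tendsto[where T=g and ?T0.0="g t"])
        (use cg in \<open>auto simp: continuous_on blinfun_inv_inner_product[OF ip]\<close>)
  qed
  have c\<theta>: "continuous_on UNIV \<theta>'" unfolding \<theta>'_def by (intro continuous_intros) auto
  note cc = bounded_bilinear.continuous_on[OF bounded_bilinear_blinfun_compose]
  have cD: "continuous_on UNIV D"
    unfolding D_def gmet_velocity_def exp_b_eq block_end_eq
    by (intro continuous_on_add continuous_on_diff continuous_on_minus cc continuous_on_const cg cb cS continuous_on_scaleR c\<theta>)
  have "\<gamma> C1_differentiable_on {0..1}"
    unfolding C1_differentiable_on_def using \<gamma>d continuous_on_subset[OF cD] by blast
  then have vp: "valid_path \<gamma>" unfolding valid_path_def by (rule C1_differentiable_imp_piecewise)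
  have sp: "gmet_speed \<gamma> t = sqrt (g_sym (\<gamma> t o\<^sub>L D t) (\<gamma> t o\<^sub>L D t))" if "t \<in> {0..1}" for t
  proof -
    have "vector_derivative \<gamma> (at t within {0..1}) = D t"
      using that by (intro vector_derivative_within[OF _ has_vector_derivative_at_within[OF \<gamma>d]])
        (simp add: trivial_limit_within islimpt_Icc)
    moreover have "blinfun_inv (\<gamma> t) = \<gamma> t" unfolding \<gamma>_def by (rule blinfun_inv_gmet[OF ip])
    ultimately show ?thesis by (simp add: gmet_speed_def Let_def)
  qed
  have "continuous_on {0..1} (\<lambda>t. sqrt (g_sym (\<gamma> t o\<^sub>L D t) (\<gamma> t o\<^sub>L D t)))"
    unfolding g_sym_def
    by (intro continuous_on_real_sqrt trace_end_continuous cc continuous_on_subset[OF c\<gamma>] continuous_on_subset[OF cD]) auto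
  then have "continuous_on {0..1} (gmet_speed \<gamma>)" by (rule continuous_on_eq) (simp add: sp)
  then have "(gmet_speed \<gamma> has_integral integral {0..1} (gmet_speed \<gamma>)) {0..1}"
    by (intro integrable_integral integrable_continuous_real)
  moreover have "pathstart \<gamma> = gmet g0 b0" "pathfinish \<gamma> = gmet g1 b1"
    by (simp_all add: pathstart_def pathfinish_def \<gamma>_def g_def b_def \<theta>_def)
  moreover have "\<forall>t\<in>{0..1}. gen_metric (\<gamma> t)" unfolding \<gamma>_def using gen_metric_gmet[OF ip tf] by blast
  ultimately show ?thesis using vp by blast
qed

lemma bilform_norm_le:
  fixes T :: "'g::euclidean_space bilform"
  shows "norm T \<le> (\<Sum>e\<in>Basis. \<Sum>f\<in>Basis. \<bar>T e f\<bar>)"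
proof -
  have "norm T \<le> (\<Sum>e\<in>Basis. norm (T e))" by (rule norm_blinfun_euclidean_le)
  also have "\<dots> \<le> (\<Sum>e\<in>Basis. \<Sum>f\<in>Basis. norm (T e f))" by (intro sum_mono norm_blinfun_euclidean_le)
  finally show ?thesis by simp
qed

text \<open>Polarization of \<open>|g(X, X) - gb(X, X)| \<le> (e\<^sup>L - 1) gb(X, X)\<close>.\<close>

lemma gmet_dist_controls:
  fixes gb :: "'g::euclidean_space bilform"
  assumes gb: "inner_product gb" and \<epsilon>: "\<epsilon> > 0"
  shows "\<exists>\<delta>>0. \<forall>g b. inner_product g \<and> two_form b \<and> gmet_dist (gmet g b) (gmet gb 0) < \<delta> \<longrightarrow>
    norm (g - gb) < \<epsilon> \<and> norm b < \<epsilon>"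
proof -
  define M where "M = norm gb + 1"
  define n where "n = real DIM('g) * real DIM('g)"
  have n: "n > 0" by (simp add: n_def)
  have M: "M > 0" by (simp add: M_def add_nonneg_pos)
  have lim: "((\<lambda>L. n * (2 * M * (exp L - 1)) + n * (L * (exp L * M))) \<longlongrightarrow> n * (2 * M * (exp 0 - 1)) + n * (0 * (exp 0 * M))) (at_right (0::real))"
    by (intro tendsto_intros)
  then have "\<forall>\<^sub>F L in at_right 0. n * (2 * M * (exp L - 1)) + n * (L * (exp L * M)) < \<epsilon>"
    using \<epsilon> by (auto dest: order_tendstoD(2))
  then obtain \<delta> where \<delta>: "\<delta> > 0" "\<And>L. 0 < L \<Longrightarrow> L < \<delta> \<Longrightarrow> n * (2 * M * (exp L - 1)) + n * (L * (exp L * M)) < \<epsilon>"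
    unfolding eventually_at_right_field by auto
  have main: "norm (g - gb) < \<epsilon> \<and> norm b < \<epsilon>"
    if g: "inner_product g" and b: "two_form b" and d: "gmet_dist (gmet g b) (gmet gb 0) < \<delta>" for g b
  proof -
    define P where "P \<gamma> L \<longleftrightarrow> valid_path \<gamma> \<and> (\<forall>t \<in> {0..1}. gen_metric (\<gamma> t)) \<and>
     pathstart \<gamma> = gmet g b \<and> pathfinish \<gamma> = gmet gb 0 \<and> (gmet_speed \<gamma> has_integral L) {0..1}" for \<gamma> L
    let ?X = "{L. \<exists>\<gamma>. P \<gamma> L}"
    have z: "two_form (0 :: 'g bilform)" by (simp add: two_form_def)
    have dX: "gmet_dist (gmet g b) (gmet gb 0) = Inf ?X"
      unfolding P_def gmet_dist_def gmet_speed_def[abs_def] ..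
    have "\<exists>\<gamma> L. P \<gamma> L" unfolding P_def by (rule gmet_path_exists[OF g b gb z])
    then have "?X \<noteq> {}" by blast
    moreover have "Inf ?X < \<delta>" using d dX by simp
    ultimately have "\<exists>L\<in>?X. L < \<delta>" by (rule cInf_lessD)
    then obtain L \<gamma> where L: "L < \<delta>" and "P \<gamma> L" by blast
    then have \<gamma>: "valid_path \<gamma>" "\<And>t. t \<in> {0..1} \<Longrightarrow> gen_metric (\<gamma> t)"
      "pathstart \<gamma> = gmet g b" "pathfinish \<gamma> = gmet gb 0" "(gmet_speed \<gamma> has_integral L) {0..1}"
      unfolding P_def by simp_all
    note est = gmet_path_estimate[OF \<gamma>(1,2) g b \<gamma>(3) gb z \<gamma>(4,5)]
    have L0: "L \<ge> 0" by (rule est(4))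
    have gbn: "gb X Y \<le> M * norm X * norm Y" for X Y
    proof -
      have "\<bar>gb X Y\<bar> \<le> norm (gb X) * norm Y" using norm_blinfun[of "gb X" Y] by simp
      also have "\<dots> \<le> norm gb * norm X * norm Y" by (intro mult_right_mono norm_blinfun) auto
      also have "\<dots> \<le> M * norm X * norm Y" unfolding M_def by (intro mult_right_mono) auto
      finally show ?thesis by simp
    qed
    define q where "q = g - gb"
    have qe: "\<bar>q X X\<bar> \<le> (exp L - 1) * gb X X" for X
    proof -
      have p: "gb X X \<ge> 0" by (rule inner_product_nonneg[OF gb])
      have 1: "q X X \<le> (exp L - 1) * gb X X" using est(1)[of X] by (simp add: q_def blinfun.bilinear_simps algebra_simps)
      have "gb X X * exp (- L) \<le> g X X" using est(2)[of X] by (simp add: exp_minus field_simps)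
      moreover have "(1 - exp (- L)) * gb X X \<le> (exp L - 1) * gb X X"
      proof (intro mult_right_mono p)
        have "exp (- L) \<le> 1" using L0 by simp
        moreover have "exp L * exp (- L) = 1" by (simp flip: exp_add)
        ultimately have "exp L - 1 - (1 - exp (- L)) = (exp L - 1) * (1 - exp (- L))" by (simp add: algebra_simps)
        moreover have "(exp L - 1) * (1 - exp (- L)) \<ge> 0" using L0 by (intro mult_nonneg_nonneg) auto
        ultimately show "1 - exp (- L) \<le> exp L - 1" by linarith
      qed
      ultimately have 2: "- q X X \<le> (exp L - 1) * gb X X" by (simp add: q_def blinfun.bilinear_simps algebra_simps)
      show ?thesis using 1 2 by linarith
    qed
    have qef: "\<bar>q e f\<bar> \<le> 2 * M * (exp L - 1)" if e: "norm e = 1" and f: "norm f = 1" for e f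
    proof -
      have qs: "q e f = q f e" by (simp add: q_def blinfun.bilinear_simps inner_product_sym[OF g, of e] inner_product_sym[OF gb, of e])
      have "4 * q e f = q (e + f) (e + f) - q (e - f) (e - f)"
        using qs by (simp add: blinfun.bilinear_simps)
      then have "4 * \<bar>q e f\<bar> \<le> \<bar>q (e + f) (e + f)\<bar> + \<bar>q (e - f) (e - f)\<bar>" by linarith
      also have "\<dots> \<le> (exp L - 1) * gb (e + f) (e + f) + (exp L - 1) * gb (e - f) (e - f)"
        by (intro add_mono qe)
      also have "\<dots> = (exp L - 1) * (2 * gb e e + 2 * gb f f)"
        by (simp add: blinfun.bilinear_simps algebra_simps)
      also have "\<dots> \<le> (exp L - 1) * (2 * M + 2 * M)"
        using gbn[of e e] gbn[of f f] L0 e f by (intro mult_left_mono) auto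
      finally show ?thesis by (simp add: algebra_simps)
    qed
    have bef: "\<bar>b e f\<bar> \<le> L * (exp L * M)" if e: "norm e = 1" and f: "norm f = 1" for e f
    proof -
      have "sqrt (gb e e) * sqrt (gb f f) \<le> sqrt M * sqrt M"
        using gbn[of e e] gbn[of f f] e f by (intro mult_mono real_sqrt_le_mono real_sqrt_ge_zero inner_product_nonneg[OF gb]) (use M in auto)
      also have "\<dots> = M" using M by simp
      finally have "L * (exp L * (sqrt (gb e e) * sqrt (gb f f))) \<le> L * (exp L * M)"
        using L0 by (intro mult_left_mono) auto
      then show ?thesis using est(3)[of e f] by (simp add: blinfun.bilinear_simps)
    qed
    have "norm q \<le> (\<Sum>e\<in>(Basis::'g set). \<Sum>f\<in>(Basis::'g set). 2 * M * (exp L - 1))"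
      by (intro order_trans[OF bilform_norm_le] sum_mono qef) auto
    then have n1: "norm q \<le> n * (2 * M * (exp L - 1))" by (simp add: n_def)
    have "norm b \<le> (\<Sum>e\<in>(Basis::'g set). \<Sum>f\<in>(Basis::'g set). L * (exp L * M))"
      by (intro order_trans[OF bilform_norm_le] sum_mono bef) auto
    then have n2: "norm b \<le> n * (L * (exp L * M))" by (simp add: n_def)
    have nn: "0 \<le> n * (2 * M * (exp L - 1))" "0 \<le> n * (L * (exp L * M))" using n M L0 by auto
    have "n * (2 * M * (exp L - 1)) + n * (L * (exp L * M)) < \<epsilon>"
      using \<delta>(2)[of L] L L0 \<epsilon> by (cases "L = 0") auto
    then show ?thesis using n1 n2 nn unfolding q_def by linarith
  qed
  then show ?thesis using \<delta>(1) by blast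
qed

section \<open>Smooth convergence of left-invariant tensors\<close>

lemma nabla_gtan_apply: "nabla_gtan \<Gamma> X (Y, \<eta>) = (\<Gamma> X Y, - (\<eta> o\<^sub>L \<Gamma> X))"
  and norm_nabla_gtan: "norm (nabla_gtan \<Gamma> X) \<le> 2 * norm (\<Gamma> X)"
proof -
  have eq: "(\<lambda>(Y, \<eta>). (\<Gamma> X Y, - (\<eta> o\<^sub>L \<Gamma> X))) = (\<lambda>z. (\<Gamma> X (fst z), - (snd z o\<^sub>L \<Gamma> X)))" by auto
  have bl: "bounded_linear (\<lambda>z::'a gtan. (\<Gamma> X (fst z), - (snd z o\<^sub>L \<Gamma> X)))"
    by (intro bounded_linear_Pair bounded_linear_minus
      bounded_linear_compose[OF blinfun.bounded_linear_right bounded_linear_fst]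
      bounded_linear_compose[OF bounded_bilinear.bounded_linear_left[OF bounded_bilinear_blinfun_compose] bounded_linear_snd])
  show a: "nabla_gtan \<Gamma> X (Y, \<eta>) = (\<Gamma> X Y, - (\<eta> o\<^sub>L \<Gamma> X))" for Y \<eta>
    unfolding nabla_gtan_def eq bounded_linear_Blinfun_apply[OF bl] by simp
  show "norm (nabla_gtan \<Gamma> X) \<le> 2 * norm (\<Gamma> X)"
  proof (rule norm_blinfun_bound)
    fix z :: "'a gtan"
    obtain Y \<eta> where z: "z = (Y, \<eta>)" by (cases z)
    have "norm (nabla_gtan \<Gamma> X z) \<le> norm (\<Gamma> X Y) + norm (\<eta> o\<^sub>L \<Gamma> X)"
      unfolding z a using norm_Pair_le[of "\<Gamma> X Y" "- (\<eta> o\<^sub>L \<Gamma> X)"] by simp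
    also have "\<dots> \<le> norm (\<Gamma> X) * norm Y + norm \<eta> * norm (\<Gamma> X)"
      by (intro add_mono norm_blinfun norm_blinfun_compose)
    also have "\<dots> \<le> norm (\<Gamma> X) * norm z + norm z * norm (\<Gamma> X)"
      using norm_fst_le[of Y \<eta>] norm_snd_le[of \<eta> Y] unfolding z by (intro add_mono mult_left_mono mult_right_mono) auto
    finally show "norm (nabla_gtan \<Gamma> X z) \<le> 2 * norm (\<Gamma> X) * norm z" by (simp add: algebra_simps)
  qed simp
qed

lemma norm_nabla_gend: "norm (nabla_gend \<Gamma> X A) \<le> 4 * norm \<Gamma> * norm X * norm A"
proof -
  have n: "norm (nabla_gtan \<Gamma> X) \<le> 2 * (norm \<Gamma> * norm X)"
    using norm_nabla_gtan[of \<Gamma> X] norm_blinfun[of \<Gamma> X] by linarith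
  have "norm (nabla_gend \<Gamma> X A) \<le> norm (nabla_gtan \<Gamma> X) * norm A + norm A * norm (nabla_gtan \<Gamma> X)"
    unfolding nabla_gend_def by (intro order_trans[OF norm_triangle_ineq4] add_mono norm_blinfun_compose)
  also have "\<dots> \<le> 2 * (norm \<Gamma> * norm X) * norm A + norm A * (2 * (norm \<Gamma> * norm X))"
    by (intro add_mono mult_right_mono mult_left_mono n) auto
  finally show ?thesis by (simp add: algebra_simps)
qed

text \<open>The bound \<open>M\<close> on the arguments has to vary in the induction, because
  \<open>nabla_iter\<close> inserts \<open>\<Gamma> X (Xs ! i)\<close> into the list.\<close>

lemma nabla_iter_bound:
  "\<exists>C\<ge>0. \<forall>A Xs. length Xs = j \<and> (\<forall>X\<in>set Xs. norm X \<le> M) \<longrightarrow> norm (nabla_iter \<Gamma> A Xs) \<le> C * norm A"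
proof (induction j arbitrary: M)
  case 0
  then show ?case by (intro exI[of _ 1]) auto
next
  case (Suc j)
  define M' where "M' = max M (norm \<Gamma> * \<bar>M\<bar> * \<bar>M\<bar>)"
  obtain C where C: "C \<ge> 0" "\<And>A Xs. length Xs = j \<Longrightarrow> \<forall>X\<in>set Xs. norm X \<le> M' \<Longrightarrow> norm (nabla_iter \<Gamma> A Xs) \<le> C * norm A"
    using Suc.IH[of M'] by blast
  have "norm (nabla_iter \<Gamma> A Xs) \<le> (4 * norm \<Gamma> * \<bar>M\<bar> * C + real j * C) * norm A"
    if len: "length Xs = Suc j" and le: "\<forall>X\<in>set Xs. norm X \<le> M" for A Xs
  proof -
    obtain X Ys where Xs: "Xs = X # Ys" "length Ys = j" using len by (cases Xs) auto
    have nX: "norm X \<le> \<bar>M\<bar>" and nY: "\<forall>Y\<in>set Ys. norm Y \<le> M" using le Xs by auto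
    have "\<forall>Y\<in>set Ys. norm Y \<le> M'" using nY by (auto simp: M'_def le_max_iff_disj)
    then have 1: "norm (nabla_iter \<Gamma> A Ys) \<le> C * norm A" by (rule C(2)[OF Xs(2)])
    have "norm (nabla_gend \<Gamma> X (nabla_iter \<Gamma> A Ys)) \<le> 4 * norm \<Gamma> * norm X * norm (nabla_iter \<Gamma> A Ys)"
      by (rule norm_nabla_gend)
    also have "\<dots> \<le> 4 * norm \<Gamma> * \<bar>M\<bar> * (C * norm A)"
      using nX 1 by (intro mult_mono) auto
    finally have a: "norm (nabla_gend \<Gamma> X (nabla_iter \<Gamma> A Ys)) \<le> 4 * norm \<Gamma> * \<bar>M\<bar> * (C * norm A)" .
    have b: "norm (nabla_iter \<Gamma> A (Ys[i := \<Gamma> X (Ys ! i)])) \<le> C * norm A" if i: "i < length Ys" for i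
    proof (rule C(2))
      have yi: "norm (Ys ! i) \<le> \<bar>M\<bar>" using nY i nth_mem by fastforce
      have "norm (\<Gamma> X (Ys ! i)) \<le> norm (\<Gamma> X) * norm (Ys ! i)" by (rule norm_blinfun)
      also have "\<dots> \<le> norm \<Gamma> * \<bar>M\<bar> * \<bar>M\<bar>"
        using norm_blinfun[of \<Gamma> X] nX yi by (intro mult_mono order_trans[OF norm_blinfun] mult_left_mono) auto
      finally have "norm (\<Gamma> X (Ys ! i)) \<le> M'" by (simp add: M'_def)
      moreover have "\<forall>Y\<in>set Ys. norm Y \<le> M'" using nY by (auto simp: M'_def le_max_iff_disj)
      ultimately show "\<forall>Y\<in>set (Ys[i := \<Gamma> X (Ys ! i)]). norm Y \<le> M'"
        using set_update_subset_insert[of Ys i "\<Gamma> X (Ys ! i)"] by blast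
    qed (simp add: Xs)
    have "norm (\<Sum>i<length Ys. nabla_iter \<Gamma> A (Ys[i := \<Gamma> X (Ys ! i)])) \<le> (\<Sum>i<length Ys. C * norm A)"
      by (rule sum_norm_le) (use b in auto)
    then have c: "norm (\<Sum>i<length Ys. nabla_iter \<Gamma> A (Ys[i := \<Gamma> X (Ys ! i)])) \<le> real j * (C * norm A)"
      using Xs by simp
    show ?thesis unfolding Xs(1) nabla_iter.simps
      using order_trans[OF norm_triangle_ineq4 add_mono[OF a c]] by (simp add: algebra_simps)
  qed
  then show ?case using C(1) by (intro exI[of _ "4 * norm \<Gamma> * \<bar>M\<bar> * C + real j * C"]) auto
qed

lemma Ck_norm_bound:
  fixes \<Gamma> :: "'g::real_normed_vector conn"
  shows "\<exists>C\<ge>0. \<forall>A. Ck_norm \<Gamma> k A \<le> C * norm A"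
proof -
  have "\<forall>j. \<exists>C\<ge>0. \<forall>A Xs. length Xs = j \<and> (\<forall>X\<in>set Xs. norm X \<le> 1) \<longrightarrow> norm (nabla_iter \<Gamma> A Xs) \<le> C * norm A"
    using nabla_iter_bound by blast
  then obtain C where C: "\<And>j. C j \<ge> 0" "\<And>j A Xs. length Xs = j \<Longrightarrow> \<forall>X\<in>set Xs. norm X \<le> 1 \<Longrightarrow> norm (nabla_iter \<Gamma> A Xs) \<le> C j * norm A"
    by metis
  have "(SUP Xs \<in> {Xs. length Xs = j \<and> (\<forall>X \<in> set Xs. norm X \<le> 1)}. norm (nabla_iter \<Gamma> A Xs)) \<le> C j * norm A" for A j
  proof (rule cSUP_least)
    have "replicate j (0::'g) \<in> {Xs. length Xs = j \<and> (\<forall>X\<in>set Xs. norm X \<le> 1)}" by auto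
    then show "{Xs::'g list. length Xs = j \<and> (\<forall>X\<in>set Xs. norm X \<le> 1)} \<noteq> {}" by blast
  next
    fix Xs :: "'g list" assume "Xs \<in> {Xs. length Xs = j \<and> (\<forall>X\<in>set Xs. norm X \<le> 1)}"
    then show "norm (nabla_iter \<Gamma> A Xs) \<le> C j * norm A" by (intro C(2)) auto
  qed
  then have "Ck_norm \<Gamma> k A \<le> (\<Sum>j\<le>k. C j) * norm A" for A
    unfolding Ck_norm_def sum_distrib_right by (intro sum_mono) auto
  then show ?thesis using C(1) by (intro exI[of _ "\<Sum>j\<le>k. C j"]) (auto intro: sum_nonneg)
qed

lemma smooth_exp_convergesI:
  assumes "\<kappa> > 0" and "\<And>t. t \<ge> 0 \<Longrightarrow> norm (\<G> t - L) \<le> K * exp (- \<kappa> * t)"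
  shows "smooth_exp_converges \<Gamma> \<G> L"
  unfolding smooth_exp_converges_def
proof (rule exI[of _ \<kappa>], intro conjI allI assms(1))
  fix k
  obtain C where C: "C \<ge> 0" "\<And>A. Ck_norm \<Gamma> k A \<le> C * norm A" using Ck_norm_bound by blast
  have "Ck_norm \<Gamma> k (\<G> t - L) \<le> C * K * exp (- \<kappa> * t)" if "t \<ge> 0" for t
    using order_trans[OF C(2) mult_left_mono[OF assms(2)[OF that] C(1)]] by (simp add: mult.assoc)
  then show "\<exists>C. \<forall>t\<ge>0. Ck_norm \<Gamma> k (\<G> t - L) \<le> C * exp (- \<kappa> * t)" by blast
qed

section \<open>Uniqueness of the flow\<close>

text \<open>Bounded and Lipschitz on \<open>S\<close>. Requiring both makes the class closed under bounded
  bilinear products, so that it contains the polynomials that define the flow.\<close>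

definition lipb :: "'x::real_normed_vector set \<Rightarrow> ('x \<Rightarrow> 'y::real_normed_vector) \<Rightarrow> bool" where
  "lipb S f \<longleftrightarrow> (\<exists>B\<ge>0. (\<forall>x\<in>S. norm (f x) \<le> B) \<and> (\<forall>x\<in>S. \<forall>y\<in>S. norm (f x - f y) \<le> B * norm (x - y)))"

lemma lipbI:
  assumes "\<And>x. x \<in> S \<Longrightarrow> norm (f x) \<le> B" "\<And>x y. x \<in> S \<Longrightarrow> y \<in> S \<Longrightarrow> norm (f x - f y) \<le> K * norm (x - y)"
  shows "lipb S f"
proof -
  let ?M = "max 0 (max B K)"
  have "norm (f x - f y) \<le> ?M * norm (x - y)" if "x \<in> S" "y \<in> S" for x y
  proof (rule order_trans[OF assms(2)[OF that]])
    show "K * norm (x - y) \<le> ?M * norm (x - y)" by (rule mult_right_mono) auto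
  qed
  moreover have "norm (f x) \<le> ?M" if "x \<in> S" for x using assms(1)[OF that] by linarith
  ultimately show ?thesis unfolding lipb_def by (intro exI[of _ ?M]) auto
qed

lemma lipbE:
  assumes "lipb S f"
  obtains B where "B \<ge> 0" "\<And>x. x \<in> S \<Longrightarrow> norm (f x) \<le> B"
    "\<And>x y. x \<in> S \<Longrightarrow> y \<in> S \<Longrightarrow> norm (f x - f y) \<le> B * norm (x - y)"
  using assms unfolding lipb_def by blast

lemma lipb_const: "lipb S (\<lambda>x. c)"
  by (rule lipbI[where B="norm c" and K=0]) auto

lemma lipb_linear:
  assumes "bounded_linear l" and "lipb S f" shows "lipb S (\<lambda>x. l (f x))"
proof -
  interpret bounded_linear l by fact
  obtain K where K: "K > 0" "\<And>x. norm (l x) \<le> norm x * K" using pos_bounded by blast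
  obtain B where B: "B \<ge> 0" "\<And>x. x \<in> S \<Longrightarrow> norm (f x) \<le> B"
    "\<And>x y. x \<in> S \<Longrightarrow> y \<in> S \<Longrightarrow> norm (f x - f y) \<le> B * norm (x - y)" using assms(2) by (rule lipbE) blast
  show ?thesis
  proof (rule lipbI)
    show "norm (l (f x)) \<le> B * K" if "x \<in> S" for x
      using order_trans[OF K(2) mult_right_mono[OF B(2)[OF that]]] K(1) by simp
    show "norm (l (f x) - l (f y)) \<le> (B * K) * norm (x - y)" if "x \<in> S" "y \<in> S" for x y
    proof -
      have "norm (l (f x) - l (f y)) \<le> norm (f x - f y) * K" using K(2)[of "f x - f y"] by (simp add: diff)
      also have "\<dots> \<le> B * norm (x - y) * K" using B(3)[OF that] K(1) by (intro mult_right_mono) auto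
      finally show ?thesis by (simp add: ac_simps)
    qed
  qed
qed

lemma lipb_add:
  assumes "lipb S f" "lipb S h" shows "lipb S (\<lambda>x. f x + h x)"
proof -
  obtain B where B: "\<And>x. x \<in> S \<Longrightarrow> norm (f x) \<le> B"
    "\<And>x y. x \<in> S \<Longrightarrow> y \<in> S \<Longrightarrow> norm (f x - f y) \<le> B * norm (x - y)" using assms(1) by (rule lipbE) blast
  obtain C where C: "\<And>x. x \<in> S \<Longrightarrow> norm (h x) \<le> C"
    "\<And>x y. x \<in> S \<Longrightarrow> y \<in> S \<Longrightarrow> norm (h x - h y) \<le> C * norm (x - y)" using assms(2) by (rule lipbE) blast
  show ?thesis
  proof (rule lipbI)
    show "norm (f x + h x) \<le> B + C" if "x \<in> S" for x using norm_triangle_mono[OF B(1) C(1)] that by blast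
    show "norm (f x + h x - (f y + h y)) \<le> (B + C) * norm (x - y)" if "x \<in> S" "y \<in> S" for x y
      using norm_triangle_mono[OF B(2)[OF that] C(2)[OF that]] by (simp add: algebra_simps)
  qed
qed

lemma lipb_bilinear:
  assumes "bounded_bilinear p" and "lipb S f" "lipb S h" shows "lipb S (\<lambda>x. p (f x) (h x))"
proof -
  interpret bounded_bilinear p by fact
  obtain K where K: "K > 0" "\<And>a b. norm (p a b) \<le> norm a * norm b * K" using pos_bounded by blast
  obtain B where B: "B \<ge> 0" "\<And>x. x \<in> S \<Longrightarrow> norm (f x) \<le> B"
    "\<And>x y. x \<in> S \<Longrightarrow> y \<in> S \<Longrightarrow> norm (f x - f y) \<le> B * norm (x - y)" using assms(2) by (rule lipbE) blast
  obtain C where C: "C \<ge> 0" "\<And>x. x \<in> S \<Longrightarrow> norm (h x) \<le> C"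
    "\<And>x y. x \<in> S \<Longrightarrow> y \<in> S \<Longrightarrow> norm (h x - h y) \<le> C * norm (x - y)" using assms(3) by (rule lipbE) blast
  show ?thesis
  proof (rule lipbI)
    show "norm (p (f x) (h x)) \<le> B * C * K" if "x \<in> S" for x
      using K B C that by (intro order_trans[OF K(2)] mult_right_mono mult_mono) auto
    show "norm (p (f x) (h x) - p (f y) (h y)) \<le> (2 * B * C * K) * norm (x - y)" if xy: "x \<in> S" "y \<in> S" for x y
    proof -
      have "p (f x) (h x) - p (f y) (h y) = p (f x - f y) (h x) + p (f y) (h x - h y)"
        by (simp add: diff_left diff_right)
      then have "norm (p (f x) (h x) - p (f y) (h y)) \<le> norm (f x - f y) * norm (h x) * K + norm (f y) * norm (h x - h y) * K"
        using norm_triangle_mono[OF K(2) K(2)] by metis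
      also have "\<dots> \<le> (B * norm (x - y)) * C * K + B * (C * norm (x - y)) * K"
        using B C K xy by (intro add_mono mult_right_mono mult_mono) auto
      finally show ?thesis by (simp add: algebra_simps)
    qed
  qed
qed

lemma lipb_compose:
  assumes "lipb T f" "lipb S h" "\<And>x. x \<in> S \<Longrightarrow> h x \<in> T" shows "lipb S (\<lambda>x. f (h x))"
proof -
  obtain B where B: "B \<ge> 0" "\<And>x. x \<in> T \<Longrightarrow> norm (f x) \<le> B"
    "\<And>x y. x \<in> T \<Longrightarrow> y \<in> T \<Longrightarrow> norm (f x - f y) \<le> B * norm (x - y)" using assms(1) by (rule lipbE) blast
  obtain C where C: "C \<ge> 0" "\<And>x y. x \<in> S \<Longrightarrow> y \<in> S \<Longrightarrow> norm (h x - h y) \<le> C * norm (x - y)" using assms(2) by (rule lipbE) blast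
  show ?thesis
  proof (rule lipbI)
    show "norm (f (h x)) \<le> B" if "x \<in> S" for x using B(2) assms(3) that by blast
    show "norm (f (h x) - f (h y)) \<le> (B * C) * norm (x - y)" if "x \<in> S" "y \<in> S" for x y
      using order_trans[OF B(3)[OF assms(3) assms(3)] mult_left_mono[OF C(2) B(1)]] that by (simp add: mult.assoc)
  qed
qed

lemma lipb_id: assumes "\<And>x. x \<in> S \<Longrightarrow> norm x \<le> M" shows "lipb S (\<lambda>x. x)"
  by (rule lipbI[where B=M and K=1]) (use assms in auto)

lemma lipb_minus: "lipb S f \<Longrightarrow> lipb S (\<lambda>x. - f x)"
  using lipb_linear[OF bounded_linear_minus[OF bounded_linear_ident]] by fast

lemma lipb_diff: "lipb S f \<Longrightarrow> lipb S h \<Longrightarrow> lipb S (\<lambda>x. f x - h x)"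
  using lipb_add[OF _ lipb_minus, of S f h] by simp

lemma lipb_scaleR: "lipb S f \<Longrightarrow> lipb S (\<lambda>x. c *\<^sub>R f x)"
  using lipb_linear[OF bounded_linear_scaleR_right] by fast

lemma lipb_mult: "lipb S f \<Longrightarrow> lipb S h \<Longrightarrow> lipb S (\<lambda>x. f x * h x)" for f :: "_ \<Rightarrow> real"
  by (rule lipb_bilinear[OF bounded_bilinear_mult])

lemma lipb_cdiv: "lipb S f \<Longrightarrow> lipb S (\<lambda>x. f x / c)" for f :: "_ \<Rightarrow> real"
  using lipb_scaleR[of S f "1 / c"] by simp

lemma lipb_sum: "(\<And>i. i \<in> I \<Longrightarrow> lipb S (f i)) \<Longrightarrow> lipb S (\<lambda>x. \<Sum>i\<in>I. f i x)"
  by (induction I rule: infinite_finite_induct) (auto intro: lipb_const lipb_add)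

lemma lipb_apply: "lipb S f \<Longrightarrow> lipb S h \<Longrightarrow> lipb S (\<lambda>x. blinfun_apply (f x) (h x))"
  by (rule lipb_bilinear[OF bounded_bilinear_blinfun_apply])

lemma lipb_blinfun_compose: "lipb S f \<Longrightarrow> lipb S h \<Longrightarrow> lipb S (\<lambda>x. f x o\<^sub>L h x)"
  by (rule lipb_bilinear[OF bounded_bilinear_blinfun_compose])

lemma lipb_bilform:
  fixes T :: "'x::real_normed_vector \<Rightarrow> 'g::euclidean_space bilform"
  assumes "\<And>e f. lipb S (\<lambda>x. T x e f)" shows "lipb S T"
proof -
  have "\<forall>e f. \<exists>B. B \<ge> 0 \<and> (\<forall>x\<in>S. norm (T x e f) \<le> B) \<and> (\<forall>x\<in>S. \<forall>y\<in>S. norm (T x e f - T y e f) \<le> B * norm (x - y))"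
    using assms unfolding lipb_def by blast
  then obtain B where B: "\<And>e f x. x \<in> S \<Longrightarrow> \<bar>T x e f\<bar> \<le> B e f"
    "\<And>e f x y. x \<in> S \<Longrightarrow> y \<in> S \<Longrightarrow> \<bar>T x e f - T y e f\<bar> \<le> B e f * norm (x - y)"
    unfolding real_norm_def by metis
  show ?thesis
  proof (rule lipbI)
    show "norm (T x) \<le> (\<Sum>e\<in>Basis. \<Sum>f\<in>Basis. B e f)" if "x \<in> S" for x
      by (intro order_trans[OF bilform_norm_le] sum_mono B(1) that)
    show "norm (T x - T y) \<le> (\<Sum>e\<in>Basis. \<Sum>f\<in>Basis. B e f) * norm (x - y)" if "x \<in> S" "y \<in> S" for x y
      unfolding sum_distrib_right using B(2)[OF that]
      by (intro order_trans[OF bilform_norm_le] sum_mono) (simp add: blinfun.bilinear_simps)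
  qed
qed

lemma lipb_continuous: "lipb S f \<Longrightarrow> continuous_on S f"
proof -
  assume "lipb S f"
  then obtain B where B: "B \<ge> 0" "\<And>x y. x \<in> S \<Longrightarrow> y \<in> S \<Longrightarrow> norm (f x - f y) \<le> B * norm (x - y)" by (rule lipbE) blast
  then have "B-lipschitz_on S f" by (intro lipschitz_onI) (auto simp: dist_norm)
  then show ?thesis by (rule lipschitz_on_continuous_on)
qed

definition tame :: "real \<Rightarrow> ('g::euclidean_space bilform \<times> 'g bilform) set" where
  "tame M = {(g, b). inner_product g \<and> norm g \<le> M \<and> norm (blinfun_inv g) \<le> M \<and> norm b \<le> M}"

text \<open>For the inverse: \<open>S - S' = S (g' - g) S'\<close>.\<close>

lemma lipb_tame:
  shows "lipb (tame M) fst" "lipb (tame M) snd" "lipb (tame M) (\<lambda>p. blinfun_inv (fst p))"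
proof -
  show "lipb (tame M) fst" "lipb (tame M) snd"
    by (rule lipbI[where B=M and K=1]; auto simp: tame_def norm_fst_le norm_snd_le)+
  show "lipb (tame M :: ('g::euclidean_space bilform \<times> 'g bilform) set) (\<lambda>p. blinfun_inv (fst p))"
  proof (rule lipbI[where B=M and K="M * M"])
    fix p q :: "'g bilform \<times> 'g bilform" assume pq: "p \<in> tame M" "q \<in> tame M"
    let ?S = "\<lambda>p::'g bilform \<times> 'g bilform. blinfun_inv (fst p)"
    have ip: "inner_product (fst p)" "inner_product (fst q)" and n: "norm (?S p) \<le> M" "norm (?S q) \<le> M" "M \<ge> 0"
      using pq order_trans[OF norm_ge_zero] by (auto simp: tame_def)
    have "?S p - ?S q = ?S p o\<^sub>L (fst q - fst p) o\<^sub>L ?S q"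
      by (rule blinfun_eqI) (simp add: blinfun.bilinear_simps blinfun_inv_inner_product[OF ip(1)] blinfun_inv_inner_product[OF ip(2)])
    then have "norm (?S p - ?S q) \<le> norm (?S p) * norm (fst q - fst p) * norm (?S q)"
      using order_trans[OF norm_blinfun_compose mult_right_mono[OF norm_blinfun_compose norm_ge_zero]] by simp
    also have "\<dots> \<le> M * norm (p - q) * M"
      using n norm_fst_le[of "fst p - fst q" "snd p - snd q"]
      by (intro mult_mono) (auto simp: norm_minus_commute minus_prod_def)
    finally show "norm (?S p - ?S q) \<le> M * M * norm (p - q)" by (simp add: ac_simps)
  qed (auto simp: tame_def)
qed

lemmas lipb_intros = lipb_add lipb_diff lipb_minus lipb_scaleR lipb_mult lipb_cdiv lipb_sum lipb_apply
  lipb_blinfun_compose lipb_const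

lemma lipb_gmet: "lipb (tame M) (\<lambda>p. gmet (fst p) (snd p))"
  unfolding gmet_def exp_b_eq block_end_eq by (intro lipb_intros lipb_tame)

context metric_lie_algebra
begin

lemma lipb_br: "lipb S f \<Longrightarrow> lipb S h \<Longrightarrow> lipb S (\<lambda>x. br (f x) (h x))"
  by (rule lipb_bilinear[OF br_bounded])

lemma lipb_fields:
  "lipb (tame M) (\<lambda>p. g_field (fst p) (snd p))" "lipb (tame M) (\<lambda>p. b_field (fst p) (snd p))"
  by (rule lipb_bilform, unfold g_field_apply b_field_apply g_rhs_def b_rhs_def b_rhs_aux_def flux_def cartan_form_def ext_d_def,
      intro lipb_intros lipb_br lipb_tame)+

text \<open>On a compact time interval both solutions stay in some \<open>tame M\<close>, where the right-hand
  sides are Lipschitz.\<close>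

lemma ode_unique:
  assumes ip: "\<And>t. t \<in> {0..<T} \<Longrightarrow> inner_product (g t)" "\<And>t. t \<in> {0..<T} \<Longrightarrow> inner_product (g' t)"
    and g: "\<And>t. t \<in> {0..<T} \<Longrightarrow> (g has_vector_derivative g_field (g t) (b t)) (at t within {0..<T})"
    and b: "\<And>t. t \<in> {0..<T} \<Longrightarrow> (b has_vector_derivative b_field (g t) (b t)) (at t within {0..<T})"
    and g': "\<And>t. t \<in> {0..<T} \<Longrightarrow> (g' has_vector_derivative g_field (g' t) (b' t)) (at t within {0..<T})"
    and b': "\<And>t. t \<in> {0..<T} \<Longrightarrow> (b' has_vector_derivative b_field (g' t) (b' t)) (at t within {0..<T})"
    and init: "g 0 = g' 0" "b 0 = b' 0" and t: "t \<in> {0..<T}"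
  shows "g t = g' t" "b t = b' t"
proof -
  have sub: "{0..t} \<subseteq> {0..<T}" using t by auto
  have bd: "bounded (q ` {0..t})" if "\<And>t. t \<in> {0..<T} \<Longrightarrow> (q has_vector_derivative q' t) (at t within {0..<T})"
    for q :: "real \<Rightarrow> 'y::real_normed_vector" and q'
  proof -
    have "continuous_on {0..<T} q"
      using that by (meson continuous_on_eq_continuous_within has_vector_derivative_continuous)
    then show ?thesis by (intro compact_imp_bounded compact_continuous_image continuous_on_subset[OF _ sub]) auto
  qed
  have bS: "bounded ((\<lambda>s. blinfun_inv (q s)) ` {0..t})"
    if q: "\<And>t. t \<in> {0..<T} \<Longrightarrow> (q has_vector_derivative q' t) (at t within {0..<T})"
      and ip: "\<And>t. t \<in> {0..<T} \<Longrightarrow> inner_product (q t)" for q :: "real \<Rightarrow> 'g bilform" and q'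
    by (rule bd, rule blinfun_inverse_has_vector_derivative[OF q]) (simp_all add: blinfun_inv_inner_product[OF ip])
  have b1: "\<exists>M. \<forall>x\<in>W. norm x \<le> M" if "bounded W" for W :: "'y::real_normed_vector set"
    using that by (simp only: bounded_iff)
  obtain M1 where M1: "\<forall>x \<in> g ` {0..t} \<union> b ` {0..t} \<union> (g' ` {0..t} \<union> b' ` {0..t}). norm x \<le> M1"
    using b1[OF bounded_Un[THEN iffD2, OF conjI[OF bounded_Un[THEN iffD2, OF conjI[OF bd[OF g] bd[OF b]]]
        bounded_Un[THEN iffD2, OF conjI[OF bd[OF g'] bd[OF b']]]]]] by (rule exE)
  obtain M2 where M2: "\<forall>x \<in> (\<lambda>s. blinfun_inv (g s)) ` {0..t} \<union> (\<lambda>s. blinfun_inv (g' s)) ` {0..t}. norm x \<le> M2"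
    using b1[OF bounded_Un[THEN iffD2, OF conjI[OF bS[OF g ip(1)] bS[OF g' ip(2)]]]] by (rule exE)
  define M where "M = max M1 M2"
  have tame1: "(g s, b s) \<in> tame M" and tame2: "(g' s, b' s) \<in> tame M" if "s \<in> {0..t}" for s
    using that sub ip[of s] M1 M2 by (auto simp: tame_def M_def le_max_iff_disj)
  obtain K1 where K1: "K1 \<ge> 0" "\<And>p q. p \<in> tame M \<Longrightarrow> q \<in> tame M \<Longrightarrow> norm (g_field (fst p) (snd p) - g_field (fst q) (snd q)) \<le> K1 * norm (p - q)"
    using lipb_fields(1)[of M] by (rule lipbE) blast
  obtain K2 where K2: "K2 \<ge> 0" "\<And>p q. p \<in> tame M \<Longrightarrow> q \<in> tame M \<Longrightarrow> norm (b_field (fst p) (snd p) - b_field (fst q) (snd q)) \<le> K2 * norm (p - q)"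
    using lipb_fields(2)[of M] by (rule lipbE) blast
  define u where "u s = (g s - g' s, b s - b' s)" for s
  define u' where "u' s = (g_field (g s) (b s) - g_field (g' s) (b' s), b_field (g s) (b s) - b_field (g' s) (b' s))" for s
  have "u t = 0"
  proof (rule differential_inequality_zero[of t u u' "K1 + K2"])
    fix s assume s: "s \<in> {0..t}"
    have sT: "s \<in> {0..<T}" using s sub by blast
    have "(u has_vector_derivative u' s) (at s within {0..<T})"
      unfolding u_def u'_def
      by (intro has_vector_derivative_Pair has_vector_derivative_diff g[OF sT] b[OF sT] g'[OF sT] b'[OF sT])
    then show "(u has_vector_derivative u' s) (at s within {0..t})"
      by (rule has_vector_derivative_within_subset[OF _ sub])
    have "norm (u' s) \<le> norm (g_field (g s) (b s) - g_field (g' s) (b' s)) + norm (b_field (g s) (b s) - b_field (g' s) (b' s))"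
      unfolding u'_def by (rule norm_Pair_le)
    also have "\<dots> \<le> K1 * norm (u s) + K2 * norm (u s)"
      using K1(2)[OF tame1[OF s] tame2[OF s]] K2(2)[OF tame1[OF s] tame2[OF s]] by (intro add_mono) (simp_all add: u_def)
    finally show "norm (u' s) \<le> (K1 + K2) * norm (u s)" by (simp add: algebra_simps)
  qed (use init t in \<open>auto simp: u_def zero_prod_def\<close>)
  then show "g t = g' t" "b t = b' t" by (simp_all add: u_def zero_prod_def)
qed

end

section \<open>Linearization of the gauge-fixed flow\<close>

definition bflip :: "'g::euclidean_space bilform \<Rightarrow> 'g bilform" where
  "bflip \<gamma> = bilform_of (\<lambda>X Y. \<gamma> Y X)"

lemma bflip_apply [simp]: "bflip \<gamma> X Y = \<gamma> Y X"
  unfolding bflip_def by (rule bilform_of_apply) (auto intro!: linearI simp: blinfun.bilinear_simps)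

lemma norm_bflip: "norm (bflip \<gamma>) \<le> norm \<gamma>"
proof (rule norm_blinfun_bound, simp, rule norm_blinfun_bound, simp)
  fix X Y
  have "norm (\<gamma> Y X) \<le> norm (\<gamma> Y) * norm X" by (rule norm_blinfun)
  also have "\<dots> \<le> norm \<gamma> * norm Y * norm X" by (intro mult_right_mono norm_blinfun) auto
  finally show "norm (bflip \<gamma> X Y) \<le> norm \<gamma> * norm X * norm Y" by (simp add: ac_simps)
qed

definition sym_part :: "'g::euclidean_space bilform \<Rightarrow> 'g bilform" where
  "sym_part \<gamma> = (1/2) *\<^sub>R (\<gamma> + bflip \<gamma>)"

definition skew_part :: "'g::euclidean_space bilform \<Rightarrow> 'g bilform" where
  "skew_part \<gamma> = (1/2) *\<^sub>R (\<gamma> - bflip \<gamma>)"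

lemma sym_part_apply: "sym_part \<gamma> X Y = (\<gamma> X Y + \<gamma> Y X) / 2"
  and skew_part_apply: "skew_part \<gamma> X Y = (\<gamma> X Y - \<gamma> Y X) / 2"
  by (simp_all add: sym_part_def skew_part_def blinfun.bilinear_simps)

lemma norm_sym_part: "norm (sym_part \<gamma>) \<le> norm \<gamma>" and norm_skew_part: "norm (skew_part \<gamma>) \<le> norm \<gamma>"
  using norm_triangle_ineq[of \<gamma> "bflip \<gamma>"] norm_triangle_ineq4[of \<gamma> "bflip \<gamma>"] norm_bflip[of \<gamma>]
  by (simp_all add: sym_part_def skew_part_def)

lemma bounded_linear_sym_part: "bounded_linear (sym_part :: 'g::euclidean_space bilform \<Rightarrow> _)"
proof (rule bounded_linear_intro)
  show "norm (sym_part \<gamma>) \<le> norm \<gamma> * 1" for \<gamma> :: "'g bilform" using norm_sym_part by simp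
qed (auto intro!: blinfun_eqI simp: sym_part_apply blinfun.bilinear_simps field_simps)

lemma bounded_linear_skew_part: "bounded_linear (skew_part :: 'g::euclidean_space bilform \<Rightarrow> _)"
proof (rule bounded_linear_intro)
  show "norm (skew_part \<gamma>) \<le> norm \<gamma> * 1" for \<gamma> :: "'g bilform" using norm_skew_part by simp
qed (auto intro!: blinfun_eqI simp: skew_part_apply blinfun.bilinear_simps field_simps)

text \<open>The product rule at a zero of the linear factor needs only continuity of the other factor.\<close>

lemma linear_times_continuous_has_derivative:
  fixes a :: "'x::real_normed_vector \<Rightarrow> real"
  assumes a: "bounded_linear a" and c: "(c \<longlongrightarrow> c0) (at 0)"
  shows "((\<lambda>x. a x * c x) has_derivative (\<lambda>h. a h * c0)) (at 0)"
proof -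
  interpret bounded_linear a by fact
  obtain K where K: "K > 0" "\<And>x. norm (a x) \<le> norm x * K" using pos_bounded by blast
  have "((\<lambda>x. norm (c x - c0)) \<longlongrightarrow> 0) (at 0)" by (rule tendsto_norm_zero[OF LIM_zero[OF c]])
  then have "((\<lambda>x. K * norm (c x - c0)) \<longlongrightarrow> K * 0) (at 0)" by (intro tendsto_intros)
  then have l: "((\<lambda>x. K * norm (c x - c0)) \<longlongrightarrow> 0) (at 0)" by simp
  have "\<forall>\<^sub>F x in at 0. norm (norm (a x * c x - a 0 * c 0 - a (x - 0) * c0) / norm (x - 0)) \<le> K * norm (c x - c0)"
    using eventually_neq_at_within[of 0 0 UNIV]
  proof eventually_elim
    case (elim x)
    have "a x * c x - a 0 * c 0 - a (x - 0) * c0 = a x * (c x - c0)" by (simp add: zero algebra_simps)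
    then have "norm (a x * c x - a 0 * c 0 - a (x - 0) * c0) \<le> (norm x * K) * norm (c x - c0)"
      using K(2)[of x] by (simp add: abs_mult mult_right_mono)
    then show ?case using elim by (simp add: divide_le_eq ac_simps)
  qed
  from Lim_null_comparison[OF this l] show ?thesis
    unfolding has_derivative_iff_norm
    by (auto intro: bounded_linear_mult_const a)
qed

context metric_lie_algebra
begin

text \<open>The change of variables \<open>\<gamma> = (g - gb) - s b\<close>: as \<open>s\<^sup>2 = 1\<close>, the
  metric and the 2-form are recovered from the symmetric and the skew part of \<open>\<gamma>\<close>.\<close>

definition met_part :: "'g bilform \<Rightarrow> 'g bilform" where "met_part \<gamma> = gb + sym_part \<gamma>"
definition form_part :: "'g bilform \<Rightarrow> 'g bilform" where "form_part \<gamma> = - s *\<^sub>R skew_part \<gamma>"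
text \<open>This form is exact, being \<open>\<xi>([Z, Y])\<close> for \<open>\<xi>(W) = \<Sum>\<^sub>e
  \<beta>([W, e], e)\<close>. It is chosen to cancel the part of the linearized flow that is not
  \<open>- \<gamma>(\<cdot>, C \<cdot>)\<close>.\<close>

definition gauge_term :: "'g bilform \<Rightarrow> 'g bilform" where
  "gauge_term \<beta> = bilform_of (\<lambda>Y Z. \<Sum>e\<in>E. \<beta> (br (br Z Y) e) e)"
definition gf_field :: "'g bilform \<Rightarrow> 'g bilform" where
  "gf_field \<gamma> = g_field (met_part \<gamma>) (form_part \<gamma>) - s *\<^sub>R b_field (met_part \<gamma>) (form_part \<gamma>) + s *\<^sub>R gauge_term (form_part \<gamma>)"
definition casimir :: "'g \<Rightarrow> 'g" where "casimir Z = (\<Sum>e\<in>E. br e (br Z e))"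

lemma gauge_term_apply: "gauge_term \<beta> Y Z = (\<Sum>e\<in>E. \<beta> (br (br Z Y) e) e)"
  unfolding gauge_term_def by (rule bilform_of_apply) (auto intro!: linearI simp: bsimps sum.distrib sum_distrib_left)

lemma gauge_term_two_form: "two_form (gauge_term \<beta>)"
  unfolding two_form_def
proof (intro allI)
  fix X Y show "gauge_term \<beta> X Y = - gauge_term \<beta> Y X"
    unfolding gauge_term_apply by (subst br_anti[of Y X]) (simp add: bsimps sum_negf)
qed

text \<open>For a form \<open>\<xi>([Z, Y])\<close> this is the Jacobi identity.\<close>

lemma ext_d_gauge_term: "ext_d br (gauge_term \<beta>) X Y Z = 0"
proof -
  have 1: "br (br X Y) Z + br (br Y Z) X + br (br Z X) Y = 0"
    using jacobi[of X Y Z] br_anti[of "br Y Z" X] br_anti[of "br Z X" Y] br_anti[of Z X] by (simp add: bsimps)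
  have "ext_d br (gauge_term \<beta>) X Y Z = (\<Sum>e\<in>E. \<beta> (br (br (br X Y) Z + br (br Y Z) X + br (br Z X) Y) e) e)"
    unfolding ext_d_def gauge_term_apply
    by (subst (1) br_anti[of Z "br X Y"], subst (1) br_anti[of X "br Y Z"], subst (1) br_anti[of Y "br Z X"])
      (simp add: bsimps sum_negf sum.distrib)
  then show ?thesis unfolding 1 by (simp add: bsimps)
qed

lemma form_part_two_form: "two_form (form_part \<gamma>)"
  by (simp add: two_form_def form_part_def skew_part_apply blinfun.bilinear_simps field_simps)

lemma abs_s: "\<bar>s\<bar> = 1" using s by (metis abs_mult_self_eq abs_1 abs_square_eq_1 power2_eq_square)

lemma norm_form_part: "norm (form_part \<gamma>) \<le> norm \<gamma>"
  using norm_skew_part[of \<gamma>] abs_s by (simp add: form_part_def)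

lemma bounded_linear_form_part: "bounded_linear form_part"
  unfolding form_part_def by (rule bounded_linear_compose[OF bounded_linear_scaleR_right bounded_linear_skew_part])

lemma gamma_of_pair:
  assumes "inner_product g" "two_form b"
  shows "met_part (g - gb - s *\<^sub>R b) = g" "form_part (g - gb - s *\<^sub>R b) = b"
proof -
  have b: "b X Y = - b Y X" for X Y using assms(2) unfolding two_form_def by blast
  have ss: "s * (s * x) = x" for x using s by (simp flip: mult.assoc)
  have "met_part (g - gb - s *\<^sub>R b) X Y = g X Y" for X Y
    using inner_product_sym[OF assms(1), of Y X] inner_product_sym[OF gb, of Y X] b[of Y X]
    by (simp add: met_part_def sym_part_apply blinfun.bilinear_simps field_simps)
  then show "met_part (g - gb - s *\<^sub>R b) = g" by (intro blinfun_eqI)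
  have "skew_part (g - gb - s *\<^sub>R b) X Y = - s * b X Y" for X Y
    using inner_product_sym[OF assms(1), of Y X] inner_product_sym[OF gb, of Y X] b[of Y X]
    by (simp add: skew_part_apply blinfun.bilinear_simps)
  then have "form_part (g - gb - s *\<^sub>R b) X Y = b X Y" for X Y
    by (simp add: form_part_def blinfun.bilinear_simps ss)
  then show "form_part (g - gb - s *\<^sub>R b) = b" by (intro blinfun_eqI)
qed

text \<open>Compares the invariant metric with the norm of the type \<open>'g\<close>.\<close>

lemma gb_lower_bound: "\<exists>c>0. \<forall>v. c * (norm v)\<^sup>2 \<le> gb v v"
proof -
  define K where "K = (\<Sum>e\<in>E. norm e) + 1"
  have K: "K > 0" unfolding K_def by (intro add_nonneg_pos sum_nonneg) auto
  have "(1 / K\<^sup>2) * (norm v)\<^sup>2 \<le> gb v v" for v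
  proof -
    have "norm v \<le> (\<Sum>e\<in>E. norm (gb v e *\<^sub>R e))" using norm_sum[of "\<lambda>e. gb v e *\<^sub>R e" E] by (simp add: onb_expansion[OF gb])
    also have "\<dots> \<le> (\<Sum>e\<in>E. sqrt (gb v v) * norm e)"
    proof (rule sum_mono)
      fix e assume "e \<in> E"
      then have "gb e e = 1" using onb_orthonormal[OF gb] unfolding orthonormal_basis_def by simp
      then show "norm (gb v e *\<^sub>R e) \<le> sqrt (gb v v) * norm e"
        using inner_product_cauchy_schwarz[OF gb, of v e] by (simp add: mult_right_mono)
    qed
    also have "\<dots> \<le> sqrt (gb v v) * K"
      unfolding sum_distrib_left[symmetric] using inner_product_nonneg[OF gb, of v]
      by (intro mult_left_mono) (auto simp: K_def)
    finally have "(norm v)\<^sup>2 \<le> (sqrt (gb v v) * K)\<^sup>2" by (intro power_mono) auto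
    then show ?thesis using K inner_product_nonneg[OF gb, of v] by (simp add: power_mult_distrib field_simps)
  qed
  then show ?thesis using K by (intro exI[of _ "1 / K\<^sup>2"]) auto
qed

text \<open>For small \<open>\<gamma>\<close> the form \<open>gb + sym_part \<gamma>\<close> is positive, and its
  inverse \<open>S\<close> satisfies \<open>S = R - S (sym_part \<gamma>) R\<close> with
  \<open>R\<close> the inverse of \<open>gb\<close>, which gives \<open>|S| \<le> 2 |R|\<close>.\<close>

lemma near_base_tame: "\<exists>r>0. \<exists>M. \<forall>\<gamma>. norm \<gamma> \<le> r \<longrightarrow> (met_part \<gamma>, form_part \<gamma>) \<in> tame M"
proof -
  obtain c where c: "c > 0" "\<And>v. c * (norm v)\<^sup>2 \<le> gb v v" using gb_lower_bound by blast
  let ?R = "blinfun_inv gb"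
  define r where "r = min (c / 2) (1 / (2 * (norm ?R + 1)))"
  have n1: "norm ?R + 1 > 0" by (simp add: add_nonneg_pos)
  have r: "r > 0" "r \<le> c / 2" "r * norm ?R \<le> 1 / 2"
  proof -
    show "r > 0" using c n1 by (simp add: r_def)
    show "r \<le> c / 2" by (simp add: r_def)
    have "r * norm ?R \<le> r * (norm ?R + 1)" using \<open>r > 0\<close> by (intro mult_left_mono) auto
    also have "\<dots> \<le> (1 / (2 * (norm ?R + 1))) * (norm ?R + 1)" using n1 by (intro mult_right_mono) (auto simp: r_def)
    also have "\<dots> = 1 / 2" using n1 by (simp add: field_simps)
    finally show "r * norm ?R \<le> 1 / 2" .
  qed
  define M where "M = norm gb + r + 2 * norm ?R"
  have "(met_part \<gamma>, form_part \<gamma>) \<in> tame M" if \<gamma>: "norm \<gamma> \<le> r" for \<gamma>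
  proof -
    have ip: "inner_product (met_part \<gamma>)"
      unfolding inner_product_def
    proof (intro conjI allI impI)
      show "met_part \<gamma> X Y = met_part \<gamma> Y X" for X Y
        by (simp add: met_part_def blinfun.bilinear_simps sym_part_apply inner_product_sym[OF gb, of X] add.commute)
      fix X :: 'g assume X: "X \<noteq> 0"
      have "\<bar>\<gamma> X X\<bar> \<le> norm (\<gamma> X) * norm X" using norm_blinfun[of "\<gamma> X" X] by simp
      also have "\<dots> \<le> norm \<gamma> * norm X * norm X" by (intro mult_right_mono norm_blinfun) auto
      also have "\<dots> \<le> (c / 2) * (norm X)\<^sup>2"
        unfolding power2_eq_square mult.assoc using \<gamma> r by (intro mult_right_mono) auto
      finally have "met_part \<gamma> X X \<ge> (c / 2) * (norm X)\<^sup>2"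
        using c(2)[of X] by (simp add: met_part_def blinfun.bilinear_simps sym_part_apply)
      moreover have "(c / 2) * (norm X)\<^sup>2 > 0" using c X by simp
      ultimately show "met_part \<gamma> X X > 0" by linarith
    qed
    let ?S = "blinfun_inv (met_part \<gamma>)"
    have "?S = ?R - (?S o\<^sub>L sym_part \<gamma> o\<^sub>L ?R)"
    proof (rule blinfun_eqI)
      fix \<xi>
      have "?S \<xi> = ?S (gb (?R \<xi>))" by (simp add: blinfun_inv_inner_product[OF gb])
      also have "gb (?R \<xi>) = met_part \<gamma> (?R \<xi>) - sym_part \<gamma> (?R \<xi>)" by (simp add: met_part_def blinfun.bilinear_simps)
      finally show "?S \<xi> = (?R - (?S o\<^sub>L sym_part \<gamma> o\<^sub>L ?R)) \<xi>"
        by (simp add: blinfun.bilinear_simps blinfun_inv_inner_product[OF ip])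
    qed
    then have "norm ?S \<le> norm ?R + norm (?S o\<^sub>L sym_part \<gamma> o\<^sub>L ?R)" by (metis norm_triangle_ineq4)
    also have "norm (?S o\<^sub>L sym_part \<gamma> o\<^sub>L ?R) \<le> norm ?S * norm (sym_part \<gamma>) * norm ?R"
      by (rule order_trans[OF norm_blinfun_compose mult_right_mono[OF norm_blinfun_compose norm_ge_zero]])
    also have "\<dots> \<le> norm ?S * r * norm ?R"
      using norm_sym_part[of \<gamma>] \<gamma> by (intro mult_right_mono mult_left_mono) auto
    also have "\<dots> \<le> norm ?S * (1 / 2)" unfolding mult.assoc by (rule mult_left_mono[OF r(3)]) simp
    finally have S: "norm ?S \<le> 2 * norm ?R" by linarith
    have "norm (met_part \<gamma>) \<le> norm gb + r" unfolding met_part_def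
      using norm_triangle_ineq[of gb "sym_part \<gamma>"] norm_sym_part[of \<gamma>] \<gamma> by linarith
    moreover have "norm (form_part \<gamma>) \<le> r" using norm_form_part \<gamma> order_trans by blast
    ultimately show ?thesis using ip S r(1) norm_ge_zero[of gb] norm_ge_zero[of ?R]
      unfolding tame_def M_def mem_Collect_eq prod.case by (intro conjI) linarith+
  qed
  then show ?thesis using r(1) by blast
qed

lemma lipb_met_form_part:
  "lipb {\<gamma>. norm \<gamma> \<le> r} met_part" "lipb {\<gamma>. norm \<gamma> \<le> r} form_part" "lipb {\<gamma>. norm \<gamma> \<le> r} (\<lambda>\<gamma>. (met_part \<gamma>, form_part \<gamma>))"
proof -
  have id: "lipb {\<gamma>. norm \<gamma> \<le> r} (\<lambda>\<gamma>::'g bilform. \<gamma>)" by (rule lipb_id) simp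
  show 1: "lipb {\<gamma>. norm \<gamma> \<le> r} met_part" unfolding met_part_def by (intro lipb_add lipb_const lipb_linear[OF bounded_linear_sym_part id])
  show 2: "lipb {\<gamma>. norm \<gamma> \<le> r} form_part" by (rule lipb_linear[OF bounded_linear_form_part id])
  have e: "(\<lambda>\<gamma>. (met_part \<gamma>, form_part \<gamma>)) = (\<lambda>\<gamma>. (met_part \<gamma>, 0) + (0, form_part \<gamma>))" by auto
  show "lipb {\<gamma>. norm \<gamma> \<le> r} (\<lambda>\<gamma>. (met_part \<gamma>, form_part \<gamma>))"
    unfolding e by (intro lipb_add lipb_linear[OF _ 1] lipb_linear[OF _ 2] bounded_linear_Pair bounded_linear_ident bounded_linear_zero)
qed

lemma lipb_fields_ball:
  assumes "\<And>\<gamma>. norm \<gamma> \<le> r \<Longrightarrow> (met_part \<gamma>, form_part \<gamma>) \<in> tame M"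
  shows "lipb {\<gamma>. norm \<gamma> \<le> r} (\<lambda>\<gamma>. g_field (met_part \<gamma>) (form_part \<gamma>))" "lipb {\<gamma>. norm \<gamma> \<le> r} (\<lambda>\<gamma>. b_field (met_part \<gamma>) (form_part \<gamma>))"
    "lipb {\<gamma>. norm \<gamma> \<le> r} gf_field"
proof -
  show 1: "lipb {\<gamma>. norm \<gamma> \<le> r} (\<lambda>\<gamma>. g_field (met_part \<gamma>) (form_part \<gamma>))"
    using lipb_compose[OF lipb_fields(1)[of M] lipb_met_form_part(3)[of r]] assms by simp
  show 2: "lipb {\<gamma>. norm \<gamma> \<le> r} (\<lambda>\<gamma>. b_field (met_part \<gamma>) (form_part \<gamma>))"
    using lipb_compose[OF lipb_fields(2)[of M] lipb_met_form_part(3)[of r]] assms by simp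
  have 3: "lipb {\<gamma>. norm \<gamma> \<le> r} (\<lambda>\<gamma>. gauge_term (form_part \<gamma>))"
    by (rule lipb_bilform, unfold gauge_term_apply, intro lipb_intros lipb_met_form_part)
  show "lipb {\<gamma>. norm \<gamma> \<le> r} gf_field" unfolding gf_field_def by (intro lipb_intros 1 2 3)
qed

text \<open>Moving \<open>ad Y\<close> from one factor of \<open>\<Sum>\<^sub>e e \<otimes> e\<close> to the other
  changes the sign, by invariance of \<open>gb\<close>.\<close>

lemma sum_ad_ad: "(\<Sum>e\<in>E. h (br Y e) (br Z e)) = - (\<Sum>e\<in>E. h e (br Z (br Y e)))" for h :: "'g bilform"
proof -
  have 1: "h (br Y e) (br Z e) = (\<Sum>f\<in>E. gb (br Y e) f * h f (br Z e))" for e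
    by (rule onb_linear_real[OF gb, symmetric]) (auto intro!: linearI simp: bsimps)
  have 2: "(\<Sum>e\<in>E. gb (br Y e) f * h f (br Z e)) = - h f (br Z (br Y f))" for f
  proof -
    have "(\<Sum>e\<in>E. gb (br Y e) f * h f (br Z e)) = - (\<Sum>e\<in>E. gb (br Y f) e * h f (br Z e))"
      unfolding bracket_form_cyclic(2)[of Y _ f] by (simp add: sum_negf)
    also have "(\<Sum>e\<in>E. gb (br Y f) e * h f (br Z e)) = h f (br Z (br Y f))"
      by (rule onb_linear_real[OF gb]) (auto intro!: linearI simp: bsimps)
    finally show ?thesis .
  qed
  show ?thesis unfolding 1 by (subst sum.swap) (simp add: 2 sum_negf)
qed

text \<open>The two factors of the quadratic part of the flow, \<open>g([e, f], Y) \<minusplus> s H(Y, e,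
  f)\<close>. At the base point \<open>H = s gb([\<cdot>, \<cdot>], \<cdot>)\<close> makes the first one
  vanish; being affine in \<open>\<gamma>\<close>, it is linear.\<close>

definition defect :: "'g bilform \<Rightarrow> 'g \<Rightarrow> 'g \<Rightarrow> 'g \<Rightarrow> real" where
  "defect \<gamma> Y e f = sym_part \<gamma> (br e f) Y - s * ext_d br (form_part \<gamma>) Y e f"

definition codefect :: "'g bilform \<Rightarrow> 'g \<Rightarrow> 'g \<Rightarrow> 'g \<Rightarrow> real" where
  "codefect \<gamma> Z e f = met_part \<gamma> (br e f) Z + s * flux (form_part \<gamma>) Z e f"

lemma defect_eq: "defect \<gamma> Y e f = met_part \<gamma> (br e f) Y - s * flux (form_part \<gamma>) Y e f"
  using bracket_form_cyclic(1)[of Y e f] s by (simp add: defect_def met_part_def flux_def cartan_form_def blinfun.bilinear_simps algebra_simps flip: mult.assoc)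

text \<open>The terms \<open>g g\<close> and \<open>H H\<close> come from the metric equation and the mixed terms
  \<open>g H\<close> from the 2-form equation; together they factorize since \<open>s\<^sup>2 =
  1\<close>.\<close>

lemma gf_field_eq:
  assumes ip: "inner_product (met_part \<gamma>)"
  defines "\<sigma> \<equiv> \<lambda>e. blinfun_inv (met_part \<gamma>) (gb e)"
  shows "gf_field \<gamma> Y Z = (\<Sum>e\<in>E. met_part \<gamma> (br Y e) (br Z (\<sigma> e))) - (\<Sum>e\<in>E. gb (br Y e) (br Z e))
    - (\<Sum>e\<in>E. \<Sum>f\<in>E. defect \<gamma> Y e f * codefect \<gamma> Z (\<sigma> e) (\<sigma> f)) / 2 + s * gauge_term (form_part \<gamma>) Y Z"
proof -
  let ?g = "met_part \<gamma>" and ?b = "form_part \<gamma>"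
  define g1 where "g1 Y e f = ?g (br e f) Y" for Y e f
  define h1 where "h1 Y e f = flux ?b Y e f" for Y e f
  have \<sigma>: "\<sigma> e = raise gb ?g e" for e by (simp add: \<sigma>_def raise_def)
  have lin: "linear (\<lambda>u. g1 Y u v)" "linear (\<lambda>v. g1 Y u v)" "linear (\<lambda>u. h1 Y u v)" "linear (\<lambda>v. h1 Y u v)" for Y u v
    by (auto intro!: linearI flux_linear simp: g1_def h1_def bsimps)
  have sw: "(\<Sum>e\<in>E. \<Sum>f\<in>E. h1 Z e f * g1 Y (\<sigma> e) (\<sigma> f)) = (\<Sum>e\<in>E. \<Sum>f\<in>E. g1 Y e f * h1 Z (\<sigma> e) (\<sigma> f))"
    unfolding \<sigma> contraction2_change_basis[OF ip gb lin(3,4) lin(1,2), symmetric]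
      contraction2_change_basis[OF ip gb lin(1,2) lin(3,4), symmetric] by (simp add: mult.commute)
  have V: "b_field ?g ?b Y Z = ((\<Sum>e\<in>E. \<Sum>f\<in>E. g1 Y e f * h1 Z (\<sigma> e) (\<sigma> f)) - (\<Sum>e\<in>E. \<Sum>f\<in>E. h1 Y e f * g1 Z (\<sigma> e) (\<sigma> f))) / 2"
    unfolding sw[symmetric] by (simp add: b_field_apply b_rhs_def b_rhs_aux_def g1_def h1_def \<sigma>_def)
  have "(\<Sum>e\<in>E. \<Sum>f\<in>E. defect \<gamma> Y e f * codefect \<gamma> Z (\<sigma> e) (\<sigma> f))
     = (\<Sum>e\<in>E. \<Sum>f\<in>E. g1 Y e f * g1 Z (\<sigma> e) (\<sigma> f)) + s * (\<Sum>e\<in>E. \<Sum>f\<in>E. g1 Y e f * h1 Z (\<sigma> e) (\<sigma> f))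
      - s * (\<Sum>e\<in>E. \<Sum>f\<in>E. h1 Y e f * g1 Z (\<sigma> e) (\<sigma> f)) - s * s * (\<Sum>e\<in>E. \<Sum>f\<in>E. h1 Y e f * h1 Z (\<sigma> e) (\<sigma> f))"
    unfolding defect_eq codefect_def g1_def[symmetric] h1_def[symmetric]
    by (simp add: sum_distrib_left algebra_simps flip: sum.distrib sum_subtractf)
  then show ?thesis
    unfolding gf_field_def blinfun.bilinear_simps V g_field_apply g_rhs_def g1_def[symmetric] h1_def[symmetric] \<sigma>_def[symmetric] s
    by (simp add: g1_def h1_def \<sigma>_def algebra_simps diff_divide_distrib add_divide_distrib)
qed

text \<open>In \<open>gf_field_eq\<close> the derivatives of the first sum through \<open>g\<close> and through
  its inverse cancel by \<open>sum_ad_ad\<close>. As \<open>defect\<close> vanishes at \<open>0\<close>,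
  only its own derivative and the value \<open>2 gb([e, f], Z)\<close> of \<open>codefect\<close> enter
  the second sum. This leaves \<open>- h(C Z, Y) - s \<beta>(C Z, Y)\<close>, with \<open>h\<close> and
  \<open>\<beta>\<close> the variations of \<open>g\<close> and \<open>b\<close>, and an exact form,
  which the gauge term removes by the Jacobi identity.\<close>

lemma gf_field_has_derivative: "((\<lambda>\<gamma>. gf_field \<gamma> Y Z) has_derivative (\<lambda>\<gamma>. - \<gamma> Y (casimir Z))) (at 0)"
  and gf_field_zero: "gf_field 0 Y Z = 0"
proof -
  let ?S = "\<lambda>\<gamma>. blinfun_inv (met_part \<gamma>)"
  define \<sigma> where "\<sigma> \<gamma> e = ?S \<gamma> (gb e)" for \<gamma> e
  obtain r M where r: "r > 0" "\<And>\<gamma>. norm \<gamma> \<le> r \<Longrightarrow> (met_part \<gamma>, form_part \<gamma>) \<in> tame M" using near_base_tame by blast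
  then have ip: "inner_product (met_part \<gamma>)" if "norm \<gamma> \<le> r" for \<gamma> using that unfolding tame_def by blast
  have ev: "\<forall>\<^sub>F \<gamma> in at 0. norm \<gamma> \<le> r"
    unfolding eventually_at using r(1) by (intro exI[of _ r]) (auto simp: dist_norm)
  have z: "sym_part 0 = (0 :: 'g bilform)" "form_part 0 = 0" "met_part 0 = gb"
    using linear_0[OF bounded_linear.linear[OF bounded_linear_sym_part]] linear_0[OF bounded_linear.linear[OF bounded_linear_form_part]]
    by (simp_all add: met_part_def)
  have gd: "(met_part has_derivative sym_part) (at 0)"
    unfolding met_part_def using has_derivative_add[OF has_derivative_const bounded_linear_imp_has_derivative[OF bounded_linear_sym_part]] by simp
  have Sd: "(?S has_derivative (\<lambda>h. - (?S 0 o\<^sub>L sym_part h o\<^sub>L ?S 0))) (at 0)"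
  proof (rule blinfun_inverse_has_derivative[OF gd])
    show "\<forall>\<^sub>F \<gamma> in at 0. \<forall>v. ?S \<gamma> (met_part \<gamma> v) = v"
      using ev by eventually_elim (simp add: blinfun_inv_inner_product(2)[OF ip])
  qed (simp_all add: z blinfun_inv_inner_product[OF gb])
  have \<sigma>0: "\<sigma> 0 e = e" for e by (simp add: \<sigma>_def z blinfun_inv_inner_product[OF gb])
  have \<sigma>d: "((\<lambda>\<gamma>. \<sigma> \<gamma> e) has_derivative (\<lambda>h. - blinfun_inv gb (sym_part h e))) (at 0)" for e
  proof -
    have "((\<lambda>\<gamma>. \<sigma> \<gamma> e) has_derivative (\<lambda>h. (- (?S 0 o\<^sub>L sym_part h o\<^sub>L ?S 0)) (gb e))) (at 0)"
      unfolding \<sigma>_def by (rule bounded_linear.has_derivative[OF blinfun.bounded_linear_left Sd])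
    then show ?thesis by (simp add: blinfun.bilinear_simps z blinfun_inv_inner_product[OF gb])
  qed
  define T1 where "T1 \<gamma> = (\<Sum>e\<in>E. met_part \<gamma> (br Y e) (br Z (\<sigma> \<gamma> e))) - (\<Sum>e\<in>E. gb (br Y e) (br Z e))" for \<gamma>
  define T3 where "T3 \<gamma> = (\<Sum>e\<in>E. \<Sum>f\<in>E. defect \<gamma> Y e f * codefect \<gamma> Z (\<sigma> \<gamma> e) (\<sigma> \<gamma> f))" for \<gamma>
  have Feq: "gf_field \<gamma> Y Z = T1 \<gamma> - T3 \<gamma> / 2 + s * gauge_term (form_part \<gamma>) Y Z" if "norm \<gamma> \<le> r" for \<gamma>
    unfolding gf_field_eq[OF ip[OF that]] T1_def T3_def \<sigma>_def by simp
  have T1d: "(T1 has_derivative (\<lambda>h. 0)) (at 0)"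
  proof -
    have "((\<lambda>\<gamma>. met_part \<gamma> (br Y e) (br Z (\<sigma> \<gamma> e))) has_derivative
        (\<lambda>h. met_part 0 (br Y e) (br Z (- blinfun_inv gb (sym_part h e))) + sym_part h (br Y e) (br Z (\<sigma> 0 e)))) (at 0)" for e
      by (rule bounded_bilinear.FDERIV[OF bounded_bilinear_blinfun_apply
            bounded_linear.has_derivative[OF blinfun.bounded_linear_left gd]
            bounded_linear.has_derivative[OF br.bounded_linear_right \<sigma>d]])
    moreover have "met_part 0 (br Y e) (br Z (- blinfun_inv gb (sym_part h e))) + sym_part h (br Y e) (br Z (\<sigma> 0 e))
       = sym_part h e (br Z (br Y e)) + sym_part h (br Y e) (br Z e)" for h e
    proof -
      have "gb (br Y e) (br Z w) = - gb (br Z (br Y e)) w" for w using ad_skew[of Z "br Y e" w] by simp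
      then show ?thesis by (simp add: z \<sigma>0 br.minus_right blinfun.minus_right inner_product_inv_apply[OF gb])
    qed
    ultimately have "((\<lambda>\<gamma>. met_part \<gamma> (br Y e) (br Z (\<sigma> \<gamma> e))) has_derivative
        (\<lambda>h. sym_part h e (br Z (br Y e)) + sym_part h (br Y e) (br Z e))) (at 0)" for e by simp
    then have "(T1 has_derivative (\<lambda>h. (\<Sum>e\<in>E. sym_part h e (br Z (br Y e)) + sym_part h (br Y e) (br Z e)) - 0)) (at 0)"
      unfolding T1_def by (intro has_derivative_diff has_derivative_sum has_derivative_const)
    then show ?thesis by (simp add: sum.distrib sum_ad_ad)
  qed
  have \<sigma>l: "((\<lambda>\<gamma>. \<sigma> \<gamma> e) \<longlongrightarrow> e) (at 0)" for e
    using has_derivative_continuous[OF \<sigma>d[of e]] by (simp add: isCont_def \<sigma>0)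
  have gl: "(met_part \<longlongrightarrow> gb) (at 0)" using has_derivative_continuous[OF gd] by (simp add: isCont_def z)
  have bl: "(form_part \<longlongrightarrow> 0) (at 0)"
    using has_derivative_continuous[OF bounded_linear_imp_has_derivative[OF bounded_linear_form_part], of 0 UNIV] by (simp add: isCont_def z)
  note ta = bounded_bilinear.tendsto[OF bounded_bilinear_blinfun_apply]
  have Bl: "((\<lambda>\<gamma>. codefect \<gamma> Z (\<sigma> \<gamma> e) (\<sigma> \<gamma> f)) \<longlongrightarrow> 2 * gb (br e f) Z) (at 0)" for e f
  proof -
    have "((\<lambda>\<gamma>. codefect \<gamma> Z (\<sigma> \<gamma> e) (\<sigma> \<gamma> f)) \<longlongrightarrow>
       gb (br e f) Z + s * (s * gb (br Z e) f + (- (0::'g bilform) (br Z e) f - (0::'g bilform) (br e f) Z - (0::'g bilform) (br f Z) e))) (at 0)"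
      unfolding codefect_def flux_def cartan_form_def ext_d_def by (intro tendsto_intros ta br.tendsto \<sigma>l gl bl)
    then show ?thesis using bracket_form_cyclic(1)[of Z e f] s by (simp flip: mult.assoc)
  qed
  have ev1: "bounded_linear (\<lambda>\<gamma>. sym_part \<gamma> u v)" "bounded_linear (\<lambda>\<gamma>. form_part \<gamma> u v)" for u v
    by (intro bounded_linear_compose[OF blinfun.bounded_linear_left bounded_linear_compose[OF blinfun.bounded_linear_left]]
        bounded_linear_sym_part bounded_linear_form_part)+
  have Abl: "bounded_linear (\<lambda>\<gamma>. defect \<gamma> Y e f)" for e f
    unfolding defect_def ext_d_def by (intro bounded_linear_sub bounded_linear_minus bounded_linear_const_mult ev1)
  have T3d: "(T3 has_derivative (\<lambda>h. \<Sum>e\<in>E. \<Sum>f\<in>E. defect h Y e f * (2 * gb (br e f) Z))) (at 0)"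
    unfolding T3_def by (intro has_derivative_sum linear_times_continuous_has_derivative[OF Abl Bl])
  have rd: "((\<lambda>\<gamma>. s * gauge_term (form_part \<gamma>) Y Z) has_derivative (\<lambda>h. s * gauge_term (form_part h) Y Z)) (at 0)"
    unfolding gauge_term_apply
    by (intro bounded_linear_imp_has_derivative bounded_linear_const_mult bounded_linear_sum ev1)
  have d: "((\<lambda>\<gamma>. T1 \<gamma> - T3 \<gamma> / 2 + s * gauge_term (form_part \<gamma>) Y Z) has_derivative
      (\<lambda>h. 0 - (\<Sum>e\<in>E. \<Sum>f\<in>E. defect h Y e f * (2 * gb (br e f) Z)) / 2 + s * gauge_term (form_part h) Y Z)) (at 0)"
    by (intro has_derivative_add has_derivative_diff T1d rd bounded_linear.has_derivative[OF bounded_linear_divide T3d])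
  have alg: "0 - (\<Sum>e\<in>E. \<Sum>f\<in>E. defect h Y e f * (2 * gb (br e f) Z)) / 2 + s * gauge_term (form_part h) Y Z = - h Y (casimir Z)" for h
  proof -
    let ?h = "sym_part h" and ?\<beta> = "form_part h"
    have "(\<Sum>f\<in>E. defect h Y e f * (2 * gb (br e f) Z)) = 2 * defect h Y e (br Z e)" for e
    proof -
      have "(\<Sum>f\<in>E. defect h Y e f * (2 * gb (br e f) Z)) = 2 * (\<Sum>f\<in>E. gb (br Z e) f * defect h Y e f)"
        using bracket_form_cyclic(1)[of Z e] by (simp add: sum_distrib_left ac_simps)
      also have "(\<Sum>f\<in>E. gb (br Z e) f * defect h Y e f) = defect h Y e (br Z e)"
        by (rule onb_linear_real[OF gb]) (auto intro!: linearI simp: defect_def ext_d_def bsimps algebra_simps)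
      finally show ?thesis .
    qed
    then have "(\<Sum>e\<in>E. \<Sum>f\<in>E. defect h Y e f * (2 * gb (br e f) Z)) / 2 = (\<Sum>e\<in>E. defect h Y e (br Z e))"
      by (simp flip: sum_distrib_left)
    also have "\<dots> = ?h (casimir Z) Y - s * (\<Sum>e\<in>E. ext_d br ?\<beta> Y e (br Z e))"
      by (simp add: defect_def sum_subtractf casimir_def blinfun.sum_right blinfun.sum_left sum_distrib_left)
    also have "(\<Sum>e\<in>E. ext_d br ?\<beta> Y e (br Z e)) = - gauge_term ?\<beta> Y Z - ?\<beta> (casimir Z) Y"
    proof -
      have anti: "?\<beta> u v = - ?\<beta> v u" for u v using form_part_two_form unfolding two_form_def by blast
      have "ext_d br ?\<beta> Y e (br Z e) = - ?\<beta> (br Y e) (br Z e) - ?\<beta> (br e (br Z e)) Y + ?\<beta> (br Y (br Z e)) e" for e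
        unfolding ext_d_def by (subst br_anti[of "br Z e" Y]) (simp add: blinfun.bilinear_simps)
      then have "(\<Sum>e\<in>E. ext_d br ?\<beta> Y e (br Z e)) = (\<Sum>e\<in>E. ?\<beta> e (br Z (br Y e))) - ?\<beta> (casimir Z) Y + (\<Sum>e\<in>E. ?\<beta> (br Y (br Z e)) e)"
        by (simp add: sum.distrib sum_subtractf sum_negf sum_ad_ad casimir_def blinfun.sum_right blinfun.sum_left)
      \<comment> \<open>the Jacobi identity turns \<open>[Z, [Y, e]]\<close> into the gauge term\<close>
      also have "(\<Sum>e\<in>E. ?\<beta> e (br Z (br Y e))) = - gauge_term ?\<beta> Y Z - (\<Sum>e\<in>E. ?\<beta> (br Y (br Z e)) e)"
      proof -
        have "?\<beta> e (br Z (br Y e)) = - ?\<beta> (br (br Z Y) e) e - ?\<beta> (br Y (br Z e)) e" for e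
          unfolding jacobi[of Z Y e] by (simp add: anti[of e] blinfun.bilinear_simps)
        then show ?thesis by (simp add: gauge_term_apply sum_subtractf sum_negf)
      qed
      finally show ?thesis by simp
    qed
    finally have "(\<Sum>e\<in>E. \<Sum>f\<in>E. defect h Y e f * (2 * gb (br e f) Z)) / 2 = ?h (casimir Z) Y - s * (- gauge_term ?\<beta> Y Z - ?\<beta> (casimir Z) Y)" .
    moreover have "s * ?\<beta> (casimir Z) Y = - skew_part h (casimir Z) Y"
      using s by (simp add: form_part_def blinfun.bilinear_simps flip: mult.assoc)
    ultimately show ?thesis by (simp add: sym_part_apply skew_part_apply algebra_simps) (simp add: field_simps)
  qed
  have d2: "((\<lambda>\<gamma>. T1 \<gamma> - T3 \<gamma> / 2 + s * gauge_term (form_part \<gamma>) Y Z) has_derivative (\<lambda>h. - h Y (casimir Z))) (at 0)"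
    using d unfolding alg .
  show "((\<lambda>\<gamma>. gf_field \<gamma> Y Z) has_derivative (\<lambda>\<gamma>. - \<gamma> Y (casimir Z))) (at 0)"
    by (rule has_derivative_transform_eventually[OF d2]) (use ev Feq r(1) in \<open>auto elim: eventually_mono\<close>)
  show "gf_field 0 Y Z = 0"
    using Feq[of 0] r(1) by (simp add: T1_def T3_def z \<sigma>0 defect_def ext_d_def gauge_term_apply blinfun.zero_left)
qed

end

section \<open>Exponential decay of the gauge-fixed flow\<close>

lemma zero_derivative_zero:
  fixes u :: "real \<Rightarrow> 'x::real_normed_vector"
  assumes "\<And>t. t \<ge> 0 \<Longrightarrow> (u has_vector_derivative 0) (at t within {0..})" "u 0 = 0" "t \<ge> 0"
  shows "u t = 0"
proof (rule differential_inequality_zero[of t u "\<lambda>_. 0" 0])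
  show "(u has_vector_derivative 0) (at s within {0..t})" if "s \<in> {0..t}" for s
    by (rule has_vector_derivative_within_subset[OF assms(1)]) (use that in auto)
qed (use assms in auto)

lemma antiderivative:
  fixes V :: "real \<Rightarrow> 'x::banach"
  assumes V: "continuous_on {0..} V" and t: "t \<ge> 0"
  shows "((\<lambda>t. integral {0..t} V) has_vector_derivative V t) (at t within {0..})"
proof -
  have "((\<lambda>t. integral {0..t} V) has_vector_derivative V t) (at t within {0..t+1})"
    using t by (intro integral_has_vector_derivative continuous_on_subset[OF V]) auto
  moreover have "at t within {0..} = at t within {0..t+1}"
    using t by (intro at_within_nhd[of t "{..<t+1}"]) auto
  ultimately show ?thesis by simp
qed

lemma exp_decay_tendsto: "c > 0 \<Longrightarrow> ((\<lambda>t::real. K * exp (- c * t)) \<longlongrightarrow> 0) at_top"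
proof -
  assume c: "c > 0"
  have "((\<lambda>t. K * exp (- c * t)) \<longlongrightarrow> K * 0) at_top"
    using c by (intro tendsto_intros filterlim_compose[OF exp_at_bot]
      filterlim_tendsto_neg_mult_at_bot[OF tendsto_const] filterlim_ident) auto
  then show ?thesis by simp
qed

lemma bilform_component_has_vector_derivative:
  assumes "(p has_vector_derivative p') F"
  shows "((\<lambda>t. blinfun_apply (blinfun_apply (p t) X) Y) has_vector_derivative blinfun_apply (blinfun_apply p' X) Y) F"
  by (rule bounded_linear.has_vector_derivative[OF blinfun.bounded_linear_left
        bounded_linear.has_vector_derivative[OF blinfun.bounded_linear_left assms]])

context metric_lie_algebra
begin

definition energy :: "'g bilform \<Rightarrow> real" where "energy \<gamma> = (\<Sum>e\<in>E. \<Sum>f\<in>E. (\<gamma> e f)\<^sup>2)"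

lemma energy_nonneg: "energy \<gamma> \<ge> 0" unfolding energy_def by (intro sum_nonneg zero_le_power2)

lemma gb_upper: "gb v v \<le> norm gb * (norm v)\<^sup>2"
proof -
  have "\<bar>gb v v\<bar> \<le> norm (gb v) * norm v" using norm_blinfun[of "gb v" v] by simp
  also have "\<dots> \<le> norm gb * norm v * norm v" by (intro mult_right_mono norm_blinfun) auto
  finally show ?thesis by (simp add: power2_eq_square)
qed

lemma norm_le_energy: "norm \<gamma> \<le> norm gb * sqrt (energy \<gamma>)"
proof -
  have sq: "sqrt (gb v v) \<le> sqrt (norm gb) * norm v" for v
    using real_sqrt_le_mono[OF gb_upper[of v]] by (simp add: real_sqrt_mult)
  have "\<bar>\<gamma> X Y\<bar> \<le> norm gb * sqrt (energy \<gamma>) * norm X * norm Y" for X Y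
  proof -
    have "\<bar>\<gamma> X Y\<bar> \<le> sqrt (energy \<gamma>) * (sqrt (gb X X) * sqrt (gb Y Y))"
      unfolding energy_def by (rule hilbert_schmidt_bound[OF gb])
    also have "\<dots> \<le> sqrt (energy \<gamma>) * ((sqrt (norm gb) * norm X) * (sqrt (norm gb) * norm Y))"
      by (intro mult_left_mono mult_mono sq real_sqrt_ge_zero energy_nonneg inner_product_nonneg[OF gb] mult_nonneg_nonneg) auto
    also have "\<dots> = norm gb * sqrt (energy \<gamma>) * norm X * norm Y"
      by (simp add: ac_simps flip: real_sqrt_mult_self[of "norm gb"])
    finally show ?thesis .
  qed
  then show ?thesis
    by (intro norm_blinfun_bound) (auto intro!: mult_nonneg_nonneg real_sqrt_ge_zero energy_nonneg)
qed

lemma energy_le_norm: "\<exists>K\<ge>0. \<forall>\<gamma>. sqrt (energy \<gamma>) \<le> K * norm \<gamma>"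
proof -
  define C where "C = (\<Sum>e\<in>E. \<Sum>f\<in>E. (norm e * norm f)\<^sup>2)"
  have C0: "C \<ge> 0" unfolding C_def by (intro sum_nonneg zero_le_power2)
  have "sqrt (energy \<gamma>) \<le> sqrt C * norm \<gamma>" for \<gamma>
  proof -
    have "energy \<gamma> \<le> (\<Sum>e\<in>E. \<Sum>f\<in>E. (norm e * norm f)\<^sup>2 * (norm \<gamma>)\<^sup>2)"
      unfolding energy_def
    proof (intro sum_mono)
      fix e f
      have "norm (\<gamma> e f) \<le> norm (\<gamma> e) * norm f" by (rule norm_blinfun)
      also have "\<dots> \<le> norm \<gamma> * norm e * norm f" by (intro mult_right_mono norm_blinfun) auto
      finally have "(norm (\<gamma> e f))\<^sup>2 \<le> (norm \<gamma> * norm e * norm f)\<^sup>2" by (intro power_mono) auto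
      then show "(\<gamma> e f)\<^sup>2 \<le> (norm e * norm f)\<^sup>2 * (norm \<gamma>)\<^sup>2" by (simp add: power_mult_distrib ac_simps)
    qed
    also have "\<dots> = C * (norm \<gamma>)\<^sup>2" by (simp add: C_def sum_distrib_right)
    finally have "sqrt (energy \<gamma>) \<le> sqrt (C * (norm \<gamma>)\<^sup>2)" by simp
    then show ?thesis by (simp add: real_sqrt_mult)
  qed
  then show ?thesis using C0 by (intro exI[of _ "sqrt C"]) auto
qed

text \<open>\<open>- (ad k)\<^sup>2\<close> is the composition of \<open>ad k\<close> with its adjoint.\<close>

lemma casimir_form: "(\<Sum>f\<in>E. \<alpha> f * \<alpha> (casimir f)) = (\<Sum>k\<in>E. \<Sum>f\<in>E. (\<alpha> (br k f))\<^sup>2)" for \<alpha> :: "'g dual"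
proof -
  have key: "(\<Sum>f\<in>E. \<alpha> f * \<alpha> (br k (br f k))) = (\<Sum>f\<in>E. (\<alpha> (br k f))\<^sup>2)" for k
  proof -
    have l: "linear (\<lambda>v. \<alpha> (br k v))" by (auto intro!: linearI simp: bsimps)
    have "\<alpha> f * \<alpha> (br k (br f k)) = (\<Sum>j\<in>E. - gb (br k f) j * \<alpha> f * \<alpha> (br k j))" for f
    proof -
      have "\<alpha> (br k (br f k)) = - \<alpha> (br k (br k f))" by (subst br_anti[of f k]) (simp add: bsimps)
      also have "\<alpha> (br k (br k f)) = (\<Sum>j\<in>E. gb (br k f) j * \<alpha> (br k j))" by (rule onb_linear_real[OF gb l, symmetric])
      finally show ?thesis by (simp add: sum_distrib_left sum_negf ac_simps)
    qed
    then have "(\<Sum>f\<in>E. \<alpha> f * \<alpha> (br k (br f k))) = (\<Sum>j\<in>E. \<Sum>f\<in>E. - gb (br k f) j * \<alpha> f * \<alpha> (br k j))"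
      by simp (rule sum.swap)
    also have "\<dots> = (\<Sum>j\<in>E. (\<Sum>f\<in>E. gb (br k j) f * \<alpha> f) * \<alpha> (br k j))"
    proof -
      have sw: "- gb (br k f) j = gb (br k j) f" for f j using bracket_form_cyclic(2)[of k f j] by simp
      show ?thesis unfolding sw sum_distrib_right ..
    qed
    also have "\<dots> = (\<Sum>j\<in>E. (\<alpha> (br k j))\<^sup>2)"
      by (simp add: onb_linear_real[OF gb linear_blinfun] power2_eq_square)
    finally show ?thesis .
  qed
  have "(\<Sum>f\<in>E. \<alpha> f * \<alpha> (casimir f)) = (\<Sum>k\<in>E. \<Sum>f\<in>E. \<alpha> f * \<alpha> (br k (br f k)))"
    by (subst sum.swap) (simp add: casimir_def blinfun.sum_right sum_distrib_left)
  then show ?thesis by (simp add: key)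
qed

text \<open>For \<open>\<alpha> = gb w\<close> the right-hand side is \<open>\<Sum>\<^sub>k |[k,
  w]|\<^sup>2\<close>, which vanishes only for central \<open>w\<close>; on the compact unit sphere it
  has a positive minimum.\<close>

lemma casimir_coercive: "\<exists>c>0. \<forall>\<alpha>::'g dual. c * (\<Sum>f\<in>E. (\<alpha> f)\<^sup>2) \<le> (\<Sum>f\<in>E. \<alpha> f * \<alpha> (casimir f))"
proof -
  define Q where "Q w = (\<Sum>k\<in>E. gb (br k w) (br k w))" for w
  have Qc: "continuous_on (sphere 0 1) Q"
    unfolding Q_def by (intro continuous_intros br.continuous_on)
  have "sphere (0::'g) 1 \<noteq> {}" by simp
  then obtain w0 where w0: "w0 \<in> sphere 0 1" "\<And>w. w \<in> sphere 0 1 \<Longrightarrow> Q w0 \<le> Q w"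
    using continuous_attains_inf[OF compact_sphere _ Qc] by metis
  have Q0: "Q w0 > 0"
  proof (rule ccontr)
    assume "\<not> Q w0 > 0"
    then have "Q w0 \<le> 0" by simp
    moreover have nn: "\<And>k. gb (br k w0) (br k w0) \<ge> 0" by (rule inner_product_nonneg[OF gb])
    ultimately have z: "(\<Sum>k\<in>E. gb (br k w0) (br k w0)) = 0" unfolding Q_def by (meson antisym sum_nonneg)
    have "br k w0 = 0" if "k \<in> E" for k
    proof -
      have "gb (br k w0) (br k w0) = 0"
        using z that sum_nonneg_eq_0_iff[OF onb_finite[OF gb], of "\<lambda>k. gb (br k w0) (br k w0)"] nn by blast
      then show ?thesis using inner_product_pos[OF gb, of "br k w0"] by force
    qed
    moreover have "(\<Sum>k\<in>E. gb X k *\<^sub>R br k w0) = br X w0" for X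
      by (rule onb_linear[OF gb]) (auto intro!: linearI simp: bsimps)
    ultimately have "br X w0 = 0" for X by (metis (no_types, lifting) scaleR_zero_right sum.neutral)
    then have "w0 = 0" by (rule center)
    then show False using w0(1) by simp
  qed
  have Qw: "Q w \<ge> Q w0 * (norm w)\<^sup>2" for w
  proof (cases "w = 0")
    case True then show ?thesis by (simp add: Q_def bsimps)
  next
    case False
    define u where "u = (1 / norm w) *\<^sub>R w"
    have u: "u \<in> sphere 0 1" "w = norm w *\<^sub>R u" using False by (simp_all add: u_def)
    have "Q w = (norm w)\<^sup>2 * Q u"
      by (subst u(2)) (simp add: Q_def bsimps sum_distrib_left power2_eq_square mult.assoc)
    then show ?thesis using mult_right_mono[OF w0(2)[OF u(1)], of "(norm w)\<^sup>2"] by (simp add: mult.commute)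
  qed
  define c where "c = Q w0 / (norm gb + 1)"
  have n1: "norm gb + 1 > 0" by (simp add: add_nonneg_pos)
  have "c * (\<Sum>f\<in>E. (\<alpha> f)\<^sup>2) \<le> (\<Sum>f\<in>E. \<alpha> f * \<alpha> (casimir f))" for \<alpha> :: "'g dual"
  proof -
    define w where "w = blinfun_inv gb \<alpha>"
    have \<alpha>: "\<alpha> = gb w" by (simp add: w_def blinfun_inv_inner_product[OF gb])
    have par: "(\<Sum>f\<in>E. (gb v f)\<^sup>2) = gb v v" for v using onb_parseval[OF gb, of v v] by (simp add: power2_eq_square)
    have "(\<alpha> (br k f))\<^sup>2 = (gb (br k w) f)\<^sup>2" for k f using ad_skew[of k w f] by (simp add: \<alpha>)
    then have "(\<Sum>f\<in>E. \<alpha> f * \<alpha> (casimir f)) = Q w" by (simp add: casimir_form par Q_def)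
    moreover have "c * (\<Sum>f\<in>E. (\<alpha> f)\<^sup>2) \<le> Q w0 * (norm w)\<^sup>2"
    proof -
      have "gb w w \<le> (norm gb + 1) * (norm w)\<^sup>2" unfolding distrib_right using gb_upper[of w] zero_le_power2[of "norm w"] by linarith
      then have "c * gb w w \<le> c * ((norm gb + 1) * (norm w)\<^sup>2)"
        using Q0 n1 by (intro mult_left_mono) (auto simp: c_def)
      then show ?thesis using n1 by (simp add: \<alpha> par c_def)
    qed
    ultimately show ?thesis using Qw[of w] by linarith
  qed
  then show ?thesis using Q0 n1 by (intro exI[of _ c]) (auto simp: c_def)
qed

text \<open>The linear part contributes at most \<open>- c energy \<gamma>\<close>, and near \<open>0\<close> the
  remainder is \<open>o(|\<gamma>|)\<close> in each entry.\<close>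

lemma lyapunov_inequality:
  "\<exists>c>0. \<exists>r>0. \<exists>M. \<forall>\<gamma> :: 'g bilform. norm \<gamma> \<le> r \<longrightarrow> (met_part \<gamma>, form_part \<gamma>) \<in> tame M \<and>
     (\<Sum>e\<in>E. \<Sum>f\<in>E. \<gamma> e f * gf_field \<gamma> e f) \<le> - c * energy \<gamma>"
proof -
  obtain c where c: "c > 0" "\<And>\<alpha>::'g dual. c * (\<Sum>f\<in>E. (\<alpha> f)\<^sup>2) \<le> (\<Sum>f\<in>E. \<alpha> f * \<alpha> (casimir f))"
    using casimir_coercive by blast
  obtain r M where r: "r > 0" "\<And>\<gamma>. norm \<gamma> \<le> r \<Longrightarrow> (met_part \<gamma>, form_part \<gamma>) \<in> tame M" using near_base_tame by blast
  define n where "n = real (card E) * real (card E) * norm gb + 1"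
  have n: "n > 0" by (simp add: n_def add_nonneg_pos)
  \<comment> \<open>so that the remainder uses up at most half of \<open>c\<close> after summation over all entries\<close>
  define \<epsilon> where "\<epsilon> = c / (2 * n)"
  have \<epsilon>: "\<epsilon> > 0" using c n by (simp add: \<epsilon>_def)
  have "\<forall>\<^sub>F \<gamma> :: 'g bilform in nhds 0. \<bar>gf_field \<gamma> e f + \<gamma> e (casimir f)\<bar> \<le> \<epsilon> * norm \<gamma>" for e f
  proof -
    obtain d where d: "d > 0" "\<And>y. norm ((y :: 'g bilform) - 0) < d \<Longrightarrow> norm (gf_field y e f - gf_field 0 e f - (- (y - 0) e (casimir f))) \<le> \<epsilon> * norm (y - 0)"
      using gf_field_has_derivative[of e f] \<epsilon> unfolding has_derivative_at_alt by blast
    show ?thesis unfolding eventually_nhds_metric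
      by (rule exI[of _ d]) (use d in \<open>auto simp: dist_norm gf_field_zero blinfun.bilinear_simps\<close>)
  qed
  then have "\<forall>\<^sub>F \<gamma> :: 'g bilform in nhds 0. \<forall>e\<in>E. \<forall>f\<in>E. \<bar>gf_field \<gamma> e f + \<gamma> e (casimir f)\<bar> \<le> \<epsilon> * norm \<gamma>"
    by (intro eventually_ball_finite onb_finite[OF gb] ballI)
  then obtain d where d: "d > 0" "\<And>\<gamma> :: 'g bilform. norm \<gamma> < d \<Longrightarrow> \<forall>e\<in>E. \<forall>f\<in>E. \<bar>gf_field \<gamma> e f + \<gamma> e (casimir f)\<bar> \<le> \<epsilon> * norm \<gamma>"
    unfolding eventually_nhds_metric by (auto simp: dist_norm)
  have main: "(\<Sum>e\<in>E. \<Sum>f\<in>E. \<gamma> e f * gf_field \<gamma> e f) \<le> - (c / 2) * energy \<gamma>" if \<gamma>: "norm \<gamma> < d" for \<gamma> :: "'g bilform"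
  proof -
    have one: "gb e e = 1" if "e \<in> E" for e
      using that onb_orthonormal[OF gb] unfolding orthonormal_basis_def by simp
    have "\<gamma> e f * gf_field \<gamma> e f \<le> - (\<gamma> e f * \<gamma> e (casimir f)) + \<epsilon> * norm gb * energy \<gamma>" if e: "e \<in> E" and f: "f \<in> E" for e f
    proof -
      have a: "\<bar>\<gamma> e f\<bar> \<le> sqrt (energy \<gamma>)"
        using hilbert_schmidt_bound[OF gb, of \<gamma> e f] one e f by (simp add: energy_def)
      have "\<gamma> e f * gf_field \<gamma> e f + \<gamma> e f * \<gamma> e (casimir f) \<le> \<bar>\<gamma> e f\<bar> * \<bar>gf_field \<gamma> e f + \<gamma> e (casimir f)\<bar>"
        by (metis abs_ge_self abs_mult distrib_left)
      also have "\<dots> \<le> sqrt (energy \<gamma>) * (\<epsilon> * (norm gb * sqrt (energy \<gamma>)))"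
      proof (intro mult_mono a)
        show "\<bar>gf_field \<gamma> e f + \<gamma> e (casimir f)\<bar> \<le> \<epsilon> * (norm gb * sqrt (energy \<gamma>))"
          using order_trans[OF d(2)[OF \<gamma>, rule_format, OF e f] mult_left_mono[OF norm_le_energy[of \<gamma>], of \<epsilon>]] \<epsilon> by simp
      qed (use energy_nonneg in auto)
      also have "\<dots> = \<epsilon> * norm gb * energy \<gamma>" using energy_nonneg[of \<gamma>] by (simp add: ac_simps)
      finally show ?thesis by linarith
    qed
    then have "(\<Sum>e\<in>E. \<Sum>f\<in>E. \<gamma> e f * gf_field \<gamma> e f) \<le> (\<Sum>e\<in>E. \<Sum>f\<in>E. - (\<gamma> e f * \<gamma> e (casimir f)) + \<epsilon> * norm gb * energy \<gamma>)"
      by (intro sum_mono) blast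
    also have "\<dots> = - (\<Sum>e\<in>E. \<Sum>f\<in>E. \<gamma> e f * \<gamma> e (casimir f)) + \<epsilon> * (n - 1) * energy \<gamma>"
      by (simp add: sum.distrib sum_negf sum_subtractf n_def)
    also have "\<dots> \<le> - (c * energy \<gamma>) + \<epsilon> * n * energy \<gamma>"
    proof (intro add_mono le_imp_neg_le mult_right_mono mult_left_mono energy_nonneg)
      show "c * energy \<gamma> \<le> (\<Sum>e\<in>E. \<Sum>f\<in>E. \<gamma> e f * \<gamma> e (casimir f))"
      proof -
        have "c * energy \<gamma> = (\<Sum>e\<in>E. c * (\<Sum>f\<in>E. (\<gamma> e f)\<^sup>2))" by (simp add: energy_def sum_distrib_left)
        also have "\<dots> \<le> (\<Sum>e\<in>E. \<Sum>f\<in>E. \<gamma> e f * \<gamma> e (casimir f))" by (rule sum_mono[OF c(2)])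
        finally show ?thesis .
      qed
    qed (use \<epsilon> in auto)
    also have "\<epsilon> * n * energy \<gamma> = (c / 2) * energy \<gamma>" using n by (simp add: \<epsilon>_def)
    finally show ?thesis by linarith
  qed
  show ?thesis
    using c(1) r d(1) main
    by (intro exI[of _ "c / 2"] conjI exI[of _ "min r (d / 2)"] exI[of _ M]) auto
qed

text \<open>The field is made globally Lipschitz by a radial retraction. The Lyapunov inequality survives the
  retraction up to a positive factor, so the energy does not grow, wherever the solution is. Started
  close enough to \<open>0\<close>, the solution therefore never leaves the ball in which the field is
  unchanged, and there the energy decays exponentially.\<close>

lemma gauge_fixed_flow:
  "\<exists>r>0. \<exists>\<kappa>>0. \<exists>\<delta>>0. \<exists>M. (\<forall>\<gamma>. norm \<gamma> \<le> r \<longrightarrow> (met_part \<gamma>, form_part \<gamma>) \<in> tame M) \<and>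
    (\<forall>\<gamma>0. norm \<gamma>0 < \<delta> \<longrightarrow> (\<exists>\<gamma>. \<gamma> 0 = \<gamma>0 \<and>
      (\<forall>t\<ge>0. (\<gamma> has_vector_derivative gf_field (\<gamma> t)) (at t within {0..}) \<and> norm (\<gamma> t) \<le> r * exp (- \<kappa> * t))))"
proof -
  obtain c r M where c: "c > 0" and r: "r > 0"
    and tly: "\<forall>\<gamma> :: 'g bilform. norm \<gamma> \<le> r \<longrightarrow> (met_part \<gamma>, form_part \<gamma>) \<in> tame M \<and>
     (\<Sum>e\<in>E. \<Sum>f\<in>E. \<gamma> e f * gf_field \<gamma> e f) \<le> - c * energy \<gamma>"
    using lyapunov_inequality by blast
  then have tame: "(met_part \<gamma>, form_part \<gamma>) \<in> tame M"
    and ly: "(\<Sum>e\<in>E. \<Sum>f\<in>E. \<gamma> e f * gf_field \<gamma> e f) \<le> - c * energy \<gamma>" if "norm \<gamma> \<le> r" for \<gamma> :: "'g bilform"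
    using that by blast+
  let ?R = "radial_retraction r :: 'g bilform \<Rightarrow> 'g bilform"
  obtain B where B: "B \<ge> 0" "\<And>x. norm x \<le> r \<Longrightarrow> norm (gf_field x) \<le> B"
    "\<And>x y. norm x \<le> r \<Longrightarrow> norm y \<le> r \<Longrightarrow> norm (gf_field x - gf_field y) \<le> B * norm (x - y)"
    using lipb_fields_ball(3)[OF tame] by (rule lipbE) auto
  have Rr: "norm (?R x) \<le> r" for x by (rule norm_radial_retraction[OF r])
  have lip: "norm (gf_field (?R x) - gf_field (?R y)) \<le> (2 * B) * norm (x - y)" for x y
    using order_trans[OF B(3)[OF Rr Rr] mult_left_mono[OF radial_retraction_lipschitz[OF r] B(1)]] by (simp add: ac_simps)
  have bd: "norm (gf_field (?R x)) \<le> B" for x by (rule B(2)[OF Rr])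
  have ineq: "(\<Sum>e\<in>E. \<Sum>f\<in>E. \<gamma> e f * gf_field (?R \<gamma>) e f) \<le> 0" for \<gamma> :: "'g bilform"
  proof -
    obtain \<theta> where \<theta>: "\<theta> > 0" "?R \<gamma> = \<theta> *\<^sub>R \<gamma>"
    proof (cases "norm \<gamma> \<le> r")
      case True then show ?thesis using that[of 1] by (simp add: radial_retraction_def)
    next
      case False
      then have "r / norm \<gamma> > 0" using r by (intro divide_pos_pos) linarith+
      then show ?thesis using that False by (simp add: radial_retraction_def)
    qed
    have "\<theta> * (\<Sum>e\<in>E. \<Sum>f\<in>E. \<gamma> e f * gf_field (?R \<gamma>) e f) = (\<Sum>e\<in>E. \<Sum>f\<in>E. ?R \<gamma> e f * gf_field (?R \<gamma>) e f)"
      unfolding sum_distrib_left by (simp add: \<theta>(2) blinfun.bilinear_simps mult.assoc)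
    also have "\<dots> \<le> - c * energy (?R \<gamma>)" by (rule ly[OF Rr])
    also have "\<dots> \<le> 0" using c energy_nonneg[of "?R \<gamma>"] by simp
    finally show ?thesis using \<theta>(1) by (simp add: mult_le_0_iff)
  qed
  obtain K where K: "K \<ge> 0" "\<And>\<gamma>. sqrt (energy \<gamma>) \<le> K * norm \<gamma>" using energy_le_norm by blast
  \<comment> \<open>the square root of the energy bounds the norm with factor \<open>norm gb\<close> and is bounded by it with factor \<open>K\<close>\<close>
  define \<delta> where "\<delta> = r / (norm gb * K + 1)"
  have nK: "norm gb * K + 1 > 0" using K by (simp add: add_nonneg_pos)
  have \<delta>: "\<delta> > 0" using r nK by (simp add: \<delta>_def)
  have "\<exists>\<gamma>. \<gamma> 0 = \<gamma>0 \<and> (\<forall>t\<ge>0. (\<gamma> has_vector_derivative gf_field (\<gamma> t)) (at t within {0..}) \<and> norm (\<gamma> t) \<le> r * exp (- c * t))"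
    if \<gamma>0: "norm \<gamma>0 < \<delta>" for \<gamma>0
  proof -
    obtain \<gamma> where init: "\<gamma> 0 = \<gamma>0" and der: "\<And>t. t \<ge> 0 \<Longrightarrow> (\<gamma> has_vector_derivative gf_field (?R (\<gamma> t))) (at t within {0..})"
      using lipschitz_ode_global_solution[of "\<lambda>x. gf_field (?R x)" "2 * B" B \<gamma>0, OF lip bd] by blast
    define N' where "N' t = 2 * (\<Sum>e\<in>E. \<Sum>f\<in>E. \<gamma> t e f * gf_field (?R (\<gamma> t)) e f)" for t
    have Nd: "((\<lambda>t. energy (\<gamma> t)) has_vector_derivative N' t) (at t within {0..})" if t: "t \<ge> 0" for t
    proof -
      note d = bilform_component_has_vector_derivative[OF der[OF t]]
      have "((\<lambda>t. \<Sum>e\<in>E. \<Sum>f\<in>E. \<gamma> t e f * \<gamma> t e f) has_vector_derivative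
          (\<Sum>e\<in>E. \<Sum>f\<in>E. \<gamma> t e f * gf_field (?R (\<gamma> t)) e f + gf_field (?R (\<gamma> t)) e f * \<gamma> t e f)) (at t within {0..})"
        by (intro has_vector_derivative_sum bounded_bilinear.has_vector_derivative[OF bounded_bilinear_mult] d)
      then show ?thesis
        by (simp add: energy_def N'_def power2_eq_square sum.distrib mult.commute sum_distrib_left)
    qed
    have N0: "energy (\<gamma> t) \<le> energy (\<gamma> 0) * exp (- 0 * t)" if "t \<ge> 0" for t
      by (rule exponential_decay[OF Nd _ that]) (use ineq in \<open>auto simp: N'_def\<close>)
    have small: "norm gb * sqrt (energy \<gamma>0) \<le> r"
    proof -
      have "norm gb * sqrt (energy \<gamma>0) \<le> norm gb * (K * norm \<gamma>0)" by (intro mult_left_mono K) auto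
      also have "\<dots> \<le> (norm gb * K) * \<delta>" unfolding mult.assoc[symmetric] using \<gamma>0 K by (intro mult_left_mono) auto
      also have "\<dots> \<le> (norm gb * K + 1) * \<delta>" using \<delta> by (intro mult_right_mono) auto
      also have "\<dots> = r" using nK by (simp add: \<delta>_def)
      finally show ?thesis .
    qed
    have stay: "norm (\<gamma> t) \<le> r" if t: "t \<ge> 0" for t
    proof -
      have "norm (\<gamma> t) \<le> norm gb * sqrt (energy (\<gamma> t))" by (rule norm_le_energy)
      also have "\<dots> \<le> norm gb * sqrt (energy \<gamma>0)" using N0[OF t] init by (intro mult_left_mono) auto
      finally show ?thesis using small by linarith
    qed
    then have R: "?R (\<gamma> t) = \<gamma> t" if "t \<ge> 0" for t using that by (simp add: radial_retraction_def)
    have decay: "energy (\<gamma> t) \<le> energy (\<gamma> 0) * exp (- (2 * c) * t)" if "t \<ge> 0" for t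
    proof (rule exponential_decay[OF Nd _ that])
      fix s :: real assume s: "s \<ge> 0"
      show "N' s \<le> - (2 * c) * energy (\<gamma> s)" unfolding N'_def R[OF s] using ly[OF stay[OF s]] by simp
    qed
    have "norm (\<gamma> t) \<le> r * exp (- c * t)" if t: "t \<ge> 0" for t
    proof -
      have "exp (- (2 * c) * t) = (exp (- c * t))\<^sup>2" by (simp add: power2_eq_square flip: exp_add)
      then have "sqrt (energy \<gamma>0 * exp (- (2 * c) * t)) = sqrt (energy \<gamma>0) * exp (- c * t)" by (simp add: real_sqrt_mult)
      then have "sqrt (energy (\<gamma> t)) \<le> sqrt (energy \<gamma>0) * exp (- c * t)"
        using real_sqrt_le_mono[OF decay[OF t]] init by simp
      then have "norm (\<gamma> t) \<le> norm gb * (sqrt (energy \<gamma>0) * exp (- c * t))"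
        using norm_le_energy[of "\<gamma> t"] by (meson mult_left_mono norm_ge_zero order_trans)
      also have "\<dots> \<le> r * exp (- c * t)" unfolding mult.assoc[symmetric] using small by (intro mult_right_mono) auto
      finally show ?thesis .
    qed
    then show ?thesis using init der R by (intro exI[of _ \<gamma>]) auto
  qed
  then show ?thesis using r c \<delta> tame by blast
qed

end

section \<open>Convergence of the generalized Ricci flow\<close>

context metric_lie_algebra
begin

lemma g_field_cong: "ext_d br b = ext_d br b' \<Longrightarrow> g_field g b = g_field g b'"
  and b_field_cong: "ext_d br b = ext_d br b' \<Longrightarrow> b_field g b = b_field g b'"
  by (simp_all add: g_field_def b_field_def g_rhs_def[abs_def] b_rhs_def[abs_def] b_rhs_aux_def[abs_def] flux_def)

lemma b_field_base: "b_field gb 0 = 0"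
proof -
  have "b_rhs_aux gb (blinfun_inv gb) 0 Y Z = s * (\<Sum>e\<in>E. \<Sum>f\<in>E. gb (br Y e) f * gb (br Z e) f)" for Y Z
    using bracket_form_cyclic(1)[of Z] by (simp add: b_rhs_aux_def flux_def cartan_form_def ext_d_def blinfun_inv_inner_product[OF gb] sum_distrib_left mult.assoc)
  then have "b_field gb 0 Y Z = 0" for Y Z by (simp add: b_field_apply b_rhs_def mult.commute)
  then show ?thesis by (intro blinfun_eqI) simp
qed

lemma sym_part_gf_field:
  assumes "inner_product (met_part \<gamma>)" shows "sym_part (gf_field \<gamma>) = g_field (met_part \<gamma>) (form_part \<gamma>)"
proof (intro blinfun_eqI)
  fix X Y
  have "b_field (met_part \<gamma>) (form_part \<gamma>) Y X = - b_field (met_part \<gamma>) (form_part \<gamma>) X Y" "gauge_term (form_part \<gamma>) Y X = - gauge_term (form_part \<gamma>) X Y"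
    using b_field_two_form gauge_term_two_form unfolding two_form_def by blast+
  then show "sym_part (gf_field \<gamma>) X Y = g_field (met_part \<gamma>) (form_part \<gamma>) X Y"
    using g_field_sym[OF assms, of "form_part \<gamma>" Y X] by (simp add: sym_part_apply gf_field_def blinfun.bilinear_simps)
qed

lemma form_part_gf_field:
  assumes "inner_product (met_part \<gamma>)" shows "form_part (gf_field \<gamma>) = b_field (met_part \<gamma>) (form_part \<gamma>) - gauge_term (form_part \<gamma>)"
proof (intro blinfun_eqI)
  fix X Y
  have ss: "s * (s * x) = x" for x using s by (simp flip: mult.assoc)
  have "b_field (met_part \<gamma>) (form_part \<gamma>) Y X = - b_field (met_part \<gamma>) (form_part \<gamma>) X Y" "gauge_term (form_part \<gamma>) Y X = - gauge_term (form_part \<gamma>) X Y"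
    using b_field_two_form gauge_term_two_form unfolding two_form_def by blast+
  then have "skew_part (gf_field \<gamma>) X Y = s * (gauge_term (form_part \<gamma>) X Y - b_field (met_part \<gamma>) (form_part \<gamma>) X Y)"
    using g_field_sym[OF assms, of "form_part \<gamma>" Y X] by (simp add: skew_part_apply gf_field_def blinfun.bilinear_simps field_simps)
  then show "form_part (gf_field \<gamma>) X Y = (b_field (met_part \<gamma>) (form_part \<gamma>) - gauge_term (form_part \<gamma>)) X Y"
    by (simp add: form_part_def[of "gf_field \<gamma>"] blinfun.bilinear_simps ss)
qed

lemma ext_d_has_vector_derivative:
  assumes "(q has_vector_derivative q') F"
  shows "((\<lambda>t. ext_d br (q t) X Y Z) has_vector_derivative ext_d br q' X Y Z) F"
  unfolding ext_d_def by (intro has_vector_derivative_diff has_vector_derivative_minus bilform_component_has_vector_derivative assms)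

lemma ext_d_tendsto:
  assumes "(q \<longlongrightarrow> l) F" shows "((\<lambda>t. ext_d br (q t) X Y Z) \<longlongrightarrow> ext_d br l X Y Z) F"
proof -
  have comp: "((\<lambda>t. q t u v) \<longlongrightarrow> l u v) F" for u v
    by (intro bounded_bilinear.tendsto[OF bounded_bilinear_blinfun_apply] assms tendsto_const)
  show ?thesis unfolding ext_d_def by (intro tendsto_diff tendsto_minus comp)
qed

text \<open>The flow from \<open>(g0, b0)\<close> in terms of pairs: it exists for all times and converges with
  rate \<open>\<kappa>\<close> to \<open>(gb, l)\<close> with \<open>l\<close> closed. The bound
  \<open>tame M\<close> makes \<open>gmet\<close> Lipschitz on the trajectory and its limit.\<close>

definition stable_flow :: "real \<Rightarrow> 'g bilform \<Rightarrow> 'g bilform \<Rightarrow> bool" where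
  "stable_flow \<kappa> g0 b0 \<longleftrightarrow>
    (\<exists>g b l K M. g 0 = g0 \<and> b 0 = b0 \<and> two_form l \<and> (\<forall>X Y Z. ext_d br l X Y Z = 0) \<and> (gb, l) \<in> tame M \<and>
      (\<forall>t\<ge>0. (g t, b t) \<in> tame M \<and> two_form (b t) \<and>
        (g has_vector_derivative g_field (g t) (b t)) (at t within {0..}) \<and>
        (b has_vector_derivative b_field (g t) (b t)) (at t within {0..}) \<and>
        norm (g t - gb) \<le> K * exp (- \<kappa> * t) \<and> norm (b t - l) \<le> K * exp (- \<kappa> * t)))"

text \<open>The gauge-fixed solution gives \<open>g\<close> and a form \<open>c\<close>. The true form
  \<open>b\<close> is obtained by integrating \<open>- d\<^sup>* H\<close> along it. The two differ by a
  closed form, so they have the same \<open>H\<close>, and \<open>(g, b)\<close> solves the flow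
  equations.\<close>

lemma stable_flow_of_pairs:
  "\<exists>\<delta>>0. \<exists>\<kappa>>0. \<forall>g0 b0. inner_product g0 \<and> two_form b0 \<and> norm (g0 - gb) < \<delta> \<and> norm b0 < \<delta> \<longrightarrow>
    stable_flow \<kappa> g0 b0"
proof -
  obtain r \<kappa> \<delta> M where r: "r > 0" and \<kappa>: "\<kappa> > 0" and \<delta>: "\<delta> > 0"
    and tame: "\<And>\<gamma>. norm \<gamma> \<le> r \<Longrightarrow> (met_part \<gamma>, form_part \<gamma>) \<in> tame M"
    and flow: "\<And>\<gamma>0. norm \<gamma>0 < \<delta> \<Longrightarrow> \<exists>\<gamma>. \<gamma> 0 = \<gamma>0 \<and>
      (\<forall>t\<ge>0. (\<gamma> has_vector_derivative gf_field (\<gamma> t)) (at t within {0..}) \<and> norm (\<gamma> t) \<le> r * exp (- \<kappa> * t))"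
    using gauge_fixed_flow by blast
  have z: "sym_part 0 = (0 :: 'g bilform)" "form_part 0 = 0" "met_part 0 = gb"
    using linear_0[OF bounded_linear.linear[OF bounded_linear_sym_part]] linear_0[OF bounded_linear.linear[OF bounded_linear_form_part]]
    by (simp_all add: met_part_def)
  let ?V = "\<lambda>\<gamma>. b_field (met_part \<gamma>) (form_part \<gamma>)"
  note lV = lipb_fields_ball(2)[OF tame]
  obtain B where B: "B \<ge> 0" "\<And>x y. norm x \<le> r \<Longrightarrow> norm y \<le> r \<Longrightarrow> norm (?V x - ?V y) \<le> B * norm (x - y)"
    using lV by (rule lipbE) auto
  have main: "stable_flow \<kappa> g0 b0"
    if g0: "inner_product g0" and b0: "two_form b0" and n0: "norm (g0 - gb) < \<delta> / 2" "norm b0 < \<delta> / 2" for g0 b0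
  proof -
    let ?\<gamma>0 = "g0 - gb - s *\<^sub>R b0"
    have "norm ?\<gamma>0 \<le> norm (g0 - gb) + norm (s *\<^sub>R b0)" by (rule norm_triangle_ineq4)
    also have "\<dots> < \<delta>" using n0 abs_s by simp
    finally obtain \<gamma> where \<gamma>0: "\<gamma> 0 = ?\<gamma>0"
      and \<gamma>d: "\<And>t. t \<ge> 0 \<Longrightarrow> (\<gamma> has_vector_derivative gf_field (\<gamma> t)) (at t within {0..})"
      and \<gamma>n: "\<And>t. t \<ge> 0 \<Longrightarrow> norm (\<gamma> t) \<le> r * exp (- \<kappa> * t)"
      using flow[of ?\<gamma>0] by blast
    have \<gamma>r: "norm (\<gamma> t) \<le> r" if t: "t \<ge> 0" for t
    proof -
      have "r * exp (- \<kappa> * t) \<le> r * 1" using r \<kappa> t by (intro mult_left_mono) auto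
      then show ?thesis using \<gamma>n[OF t] by linarith
    qed
    define g where "g t = met_part (\<gamma> t)" for t
    define c where "c t = form_part (\<gamma> t)" for t
    define V where "V t = b_field (g t) (c t)" for t
    have ip: "inner_product (g t)" if "t \<ge> 0" for t using tame[OF \<gamma>r[OF that]] by (simp add: tame_def g_def)
    have gd: "(g has_vector_derivative g_field (g t) (c t)) (at t within {0..})" if t: "t \<ge> 0" for t
    proof -
      have "((\<lambda>t. gb + sym_part (\<gamma> t)) has_vector_derivative 0 + sym_part (gf_field (\<gamma> t))) (at t within {0..})"
        by (intro has_vector_derivative_add has_vector_derivative_const
            bounded_linear.has_vector_derivative[OF bounded_linear_sym_part \<gamma>d[OF t]])
      then show ?thesis using sym_part_gf_field ip[OF t] by (simp add: g_def[abs_def] c_def met_part_def)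
    qed
    have cd: "(c has_vector_derivative V t - gauge_term (c t)) (at t within {0..})" if t: "t \<ge> 0" for t
      using bounded_linear.has_vector_derivative[OF bounded_linear_form_part \<gamma>d[OF t]] form_part_gf_field ip[OF t]
      by (simp add: g_def c_def[abs_def] V_def)
    have \<gamma>c: "continuous_on {0..} \<gamma>"
      using \<gamma>d by (meson atLeast_iff continuous_on_eq_continuous_within has_vector_derivative_continuous)
    have Vc: "continuous_on {0..} V"
      unfolding V_def g_def c_def
      by (rule continuous_on_compose2[OF lipb_continuous[OF lV] \<gamma>c]) (use \<gamma>r in auto)
    define b where "b t = b0 + integral {0..t} V" for t
    have bd: "(b has_vector_derivative V t) (at t within {0..})" if t: "t \<ge> 0" for t
      unfolding b_def using has_vector_derivative_add[OF has_vector_derivative_const antiderivative[OF Vc t]] by simp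
    have init: "g 0 = g0" "c 0 = b0" "b 0 = b0"
      using gamma_of_pair[OF g0 b0] by (simp_all add: g_def c_def b_def \<gamma>0)
    \<comment> \<open>the gauge term is closed, so \<open>c - b\<close> stays closed\<close>
    have ext: "ext_d br (c t) X Y Z = ext_d br (b t) X Y Z" if t: "t \<ge> 0" for t X Y Z
    proof -
      have lin: "ext_d br (p - q) X Y Z = ext_d br p X Y Z - ext_d br q X Y Z" for p q
        by (simp add: ext_d_def blinfun.bilinear_simps)
      have "((\<lambda>t. ext_d br (b t) X Y Z - ext_d br (c t) X Y Z) has_vector_derivative 0) (at t within {0..})" if t: "t \<ge> 0" for t
      proof -
        have "((\<lambda>t. ext_d br (b t) X Y Z - ext_d br (c t) X Y Z) has_vector_derivative
           ext_d br (V t) X Y Z - ext_d br (V t - gauge_term (c t)) X Y Z) (at t within {0..})"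
          by (intro has_vector_derivative_diff ext_d_has_vector_derivative bd[OF t] cd[OF t])
        then show ?thesis by (simp add: lin ext_d_gauge_term)
      qed
      from zero_derivative_zero[OF this _ t] show ?thesis by (simp add: init)
    qed
    then have extf: "ext_d br (c t) = ext_d br (b t)" if "t \<ge> 0" for t using that by (simp add: fun_eq_iff)
    have Vn: "norm (V t) \<le> (B * r) * exp (- \<kappa> * t)" if t: "t \<ge> 0" for t
    proof -
      have "norm (?V (\<gamma> t) - ?V 0) \<le> B * norm (\<gamma> t - 0)" using r by (intro B(2) \<gamma>r[OF t]) simp
      also have "\<dots> \<le> B * (r * exp (- \<kappa> * t))" using \<gamma>n[OF t] B(1) by (intro mult_left_mono) auto
      finally show ?thesis by (simp add: V_def g_def c_def z b_field_base mult.assoc)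
    qed
    obtain l where l: "\<And>t. t \<ge> 0 \<Longrightarrow> norm (b t - l) \<le> (B * r) / \<kappa> * exp (- \<kappa> * t)"
      using exponentially_decaying_derivative_converges[OF bd Vn \<kappa>] by blast
    define K where "K = max r ((B * r) / \<kappa>)"
    have K0: "K \<ge> 0" using r by (simp add: K_def)
    have bl: "norm (b t - l) \<le> K * exp (- \<kappa> * t)" if t: "t \<ge> 0" for t
    proof -
      have "(B * r) / \<kappa> * exp (- \<kappa> * t) \<le> K * exp (- \<kappa> * t)" by (intro mult_right_mono) (auto simp: K_def)
      then show ?thesis using l[OF t] by linarith
    qed
    have gl: "norm (g t - gb) \<le> K * exp (- \<kappa> * t)" if t: "t \<ge> 0" for t
    proof -
      have "norm (g t - gb) \<le> norm (\<gamma> t)" using norm_sym_part[of "\<gamma> t"] by (simp add: g_def met_part_def)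
      also have "\<dots> \<le> r * exp (- \<kappa> * t)" by (rule \<gamma>n[OF t])
      also have "\<dots> \<le> K * exp (- \<kappa> * t)" by (intro mult_right_mono) (auto simp: K_def)
      finally show ?thesis .
    qed
    have "\<forall>\<^sub>F t in at_top. norm (b t - l) \<le> K * exp (- \<kappa> * t)"
      using bl by (intro eventually_at_top_linorderI[of 0])
    from Lim_null_comparison[OF this exp_decay_tendsto[OF \<kappa>]] have "((\<lambda>t. b t - l) \<longlongrightarrow> 0) at_top" .
    then have blim: "(b \<longlongrightarrow> l) at_top" by (simp add: LIM_zero_iff)
    have "\<forall>\<^sub>F t in at_top. norm (c t) \<le> r * exp (- \<kappa> * t)"
      using order_trans[OF norm_form_part \<gamma>n] by (intro eventually_at_top_linorderI[of 0]) (simp add: c_def)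
    from Lim_null_comparison[OF this exp_decay_tendsto[OF \<kappa>]] have clim: "(c \<longlongrightarrow> 0) at_top" .
    have ext_l: "ext_d br l X Y Z = 0" for X Y Z
    proof -
      have 1: "((\<lambda>t. ext_d br (c t) X Y Z) \<longlongrightarrow> ext_d br 0 X Y Z) at_top" by (rule ext_d_tendsto[OF clim])
      have "((\<lambda>t. ext_d br (c t) X Y Z) \<longlongrightarrow> ext_d br l X Y Z) at_top"
        by (rule Lim_transform_eventually[OF ext_d_tendsto[OF blim]])
          (use ext in \<open>auto intro!: eventually_at_top_linorderI[of 0]\<close>)
      from tendsto_unique[OF _ this 1] show ?thesis by (simp add: ext_d_def)
    qed
    have btf: "two_form (b t)" if t: "t \<ge> 0" for t
      unfolding two_form_def
    proof (intro allI)
      fix X Y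
      have d: "((\<lambda>t. b t X Y + b t Y X) has_vector_derivative 0) (at t within {0..})" if t: "t \<ge> 0" for t
      proof -
        have "V t Y X = - V t X Y" unfolding V_def using b_field_two_form unfolding two_form_def by blast
        then show ?thesis
          using has_vector_derivative_add[OF bilform_component_has_vector_derivative[OF bd[OF t], of X Y]
              bilform_component_has_vector_derivative[OF bd[OF t], of Y X]] by simp
      qed
      have "b0 X Y = - b0 Y X" using b0 unfolding two_form_def by blast
      then have i0: "b 0 X Y + b 0 Y X = 0" by (simp add: init)
      have "b t X Y + b t Y X = 0" by (rule zero_derivative_zero[OF d i0 t])
      then show "b t X Y = - b t Y X" by simp
    qed
    have ltf: "two_form l"
      unfolding two_form_def
    proof (intro allI)
      fix X Y
      have comp: "((\<lambda>t. b t u v) \<longlongrightarrow> l u v) at_top" for u v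
        by (intro bounded_bilinear.tendsto[OF bounded_bilinear_blinfun_apply] blim tendsto_const)
      have "((\<lambda>t. b t X Y) \<longlongrightarrow> - l Y X) at_top"
      proof (rule Lim_transform_eventually[OF tendsto_minus[OF comp]])
        show "\<forall>\<^sub>F t in at_top. - b t Y X = b t X Y"
        proof (rule eventually_at_top_linorderI[of 0])
          fix t :: real assume "t \<ge> 0"
          from btf[OF this] have "b t X Y = - b t Y X" unfolding two_form_def by blast
          then show "- b t Y X = b t X Y" by simp
        qed
      qed
      from tendsto_unique[OF _ comp this] show "l X Y = - l Y X" by simp
    qed
    define M' where "M' = max M (norm l + K)"
    have bn: "norm (b t) \<le> M'" if t: "t \<ge> 0" for t
    proof -
      have "norm (b t) \<le> norm l + norm (b t - l)" using norm_triangle_ineq[of l "b t - l"] by simp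
      also have "norm (b t - l) \<le> K * exp (- \<kappa> * t)" by (rule bl[OF t])
      also have "\<dots> \<le> K * 1" using K0 \<kappa> t by (intro mult_left_mono) auto
      finally show ?thesis by (simp add: M'_def)
    qed
    have tm: "(g t, b t) \<in> tame M'" if t: "t \<ge> 0" for t
      using tame[OF \<gamma>r[OF t]] bn[OF t] by (auto simp: tame_def g_def M'_def le_max_iff_disj)
    have tl: "(gb, l) \<in> tame M'"
      using tame[of 0] r K0 by (auto simp: tame_def z M'_def le_max_iff_disj)
    show ?thesis unfolding stable_flow_def
      using init(1,3) ltf ext_l tl tm btf gd bd gl bl extf g_field_cong[OF extf] b_field_cong[OF extf]
      by (intro exI[of _ g] exI[of _ b] exI[of _ l] exI[of _ K] exI[of _ M']) (auto simp: V_def)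
  qed
  show ?thesis using \<kappa> \<delta> main by (intro exI[of _ "\<delta> / 2"] conjI exI[of _ \<kappa>]) auto
qed

text \<open>The connection \<open>k [X, Y]\<close> with \<open>k = (1 + c) / 2\<close> is metric with torsion
  \<open>c gb([X, Y], Z)\<close>. For \<open>c = \<plusminus>1\<close> one has \<open>k\<^sup>2 =
  k\<close>, and then it is flat by the Jacobi identity.\<close>

lemma bismut_flat_base: "bismut_flat br gb Hb"
proof -
  have conn: "\<exists>\<Gamma>. metric_connection br gb (cartan_form br gb c) \<Gamma> \<and> flat br \<Gamma>" if c: "c * c = 1" for c :: real
  proof -
    define k where "k = (1 + c) / 2"
    have kk: "k * k = k" using c by (simp add: k_def field_simps)
    define \<Gamma> where "\<Gamma> = Blinfun (\<lambda>X. Blinfun (\<lambda>Y. k *\<^sub>R br X Y))"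
    have bb: "bounded_bilinear (\<lambda>X Y. k *\<^sub>R br X Y)"
      by (rule bilinear_bounded_euclidean) (auto intro!: linearI simp: bsimps scaleR_add_right)
    have \<Gamma>: "\<Gamma> X Y = k *\<^sub>R br X Y" for X Y unfolding \<Gamma>_def by (rule blinfun2_apply[OF bb])
    have "gb (\<Gamma> X Y) Z + gb Y (\<Gamma> X Z) = 0" for X Y Z
      using ad_skew[of X Y Z] by (simp add: \<Gamma> blinfun.bilinear_simps)
    moreover have "gb (\<Gamma> X Y - \<Gamma> Y X - br X Y) Z = cartan_form br gb c X Y Z" for X Y Z
      by (simp add: \<Gamma> br_anti[of Y X] cartan_form_def blinfun.bilinear_simps k_def field_simps)
    moreover have "curvature br \<Gamma> X Y Z = 0" for X Y Z
    proof -
      have "k *\<^sub>R (k *\<^sub>R x) = k *\<^sub>R x" for x :: 'g using kk by simp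
      then show ?thesis by (simp add: curvature_def \<Gamma> bsimps jacobi[of X Y Z] scaleR_add_right)
    qed
    ultimately show ?thesis unfolding metric_connection_def flat_def by blast
  qed
  have neg: "(\<lambda>X Y Z. - Hb X Y Z) = cartan_form br gb (- s)" by (simp add: fun_eq_iff cartan_form_def)
  obtain \<Gamma> \<Delta> where "metric_connection br gb Hb \<Gamma>" "flat br \<Gamma>"
    "metric_connection br gb (cartan_form br gb (- s)) \<Delta>" "flat br \<Delta>"
    using conn[of s] conn[of "- s"] s by auto
  then show ?thesis unfolding bismut_flat_def neg
    using connection_eqI[OF gb] by metis
qed

lemma stable_gen_ricci_flow:
  "\<exists>\<delta>>0. \<forall>\<G>0. gen_metric \<G>0 \<and> gmet_dist \<G>0 (gmet gb 0) < \<delta> \<longrightarrow>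
    (\<exists>\<G>. gen_ricci_flow br Hb {0..} \<G> \<and> \<G> 0 = \<G>0 \<and>
      (\<forall>T>0. \<forall>\<G>'. gen_ricci_flow br Hb {0..<T} \<G>' \<and> \<G>' 0 = \<G>0 \<longrightarrow> (\<forall>t\<in>{0..<T}. \<G>' t = \<G> t)) \<and>
      (\<exists>l. two_form l \<and> H_of br Hb (gmet gb l) = Hb \<and> smooth_exp_converges \<Gamma> \<G> (gmet gb l)))"
  (is "\<exists>\<delta>>0. \<forall>\<G>0. _ \<longrightarrow> ?Q \<G>0")
proof -
  obtain \<delta>1 \<kappa> where \<delta>1: "\<delta>1 > 0" and \<kappa>: "\<kappa> > 0" and ex: "\<And>g0 b0. inner_product g0 \<Longrightarrow> two_form b0 \<Longrightarrow> norm (g0 - gb) < \<delta>1 \<Longrightarrow> norm b0 < \<delta>1 \<Longrightarrow>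
    stable_flow \<kappa> g0 b0"
    using stable_flow_of_pairs by blast
  obtain \<delta> where \<delta>: "\<delta> > 0" and dist: "\<And>g b. inner_product g \<Longrightarrow> two_form b \<Longrightarrow> gmet_dist (gmet g b) (gmet gb 0) < \<delta> \<Longrightarrow>
    norm (g - gb) < \<delta>1 \<and> norm b < \<delta>1"
    using gmet_dist_controls[OF gb \<delta>1] by blast
  have "?Q \<G>0"
    if G0: "gen_metric \<G>0" "gmet_dist \<G>0 (gmet gb 0) < \<delta>" for \<G>0
  proof -
    obtain g0 b0 where p: "inner_product g0" "two_form b0" "\<G>0 = gmet g0 b0"
      using gen_metric_imp_gmet[OF G0(1)] by blast
    have n: "norm (g0 - gb) < \<delta>1" "norm b0 < \<delta>1" using dist[OF p(1,2)] G0(2) p(3) by auto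
    obtain g b l K M where init: "g 0 = g0" "b 0 = b0" and l: "two_form l" "\<And>X Y Z. ext_d br l X Y Z = 0"
      and tl: "(gb, l) \<in> tame M"
      and tm: "\<And>t. t \<ge> 0 \<Longrightarrow> (g t, b t) \<in> tame M" and tf: "\<And>t. t \<ge> 0 \<Longrightarrow> two_form (b t)"
      and gd: "\<And>t. t \<ge> 0 \<Longrightarrow> (g has_vector_derivative g_field (g t) (b t)) (at t within {0..})"
      and bd: "\<And>t. t \<ge> 0 \<Longrightarrow> (b has_vector_derivative b_field (g t) (b t)) (at t within {0..})"
      and gn: "\<And>t. t \<ge> 0 \<Longrightarrow> norm (g t - gb) \<le> K * exp (- \<kappa> * t)"
      and bn: "\<And>t. t \<ge> 0 \<Longrightarrow> norm (b t - l) \<le> K * exp (- \<kappa> * t)"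
      using ex[OF p(1,2) n] unfolding stable_flow_def by blast
    have ip: "inner_product (g t)" if "t \<ge> 0" for t using tm[OF that] by (simp add: tame_def)
    define \<G> where "\<G> t = gmet (g t) (b t)" for t
    have flow: "gen_ricci_flow br Hb {0..} \<G>"
      unfolding \<G>_def by (rule ode_imp_flow) (use ip tf gd bd in auto)
    have G00: "\<G> 0 = \<G>0" by (simp add: \<G>_def init p(3))
    have uniq: "\<G>' t = \<G> t"
      if T: "T > 0" and f': "gen_ricci_flow br Hb {0..<T} \<G>'" and i': "\<G>' 0 = \<G>0" and t: "t \<in> {0..<T}" for T \<G>' t
    proof -
      have bot: "at t within {0..<T} \<noteq> bot" if "t \<in> {0..<T}" for t
      proof -
        have "{t<..<T} \<subseteq> {0..<T}" "t < T" using that by auto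
        then have "t islimpt {0..<T}" using islimpt_subset[OF islimpt_greaterThanLessThan1] by blast
        then show ?thesis by (simp add: trivial_limit_within)
      qed
      obtain g' b' where gb': "\<forall>t\<in>{0..<T}. inner_product (g' t) \<and> two_form (b' t) \<and> \<G>' t = gmet (g' t) (b' t) \<and>
         (g' has_vector_derivative g_field (g' t) (b' t)) (at t within {0..<T}) \<and> (b' has_vector_derivative b_field (g' t) (b' t)) (at t within {0..<T})"
        using flow_imp_ode[OF f' bot] by blast
      have z: "0 \<in> {0..<T}" using T by simp
      have i0: "g0 = g' 0" "b0 = b' 0"
        using gmet_eq_iff[OF p(1), of "g' 0" b0 "b' 0"] gb' z i' p(3) by auto
      have sub: "{0..<T} \<subseteq> {0..}" by auto
      have "g t = g' t" "b t = b' t"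
        by (rule ode_unique[of T g g' b b'];
            use ip gb' init i0 t has_vector_derivative_within_subset[OF gd sub] has_vector_derivative_within_subset[OF bd sub] in auto)+
      then show ?thesis using gb' t by (simp add: \<G>_def)
    qed
    obtain B where B: "B \<ge> 0" "\<And>p q :: 'g bilform \<times> 'g bilform. p \<in> tame M \<Longrightarrow> q \<in> tame M \<Longrightarrow>
        norm (gmet (fst p) (snd p) - gmet (fst q) (snd q)) \<le> B * norm (p - q)"
      using lipb_gmet[of M] by (rule lipbE) blast
    have conv: "norm (\<G> t - gmet gb l) \<le> (B * (K + K)) * exp (- \<kappa> * t)" if t: "t \<ge> 0" for t
    proof -
      have "norm ((g t, b t) - (gb, l)) \<le> norm (g t - gb) + norm (b t - l)"
        using norm_Pair_le[of "g t - gb" "b t - l"] by simp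
      also have "\<dots> \<le> (K + K) * exp (- \<kappa> * t)" using gn[OF t] bn[OF t] by (simp add: algebra_simps)
      finally have "B * norm ((g t, b t) - (gb, l)) \<le> B * ((K + K) * exp (- \<kappa> * t))" using B(1) by (rule mult_left_mono)
      then show ?thesis using B(2)[OF tm[OF t] tl] by (simp add: \<G>_def mult.assoc)
    qed
    have "smooth_exp_converges \<Gamma> \<G> (gmet gb l)" by (rule smooth_exp_convergesI[OF \<kappa> conv])
    moreover have "H_of br Hb (gmet gb l) = Hb"
      by (simp add: fun_eq_iff H_of_def gmet_pair_gmet[OF gb l(1)] l(2))
    ultimately show ?thesis using flow G00 uniq l(1) by (intro exI[of _ \<G>]) blast
  qed
  then show ?thesis using \<delta> by blast
qed

end

theorem theorem4:
  fixes G :: "('a::t2_space) monoid"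
    and A :: "('a, 'g::euclidean_space) chart set"
    and U :: "'a set" and \<phi> :: "'a \<Rightarrow> 'g"
    and br :: "'g \<Rightarrow> 'g \<Rightarrow> 'g"
    and gb :: "'g bilform" and s :: real and Hb :: "'g form3" and \<G>b :: "'g gend"
  assumes "lie_group G A"
    and "compact (carrier G)" and "simply_connected (carrier G)"
    and "(U, \<phi>) \<in> A" and "\<one>\<^bsub>G\<^esub> \<in> U"
    and "br = lie_bracket G U \<phi>"
    and "semisimple br"
    and "bi_invariant_metric G U \<phi> gb"
    and "s = 1 \<or> s = - 1" and "Hb = cartan_form br gb s"
    and "\<G>b = gmet gb 0"
  shows "\<exists>\<delta>>0. \<forall>\<G>0. gen_metric \<G>0 \<and> gmet_dist \<G>0 \<G>b < \<delta> \<longrightarrow>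
    (\<exists>\<G>. gen_ricci_flow br Hb {0..} \<G> \<and> \<G> 0 = \<G>0 \<and>
      (\<forall>T>0. \<forall>\<G>'. gen_ricci_flow br Hb {0..<T} \<G>' \<and> \<G>' 0 = \<G>0 \<longrightarrow> (\<forall>t\<in>{0..<T}. \<G>' t = \<G> t)) \<and>
      (\<exists>\<G>lim. bi_invariant_bismut_flat G U \<phi> Hb \<G>lim \<and>
        smooth_exp_converges (levi_civita br gb) \<G> \<G>lim))"
proof -
  interpret C: lie_group_chart G A U \<phi> by unfold_locales (use assms in auto)
  have gb: "inner_product gb" using assms(8) by (simp add: bi_invariant_metric_def)
  have bb: "bounded_bilinear br" using C.br_bilinear assms(6) by simp
  interpret M: metric_lie_algebra br gb s
  proof (rule metric_lie_algebra.intro)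
    show "br X Y = - br Y X" for X Y unfolding assms(6) by (rule C.br_antisym)
    show "br X (br Y Z) = br (br X Y) Z + br Y (br X Z)" for X Y Z unfolding assms(6) by (rule C.br_jacobi)
    show "gb (br X Y) Z + gb Y (br X Z) = 0" for X Y Z
      unfolding assms(6) by (rule C.bi_invariant_metric_ad_invariant[OF assms(8)])
    show "Z = 0" if "\<And>X. br X Z = 0" for Z
    proof (rule semisimple_center_trivial[OF assms(7) _ _ that])
      show "linear (br X)" for X using bounded_bilinear.bounded_linear_right[OF bb] bounded_linear.linear by blast
      show "br X Y = - br Y X" for X Y unfolding assms(6) by (rule C.br_antisym)
    qed
    show "s * s = 1" using assms(9) by auto
  qed (rule bb gb)+
  have lim: "bi_invariant_bismut_flat G U \<phi> Hb (gmet gb l)"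
    if l: "two_form l" "H_of br Hb (gmet gb l) = Hb" for l
    unfolding bi_invariant_bismut_flat_def Let_def assms(6)[symmetric] l(2) metric_of_def gmet_pair_gmet[OF gb l(1)] fst_conv
    using gen_metric_gmet[OF gb l(1)] assms(8) C.cartan_form_bi_invariant[OF assms(8), of s] M.bismut_flat_base assms(6,10)
    by simp
  obtain \<delta> where \<delta>: "\<delta> > 0" "\<And>\<G>0. gen_metric \<G>0 \<and> gmet_dist \<G>0 (gmet gb 0) < \<delta> \<Longrightarrow>
    (\<exists>\<G>. gen_ricci_flow br Hb {0..} \<G> \<and> \<G> 0 = \<G>0 \<and>
      (\<forall>T>0. \<forall>\<G>'. gen_ricci_flow br Hb {0..<T} \<G>' \<and> \<G>' 0 = \<G>0 \<longrightarrow> (\<forall>t\<in>{0..<T}. \<G>' t = \<G> t)) \<and>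
      (\<exists>l. two_form l \<and> H_of br Hb (gmet gb l) = Hb \<and> smooth_exp_converges (levi_civita br gb) \<G> (gmet gb l)))"
    using M.stable_gen_ricci_flow[of "levi_civita br gb"] unfolding assms(10)[symmetric] by blast
  show ?thesis
    unfolding assms(11)
  proof (intro exI[of _ \<delta>] conjI allI impI \<delta>(1))
    fix \<G>0 assume "gen_metric \<G>0 \<and> gmet_dist \<G>0 (gmet gb 0) < \<delta>"
    from \<delta>(2)[OF this] obtain \<G> l where flow: "gen_ricci_flow br Hb {0..} \<G>" "\<G> 0 = \<G>0"
      and uniq: "\<forall>T>0. \<forall>\<G>'. gen_ricci_flow br Hb {0..<T} \<G>' \<and> \<G>' 0 = \<G>0 \<longrightarrow> (\<forall>t\<in>{0..<T}. \<G>' t = \<G> t)"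
      and l: "two_form l" "H_of br Hb (gmet gb l) = Hb" and conv: "smooth_exp_converges (levi_civita br gb) \<G> (gmet gb l)"
      by blast
    show "\<exists>\<G>. gen_ricci_flow br Hb {0..} \<G> \<and> \<G> 0 = \<G>0 \<and>
      (\<forall>T>0. \<forall>\<G>'. gen_ricci_flow br Hb {0..<T} \<G>' \<and> \<G>' 0 = \<G>0 \<longrightarrow> (\<forall>t\<in>{0..<T}. \<G>' t = \<G> t)) \<and>
      (\<exists>\<G>lim. bi_invariant_bismut_flat G U \<phi> Hb \<G>lim \<and> smooth_exp_converges (levi_civita br gb) \<G> \<G>lim)"
      by (intro exI[of _ \<G>] conjI flow uniq exI[of _ "gmet gb l"] lim[OF l] conv)
  qed
qed

end
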